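(* Let $D\subset\mathbb{C}^n$ be a bounded strongly pseudoconvex domain with $C^\infty$ smooth boundary $\partial D$, and let $f$ be a holomorphic function on $\bar D$ with only isolated critical points in $D$ and no critical points on $\partial D$. Then for every degree $k$ there is a direct sum decomposition $$L^2_k(D)=\mathcal{H}^k\oplus \operatorname{im}(\bar\partial_f)\oplus \operatorname{im}(\bar\partial_f^* ),$$ where the images are the parts lying in degree $k$, and consequently there is an isomorphism $$H^k_{((2),\bar\partial_f)}\cong \mathcal{H}^k .$$ Furthermore, all the spaces $\mathcal{H}^k$ are finite dimensional.
   Context: "Holomorphic on $\bar D$" means holomorphic in a neighborhood of $\bar D$. For forms $\varphi=\sum'_{I,J}\varphi_{I,J}\,dz^I\wedge d\bar z^J$ and $\psi=\sum'_{I,J}\psi_{I,J}\,dz^I\wedge d\bar z^J$ (sums over strictly increasing multi-indices) on $D$, set $\langle\varphi,\psi\rangle=\sum'_{I,J}\int_D\varphi_{I,J}\overline{\psi_{I,J}}\,dV$. Let $L^2_{(p,q)}(D)$ be the Hilbert space of $(p,q)$-forms with $L^2$ coefficients, $L^2_k(D)=\bigoplus_{p+q=k}L^2_{(p,q)}(D)$ and $L^2(D)=\bigoplus_k L^2_k(D)$. Put $f_i=\partial f/\partial z_i$, $\partial f=\sum_i f_i\,dz_i$, and $\bar\partial_f=\bar\partial+\partial f\wedge$. It is regarded as a closed densely defined operator $L^2_k(D)\to L^2_{k+1}(D)$ with domain $\operatorname{Dom}(\bar\partial_f)=\{\varphi\in L^2(D):\bar\partial_f\varphi\in L^2(D)\}$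 (derivatives in the generalized sense). Let $\bar\partial_f^*$ be its Hilbert space adjoint. The twisted Laplacian is $\Delta_f=\bar\partial_f\bar\partial_f^*+\bar\partial_f^*\bar\partial_f$ with domain $\{\varphi\in\operatorname{Dom}(\bar\partial_f)\cap\operatorname{Dom}(\bar\partial_f^* ):\bar\partial_f\varphi\in\operatorname{Dom}(\bar\partial_f^* ),\ \bar\partial_f^*\varphi\in\operatorname{Dom}(\bar\partial_f)\}$. Let $\mathcal{H}^k$ be the kernel of $\Delta_f$ in $L^2_k(D)$. The $L^2$ cohomology is $H^k_{((2),\bar\partial_f)}=\{\varphi\in\operatorname{Dom}(\bar\partial_f)\cap L^2_k(D):\bar\partial_f\varphi=0\}\,/\,\bar\partial_f(\operatorname{Dom}(\bar\partial_f)\cap L^2_{k-1}(D))$. *)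

theory Defs
  imports "HOL-Analysis.Analysis"
begin

section \<open>Differentiability in several complex variables\<close>

text \<open>\<open>\<complex>\<^sup>n\<close> is \<^typ>\<open>complex ^ 'n\<close> with \<open>n = CARD('n)\<close>; the order on \<^typ>\<open>'n\<close> is
  the order of the coordinates.  As a Euclidean space it is \<open>\<real>\<^bsup>2n\<^esup>\<close>, so \<^term>\<open>lebesgue\<close> is
  the volume \<open>dV\<close>.\<close>

primrec Ck_on :: "nat \<Rightarrow> 'a::real_normed_vector set \<Rightarrow> ('a \<Rightarrow> 'b::real_normed_vector) \<Rightarrow> bool" where
  "Ck_on 0 U f \<longleftrightarrow> continuous_on U f"
| "Ck_on (Suc k) U f \<longleftrightarrow>
     (\<forall>x\<in>U. f differentiable (at x)) \<and> (\<forall>v. Ck_on k U (\<lambda>x. frechet_derivative f (at x) v))"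

definition smooth_on :: "'a::real_normed_vector set \<Rightarrow> ('a \<Rightarrow> 'b::real_normed_vector) \<Rightarrow> bool" where
  "smooth_on U f \<longleftrightarrow> (\<forall>k. Ck_on k U f)"

text \<open>The operators \<open>\<partial>/\<partial>z\<^sub>i = (\<partial>/\<partial>x\<^sub>i - \<i> \<partial>/\<partial>y\<^sub>i)/2\<close> and
  \<open>\<partial>/\<partial>zbar\<^sub>i = (\<partial>/\<partial>x\<^sub>i + \<i> \<partial>/\<partial>y\<^sub>i)/2\<close>.\<close>

definition d_z :: "'n::finite \<Rightarrow> (complex ^ 'n \<Rightarrow> complex) \<Rightarrow> complex ^ 'n \<Rightarrow> complex" where
  "d_z i g z = (frechet_derivative g (at z) (axis i 1)
                 - \<i> * frechet_derivative g (at z) (axis i \<i>)) / 2"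

definition d_zbar :: "'n::finite \<Rightarrow> (complex ^ 'n \<Rightarrow> complex) \<Rightarrow> complex ^ 'n \<Rightarrow> complex" where
  "d_zbar i g z = (frechet_derivative g (at z) (axis i 1)
                    + \<i> * frechet_derivative g (at z) (axis i \<i>)) / 2"

definition holomorphic_cn :: "(complex ^ 'n::finite \<Rightarrow> complex) \<Rightarrow> (complex ^ 'n) set \<Rightarrow> bool" where
  "holomorphic_cn g U \<longleftrightarrow>
     (\<forall>z\<in>U. \<exists>g'. (g has_derivative g') (at z) \<and> (\<forall>c v. g' (c *s v) = c * g' v))"

definition holomorphic_near_closure ::
    "(complex ^ 'n::finite \<Rightarrow> complex) \<Rightarrow> (complex ^ 'n) set \<Rightarrow> bool" where
  "holomorphic_near_closure g D \<longleftrightarrow> (\<exists>U. open U \<and> closure D \<subseteq> U \<and> holomorphic_cn g U)"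

definition crit_points :: "(complex ^ 'n::finite \<Rightarrow> complex) \<Rightarrow> (complex ^ 'n) set" where
  "crit_points f = {z. \<forall>i. d_z i f z = 0}"


section \<open>Strongly pseudoconvex domains\<close>

definition domain_cn :: "(complex ^ 'n::finite) set \<Rightarrow> bool" where
  "domain_cn D \<longleftrightarrow> open D \<and> connected D \<and> D \<noteq> {}"

definition defining_function ::
    "nat \<Rightarrow> (complex ^ 'n::finite) set \<Rightarrow> (complex ^ 'n) set \<Rightarrow> (complex ^ 'n \<Rightarrow> real) \<Rightarrow> bool" where
  "defining_function k D U \<rho> \<longleftrightarrow>
     open U \<and> frontier D \<subseteq> U \<and> Ck_on k U \<rho> \<and> D \<inter> U = {z\<in>U. \<rho> z < 0} \<and>
     (\<forall>z\<in>frontier D. frechet_derivative \<rho> (at z) \<noteq> (\<lambda>v. 0))"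

definition smooth_boundary :: "(complex ^ 'n::finite) set \<Rightarrow> bool" where
  "smooth_boundary D \<longleftrightarrow> (\<exists>U \<rho>. \<forall>k. defining_function k D U \<rho>)"

definition levi_form :: "(complex ^ 'n::finite \<Rightarrow> real) \<Rightarrow> complex ^ 'n \<Rightarrow> complex ^ 'n \<Rightarrow> complex" where
  "levi_form \<rho> z t =
     (\<Sum>i\<in>UNIV. \<Sum>j\<in>UNIV. d_z i (d_zbar j (\<lambda>w. complex_of_real (\<rho> w))) z * t $ i * cnj (t $ j))"

text \<open>Positivity of the Levi form on the complex tangent space at every boundary point.  The
  condition does not depend on the choice of the \<open>C\<^sup>2\<close> defining function.\<close>

definition strongly_pseudoconvex :: "(complex ^ 'n::finite) set \<Rightarrow> bool" where
  "strongly_pseudoconvex D \<longleftrightarrow>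
     (\<exists>U \<rho>. defining_function 2 D U \<rho> \<and>
        (\<forall>z\<in>frontier D. \<forall>t. t \<noteq> 0 \<and> (\<Sum>i\<in>UNIV. d_z i (\<lambda>w. complex_of_real (\<rho> w)) z * t $ i) = 0
           \<longrightarrow> Re (levi_form \<rho> z t) > 0))"


section \<open>Differential forms up to null sets\<close>

text \<open>A raw form assigns to each pair \<open>(I, J)\<close> the coefficient of \<open>dz\<^sup>I \<and> dzbar\<^sup>J\<close>; a strictly
  increasing multi-index is a set of indices.  A \<^emph>\<open>form\<close> is a raw form on \<open>\<complex>\<^sup>n\<close> modulo equality
  almost everywhere; forms on \<open>D\<close> are extended by zero to \<open>\<complex>\<^sup>n\<close>.\<close>

type_synonym 'n raw_form = "'n set \<Rightarrow> 'n set \<Rightarrow> complex ^ 'n \<Rightarrow> complex"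

definition ae_eq :: "'n::finite raw_form \<Rightarrow> 'n raw_form \<Rightarrow> bool" where
  "ae_eq \<phi> \<psi> \<longleftrightarrow> (\<forall>I J. AE z in lebesgue. \<phi> I J z = \<psi> I J z)"

lemma ae_eq_binop:
  assumes "ae_eq \<phi> \<phi>'" "ae_eq \<psi> \<psi>'"
  shows "ae_eq (\<lambda>I J z. F (\<phi> I J z) (\<psi> I J z)) (\<lambda>I J z. F (\<phi>' I J z) (\<psi>' I J z))"
  unfolding ae_eq_def
proof (intro allI)
  fix I J
  have "AE z in lebesgue. \<phi> I J z = \<phi>' I J z" "AE z in lebesgue. \<psi> I J z = \<psi>' I J z"
    using assms by (auto simp: ae_eq_def)
  then show "AE z in lebesgue. F (\<phi> I J z) (\<psi> I J z) = F (\<phi>' I J z) (\<psi>' I J z)"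
    by eventually_elim simp
qed

lemma equivp_ae_eq: "equivp (ae_eq :: 'n::finite raw_form \<Rightarrow> _)"
proof (rule equivpI)
  show "reflp (ae_eq :: 'n raw_form \<Rightarrow> _)" by (auto simp: reflp_def ae_eq_def)
  show "symp (ae_eq :: 'n raw_form \<Rightarrow> _)" by (auto simp: symp_def ae_eq_def eq_commute)
  show "transp (ae_eq :: 'n raw_form \<Rightarrow> _)"
  proof (rule transpI)
    fix \<phi> \<psi> \<theta> :: "'n raw_form"
    assume A: "ae_eq \<phi> \<psi>" "ae_eq \<psi> \<theta>"
    show "ae_eq \<phi> \<theta>"
      unfolding ae_eq_def
    proof (intro allI)
      fix I J
      have "AE z in lebesgue. \<phi> I J z = \<psi> I J z" "AE z in lebesgue. \<psi> I J z = \<theta> I J z"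
        using A by (auto simp: ae_eq_def)
      then show "AE z in lebesgue. \<phi> I J z = \<theta> I J z"
        by eventually_elim simp
    qed
  qed
qed

quotient_type 'n form = "'n::finite raw_form" / ae_eq
  by (rule equivp_ae_eq)

instantiation form :: (finite) ab_group_add
begin

lift_definition zero_form :: "'a form" is "\<lambda>I J z. 0" .
lift_definition plus_form :: "'a form \<Rightarrow> 'a form \<Rightarrow> 'a form" is "\<lambda>\<phi> \<psi> I J z. \<phi> I J z + \<psi> I J z"
  by (rule ae_eq_binop)
lift_definition minus_form :: "'a form \<Rightarrow> 'a form \<Rightarrow> 'a form" is "\<lambda>\<phi> \<psi> I J z. \<phi> I J z - \<psi> I J z"
  by (rule ae_eq_binop)
lift_definition uminus_form :: "'a form \<Rightarrow> 'a form" is "\<lambda>\<phi> I J z. - \<phi> I J z"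
  by (rule ae_eq_binop[where F = "\<lambda>x y. - x"])

instance
  by standard (transfer; simp add: ae_eq_def algebra_simps)+

end

lift_definition scale_form :: "complex \<Rightarrow> 'n::finite form \<Rightarrow> 'n form" is
  "\<lambda>c \<phi> I J z. c * \<phi> I J z"
  by (rule ae_eq_binop[where F = "\<lambda>x y. _ * x"])

interpretation form: vector_space "scale_form :: complex \<Rightarrow> 'n::finite form \<Rightarrow> 'n form"
  by unfold_locales (transfer; simp add: ae_eq_def algebra_simps)+

text \<open>A representative of the class; everything below is independent of its choice.\<close>

abbreviation coef :: "'n::finite form \<Rightarrow> 'n set \<Rightarrow> 'n set \<Rightarrow> complex ^ 'n \<Rightarrow> complex" where
  "coef \<equiv> rep_form"

definition L2 :: "(complex ^ 'n::finite) set \<Rightarrow> 'n form set" where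
  "L2 D = {\<phi>. \<forall>I J. coef \<phi> I J \<in> borel_measurable lebesgue \<and>
                    integrable lebesgue (\<lambda>z. (cmod (coef \<phi> I J z))\<^sup>2) \<and>
                    (AE z in lebesgue. z \<notin> D \<longrightarrow> coef \<phi> I J z = 0)}"

text \<open>Degrees are integers, so that \<open>L2_deg D (-1) = {0}\<close>.\<close>

definition L2_deg :: "(complex ^ 'n::finite) set \<Rightarrow> int \<Rightarrow> 'n form set" where
  "L2_deg D k = {\<phi>\<in>L2 D. \<forall>I J. int (card I + card J) \<noteq> k \<longrightarrow>
                   (AE z in lebesgue. coef \<phi> I J z = 0)}"

definition inner_form :: "(complex ^ 'n::finite) set \<Rightarrow> 'n form \<Rightarrow> 'n form \<Rightarrow> complex" where
  "inner_form D \<phi> \<psi> =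
     (\<Sum>I\<in>UNIV. \<Sum>J\<in>UNIV. LINT z:D|lebesgue. coef \<phi> I J z * cnj (coef \<psi> I J z))"


section \<open>The twisted operators\<close>

definition test_function :: "(complex ^ 'n::finite) set \<Rightarrow> (complex ^ 'n \<Rightarrow> complex) \<Rightarrow> bool" where
  "test_function D \<theta> \<longleftrightarrow>
     smooth_on UNIV \<theta> \<and> compact (closure {z. \<theta> z \<noteq> 0}) \<and> closure {z. \<theta> z \<noteq> 0} \<subseteq> D"

text \<open>\<open>\<psi> = dbar \<phi> + \<partial>f \<and> \<phi>\<close> on \<open>D\<close> in the sense of distributions, coefficient by coefficient:
  the \<open>dz\<^sup>I \<and> dzbar\<^sup>J\<close> coefficient of the right-hand side collects, for \<open>j \<in> J\<close>, the terms
  \<open>\<partial>\<phi>\<^sub>I\<^sub>,\<^sub>J\<^sub>-\<^sub>j/\<partial>zbar\<^sub>j\<close> (with the sign of moving \<open>dzbar\<^sub>j\<close> past \<open>dz\<^sup>I\<close> into its place in \<open>dzbar\<^sup>J\<close>)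
  and, for \<open>i \<in> I\<close>, the terms \<open>f\<^sub>i \<phi>\<^sub>I\<^sub>-\<^sub>i\<^sub>,\<^sub>J\<close>.  Only the total expression, not the individual
  derivatives, is required to be a function.\<close>

definition weak_dbar ::
    "(complex ^ 'n::{finite,linorder}) set \<Rightarrow> (complex ^ 'n::{finite,linorder} \<Rightarrow> complex) \<Rightarrow> 'n form \<Rightarrow> 'n form \<Rightarrow> bool"
  where
  "weak_dbar D f \<phi> \<psi> \<longleftrightarrow>
     (\<forall>I J \<theta>. test_function D \<theta> \<longrightarrow>
        (LINT z:D|lebesgue. coef \<psi> I J z * \<theta> z) =
          (\<Sum>j\<in>J. (-1) ^ (card I + card {l\<in>J. l < j}) *
                    - (LINT z:D|lebesgue. coef \<phi> I (J - {j}) z * d_zbar j \<theta> z)) +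
          (\<Sum>i\<in>I. (-1) ^ card {l\<in>I. l < i} *
                    (LINT z:D|lebesgue. d_z i f z * coef \<phi> (I - {i}) J z * \<theta> z)))"

definition Dom_dbar ::
    "(complex ^ 'n::{finite,linorder}) set \<Rightarrow> (complex ^ 'n::{finite,linorder} \<Rightarrow> complex) \<Rightarrow> 'n form set" where
  "Dom_dbar D f = {\<phi>\<in>L2 D. \<exists>\<psi>\<in>L2 D. weak_dbar D f \<phi> \<psi>}"

definition dbar ::
    "(complex ^ 'n::{finite,linorder}) set \<Rightarrow> (complex ^ 'n::{finite,linorder} \<Rightarrow> complex) \<Rightarrow> 'n form \<Rightarrow> 'n form" where
  "dbar D f \<phi> = (THE \<psi>. \<psi> \<in> L2 D \<and> weak_dbar D f \<phi> \<psi>)"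

definition Dom_dbar_adj ::
    "(complex ^ 'n::{finite,linorder}) set \<Rightarrow> (complex ^ 'n::{finite,linorder} \<Rightarrow> complex) \<Rightarrow> 'n form set" where
  "Dom_dbar_adj D f =
     {\<psi>\<in>L2 D. \<exists>\<eta>\<in>L2 D. \<forall>\<phi>\<in>Dom_dbar D f. inner_form D (dbar D f \<phi>) \<psi> = inner_form D \<phi> \<eta>}"

definition dbar_adj ::
    "(complex ^ 'n::{finite,linorder}) set \<Rightarrow> (complex ^ 'n::{finite,linorder} \<Rightarrow> complex) \<Rightarrow> 'n form \<Rightarrow> 'n form" where
  "dbar_adj D f \<psi> =
     (THE \<eta>. \<eta> \<in> L2 D \<and> (\<forall>\<phi>\<in>Dom_dbar D f. inner_form D (dbar D f \<phi>) \<psi> = inner_form D \<phi> \<eta>))"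

definition Dom_laplacian ::
    "(complex ^ 'n::{finite,linorder}) set \<Rightarrow> (complex ^ 'n::{finite,linorder} \<Rightarrow> complex) \<Rightarrow> 'n form set" where
  "Dom_laplacian D f =
     {\<phi>\<in>Dom_dbar D f \<inter> Dom_dbar_adj D f. dbar D f \<phi> \<in> Dom_dbar_adj D f \<and> dbar_adj D f \<phi> \<in> Dom_dbar D f}"

definition laplacian ::
    "(complex ^ 'n::{finite,linorder}) set \<Rightarrow> (complex ^ 'n::{finite,linorder} \<Rightarrow> complex) \<Rightarrow> 'n form \<Rightarrow> 'n form" where
  "laplacian D f \<phi> = dbar D f (dbar_adj D f \<phi>) + dbar_adj D f (dbar D f \<phi>)"

definition harmonic ::
    "(complex ^ 'n::{finite,linorder}) set \<Rightarrow> (complex ^ 'n::{finite,linorder} \<Rightarrow> complex) \<Rightarrow> int \<Rightarrow> 'n form set" where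
  "harmonic D f k = {\<phi>\<in>Dom_laplacian D f \<inter> L2_deg D k. laplacian D f \<phi> = 0}"

definition im_dbar ::
    "(complex ^ 'n::{finite,linorder}) set \<Rightarrow> (complex ^ 'n::{finite,linorder} \<Rightarrow> complex) \<Rightarrow> int \<Rightarrow> 'n form set" where
  "im_dbar D f k = dbar D f ` Dom_dbar D f \<inter> L2_deg D k"

definition im_dbar_adj ::
    "(complex ^ 'n::{finite,linorder}) set \<Rightarrow> (complex ^ 'n::{finite,linorder} \<Rightarrow> complex) \<Rightarrow> int \<Rightarrow> 'n form set" where
  "im_dbar_adj D f k = dbar_adj D f ` Dom_dbar_adj D f \<inter> L2_deg D k"


section \<open>Cohomology\<close>

definition cocycles ::
    "(complex ^ 'n::{finite,linorder}) set \<Rightarrow> (complex ^ 'n::{finite,linorder} \<Rightarrow> complex) \<Rightarrow> int \<Rightarrow> 'n form set" where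
  "cocycles D f k = {\<phi>\<in>Dom_dbar D f \<inter> L2_deg D k. dbar D f \<phi> = 0}"

definition coboundaries ::
    "(complex ^ 'n::{finite,linorder}) set \<Rightarrow> (complex ^ 'n::{finite,linorder} \<Rightarrow> complex) \<Rightarrow> int \<Rightarrow> 'n form set" where
  "coboundaries D f k = dbar D f ` (Dom_dbar D f \<inter> L2_deg D (k - 1))"

definition cohomologous ::
    "(complex ^ 'n::{finite,linorder}) set \<Rightarrow> (complex ^ 'n::{finite,linorder} \<Rightarrow> complex) \<Rightarrow> int \<Rightarrow> ('n form \<times> 'n form) set"
  where
  "cohomologous D f k =
     {(\<phi>, \<psi>). \<phi> \<in> cocycles D f k \<and> \<psi> \<in> cocycles D f k \<and> \<phi> - \<psi> \<in> coboundaries D f k}"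

definition cohomology_class ::
    "(complex ^ 'n::{finite,linorder}) set \<Rightarrow> (complex ^ 'n::{finite,linorder} \<Rightarrow> complex) \<Rightarrow> int \<Rightarrow> 'n form \<Rightarrow> 'n form set"
  where
  "cohomology_class D f k \<phi> = cohomologous D f k `` {\<phi>}"

definition cohomology ::
    "(complex ^ 'n::{finite,linorder}) set \<Rightarrow> (complex ^ 'n::{finite,linorder} \<Rightarrow> complex) \<Rightarrow> int \<Rightarrow> 'n form set set" where
  "cohomology D f k = cocycles D f k // cohomologous D f k"

text \<open>Linearity refers to the quotient vector space structure \<open>[\<phi>] + [\<psi>] = [\<phi> + \<psi>]\<close>,
  \<open>c [\<phi>] = [c \<phi>]\<close> on the cohomology.\<close>

definition cohomology_iso ::
    "(complex ^ 'n::{finite,linorder}) set \<Rightarrow> (complex ^ 'n::{finite,linorder} \<Rightarrow> complex) \<Rightarrow> int \<Rightarrow>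
      ('n form set \<Rightarrow> 'n form) \<Rightarrow> 'n form set \<Rightarrow> bool" where
  "cohomology_iso D f k T V \<longleftrightarrow>
     bij_betw T (cohomology D f k) V \<and>
     (\<forall>\<phi>\<in>cocycles D f k. \<forall>\<psi>\<in>cocycles D f k.
        T (cohomology_class D f k (\<phi> + \<psi>)) =
          T (cohomology_class D f k \<phi>) + T (cohomology_class D f k \<psi>)) \<and>
     (\<forall>c. \<forall>\<phi>\<in>cocycles D f k.
        T (cohomology_class D f k (scale_form c \<phi>)) = scale_form c (T (cohomology_class D f k \<phi>)))"


section \<open>Direct sums and dimension\<close>

text \<open>Direct sum of subspaces of the Hilbert space \<open>L2 D\<close>: an orthogonal direct sum.\<close>

definition orthogonal_sets :: "(complex ^ 'n::finite) set \<Rightarrow> 'n form set \<Rightarrow> 'n form set \<Rightarrow> bool" where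
  "orthogonal_sets D A B \<longleftrightarrow> (\<forall>a\<in>A. \<forall>b\<in>B. inner_form D a b = 0)"

definition direct_sum3 ::
    "(complex ^ 'n::finite) set \<Rightarrow> 'n form set \<Rightarrow> 'n form set \<Rightarrow> 'n form set \<Rightarrow> 'n form set \<Rightarrow> bool" where
  "direct_sum3 D V A B C \<longleftrightarrow>
     form.subspace A \<and> form.subspace B \<and> form.subspace C \<and>
     A \<subseteq> V \<and> B \<subseteq> V \<and> C \<subseteq> V \<and>
     (\<forall>v\<in>V. \<exists>!(a, b, c). a \<in> A \<and> b \<in> B \<and> c \<in> C \<and> v = a + b + c) \<and>
     orthogonal_sets D A B \<and> orthogonal_sets D A C \<and> orthogonal_sets D B C"

definition finite_dim :: "'n::finite form set \<Rightarrow> bool" where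
  "finite_dim V \<longleftrightarrow> (\<exists>S. finite S \<and> form.span S = V)"

end

theory Submission
  imports Defs "HOL-Complex_Analysis.Complex_Analysis"
begin

text \<open>Let \<open>r\<close> be a bump function that is positive at the critical points.  The field
  \<open>g\<^sub>i = conj(f\<^sub>i) / (|\<partial>f|\<^sup>2 + r)\<close> is smooth and bounded on \<open>D\<close> together with its derivatives, because \<open>\<partial>f\<close>
  has no zero on \<open>\<partial>D\<close>, and \<open>\<Sum> g\<^sub>i f\<^sub>i = 1\<close> off a compact \<open>K \<subseteq> D\<close>.  Contraction \<open>h\<close> with \<open>g\<close> satisfies
  \<open>dbar\<^sub>f h + h dbar\<^sub>f = 1 - B\<close>, where off \<open>K\<close> the bounded operator \<open>B\<close> strictly raises the antiholomorphic
  degree and so is nilpotent.  Iterating, every \<open>\<phi>\<close> orthogonal to \<open>im dbar\<^sub>f\<close> satisfies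
  \<open>|\<phi>| \<le> c (|dbar\<^sub>f \<phi>| + |\<eta> \<phi>|)\<close> for a cutoff \<open>\<eta>\<close> that is at least 1 on \<open>K\<close>.  Such \<open>\<phi>\<close> also lies in the
  kernel of the formal adjoint, so the Fourier coefficients of \<open>\<eta> \<phi>\<close> obey an elliptic estimate and
  Rellich's argument makes \<open>\<eta> \<phi>\<close> range over a precompact set.  Closed range and finiteness of the
  harmonic space are then Hilbert space theory.\<close>

section \<open>Smooth functions and test functions\<close>

text \<open>No regularity up to the boundary is ever established. The contraction \<open>h\<close>
  acts on the maximal domain of \<open>dbar\<^sub>f\<close>, because multiplication by the smooth
  \<open>g\<^sub>i\<close> sends test functions on D to test functions, so that no boundary
  condition has to be checked; only the compactly supported \<open>\<eta> \<phi>\<close> needs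
  regularity. When the homotopy identity for a form \<open>B^m \<phi>\<close> is paired with \<phi>,
  the term \<open>dbar\<^sub>f h B^m \<phi>\<close> drops out, since \<phi> is orthogonal to the
  image. What remains after n + 1 rounds is the pairing of \<phi> with
  \<open>B^(n+1) \<phi>\<close>, which lives on \<open>K\<close>. Orthogonality to the image
  contains the weak equation of the formal adjoint because test forms lie in the domain. Jointly
  with the equation for \<open>dbar\<^sub>f \<phi>\<close> it is an elliptic first order system: by
  the anticommutation relations its symbol squares to the squared frequency. The Hilbert space
  argument runs over the reals and in all degrees at once; complex scalars and the grading return at
  the end because the graph of the operator is stable under both.\<close>

lemma Ck_on_cong:
  assumes "open U" "\<And>x. x \<in> U \<Longrightarrow> f x = g x" "Ck_on k U f"
  shows "Ck_on k U g"
  using assms(2,3)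
proof (induction k arbitrary: f g)
  case 0
  then show ?case by (simp cong: continuous_on_cong)
next
  case (Suc k)
  have fd: "frechet_derivative f (at x) = frechet_derivative g (at x)" if "x \<in> U" for x
    using frechet_derivative_transform_within_open[of f x U g] Suc.prems assms(1) that by auto
  have "g differentiable (at x)" if "x \<in> U" for x
  proof -
    have "(f has_derivative frechet_derivative f (at x)) (at x)"
      using Suc.prems that by (simp add: frechet_derivative_works)
    then have "(g has_derivative frechet_derivative f (at x)) (at x)"
      using has_derivative_transform_within_open assms(1) that Suc.prems(1) by blast
    then show ?thesis by (auto simp: differentiable_def)
  qed
  moreover have "Ck_on k U (\<lambda>x. frechet_derivative g (at x) v)" for v
    by (rule Suc.IH[of "\<lambda>x. frechet_derivative f (at x) v"]) (use fd Suc.prems in auto)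
  ultimately show ?case by simp
qed

text \<open>An explicit derivative replaces the choice hidden in \<open>frechet_derivative\<close>;
  with it each closure property of C^k functions below is an induction on k.\<close>

lemma Ck_on_SucI:
  assumes "open U" "\<And>x. x \<in> U \<Longrightarrow> (f has_derivative f' x) (at x)"
    "\<And>v. Ck_on k U (\<lambda>x. f' x v)"
  shows "Ck_on (Suc k) U f"
proof -
  have fd: "frechet_derivative f (at x) = f' x" if "x \<in> U" for x
    using frechet_derivative_at[OF assms(2)[OF that]] by simp
  have "Ck_on k U (\<lambda>x. frechet_derivative f (at x) v)" for v
    by (rule Ck_on_cong[OF assms(1) _ assms(3)[of v]]) (simp add: fd)
  then show ?thesis using assms(2) by (auto simp: differentiable_def)
qed

lemma Ck_on_SucD:
  assumes "Ck_on (Suc k) U f"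
  shows "\<And>x. x \<in> U \<Longrightarrow> (f has_derivative frechet_derivative f (at x)) (at x)"
    "\<And>v. Ck_on k U (\<lambda>x. frechet_derivative f (at x) v)"
  using assms by (auto simp: frechet_derivative_works)

lemma Ck_on_Suc_imp: "Ck_on (Suc k) U f \<Longrightarrow> Ck_on k U f"
proof (induction k arbitrary: f)
  case 0
  then show ?case
    by (auto simp: continuous_on_eq_continuous_within intro!: differentiable_imp_continuous_within
        intro: differentiable_at_withinI)
next
  case (Suc k)
  show ?case using Suc.prems Suc.IH by (subst Ck_on.simps) (auto simp del: Ck_on.simps simp: Ck_on.simps(2)[of "Suc k"])
qed

lemma Ck_on_subset: "Ck_on k U f \<Longrightarrow> V \<subseteq> U \<Longrightarrow> Ck_on k V f"
  by (induction k arbitrary: f) (auto intro: continuous_on_subset)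

lemma Ck_on_Un:
  assumes "open U" "open V" "Ck_on k U f" "Ck_on k V f"
  shows "Ck_on k (U \<union> V) f"
  using assms(3,4) by (induction k arbitrary: f) (auto intro: continuous_on_open_Un assms)

lemma Ck_on_const: "open U \<Longrightarrow> Ck_on k U (\<lambda>x. c)"
proof (induction k arbitrary: c)
  case (Suc k)
  then show ?case by (intro Ck_on_SucI[where f' = "\<lambda>x v. 0"]) auto
qed auto

lemma Ck_on_bounded_linear_comp:
  assumes "bounded_linear L" "open U" "Ck_on k U f"
  shows "Ck_on k U (\<lambda>x. L (f x))"
  using assms(3)
proof (induction k arbitrary: f)
  case 0
  then show ?case using assms(1) by (auto intro: bounded_linear.continuous_on)
next
  case (Suc k)
  show ?case
    by (rule Ck_on_SucI[OF assms(2), where f' = "\<lambda>x v. L (frechet_derivative f (at x) v)"])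
      (use Ck_on_SucD[OF Suc.prems] Suc.IH bounded_linear.has_derivative[OF assms(1)] in blast)+
qed

lemma Ck_on_bounded_linear:
  assumes "bounded_linear L" "open U"
  shows "Ck_on k U L"
proof (cases k)
  case 0
  then show ?thesis using assms by (auto intro: linear_continuous_on)
next
  case (Suc m)
  show ?thesis unfolding Suc
    by (rule Ck_on_SucI[OF assms(2), where f' = "\<lambda>x v. L v"])
      (auto intro: bounded_linear_imp_has_derivative assms Ck_on_const)
qed

lemma Ck_on_add:
  assumes "open U" "Ck_on k U f" "Ck_on k U g"
  shows "Ck_on k U (\<lambda>x. f x + g x)"
  using assms(2,3)
proof (induction k arbitrary: f g)
  case 0
  then show ?case by (auto intro: continuous_intros)
next
  case (Suc k)
  show ?case
    by (rule Ck_on_SucI[OF assms(1),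
          where f' = "\<lambda>x v. frechet_derivative f (at x) v + frechet_derivative g (at x) v"])
      (use Ck_on_SucD[OF Suc.prems(1)] Ck_on_SucD[OF Suc.prems(2)] Suc.IH has_derivative_add in blast)+
qed

lemma Ck_on_mult:
  fixes f g :: "'a::real_normed_vector \<Rightarrow> 'b::real_normed_algebra"
  assumes "open U" "Ck_on k U f" "Ck_on k U g"
  shows "Ck_on k U (\<lambda>x. f x * g x)"
  using assms(2,3)
proof (induction k arbitrary: f g)
  case 0
  then show ?case by (auto intro: continuous_intros)
next
  case (Suc k)
  \<comment> \<open>The product rule at order k + 1 also involves the undifferentiated factors, at
    order k.\<close>
  have *: "Ck_on k U f" "Ck_on k U g" using Suc.prems Ck_on_Suc_imp by blast+
  show ?case
  proof (rule Ck_on_SucI[OF assms(1), where f' = "\<lambda>x v. f x * frechet_derivative g (at x) v + frechet_derivative f (at x) v * g x"])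
    fix x assume "x \<in> U"
    then show "((\<lambda>x. f x * g x) has_derivative
        (\<lambda>v. f x * frechet_derivative g (at x) v + frechet_derivative f (at x) v * g x)) (at x)"
      using has_derivative_mult Ck_on_SucD(1)[OF Suc.prems(1)] Ck_on_SucD(1)[OF Suc.prems(2)] by blast
  next
    fix v
    show "Ck_on k U (\<lambda>x. f x * frechet_derivative g (at x) v + frechet_derivative f (at x) v * g x)"
      by (intro Ck_on_add assms Suc.IH * Ck_on_SucD[OF Suc.prems(1)] Ck_on_SucD[OF Suc.prems(2)])
  qed
qed

lemma Ck_on_uminus:
  assumes "open U" "Ck_on k U f"
  shows "Ck_on k U (\<lambda>x. - f x)"
  using Ck_on_bounded_linear_comp[OF bounded_linear_minus[OF bounded_linear_ident] assms] .

lemma Ck_on_diff: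
  assumes "open U" "Ck_on k U f" "Ck_on k U g"
  shows "Ck_on k U (\<lambda>x. f x - g x)"
  using Ck_on_add[OF assms(1,2) Ck_on_uminus[OF assms(1,3)]] by simp

lemma Ck_on_sum:
  assumes "open U" "finite S" "\<And>i. i \<in> S \<Longrightarrow> Ck_on k U (f i)"
  shows "Ck_on k U (\<lambda>x. \<Sum>i\<in>S. f i x)"
  using assms(2,3) by (induction S) (auto intro: Ck_on_const Ck_on_add assms(1))

lemma Ck_on_prod:
  fixes f :: "'i \<Rightarrow> 'a::real_normed_vector \<Rightarrow> 'b::{real_normed_algebra, comm_ring_1}"
  assumes "open U" "finite S" "\<And>i. i \<in> S \<Longrightarrow> Ck_on k U (f i)"
  shows "Ck_on k U (\<lambda>x. \<Prod>i\<in>S. f i x)"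
  using assms(2,3) by (induction S) (auto intro: Ck_on_const Ck_on_mult assms(1))

lemma Ck_on_inverse:
  fixes g :: "'a::real_normed_vector \<Rightarrow> 'b::real_normed_field"
  assumes "open U" "Ck_on k U g" "\<And>x. x \<in> U \<Longrightarrow> g x \<noteq> 0"
  shows "Ck_on k U (\<lambda>x. inverse (g x))"
  using assms(2)
proof (induction k)
  case 0
  then show ?case using assms(3) by (auto intro!: continuous_intros)
next
  case (Suc k)
  have *: "Ck_on k U (\<lambda>x. inverse (g x))" using Suc Ck_on_Suc_imp by blast
  show ?case
  proof (rule Ck_on_SucI[OF assms(1), where f' = "\<lambda>x v. - (inverse (g x) * frechet_derivative g (at x) v * inverse (g x))"])
    fix x assume "x \<in> U"
    then show "((\<lambda>x. inverse (g x)) has_derivative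
        (\<lambda>v. - (inverse (g x) * frechet_derivative g (at x) v * inverse (g x)))) (at x)"
      by (intro Deriv.has_derivative_inverse assms Ck_on_SucD[OF Suc.prems])
  qed (intro Ck_on_mult Ck_on_uminus assms * Ck_on_SucD[OF Suc.prems])
qed

lemma Ck_on_exp:
  fixes g :: "'a::real_normed_vector \<Rightarrow> complex"
  assumes "open U" "Ck_on k U g"
  shows "Ck_on k U (\<lambda>x. exp (g x))"
  using assms(2)
proof (induction k)
  case 0
  then show ?case by (auto intro!: continuous_intros)
next
  case (Suc k)
  have *: "Ck_on k U (\<lambda>x. exp (g x))" using Suc Ck_on_Suc_imp by blast
  show ?case
  proof (rule Ck_on_SucI[OF assms(1), where f' = "\<lambda>x v. frechet_derivative g (at x) v * exp (g x)"])
    fix x assume "x \<in> U"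
    from Ck_on_SucD(1)[OF Suc.prems this]
    show "((\<lambda>x. exp (g x)) has_derivative (\<lambda>v. frechet_derivative g (at x) v * exp (g x))) (at x)"
      using has_derivative_compose[of g "frechet_derivative g (at x)" x UNIV exp "\<lambda>v. v * exp (g x)"]
      by (simp add: has_field_derivative_def [symmetric] mult.commute[of _ "exp (g x)"] DERIV_exp)
  qed (intro Ck_on_mult assms * Ck_on_SucD[OF Suc.prems])
qed

section \<open>A flat function and the smoothness of its compositions\<close>

definition flat_exp :: "nat \<Rightarrow> real \<Rightarrow> real" where
  "flat_exp m t = (if t > 0 then inverse t ^ m * exp (- inverse t) else 0)"

lemma flat_exp_0_lim: "((\<lambda>t. flat_exp m t) \<longlongrightarrow> 0) (at 0)"
proof -
  have "((\<lambda>t::real. inverse t ^ m * exp (- inverse t)) \<longlongrightarrow> 0) (at_right 0)"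
  proof -
    have "((\<lambda>s::real. s ^ m / exp s) \<longlongrightarrow> 0) at_top" by (rule tendsto_power_div_exp_0)
    from filterlim_compose[OF this filterlim_inverse_at_top_right]
    show ?thesis by (simp add: exp_minus divide_inverse)
  qed
  then have "(flat_exp m \<longlongrightarrow> 0) (at_right 0)"
    by (rule Lim_transform_eventually) (auto simp: flat_exp_def eventually_at_filter)
  moreover have "(flat_exp m \<longlongrightarrow> 0) (at_left 0)"
    by (rule tendsto_eventually) (auto simp: flat_exp_def eventually_at_filter)
  ultimately show ?thesis by (simp add: filterlim_split_at)
qed

text \<open>The functions t^-m exp (-1/t), extended by 0, are closed under differentiation up to
  linear combinations. Carrying the exponent m along lets one induction prove smoothness for all m,
  in particular for m = 0, from which the bumps are built.\<close>

lemma DERIV_flat_exp: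
  "(flat_exp m has_field_derivative (flat_exp (m + 2) t - of_nat m * flat_exp (m + 1) t)) (at t)"
proof (cases "t = 0")
  case True
  \<comment> \<open>At 0 the difference quotient of index m is the function of index m + 1, which
    tends to 0.\<close>
  have "((\<lambda>y. (flat_exp m y - flat_exp m 0) / (y - 0)) \<longlongrightarrow> 0) (at 0)"
    by (rule Lim_transform_eventually[OF flat_exp_0_lim[of "Suc m"]])
      (auto simp: flat_exp_def eventually_at_filter field_simps)
  then show ?thesis using True by (simp add: has_field_derivative_iff flat_exp_def)
next
  case False
  show ?thesis
  proof (cases "t > 0")
    case True
    have "((\<lambda>t. inverse t ^ m * exp (- inverse t)) has_field_derivative
         (flat_exp (m + 2) t - of_nat m * flat_exp (m + 1) t)) (at t)"
    proof (cases m)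
      case 0
      then show ?thesis using True
        by (auto intro!: derivative_eq_intros simp: flat_exp_def power2_eq_square field_simps)
    next
      case (Suc l)
      have "((\<lambda>t::real. exp (- inverse t)) has_field_derivative exp (- inverse t) * inverse t ^ 2) (at t)"
        using True by (auto intro!: derivative_eq_intros simp: power2_eq_square field_simps)
      from DERIV_mult[OF DERIV_power_Suc[OF DERIV_inverse, of t l] this] True
      show ?thesis unfolding Suc
        by (simp add: flat_exp_def power2_eq_square algebra_simps)
    qed
    then show ?thesis
      by (rule has_field_derivative_transform_within_open[where S = "{0<..}"])
        (use True in \<open>auto simp: flat_exp_def\<close>)
  next
    case nt: False
    have "((\<lambda>t. 0) has_field_derivative (flat_exp (m + 2) t - of_nat m * flat_exp (m + 1) t)) (at t)"
      using nt by (simp add: flat_exp_def)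
    then show ?thesis
      by (rule has_field_derivative_transform_within_open[where S = "{..<0}"])
        (use False nt in \<open>auto simp: flat_exp_def\<close>)
  qed
qed

lemma Ck_on_flat_exp:
  assumes "open U" "Ck_on k U g"
  shows "Ck_on k U (\<lambda>x. flat_exp m (g x))"
  using assms(2)
proof (induction k arbitrary: m)
  case 0
  have "continuous_on UNIV (flat_exp m)"
    using DERIV_flat_exp by (meson DERIV_isCont continuous_at_imp_continuous_on)
  with 0 show ?case by (auto intro: continuous_on_compose2)
next
  case (Suc k)
  have *: "Ck_on k U (\<lambda>x. flat_exp m (g x))" for m using Suc Ck_on_Suc_imp by blast
  show ?case
  proof (rule Ck_on_SucI[OF assms(1), where f' = "\<lambda>x v. (flat_exp (m + 2) (g x) - of_nat m * flat_exp (m + 1) (g x)) * frechet_derivative g (at x) v"])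
    fix x assume "x \<in> U"
    from Ck_on_SucD(1)[OF Suc.prems this]
    show "((\<lambda>x. flat_exp m (g x)) has_derivative (\<lambda>v. (flat_exp (m + 2) (g x) - of_nat m * flat_exp (m + 1) (g x)) * frechet_derivative g (at x) v)) (at x)"
      using has_derivative_compose[of g "frechet_derivative g (at x)" x UNIV "flat_exp m"]
        DERIV_flat_exp[of m "g x"] unfolding has_field_derivative_def by blast
  qed (intro Ck_on_mult Ck_on_diff Ck_on_const assms * Ck_on_SucD[OF Suc.prems])
qed

lemma smooth_on_imp_continuous_on: "smooth_on U f \<Longrightarrow> continuous_on U f"
  unfolding smooth_on_def using Ck_on.simps(1) by blast

lemma smooth_on_has_derivative:
  "smooth_on U f \<Longrightarrow> x \<in> U \<Longrightarrow> (f has_derivative frechet_derivative f (at x)) (at x)"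
  unfolding smooth_on_def using Ck_on_SucD(1)[of 0 U f x] by blast

lemma smooth_on_frechet_derivative: "smooth_on U f \<Longrightarrow> smooth_on U (\<lambda>x. frechet_derivative f (at x) v)"
  unfolding smooth_on_def using Ck_on_SucD(2) by blast

lemma smooth_on_cong:
  "open U \<Longrightarrow> (\<And>x. x \<in> U \<Longrightarrow> f x = g x) \<Longrightarrow> smooth_on U f \<Longrightarrow> smooth_on U g"
  unfolding smooth_on_def using Ck_on_cong by blast

lemma smooth_on_subset: "smooth_on U f \<Longrightarrow> V \<subseteq> U \<Longrightarrow> smooth_on V f"
  unfolding smooth_on_def using Ck_on_subset by blast

lemma smooth_on_Un: "open U \<Longrightarrow> open V \<Longrightarrow> smooth_on U f \<Longrightarrow> smooth_on V f \<Longrightarrow> smooth_on (U \<union> V) f"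
  unfolding smooth_on_def using Ck_on_Un by blast

lemma smooth_on_const: "open U \<Longrightarrow> smooth_on U (\<lambda>x. c)"
  unfolding smooth_on_def using Ck_on_const by blast

lemma smooth_on_add: "open U \<Longrightarrow> smooth_on U f \<Longrightarrow> smooth_on U g \<Longrightarrow> smooth_on U (\<lambda>x. f x + g x)"
  unfolding smooth_on_def using Ck_on_add by blast

lemma smooth_on_diff: "open U \<Longrightarrow> smooth_on U f \<Longrightarrow> smooth_on U g \<Longrightarrow> smooth_on U (\<lambda>x. f x - g x)"
  unfolding smooth_on_def using Ck_on_diff by blast

lemma smooth_on_mult:
  fixes f g :: "'a::real_normed_vector \<Rightarrow> 'b::real_normed_algebra"
  shows "open U \<Longrightarrow> smooth_on U f \<Longrightarrow> smooth_on U g \<Longrightarrow> smooth_on U (\<lambda>x. f x * g x)"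
  unfolding smooth_on_def using Ck_on_mult by blast

lemma smooth_on_sum:
  "open U \<Longrightarrow> finite S \<Longrightarrow> (\<And>i. i \<in> S \<Longrightarrow> smooth_on U (f i)) \<Longrightarrow> smooth_on U (\<lambda>x. \<Sum>i\<in>S. f i x)"
  unfolding smooth_on_def by (simp add: Ck_on_sum)

lemma smooth_on_bounded_linear_comp:
  "bounded_linear L \<Longrightarrow> open U \<Longrightarrow> smooth_on U f \<Longrightarrow> smooth_on U (\<lambda>x. L (f x))"
  unfolding smooth_on_def using Ck_on_bounded_linear_comp by blast

lemma smooth_on_bounded_linear: "bounded_linear L \<Longrightarrow> open U \<Longrightarrow> smooth_on U L"
  unfolding smooth_on_def using Ck_on_bounded_linear by blast

lemma smooth_on_prod:
  fixes f :: "'i \<Rightarrow> 'a::real_normed_vector \<Rightarrow> 'b::{real_normed_algebra, comm_ring_1}"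
  shows "open U \<Longrightarrow> finite S \<Longrightarrow> (\<And>i. i \<in> S \<Longrightarrow> smooth_on U (f i)) \<Longrightarrow> smooth_on U (\<lambda>x. \<Prod>i\<in>S. f i x)"
  unfolding smooth_on_def by (simp add: Ck_on_prod)

lemma smooth_on_inverse:
  fixes g :: "'a::real_normed_vector \<Rightarrow> 'b::real_normed_field"
  shows "open U \<Longrightarrow> smooth_on U g \<Longrightarrow> (\<And>x. x \<in> U \<Longrightarrow> g x \<noteq> 0) \<Longrightarrow> smooth_on U (\<lambda>x. inverse (g x))"
  unfolding smooth_on_def by (simp add: Ck_on_inverse)

lemma smooth_on_exp:
  fixes g :: "'a::real_normed_vector \<Rightarrow> complex"
  shows "open U \<Longrightarrow> smooth_on U g \<Longrightarrow> smooth_on U (\<lambda>x. exp (g x))"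
  unfolding smooth_on_def by (simp add: Ck_on_exp)

lemma smooth_on_flat_exp: "open U \<Longrightarrow> smooth_on U g \<Longrightarrow> smooth_on U (\<lambda>x. flat_exp m (g x))"
  unfolding smooth_on_def by (simp add: Ck_on_flat_exp)

section \<open>Symmetry of second derivatives\<close>

lemma smooth_on_DERIV_along:
  fixes \<phi> :: "'a::real_normed_vector \<Rightarrow> real"
  assumes "smooth_on UNIV \<phi>"
  shows "((\<lambda>s. \<phi> (y + s *\<^sub>R v)) has_field_derivative frechet_derivative \<phi> (at (y + s *\<^sub>R v)) v) (at s)"
proof -
  let ?D = "frechet_derivative \<phi> (at (y + s *\<^sub>R v))"
  have D: "(\<phi> has_derivative ?D) (at (y + s *\<^sub>R v))"
    using smooth_on_has_derivative[OF assms] by simp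
  have "((\<lambda>s. y + s *\<^sub>R v) has_derivative (\<lambda>t. t *\<^sub>R v)) (at s)"
    by (auto intro!: derivative_eq_intros)
  from has_derivative_compose[OF this D]
  have "((\<lambda>s. \<phi> (y + s *\<^sub>R v)) has_derivative (\<lambda>t. ?D (t *\<^sub>R v))) (at s)" .
  moreover have "(\<lambda>t. ?D (t *\<^sub>R v)) = times (?D v)"
    using linear_cmul[OF has_derivative_linear[OF D]] by (auto simp: mult.commute)
  ultimately show ?thesis by (simp add: has_field_derivative_def)
qed

text \<open>The mean value theorem is used twice: in direction v for the increment of \<phi> along h
  w, then in direction w for the derivative along v. The left side is symmetric in v and w, so the
  mixed derivatives in both orders can be compared through it.\<close>

lemma second_difference_MVT:
  fixes \<phi> :: "'a::real_normed_vector \<Rightarrow> real"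
  assumes "smooth_on UNIV \<phi>" "h > 0"
  shows "\<exists>s t. 0 < s \<and> s < h \<and> 0 < t \<and> t < h \<and>
     \<phi> (x + h *\<^sub>R v + h *\<^sub>R w) - \<phi> (x + h *\<^sub>R v) - \<phi> (x + h *\<^sub>R w) + \<phi> x
      = h * h * frechet_derivative (\<lambda>y. frechet_derivative \<phi> (at y) v) (at (x + s *\<^sub>R v + t *\<^sub>R w)) w"
proof -
  let ?Dv = "\<lambda>y. frechet_derivative \<phi> (at y) v"
  have "((\<lambda>s. \<phi> ((x + h *\<^sub>R w) + s *\<^sub>R v) - \<phi> (x + s *\<^sub>R v)) has_field_derivative
        (?Dv ((x + h *\<^sub>R w) + s *\<^sub>R v) - ?Dv (x + s *\<^sub>R v))) (at s)" for s
    by (intro DERIV_diff smooth_on_DERIV_along assms)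
  from MVT2[OF assms(2) this] obtain s where s: "0 < s" "s < h"
    "(\<phi> ((x + h *\<^sub>R w) + h *\<^sub>R v) - \<phi> (x + h *\<^sub>R v)) - (\<phi> ((x + h *\<^sub>R w)) - \<phi> x)
      = h * (?Dv ((x + h *\<^sub>R w) + s *\<^sub>R v) - ?Dv (x + s *\<^sub>R v))" by auto
  have "smooth_on UNIV ?Dv" by (rule smooth_on_frechet_derivative[OF assms(1)])
  from smooth_on_DERIV_along[OF this]
  have "((\<lambda>t. ?Dv ((x + s *\<^sub>R v) + t *\<^sub>R w)) has_field_derivative
     frechet_derivative ?Dv (at ((x + s *\<^sub>R v) + t *\<^sub>R w)) w) (at t)" for t .
  from MVT2[OF assms(2) this] obtain t where t: "0 < t" "t < h"
    "?Dv ((x + s *\<^sub>R v) + h *\<^sub>R w) - ?Dv (x + s *\<^sub>R v) = h * frechet_derivative ?Dv (at ((x + s *\<^sub>R v) + t *\<^sub>R w)) w"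
    by auto
  show ?thesis
    using s t by (intro exI[of _ s] exI[of _ t]) (simp add: algebra_simps)
qed

lemma symmetric_second_derivative_real:
  fixes \<phi> :: "'a::real_normed_vector \<Rightarrow> real"
  assumes "smooth_on UNIV \<phi>"
  shows "frechet_derivative (\<lambda>y. frechet_derivative \<phi> (at y) v) (at x) w =
    frechet_derivative (\<lambda>y. frechet_derivative \<phi> (at y) w) (at x) v"
proof (rule ccontr)
  let ?D = "\<lambda>v w x. frechet_derivative (\<lambda>y. frechet_derivative \<phi> (at y) v) (at x) w"
  assume neq: "?D v w x \<noteq> ?D w v x"
  \<comment> \<open>Half the supposed gap: a single number cannot be closer than this to both mixed
    derivatives at x.\<close>
  define e where "e = \<bar>?D v w x - ?D w v x\<bar> / 2"
  have e: "e > 0" using neq by (simp add: e_def)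
  have c: "isCont (?D v w) x" for v w
    using smooth_on_imp_continuous_on[OF smooth_on_frechet_derivative[OF smooth_on_frechet_derivative[OF assms]]]
    by (simp add: continuous_on_eq_continuous_at)
  obtain d1 where d1: "d1 > 0" "\<And>y. dist y x < d1 \<Longrightarrow> dist (?D v w y) (?D v w x) < e"
    using c[of v w] e unfolding continuous_at_eps_delta by blast
  obtain d2 where d2: "d2 > 0" "\<And>y. dist y x < d2 \<Longrightarrow> dist (?D w v y) (?D w v x) < e"
    using c[of w v] e unfolding continuous_at_eps_delta by blast
  \<comment> \<open>Keeps every point x + s v + t w with s, t < h within both radii; the 1 in the
    denominator covers v = w = 0.\<close>
  define h where "h = min d1 d2 / (norm v + norm w + 1)"
  have h: "h > 0" using d1 d2 by (simp add: h_def add_nonneg_pos)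
  have near: "dist (x + s *\<^sub>R v + t *\<^sub>R w) x < min d1 d2" if "0 < s" "s < h" "0 < t" "t < h" for s t
  proof -
    have "dist (x + s *\<^sub>R v + t *\<^sub>R w) x \<le> s * norm v + t * norm w"
      using that norm_triangle_ineq[of "s *\<^sub>R v" "t *\<^sub>R w"] by (simp add: dist_norm algebra_simps)
    also have "\<dots> \<le> h * norm v + h * norm w"
      using that by (intro add_mono mult_right_mono) auto
    also have "\<dots> < h * (norm v + norm w + 1)" using h by (simp add: algebra_simps)
    also have "\<dots> = min d1 d2" by (simp add: h_def add_nonneg_eq_0_iff)
    finally show ?thesis .
  qed
  obtain s t where st: "0 < s" "s < h" "0 < t" "t < h"
    "\<phi> (x + h *\<^sub>R v + h *\<^sub>R w) - \<phi> (x + h *\<^sub>R v) - \<phi> (x + h *\<^sub>R w) + \<phi> x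
      = h * h * ?D v w (x + s *\<^sub>R v + t *\<^sub>R w)"
    using second_difference_MVT[OF assms h, of x v w] by blast
  obtain s' t' where st': "0 < s'" "s' < h" "0 < t'" "t' < h"
    "\<phi> (x + h *\<^sub>R w + h *\<^sub>R v) - \<phi> (x + h *\<^sub>R w) - \<phi> (x + h *\<^sub>R v) + \<phi> x
      = h * h * ?D w v (x + s' *\<^sub>R w + t' *\<^sub>R v)"
    using second_difference_MVT[OF assms h, of x w v] by blast
  have "h * h * ?D v w (x + s *\<^sub>R v + t *\<^sub>R w) = h * h * ?D w v (x + s' *\<^sub>R w + t' *\<^sub>R v)"
    using st(5) st'(5) by (simp add: algebra_simps)
  then have eq: "?D v w (x + s *\<^sub>R v + t *\<^sub>R w) = ?D w v (x + s' *\<^sub>R w + t' *\<^sub>R v)"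
    using h by simp
  have "x + s' *\<^sub>R w + t' *\<^sub>R v = x + t' *\<^sub>R v + s' *\<^sub>R w" by (simp add: algebra_simps)
  then have "dist (x + s' *\<^sub>R w + t' *\<^sub>R v) x < d2"
    using near[OF st'(3,4,1,2)] by (simp only: min_less_iff_conj)
  then have "dist (?D w v (x + s' *\<^sub>R w + t' *\<^sub>R v)) (?D w v x) < e"
    by (rule d2(2))
  moreover have "dist (?D v w (x + s *\<^sub>R v + t *\<^sub>R w)) (?D v w x) < e"
    using d1(2) near[of s t] st by simp
  moreover have "False" if "\<bar>P - b\<bar> < \<bar>a - b\<bar> / 2" "\<bar>P - a\<bar> < \<bar>a - b\<bar> / 2" for P a b :: real
    using that by (simp add: abs_if split: if_splits)
  ultimately show False using eq unfolding e_def dist_real_def by metis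
qed

lemma frechet_derivative_bounded_linear_comp:
  assumes "bounded_linear L" "smooth_on UNIV f"
  shows "frechet_derivative (\<lambda>y. L (f y)) (at x) v = L (frechet_derivative f (at x) v)"
  using frechet_derivative_at[OF bounded_linear.has_derivative[OF assms(1) smooth_on_has_derivative[OF assms(2), of x]]]
  by (metis UNIV_I)

lemma symmetric_second_derivative_complex:
  fixes \<phi> :: "'a::real_normed_vector \<Rightarrow> complex"
  assumes "smooth_on UNIV \<phi>"
  shows "frechet_derivative (\<lambda>y. frechet_derivative \<phi> (at y) v) (at x) w =
    frechet_derivative (\<lambda>y. frechet_derivative \<phi> (at y) w) (at x) v"
proof -
  have *: "L (frechet_derivative (\<lambda>y. frechet_derivative \<phi> (at y) v) (at x) w)
     = frechet_derivative (\<lambda>y. frechet_derivative (\<lambda>y. L (\<phi> y)) (at y) v) (at x) w"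
    if "bounded_linear L" for L :: "complex \<Rightarrow> real" and v w
    using frechet_derivative_bounded_linear_comp[OF that smooth_on_frechet_derivative[OF assms]]
      frechet_derivative_bounded_linear_comp[OF that assms] by simp
  have "L (frechet_derivative (\<lambda>y. frechet_derivative \<phi> (at y) v) (at x) w) =
    L (frechet_derivative (\<lambda>y. frechet_derivative \<phi> (at y) w) (at x) v)"
    if "bounded_linear L" for L :: "complex \<Rightarrow> real"
    unfolding *[OF that]
    by (rule symmetric_second_derivative_real[OF smooth_on_bounded_linear_comp[OF that open_UNIV assms]])
  from this[OF bounded_linear_Re] this[OF bounded_linear_Im] show ?thesis
    by (rule complex_eqI)
qed

section \<open>Wirtinger derivatives and test functions\<close>

lemma d_zbar_has_derivative:
  assumes "(g has_derivative g') (at z)"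
  shows "d_zbar i g z = (g' (axis i 1) + \<i> * g' (axis i \<i>)) / 2"
  using frechet_derivative_at[OF assms] by (simp add: d_zbar_def)

lemma d_zbar_mult:
  assumes "f differentiable (at z)" "g differentiable (at z)"
  shows "d_zbar i (\<lambda>x. f x * g x) z = f z * d_zbar i g z + d_zbar i f z * g z"
  unfolding d_zbar_has_derivative[OF has_derivative_mult[OF assms[unfolded frechet_derivative_works]]]
  by (simp add: d_zbar_def field_simps)

lemma smooth_on_d_zbar:
  assumes "open U" "smooth_on U g"
  shows "smooth_on U (d_zbar i g)"
proof -
  have "smooth_on U (\<lambda>z. (1/2) * (frechet_derivative g (at z) (axis i 1) + \<i> * frechet_derivative g (at z) (axis i \<i>)))"
    by (intro smooth_on_mult smooth_on_add smooth_on_const smooth_on_frechet_derivative assms)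
  then show ?thesis
    by (rule smooth_on_cong[OF assms(1), rotated]) (simp add: d_zbar_def)
qed

text \<open>This is dbar dbar = 0 on the side of the test function, as \<open>wd_square\<close> uses
  it.\<close>

lemma d_zbar_commute:
  assumes "smooth_on UNIV \<theta>"
  shows "d_zbar i (d_zbar j \<theta>) z = d_zbar j (d_zbar i \<theta>) z"
proof -
  let ?D = "\<lambda>v w. frechet_derivative (\<lambda>y. frechet_derivative \<theta> (at y) v) (at z) w"
  have hd: "(d_zbar j \<theta> has_derivative
      (\<lambda>w. (1/2) * (?D (axis j 1) w + \<i> * ?D (axis j \<i>) w))) (at z)" for j
  proof -
    have "((\<lambda>z. (1/2) * (frechet_derivative \<theta> (at z) (axis j 1) + \<i> * frechet_derivative \<theta> (at z) (axis j \<i>))) has_derivative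
      (\<lambda>w. (1/2) * (?D (axis j 1) w + \<i> * ?D (axis j \<i>) w))) (at z)"
      by (intro has_derivative_mult_right has_derivative_add
          smooth_on_has_derivative[OF smooth_on_frechet_derivative[OF assms] UNIV_I])
    then show ?thesis by (simp add: d_zbar_def[abs_def])
  qed
  have alg: "((1/2) * (a + \<i> * c) + \<i> * ((1/2) * (b + \<i> * d))) / 2 =
      ((1/2) * (a + \<i> * b) + \<i> * ((1/2) * (c + \<i> * d))) / 2" for a b c d :: complex
    by (simp add: algebra_simps add_divide_distrib diff_divide_distrib)
  show ?thesis
    unfolding d_zbar_has_derivative[OF hd]
      symmetric_second_derivative_complex[OF assms, of "axis i 1" z "axis j 1"]
      symmetric_second_derivative_complex[OF assms, of "axis i 1" z "axis j \<i>"]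
      symmetric_second_derivative_complex[OF assms, of "axis i \<i>" z "axis j 1"]
      symmetric_second_derivative_complex[OF assms, of "axis i \<i>" z "axis j \<i>"]
    by (rule alg)
qed

lemma smooth_on_differentiable: "smooth_on U f \<Longrightarrow> x \<in> U \<Longrightarrow> f differentiable (at x)"
  unfolding differentiable_def using smooth_on_has_derivative[of U f x] by blast

lemma test_functionI:
  assumes "smooth_on UNIV \<theta>" "compact C" "C \<subseteq> D" "\<And>z. \<theta> z \<noteq> 0 \<Longrightarrow> z \<in> C"
  shows "test_function D \<theta>"
proof -
  have "closure {z. \<theta> z \<noteq> 0} \<subseteq> C"
    using assms(2,4) by (intro closure_minimal) (auto intro: compact_imp_closed)
  moreover from this have "compact (closure {z. \<theta> z \<noteq> 0})"
    using compact_Int_closed[OF assms(2) closed_closure[of "{z. \<theta> z \<noteq> 0}"]] by (metis Int_absorb1)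
  ultimately show ?thesis using assms(1,3) unfolding test_function_def by (metis subset_trans)
qed

lemma test_function_smooth: "test_function D \<theta> \<Longrightarrow> smooth_on UNIV \<theta>"
  by (simp add: test_function_def)

lemma test_function_differentiable: "test_function D \<theta> \<Longrightarrow> \<theta> differentiable (at z)"
  by (rule smooth_on_differentiable[OF test_function_smooth UNIV_I])

lemma test_function_outside: "test_function D \<theta> \<Longrightarrow> z \<notin> D \<Longrightarrow> \<theta> z = 0"
  using closure_subset[of "{z. \<theta> z \<noteq> 0}"] by (auto simp: test_function_def)

lemma test_function_bounded:
  assumes "test_function D \<theta>"
  obtains B where "\<And>z. norm (\<theta> z) \<le> B" "B > 0"
proof -
  let ?C = "closure {z. \<theta> z \<noteq> 0}"
  have "continuous_on ?C \<theta>"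
    by (rule continuous_on_subset[OF smooth_on_imp_continuous_on[OF test_function_smooth[OF assms]]]) simp
  then have "compact (\<theta> ` ?C)"
    using assms by (intro compact_continuous_image) (auto simp: test_function_def)
  then obtain B where B: "B > 0" "\<And>y. y \<in> \<theta> ` ?C \<Longrightarrow> norm y \<le> B"
    using compact_imp_bounded[of "\<theta> ` ?C"] unfolding bounded_pos by metis
  have "norm (\<theta> z) \<le> B" for z
    using B closure_subset[of "{z. \<theta> z \<noteq> 0}"] by (cases "\<theta> z = 0") (auto simp: subset_iff)
  then show ?thesis using that B(1) by metis
qed

text \<open>The factor g is controlled on D only. The product is nevertheless smooth everywhere: D
  and the complement of the support of \<theta> are open, cover the space, and on the second set the
  product is 0.\<close>

lemma test_function_mult:
  assumes "open D" "smooth_on D g" "test_function D \<theta>"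
  shows "test_function D (\<lambda>z. g z * \<theta> z)"
proof -
  let ?C = "closure {z. \<theta> z \<noteq> 0}"
  have C: "compact ?C" "?C \<subseteq> D" and s: "smooth_on UNIV \<theta>"
    using assms(3) by (auto simp: test_function_def)
  have "smooth_on D (\<lambda>z. g z * \<theta> z)"
    using assms smooth_on_subset[OF s] by (intro smooth_on_mult) auto
  moreover have "smooth_on (- ?C) (\<lambda>z. g z * \<theta> z)"
    by (rule smooth_on_cong[OF _ _ smooth_on_const[of _ 0]])
      (use closure_subset[of "{z. \<theta> z \<noteq> 0}"] in \<open>auto simp: open_Compl\<close>)
  ultimately have "smooth_on (D \<union> - ?C) (\<lambda>z. g z * \<theta> z)"
    by (intro smooth_on_Un) (use assms(1) in auto)
  moreover have "D \<union> - ?C = UNIV" using C by auto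
  ultimately show ?thesis
    using C closure_subset[of "{z. \<theta> z \<noteq> 0}"] by (intro test_functionI[of _ ?C]) auto
qed

lemma test_function_d_zbar:
  assumes "test_function D \<theta>"
  shows "test_function D (d_zbar j \<theta>)"
proof (rule test_functionI)
  let ?C = "closure {z. \<theta> z \<noteq> 0}"
  show "smooth_on UNIV (d_zbar j \<theta>)"
    by (intro smooth_on_d_zbar test_function_smooth[OF assms]) auto
  show "compact ?C" "?C \<subseteq> D" using assms by (auto simp: test_function_def)
  fix z assume nz: "d_zbar j \<theta> z \<noteq> 0"
  show "z \<in> ?C"
  proof (rule ccontr)
    assume z: "z \<notin> ?C"
    have "(\<theta> has_derivative (\<lambda>v. 0)) (at z)"
      by (rule has_derivative_transform_within_open[of "\<lambda>_. 0" _ _ UNIV "- ?C"])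
        (use z closure_subset[of "{z. \<theta> z \<noteq> 0}"] in auto)
    from d_zbar_has_derivative[OF this] nz show False by simp
  qed
qed

lemma test_function_cnj:
  assumes "test_function D \<theta>" shows "test_function D (\<lambda>z. cnj (\<theta> z))"
proof -
  have "{z. cnj (\<theta> z) \<noteq> 0} = {z. \<theta> z \<noteq> 0}" by auto
  moreover have "smooth_on UNIV (\<lambda>z. cnj (\<theta> z))"
    by (rule smooth_on_bounded_linear_comp[OF bounded_linear_cnj open_UNIV test_function_smooth[OF assms]])
  ultimately show ?thesis using assms unfolding test_function_def by simp
qed

section \<open>Box bumps and cutoff functions\<close>

lemma smooth_on_inner_coord: "open U \<Longrightarrow> smooth_on U (\<lambda>z. z \<bullet> b)"
  by (intro smooth_on_bounded_linear bounded_linear_inner_left)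

text \<open>The product form permits approximation one coordinate at a time. The factor
  \<open>Suc m\<close> makes the bumps converge to the indicator of the open box while they stay
  below 1, as dominated convergence requires.\<close>

definition box_bump :: "'a::euclidean_space \<Rightarrow> 'a \<Rightarrow> nat \<Rightarrow> 'a \<Rightarrow> complex" where
  "box_bump a c m z = of_real (\<Prod>b\<in>Basis. flat_exp 0 (real (Suc m) * ((z \<bullet> b - a \<bullet> b) * (c \<bullet> b - z \<bullet> b))))"

lemma flat_exp_nonneg: "0 \<le> flat_exp m t"
  by (simp add: flat_exp_def)

lemma flat_exp_0_le_1: "flat_exp 0 t \<le> 1"
  by (simp add: flat_exp_def)

lemma smooth_on_box_bump: "smooth_on UNIV (box_bump a c m)"
  unfolding box_bump_def[abs_def]
  by (rule smooth_on_bounded_linear_comp[OF bounded_linear_of_real open_UNIV])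
    (intro smooth_on_prod smooth_on_flat_exp
      smooth_on_mult smooth_on_const smooth_on_diff smooth_on_inner_coord open_UNIV finite_Basis)

lemma box_bump_nonzero_iff:
  assumes "\<And>b. b \<in> Basis \<Longrightarrow> a \<bullet> b \<le> c \<bullet> b"
  shows "box_bump a c m z \<noteq> 0 \<longleftrightarrow> z \<in> box a c"
proof -
  have "flat_exp 0 (real (Suc m) * ((z \<bullet> b - a \<bullet> b) * (c \<bullet> b - z \<bullet> b))) \<noteq> 0 \<longleftrightarrow> a \<bullet> b < z \<bullet> b \<and> z \<bullet> b < c \<bullet> b"
    if "b \<in> Basis" for b
    using assms[OF that] by (auto simp: flat_exp_def zero_less_mult_iff)
  then show ?thesis by (auto simp: box_bump_def mem_box)
qed

lemma test_function_box_bump: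
  assumes "\<And>b. b \<in> Basis \<Longrightarrow> a \<bullet> b \<le> c \<bullet> b" "cbox a c \<subseteq> D"
  shows "test_function D (box_bump a c m)"
  by (rule test_functionI[OF smooth_on_box_bump compact_cbox assms(2)])
    (use box_bump_nonzero_iff[OF assms(1)] box_subset_cbox in blast)

lemma norm_box_bump_le: "norm (box_bump a c m z) \<le> 1"
  unfolding box_bump_def norm_of_real
  by (auto simp: abs_prod flat_exp_nonneg flat_exp_0_le_1 intro!: prod_le_1)

lemma box_bump_tendsto:
  assumes "\<And>b. b \<in> Basis \<Longrightarrow> a \<bullet> b \<le> c \<bullet> b"
  shows "(\<lambda>m. box_bump a c m z) \<longlonglongrightarrow> indicator (box a c) z"
proof (cases "z \<in> box a c")
  case False
  then have "box_bump a c m z = 0" for m using box_bump_nonzero_iff[OF assms] by blast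
  then show ?thesis using False by simp
next
  case True
  have "(\<lambda>m. flat_exp 0 (real (Suc m) * ((z \<bullet> b - a \<bullet> b) * (c \<bullet> b - z \<bullet> b)))) \<longlonglongrightarrow> 1" if "b \<in> Basis" for b
  proof -
    have p: "(z \<bullet> b - a \<bullet> b) * (c \<bullet> b - z \<bullet> b) > 0" (is "?p > 0") using True that by (auto simp: mem_box)
    have "(\<lambda>m. exp (- (inverse (real (Suc m)) * inverse ?p))) \<longlonglongrightarrow> exp (- (0 * inverse ?p))"
      by (intro tendsto_intros LIMSEQ_inverse_real_of_nat)
    then show ?thesis using p by (simp add: flat_exp_def)
  qed
  then have "(\<lambda>m. complex_of_real (\<Prod>b\<in>Basis. flat_exp 0 (real (Suc m) * ((z \<bullet> b - a \<bullet> b) * (c \<bullet> b - z \<bullet> b)))))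
     \<longlonglongrightarrow> of_real (\<Prod>b\<in>(Basis::'a set). 1)"
    by (intro tendsto_of_real tendsto_prod)
  then show ?thesis using True by (simp add: box_bump_def)
qed

text \<open>Finitely many box bumps cover K, so their sum has a positive minimum there, and dividing
  by it gives the bound 1. A lower bound on K is aimed at, not a plateau.\<close>

lemma exists_test_function_ge_1:
  fixes D :: "(complex ^ 'n::finite) set"
  assumes "open D" "compact K" "K \<subseteq> D"
  shows "\<exists>r. test_function D (\<lambda>z. complex_of_real (r z)) \<and> (\<forall>z. 0 \<le> r z) \<and> (\<forall>z\<in>K. 1 \<le> r z)"
proof -
  have "\<exists>a c. (\<forall>b\<in>Basis. a \<bullet> b \<le> c \<bullet> b) \<and> x \<in> box a c \<and> cbox a c \<subseteq> D" if "x \<in> K" for x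
  proof -
    obtain a c where ac: "cbox a c \<subseteq> D" "x \<in> box a c" "\<forall>b\<in>Basis. a \<bullet> b < c \<bullet> b"
      by (rule open_contains_cbox[OF assms(1) subsetD[OF assms(3) \<open>x \<in> K\<close>]])
    then show ?thesis by (intro exI[of _ a] exI[of _ c]) (auto intro: less_imp_le)
  qed
  then have "\<forall>x\<in>K. \<exists>a c. (\<forall>b\<in>Basis. a \<bullet> b \<le> c \<bullet> b) \<and> x \<in> box a c \<and> cbox a c \<subseteq> D" by simp
  from bchoice[OF this] obtain a where
    a: "\<forall>x\<in>K. \<exists>c. (\<forall>b\<in>Basis. a x \<bullet> b \<le> c \<bullet> b) \<and> x \<in> box (a x) c \<and> cbox (a x) c \<subseteq> D" ..
  from bchoice[OF a] obtain c where
    c: "\<forall>x\<in>K. (\<forall>b\<in>Basis. a x \<bullet> b \<le> c x \<bullet> b) \<and> x \<in> box (a x) (c x) \<and> cbox (a x) (c x) \<subseteq> D" ..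
  have ac: "\<And>x b. x \<in> K \<Longrightarrow> b \<in> Basis \<Longrightarrow> a x \<bullet> b \<le> c x \<bullet> b"
    "\<And>x. x \<in> K \<Longrightarrow> x \<in> box (a x) (c x)" "\<And>x. x \<in> K \<Longrightarrow> cbox (a x) (c x) \<subseteq> D"
    using c by simp_all
  have cov: "K \<subseteq> (\<Union>x\<in>K. box (a x) (c x))" using ac by blast
  obtain F where F: "F \<subseteq> K" "finite F" "K \<subseteq> (\<Union>x\<in>F. box (a x) (c x))"
    by (rule compactE_image[OF assms(2) open_box cov])
  let ?g = "\<lambda>x z. \<Prod>b\<in>Basis. flat_exp 0 (real (Suc 0) * ((z \<bullet> b - a x \<bullet> b) * (c x \<bullet> b - z \<bullet> b)))"
  have g: "box_bump (a x) (c x) 0 z = of_real (?g x z)" for x z by (simp add: box_bump_def)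
  have gnn: "?g x z \<ge> 0" for x z by (intro prod_nonneg) (simp add: flat_exp_nonneg)
  define s where "s z = (\<Sum>x\<in>F. ?g x z)" for z
  have snn: "s z \<ge> 0" for z unfolding s_def by (intro sum_nonneg gnn)
  have spos: "s z > 0" if "z \<in> K" for z
  proof -
    obtain x where x: "x \<in> F" "z \<in> box (a x) (c x)" using F \<open>z \<in> K\<close> by blast
    then have "box_bump (a x) (c x) 0 z \<noteq> 0" using box_bump_nonzero_iff[of "a x" "c x" 0 z] ac(1) F by blast
    then have "?g x z > 0" using gnn[of z x] unfolding g by (simp only: of_real_eq_0_iff)
    then show ?thesis unfolding s_def using sum_pos2[OF F(2) x(1), of "\<lambda>x. ?g x z"] gnn by simp
  qed
  have ssm: "smooth_on UNIV (\<lambda>z. s z)" unfolding s_def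
    by (intro smooth_on_sum smooth_on_prod smooth_on_flat_exp
      smooth_on_mult smooth_on_const smooth_on_diff smooth_on_inner_coord F) auto
  \<comment> \<open>The minimum of s over K, or 1 if K is empty, as happens when f has no critical
    points.\<close>
  obtain m where m: "m > 0" "\<And>z. z \<in> K \<Longrightarrow> m \<le> s z"
  proof (cases "K = {}")
    case False
    obtain z0 where "z0 \<in> K" "\<And>z. z \<in> K \<Longrightarrow> s z0 \<le> s z"
      using continuous_attains_inf[OF assms(2) False continuous_on_subset[OF smooth_on_imp_continuous_on[OF ssm] subset_UNIV]] by metis
    then show ?thesis using that[of "s z0"] spos by simp
  qed (use that[of 1] in auto)
  let ?C = "\<Union>x\<in>F. cbox (a x) (c x)"
  have "test_function D (\<lambda>z. complex_of_real (inverse m * s z))"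
  proof (rule test_functionI[of _ ?C])
    show "smooth_on UNIV (\<lambda>z. complex_of_real (inverse m * s z))"
      by (rule smooth_on_bounded_linear_comp[OF bounded_linear_of_real open_UNIV])
        (intro smooth_on_mult smooth_on_const ssm open_UNIV)
    show "compact ?C" using F by (intro compact_UN) auto
    show "?C \<subseteq> D" using ac F by blast
    fix z assume "complex_of_real (inverse m * s z) \<noteq> 0"
    then have "s z \<noteq> 0" by auto
    then obtain x where x: "x \<in> F" "?g x z \<noteq> 0" unfolding s_def by (meson sum.neutral)
    then have "box_bump (a x) (c x) 0 z \<noteq> 0" unfolding g by (simp only: of_real_eq_0_iff not_False_eq_True)
    then have "z \<in> box (a x) (c x)" using box_bump_nonzero_iff[of "a x" "c x" 0 z] ac(1) F x(1) by blast
    then show "z \<in> ?C" using x(1) box_subset_cbox[of "a x" "c x"] by blast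
  qed
  moreover have "inverse m * s z \<ge> 0" for z using m snn by simp
  moreover have "inverse m * s z \<ge> 1" if "z \<in> K" for z using m(1) m(2)[OF that] by (simp add: field_simps)
  ultimately show ?thesis by (intro exI[of _ "\<lambda>z. inverse m * s z"]) blast
qed

section \<open>Holomorphic functions of several variables\<close>

lemma axis_scale: "axis i (c * x) = c *s axis i (x :: complex)"
  by (simp add: vec_eq_iff axis_def)

lemma norm_axis: "norm (axis i x :: 'a::real_normed_vector ^ 'n::finite) = norm x"
  by (simp add: norm_vec_def L2_set_def axis_def if_distrib[of norm] if_distrib[of "\<lambda>x. x ^ 2"] cong: if_cong)

lemma bounded_linear_axis: "bounded_linear (axis i :: 'a::real_normed_vector \<Rightarrow> 'a ^ 'n::finite)"
  by (rule bounded_linear_intro[of _ 1]) (auto simp: norm_axis, auto simp: vec_eq_iff axis_def)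

lemma complex_linear_derivative:
  fixes f :: "complex ^ 'n::finite \<Rightarrow> complex"
  assumes "(f has_derivative f') (at z)" "\<And>c v. f' (c *s v) = c * f' v"
  shows "d_z i f z = f' (axis i 1)" "d_zbar i f z = 0" "f' v = (\<Sum>l\<in>UNIV. v $ l * d_z l f z)"
proof -
  have D: "frechet_derivative f (at z) = f'" using frechet_derivative_at[OF assms(1)] by simp
  have i: "f' (axis l \<i>) = \<i> * f' (axis l 1)" for l
    using assms(2)[of \<i> "axis l 1"] axis_scale[of l \<i> 1] by simp
  show dz: "d_z i f z = f' (axis i 1)" for i by (simp add: d_z_def D i)
  show "d_zbar i f z = 0" by (simp add: d_zbar_def D i)
  have "f' v = f' (\<Sum>l\<in>UNIV. (v $ l) *s axis l 1)" by (simp only: basis_expansion)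
  also have "\<dots> = (\<Sum>l\<in>UNIV. f' ((v $ l) *s axis l 1))"
    using linear_sum[OF has_derivative_linear[OF assms(1)]] .
  finally show "f' v = (\<Sum>l\<in>UNIV. v $ l * d_z l f z)" by (simp add: assms(2) dz)
qed

lemma holomorphic_cn_derivative:
  fixes f :: "complex ^ 'n::finite \<Rightarrow> complex"
  assumes "holomorphic_cn f U" "z \<in> U"
  shows "(f has_derivative (\<lambda>v. \<Sum>l\<in>UNIV. v $ l * d_z l f z)) (at z)" "d_zbar i f z = 0"
proof -
  obtain f' where f': "(f has_derivative f') (at z)" "\<And>c v. f' (c *s v) = c * f' v"
    using assms unfolding holomorphic_cn_def by blast
  have "f' = (\<lambda>v. \<Sum>l\<in>UNIV. v $ l * d_z l f z)" using complex_linear_derivative(3)[OF f'] by blast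
  with f'(1) show "(f has_derivative (\<lambda>v. \<Sum>l\<in>UNIV. v $ l * d_z l f z)) (at z)" by simp
  show "d_zbar i f z = 0" by (rule complex_linear_derivative(2)[OF f'])
qed

lemma holomorphic_cn_subset: "holomorphic_cn f U \<Longrightarrow> V \<subseteq> U \<Longrightarrow> holomorphic_cn f V"
  unfolding holomorphic_cn_def by blast

lemma holomorphic_cn_continuous_on:
  assumes "holomorphic_cn f U"
  shows "continuous_on U f"
  using holomorphic_cn_derivative(1)[OF assms]
  by (meson continuous_at_imp_continuous_on has_derivative_continuous)

definition circ :: "real \<Rightarrow> real \<Rightarrow> complex" where
  "circ r t = of_real r * exp (2 * of_real pi * \<i> * of_real t)"

lemma norm_circ: "r \<ge> 0 \<Longrightarrow> norm (circ r t) = r"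
  by (simp add: circ_def norm_mult)

lemma circ_in:
  fixes z :: "complex ^ 'n::finite"
  assumes "z \<in> ball z0 r" "r \<ge> 0"
  shows "z + axis i (circ r t) \<in> cball z0 (2 * r)"
proof -
  have "dist z0 (z + axis i (circ r t)) \<le> dist z0 z + norm (axis i (circ r t))"
    by (metis add_diff_cancel_left' dist_commute dist_norm dist_triangle)
  moreover have "norm (axis i (circ r t) :: complex ^ 'n) = r" by (simp add: norm_circ assms(2) norm_axis)
  ultimately show ?thesis using assms by (simp add: dist_commute)
qed

text \<open>Cauchy's formula for the first derivative on the slice through z in direction i. On the
  circle d\<zeta> / \<zeta>^2 = 2 pi i dt / \<zeta>, so the factor 2 pi i cancels. The radius of the
  circle does not depend on z, hence the right side is a parameter integral that can be
  differentiated in z; the ball of radius 2 r contains all these circles.\<close>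

lemma d_z_Cauchy_integral:
  fixes f :: "complex ^ 'n::finite \<Rightarrow> complex"
  assumes "holomorphic_cn f U" "cball z0 (2 * r) \<subseteq> U" "r > 0" "z \<in> ball z0 r"
  shows "d_z i f z = integral (cbox 0 1) (\<lambda>t. f (z + axis i (circ r t)) * inverse (circ r t))"
proof -
  define g where "g \<zeta> = f (z + axis i \<zeta>)" for \<zeta>
  have inU: "z + axis i \<zeta> \<in> U" if "norm \<zeta> \<le> r" for \<zeta> :: complex
  proof -
    have "dist z0 (z + axis i \<zeta>) \<le> dist z0 z + norm (axis i \<zeta> :: complex ^ 'n)"
      by (metis add_diff_cancel_left' dist_commute dist_norm dist_triangle)
    then have "z + axis i \<zeta> \<in> cball z0 (2 * r)" using that assms(4) by (simp add: norm_axis)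
    then show ?thesis using assms(2) by blast
  qed
  have gd: "(g has_field_derivative d_z i f (z + axis i \<zeta>)) (at \<zeta>)" if "norm \<zeta> \<le> r" for \<zeta>
  proof -
    have "((\<lambda>\<zeta>. z + axis i \<zeta>) has_derivative (\<lambda>v. axis i v)) (at \<zeta>)"
      using has_derivative_add[OF has_derivative_const bounded_linear_imp_has_derivative[OF bounded_linear_axis]] by simp
    from has_derivative_compose[OF this holomorphic_cn_derivative(1)[OF assms(1) inU[OF that]]]
    have "(g has_derivative (\<lambda>v. \<Sum>l\<in>UNIV. axis i v $ l * d_z l f (z + axis i \<zeta>))) (at \<zeta>)"
      unfolding g_def .
    moreover have "(\<lambda>v. \<Sum>l\<in>UNIV. axis i v $ l * d_z l f (z + axis i \<zeta>)) = times (d_z i f (z + axis i \<zeta>))"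
      by (auto simp: axis_def if_distrib[of "\<lambda>x. x * _"] cong: if_cong)
    ultimately show ?thesis by (simp add: has_field_derivative_def)
  qed
  have cont: "continuous_on (cball 0 r) g"
    using gd by (intro continuous_at_imp_continuous_on ballI DERIV_isCont) auto
  have hol: "g holomorphic_on ball 0 r"
  proof (rule holomorphic_onI)
    fix x :: complex assume "x \<in> ball 0 r"
    then have "norm x \<le> r" by simp
    from has_field_derivative_at_within[OF gd[OF this]]
    show "g field_differentiable at x within ball 0 r" unfolding field_differentiable_def by blast
  qed
  have "deriv g 0 = d_z i f z"
    using gd[of 0] assms(3) by (simp add: DERIV_imp_deriv axis_def vec_eq_iff flip: zero_vec_def)
  moreover have "contour_integral (circlepath 0 r) (\<lambda>u. g u / (u - 0)^2) = (2 * pi * \<i>) * deriv g 0"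
    by (rule Cauchy_contour_integral_circlepath_2[OF cont hol]) (use assms in auto)
  moreover have "contour_integral (circlepath 0 r) (\<lambda>u. g u / (u - 0)^2) =
      integral {0..1} (\<lambda>t. (2 * pi * \<i>) * (g (circ r t) * inverse (circ r t)))"
    unfolding contour_integral_integral
  proof (rule integral_cong)
    fix t :: real
    have "vector_derivative (circlepath 0 r) (at t) = (2 * pi * \<i>) * circ r t"
      by (simp only: vector_derivative_circlepath circ_def of_real_mult of_real_numeral mult_ac)
    moreover have "circlepath 0 r t = circ r t"
      by (simp add: circlepath circ_def mult_ac)
    moreover have "circ r t \<noteq> 0" using norm_circ[of r t] assms(3) by auto
    ultimately
    show "g (circlepath 0 r t) / (circlepath 0 r t - 0)\<^sup>2 * vector_derivative (circlepath 0 r) (at t) =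
        (2 * pi * \<i>) * (g (circ r t) * inverse (circ r t))"
      by (simp add: power2_eq_square field_simps)
  qed
  moreover have "\<dots> = (2 * pi * \<i>) * integral {0..1} (\<lambda>t. g (circ r t) * inverse (circ r t))"
    by simp
  ultimately show ?thesis by (simp add: g_def)
qed

lemma continuous_on_circ_comp:
  fixes f :: "complex ^ 'n::finite \<Rightarrow> complex"
  assumes "continuous_on U f" "cball z0 (2 * r) \<subseteq> U" "r > 0"
  shows "continuous_on (ball z0 r \<times> cbox 0 1) (\<lambda>(z, t). f (z + axis i (circ r t)) * inverse (circ r t))"
proof -
  have c: "continuous_on (ball z0 r \<times> cbox (0::real) 1) (\<lambda>p. z0 - z0 + fst p + axis i (circ r (snd p)))"
    unfolding circ_def by (intro continuous_intros bounded_linear.continuous_on[OF bounded_linear_axis])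
  have nz: "circ r t \<noteq> 0" for t using norm_circ[of r t] assms(3) by auto
  have "continuous_on (ball z0 r \<times> cbox 0 1) (\<lambda>p. f (fst p + axis i (circ r (snd p))))"
    by (rule continuous_on_compose2[OF assms(1)]) (use c circ_in[of _ z0 r] assms in \<open>auto\<close>)
  moreover have "continuous_on (ball z0 r \<times> cbox 0 1) (\<lambda>p. inverse (circ r (snd p)))"
    using nz unfolding circ_def by (intro continuous_intros) auto
  ultimately show ?thesis by (auto simp: case_prod_unfold intro!: continuous_intros)
qed

lemma continuous_on_d_z:
  fixes f :: "complex ^ 'n::finite \<Rightarrow> complex"
  assumes "open U" "holomorphic_cn f U"
  shows "continuous_on U (d_z i f)"
proof (intro continuous_at_imp_continuous_on ballI)
  fix z0 assume "z0 \<in> U"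
  then obtain e where e: "e > 0" "cball z0 e \<subseteq> U" using assms(1) open_contains_cball by blast
  define r where "r = e / 2"
  have r: "r > 0" "cball z0 (2 * r) \<subseteq> U" using e by (auto simp: r_def)
  have "continuous_on (ball z0 r) (\<lambda>z. integral (cbox 0 1) (\<lambda>t. f (z + axis i (circ r t)) * inverse (circ r t)))"
    by (rule integral_continuous_on_param[OF continuous_on_circ_comp[OF holomorphic_cn_continuous_on[OF assms(2)] r(2,1)]])
  then have "continuous_on (ball z0 r) (d_z i f)"
    by (subst continuous_on_cong[OF refl d_z_Cauchy_integral[OF assms(2) r(2,1)]])
  then show "isCont (d_z i f) z0" using r(1) by (simp add: continuous_on_eq_continuous_at)
qed

text \<open>The Cauchy integral is differentiated under the integral sign. Continuity of the
  \<open>d_z l f\<close> supplies the hypothesis of the Leibniz rule, and an integral of complex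
  linear derivatives is complex linear.\<close>

lemma holomorphic_cn_d_z:
  fixes f :: "complex ^ 'n::finite \<Rightarrow> complex"
  assumes "open U" "holomorphic_cn f U"
  shows "holomorphic_cn (d_z i f) U"
  unfolding holomorphic_cn_def
proof
  fix z0 assume "z0 \<in> U"
  then obtain e where e: "e > 0" "cball z0 e \<subseteq> U" using assms(1) open_contains_cball by blast
  define r where "r = e / 2"
  have r: "r > 0" "cball z0 (2 * r) \<subseteq> U" using e by (auto simp: r_def)
  define B where "B l = Blinfun (\<lambda>v::complex^'n. v $ l)" for l
  have B: "blinfun_apply (B l) v = v $ l" for l v
    unfolding B_def by (simp add: bounded_linear_Blinfun_apply bounded_linear_vec_nth)
  define c where "c l z t = d_z l f (z + axis i (circ r t)) * inverse (circ r t)" for l z t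
  \<comment> \<open>The derivative of the integrand in z, packaged as a bounded linear function
    because the Leibniz rule integrates it in that space.\<close>
  define fx where "fx z t = (\<Sum>l\<in>UNIV. blinfun_mult_left (c l z t) o\<^sub>L B l)" for z t
  have fx: "blinfun_apply (fx z t) v = (\<Sum>l\<in>UNIV. v $ l * c l z t)" for z t v
    by (simp add: fx_def blinfun.sum_left B)
  have contfx: "continuous_on (ball z0 r \<times> cbox 0 1) (\<lambda>(z, t). fx z t)"
  proof -
    have cc: "continuous_on (ball z0 r \<times> cbox 0 1) (\<lambda>p. c l (fst p) (snd p))" for l
      using continuous_on_circ_comp[OF continuous_on_d_z[OF assms] r(2,1), of l i]
      by (simp add: case_prod_unfold c_def)
    show ?thesis unfolding case_prod_unfold fx_def
      by (intro continuous_on_sum bounded_bilinear.continuous_on[OF bounded_bilinear_blinfun_compose]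
          bounded_linear.continuous_on[OF bounded_linear_blinfun_mult_left] cc continuous_on_const)
  qed
  have "((\<lambda>z. integral (cbox 0 1) (\<lambda>t. f (z + axis i (circ r t)) * inverse (circ r t)))
      has_derivative blinfun_apply (integral (cbox 0 1) (fx z0))) (at z0 within ball z0 r)"
  proof (rule leibniz_rule[where f = "\<lambda>z t. f (z + axis i (circ r t)) * inverse (circ r t)" and fx = fx and
        U = "ball z0 r" and a = 0 and b = 1 and ?x0.0 = z0])
    show "continuous_on (ball z0 r \<times> cbox 0 1) (\<lambda>(z, t). fx z t)" by (rule contfx)
    show "z0 \<in> ball z0 r" "convex (ball z0 r)" using r by auto
  next
    fix z t assume z: "z \<in> ball z0 r" "t \<in> cbox (0::real) 1"
    have "z + axis i (circ r t) \<in> U" using circ_in[OF z(1)] r by auto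
    note D = holomorphic_cn_derivative(1)[OF assms(2) this]
    have tr: "((\<lambda>z. z + axis i (circ r t)) has_derivative (\<lambda>v. v)) (at z)"
      by (auto intro!: derivative_eq_intros)
    have "((\<lambda>z. f (z + axis i (circ r t))) has_derivative (\<lambda>v. \<Sum>l\<in>UNIV. v $ l * d_z l f (z + axis i (circ r t)))) (at z)"
      by (rule has_derivative_compose[OF tr D])
    then have "((\<lambda>z. f (z + axis i (circ r t)) * inverse (circ r t)) has_derivative
       (\<lambda>v. (\<Sum>l\<in>UNIV. v $ l * d_z l f (z + axis i (circ r t))) * inverse (circ r t))) (at z)"
      by (rule has_derivative_mult_left)
    moreover have "(\<lambda>v. (\<Sum>l\<in>UNIV. v $ l * d_z l f (z + axis i (circ r t))) * inverse (circ r t)) = blinfun_apply (fx z t)"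
      by (auto simp: fx c_def sum_distrib_right mult.assoc)
    ultimately have "((\<lambda>z. f (z + axis i (circ r t)) * inverse (circ r t)) has_derivative blinfun_apply (fx z t)) (at z)"
      by simp
    then show "((\<lambda>z. f (z + axis i (circ r t)) * inverse (circ r t)) has_derivative blinfun_apply (fx z t)) (at z within ball z0 r)"
      by (rule has_derivative_at_withinI)
  next
    fix z assume z: "z \<in> ball z0 r"
    have "continuous_on (cbox 0 1) (\<lambda>t. (\<lambda>(z, t). f (z + axis i (circ r t)) * inverse (circ r t)) (z, t))"
      by (rule continuous_on_compose2[OF continuous_on_circ_comp[OF holomorphic_cn_continuous_on[OF assms(2)] r(2,1)]])
        (use z in \<open>auto intro!: continuous_intros\<close>)
    then show "(\<lambda>t. f (z + axis i (circ r t)) * inverse (circ r t)) integrable_on cbox 0 1"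
      by (intro integrable_continuous) simp
  qed
  then have hd: "((\<lambda>z. integral (cbox 0 1) (\<lambda>t. f (z + axis i (circ r t)) * inverse (circ r t)))
      has_derivative blinfun_apply (integral (cbox 0 1) (fx z0))) (at z0)"
    using at_within_open[of z0 "ball z0 r"] r(1) by simp
  have "(d_z i f has_derivative blinfun_apply (integral (cbox 0 1) (fx z0))) (at z0)"
    by (rule has_derivative_transform_within_open[OF hd open_ball[of z0 r]])
      (use r(1) d_z_Cauchy_integral[OF assms(2) r(2,1), symmetric] in simp_all)
  moreover have "blinfun_apply (integral (cbox 0 1) (fx z0)) (a *s v) = a * blinfun_apply (integral (cbox 0 1) (fx z0)) v" for a v
  proof -
    have "continuous_on (cbox 0 1) (\<lambda>t. (\<lambda>(z, t). fx z t) (z0, t))"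
      by (rule continuous_on_compose2[OF contfx]) (use r in \<open>auto intro!: continuous_intros\<close>)
    then have int: "fx z0 integrable_on cbox 0 1"
      by (intro integrable_continuous) simp
    have ap: "blinfun_apply (integral (cbox 0 1) (fx z0)) v = integral (cbox 0 1) (\<lambda>t. blinfun_apply (fx z0 t) v)" for v
      using integral_linear[OF int blinfun.bounded_linear_left[of v]] by (simp add: o_def)
    show ?thesis unfolding ap fx by (simp add: mult.assoc sum_distrib_left[symmetric])
  qed
  ultimately show "\<exists>g'. (d_z i f has_derivative g') (at z0) \<and> (\<forall>c v. g' (c *s v) = c * g' v)" by blast
qed

text \<open>Each directional derivative of f is a constant combination of the
  \<open>d_z l f\<close>, which are holomorphic again, so the induction on k closes.\<close>

lemma holomorphic_cn_imp_smooth_on: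
  fixes f :: "complex ^ 'n::finite \<Rightarrow> complex"
  assumes "open U" "holomorphic_cn f U"
  shows "smooth_on U f"
proof -
  have "Ck_on k U f" for k
    using assms(2)
  proof (induction k arbitrary: f)
    case 0
    then show ?case by (simp add: holomorphic_cn_continuous_on)
  next
    case (Suc k)
    show ?case
    proof (rule Ck_on_SucI[OF assms(1) holomorphic_cn_derivative(1)[OF Suc.prems]])
      fix v :: "complex ^ 'n"
      show "Ck_on k U (\<lambda>x. \<Sum>l\<in>UNIV. v $ l * d_z l f x)"
        by (intro Ck_on_sum Ck_on_mult Ck_on_const assms(1) Suc.IH holomorphic_cn_d_z Suc.prems finite)
    qed
  qed
  then show ?thesis by (simp add: smooth_on_def)
qed

lemma d_zbar_holomorphic_mult:
  assumes "holomorphic_cn g U" "z \<in> U" "\<theta> differentiable (at z)"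
  shows "d_zbar i (\<lambda>x. g x * \<theta> x) z = g z * d_zbar i \<theta> z"
proof -
  have "g differentiable (at z)" using holomorphic_cn_derivative(1)[OF assms(1,2)] by (auto simp: differentiable_def)
  then show ?thesis using d_zbar_mult[OF _ assms(3)] holomorphic_cn_derivative(2)[OF assms(1,2)] by simp
qed

section \<open>The Hilbert space of square integrable functions\<close>

definition sqint :: "('a::euclidean_space \<Rightarrow> complex) \<Rightarrow> bool" where
  "sqint f \<longleftrightarrow> f \<in> borel_measurable lebesgue \<and> integrable lebesgue (\<lambda>z. (cmod (f z))\<^sup>2)"

lemma sqint_measurable: "sqint f \<Longrightarrow> f \<in> borel_measurable lebesgue"
  by (simp add: sqint_def)

lemma sqint_integrable: "sqint f \<Longrightarrow> integrable lebesgue (\<lambda>z. (cmod (f z))\<^sup>2)"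
  by (simp add: sqint_def)

lemma sqint_bound:
  assumes "f \<in> borel_measurable lebesgue" "integrable lebesgue g" "AE z in lebesgue. (cmod (f z))\<^sup>2 \<le> g z"
  shows "sqint f"
  unfolding sqint_def
proof
  show "integrable lebesgue (\<lambda>z. (cmod (f z))\<^sup>2)"
  proof (rule Bochner_Integration.integrable_bound[OF assms(2)])
    show "(\<lambda>z. (cmod (f z))\<^sup>2) \<in> borel_measurable lebesgue" using assms(1) by measurable
    show "AE z in lebesgue. norm ((cmod (f z))\<^sup>2) \<le> norm (g z)"
      using assms(3) by eventually_elim simp
  qed
qed (rule assms(1))

lemma sqint_0 [simp]: "sqint (\<lambda>z. 0)"
  by (simp add: sqint_def)

lemma sqint_add:
  assumes "sqint f" "sqint g" shows "sqint (\<lambda>z. f z + g z)"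
proof (rule sqint_bound[where g = "\<lambda>z. 2 * (cmod (f z))\<^sup>2 + 2 * (cmod (g z))\<^sup>2"])
  show "(\<lambda>z. f z + g z) \<in> borel_measurable lebesgue"
    using assms by (auto intro: borel_measurable_add sqint_measurable)
  show "integrable lebesgue (\<lambda>z. 2 * (cmod (f z))\<^sup>2 + 2 * (cmod (g z))\<^sup>2)"
    using assms by (auto intro!: sqint_integrable)
  have "(cmod (a + b))\<^sup>2 \<le> 2 * (cmod a)\<^sup>2 + 2 * (cmod b)\<^sup>2" for a b
  proof -
    have "(cmod (a + b))\<^sup>2 \<le> (cmod a + cmod b)\<^sup>2" by (intro power_mono norm_triangle_ineq) auto
    also have "\<dots> \<le> 2 * (cmod a)\<^sup>2 + 2 * (cmod b)\<^sup>2"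
      using zero_le_power2[of "cmod a - cmod b"] by (simp add: power2_eq_square algebra_simps)
    finally show ?thesis .
  qed
  then show "AE z in lebesgue. (cmod (f z + g z))\<^sup>2 \<le> 2 * (cmod (f z))\<^sup>2 + 2 * (cmod (g z))\<^sup>2" by simp
qed

definition bmeas :: "('a::euclidean_space \<Rightarrow> complex) \<Rightarrow> bool" where
  "bmeas b \<longleftrightarrow> b \<in> borel_measurable lebesgue \<and> (\<exists>B. \<forall>z. cmod (b z) \<le> B)"

lemma bmeasI: "b \<in> borel_measurable lebesgue \<Longrightarrow> (\<And>z. cmod (b z) \<le> B) \<Longrightarrow> bmeas b"
  by (auto simp: bmeas_def)

lemma bmeas_const [simp]: "bmeas (\<lambda>z. c)"
  by (auto simp: bmeas_def)

lemma sqint_bmeas_mult: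
  assumes "bmeas b" "sqint f" shows "sqint (\<lambda>z. b z * f z)"
proof -
  obtain B where B: "\<And>z. cmod (b z) \<le> B" using assms(1) by (auto simp: bmeas_def)
  have m: "b \<in> borel_measurable lebesgue" using assms(1) by (simp add: bmeas_def)
  show ?thesis
  proof (rule sqint_bound[where g = "\<lambda>z. B\<^sup>2 * (cmod (f z))\<^sup>2"])
    show "(\<lambda>z. b z * f z) \<in> borel_measurable lebesgue"
      by (intro borel_measurable_times m sqint_measurable assms)
    show "integrable lebesgue (\<lambda>z. B\<^sup>2 * (cmod (f z))\<^sup>2)"
      using sqint_integrable[OF assms(2)] by simp
    show "AE z in lebesgue. (cmod (b z * f z))\<^sup>2 \<le> B\<^sup>2 * (cmod (f z))\<^sup>2"
      using B by (auto simp: norm_mult power_mult_distrib intro!: AE_I2 mult_right_mono power_mono)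
  qed
qed

lemma bmeas_mult: "bmeas b \<Longrightarrow> bmeas c \<Longrightarrow> bmeas (\<lambda>z. b z * c z)"
  unfolding bmeas_def
  by (auto simp: norm_mult) (meson mult_mono' norm_ge_zero)

lemma bmeas_add:
  assumes "bmeas b" "bmeas c" shows "bmeas (\<lambda>z. b z + c z)"
proof -
  obtain B C where "\<And>z. cmod (b z) \<le> B" "\<And>z. cmod (c z) \<le> C" using assms unfolding bmeas_def by metis
  then have "cmod (b z + c z) \<le> B + C" for z by (meson add_mono norm_triangle_ineq order_trans)
  then show ?thesis using assms by (intro bmeasI[where B = "B + C"] borel_measurable_add) (auto simp: bmeas_def)
qed

lemma bmeas_sum: "(\<And>i. i \<in> S \<Longrightarrow> bmeas (b i)) \<Longrightarrow> bmeas (\<lambda>z. \<Sum>i\<in>S. b i z)"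
  by (induction S rule: infinite_finite_induct) (auto intro: bmeas_add)

lemma bmeas_indicator: "A \<in> sets lebesgue \<Longrightarrow> bmeas (indicator A)"
  by (rule bmeasI[where B = 1]) (auto simp: indicator_def)

lemma sqint_cmult: "sqint f \<Longrightarrow> sqint (\<lambda>z. c * f z)"
  using sqint_bmeas_mult[OF bmeas_const] .

lemma sqint_uminus: "sqint f \<Longrightarrow> sqint (\<lambda>z. - f z)"
  using sqint_cmult[of f "-1"] by simp

lemma sqint_diff: "sqint f \<Longrightarrow> sqint g \<Longrightarrow> sqint (\<lambda>z. f z - g z)"
  using sqint_add[OF _ sqint_uminus, of f g] by simp

lemma cnj_measurable: "f \<in> borel_measurable M \<Longrightarrow> (\<lambda>z. cnj (f z)) \<in> borel_measurable M"
  by (rule measurable_compose[where N = borel, OF _ borel_measurable_continuous_onI])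
    (auto intro: continuous_intros)

lemma bmeas_cnj: "bmeas b \<Longrightarrow> bmeas (\<lambda>z. cnj (b z))"
  unfolding bmeas_def by (auto intro: cnj_measurable)

lemma sqint_cnj: "sqint f \<Longrightarrow> sqint (\<lambda>z. cnj (f z))"
  unfolding sqint_def by (auto intro: cnj_measurable)

lemma integrable_sqint_mult:
  assumes "sqint f" "sqint g"
  shows "integrable lebesgue (\<lambda>z. f z * g z)"
proof (rule Bochner_Integration.integrable_bound[where f = "\<lambda>z. (cmod (f z))\<^sup>2 + (cmod (g z))\<^sup>2"])
  show "integrable lebesgue (\<lambda>z. (cmod (f z))\<^sup>2 + (cmod (g z))\<^sup>2)"
    using assms by (auto intro!: sqint_integrable)
  show "(\<lambda>z. f z * g z) \<in> borel_measurable lebesgue"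
    by (intro borel_measurable_times sqint_measurable assms)
  have "cmod (a * b) \<le> (cmod a)\<^sup>2 + (cmod b)\<^sup>2" for a b
  proof -
    have "2 * (cmod a * cmod b) \<le> (cmod a)\<^sup>2 + (cmod b)\<^sup>2"
      using zero_le_power2[of "cmod a - cmod b"] by (simp add: power2_eq_square algebra_simps)
    moreover have "0 \<le> cmod a * cmod b" by simp
    ultimately show ?thesis unfolding norm_mult by linarith
  qed
  then show "AE z in lebesgue. norm (f z * g z) \<le> norm ((cmod (f z))\<^sup>2 + (cmod (g z))\<^sup>2)"
    by (auto simp: abs_of_nonneg)
qed

text \<open>Square integrability is part of the relation. The quotient is therefore partial, and
  every representative of an element of \<open>lsq\<close> is square integrable.\<close>

definition sq_rel :: "('a::euclidean_space \<Rightarrow> complex) \<Rightarrow> ('a \<Rightarrow> complex) \<Rightarrow> bool" where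
  "sq_rel f g \<longleftrightarrow> sqint f \<and> sqint g \<and> (AE z in lebesgue. f z = g z)"

lemma part_equivp_sq_rel: "part_equivp sq_rel"
proof (rule part_equivpI)
  show "\<exists>f. sq_rel f (f :: 'a::euclidean_space \<Rightarrow> complex)"
    by (rule exI[of _ "\<lambda>z. 0"]) (simp add: sq_rel_def)
  show "symp (sq_rel :: ('a::euclidean_space \<Rightarrow> complex) \<Rightarrow> _)"
    by (rule sympI) (auto simp: sq_rel_def elim: AE_mp)
  show "transp (sq_rel :: ('a::euclidean_space \<Rightarrow> complex) \<Rightarrow> _)"
    by (rule transpI) (auto simp: sq_rel_def elim: AE_mp)
qed

quotient_type (overloaded) 'a lsq = "'a::euclidean_space \<Rightarrow> complex" / partial: sq_rel
  by (rule part_equivp_sq_rel)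

lemma sqint_rep [simp]: "sqint (rep_lsq u)"
  using Quotient_rep_reflp[OF Quotient_lsq, of u] by (simp add: sq_rel_def)

lemma measurable_rep [measurable, simp]: "rep_lsq u \<in> borel_measurable lebesgue"
  by (rule sqint_measurable[OF sqint_rep])

lemma abs_rep_lsq [simp]: "abs_lsq (rep_lsq u) = u"
  by (rule Quotient_abs_rep[OF Quotient_lsq])

lemma abs_lsq_eq_iff:
  "sqint f \<Longrightarrow> sqint g \<Longrightarrow> abs_lsq f = abs_lsq g \<longleftrightarrow> (AE z in lebesgue. f z = g z)"
  using Quotient_rel[OF Quotient_lsq, of f g] by (auto simp: sq_rel_def)

lemma rep_abs_lsq: "sqint f \<Longrightarrow> AE z in lebesgue. rep_lsq (abs_lsq f) z = f z"
  by (subst abs_lsq_eq_iff[symmetric]) auto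

lemma lsq_eq_iff: "u = v \<longleftrightarrow> (AE z in lebesgue. rep_lsq u z = rep_lsq v z)"
  using abs_lsq_eq_iff[of "rep_lsq u" "rep_lsq v"] by simp

instantiation lsq :: (euclidean_space) real_vector
begin

definition zero_lsq :: "'a lsq" where "0 = abs_lsq (\<lambda>z. 0)"
definition plus_lsq :: "'a lsq \<Rightarrow> 'a lsq \<Rightarrow> 'a lsq" where "u + v = abs_lsq (\<lambda>z. rep_lsq u z + rep_lsq v z)"
definition minus_lsq :: "'a lsq \<Rightarrow> 'a lsq \<Rightarrow> 'a lsq" where "u - v = abs_lsq (\<lambda>z. rep_lsq u z - rep_lsq v z)"
definition uminus_lsq :: "'a lsq \<Rightarrow> 'a lsq" where "- u = abs_lsq (\<lambda>z. - rep_lsq u z)"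
definition scaleR_lsq :: "real \<Rightarrow> 'a lsq \<Rightarrow> 'a lsq" where "r *\<^sub>R u = abs_lsq (\<lambda>z. of_real r * rep_lsq u z)"

lemma rep_zero_lsq: "AE z in lebesgue. rep_lsq (0 :: 'a lsq) z = 0"
  unfolding zero_lsq_def by (rule rep_abs_lsq) simp
lemma rep_plus_lsq: "AE z in lebesgue. rep_lsq (u + v :: 'a lsq) z = rep_lsq u z + rep_lsq v z"
  unfolding plus_lsq_def by (rule rep_abs_lsq) (simp add: sqint_add)
lemma rep_minus_lsq: "AE z in lebesgue. rep_lsq (u - v :: 'a lsq) z = rep_lsq u z - rep_lsq v z"
  unfolding minus_lsq_def by (rule rep_abs_lsq) (simp add: sqint_diff)
lemma rep_uminus_lsq: "AE z in lebesgue. rep_lsq (- u :: 'a lsq) z = - rep_lsq u z"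
  unfolding uminus_lsq_def by (rule rep_abs_lsq) (simp add: sqint_uminus)
lemma rep_scaleR_lsq: "AE z in lebesgue. rep_lsq (r *\<^sub>R u :: 'a lsq) z = of_real r * rep_lsq u z"
  unfolding scaleR_lsq_def by (rule rep_abs_lsq) (simp add: sqint_cmult)

instance
proof
  fix u v w :: "'a lsq" and a b :: real
  show "u + v + w = u + (v + w)"
    unfolding lsq_eq_iff using rep_plus_lsq[of "u + v" w] rep_plus_lsq[of u v] rep_plus_lsq[of u "v + w"] rep_plus_lsq[of v w]
    by eventually_elim simp
  show "u + v = v + u"
    unfolding lsq_eq_iff using rep_plus_lsq[of u v] rep_plus_lsq[of v u] by eventually_elim simp
  show "0 + u = u"
    unfolding lsq_eq_iff using rep_plus_lsq[of 0 u] rep_zero_lsq by eventually_elim simp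
  show "- u + u = 0"
    unfolding lsq_eq_iff using rep_plus_lsq[of "- u" u] rep_uminus_lsq[of u] rep_zero_lsq by eventually_elim simp
  show "u - v = u + - v"
    unfolding lsq_eq_iff using rep_plus_lsq[of u "- v"] rep_uminus_lsq[of v] rep_minus_lsq[of u v] by eventually_elim simp
  show "a *\<^sub>R (u + v) = a *\<^sub>R u + a *\<^sub>R v"
    unfolding lsq_eq_iff using rep_plus_lsq[of u v] rep_plus_lsq[of "a *\<^sub>R u" "a *\<^sub>R v"]
      rep_scaleR_lsq[of a u] rep_scaleR_lsq[of a v] rep_scaleR_lsq[of a "u + v"]
    by eventually_elim (simp add: algebra_simps)
  show "(a + b) *\<^sub>R u = a *\<^sub>R u + b *\<^sub>R u"
    unfolding lsq_eq_iff using rep_plus_lsq[of "a *\<^sub>R u" "b *\<^sub>R u"]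
      rep_scaleR_lsq[of a u] rep_scaleR_lsq[of b u] rep_scaleR_lsq[of "a + b" u]
    by eventually_elim (simp add: algebra_simps)
  show "a *\<^sub>R b *\<^sub>R u = (a * b) *\<^sub>R u"
    unfolding lsq_eq_iff using rep_scaleR_lsq[of a "b *\<^sub>R u"] rep_scaleR_lsq[of b u] rep_scaleR_lsq[of "a * b" u]
    by eventually_elim (simp add: algebra_simps)
  show "1 *\<^sub>R u = u"
    unfolding lsq_eq_iff using rep_scaleR_lsq[of 1 u] by eventually_elim simp
qed

end

text \<open>The type \<open>lsq\<close> is a \<^emph>\<open>real\<close> Hilbert space with inner product \<open>Re (cin u v)\<close>; the library has no
  complex inner product spaces.\<close>

definition cin :: "'a::euclidean_space lsq \<Rightarrow> 'a lsq \<Rightarrow> complex" where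
  "cin u v = (LINT z|lebesgue. rep_lsq u z * cnj (rep_lsq v z))"

lemma cin_integrable: "integrable lebesgue (\<lambda>z. rep_lsq u z * cnj (rep_lsq v z))"
  by (simp add: integrable_sqint_mult sqint_cnj)

lemma cin_cong:
  assumes "AE z in lebesgue. rep_lsq u z = f z" "AE z in lebesgue. rep_lsq v z = g z"
    "f \<in> borel_measurable lebesgue" "g \<in> borel_measurable lebesgue"
  shows "cin u v = (LINT z|lebesgue. f z * cnj (g z))"
  unfolding cin_def
proof (rule integral_cong_AE)
  show "AE z in lebesgue. rep_lsq u z * cnj (rep_lsq v z) = f z * cnj (g z)"
    using assms(1,2) by eventually_elim simp
qed (auto intro!: borel_measurable_times cnj_measurable assms(3,4))

lemma cin_add_left: "cin (u + v) w = cin u w + cin v w"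
proof -
  have "cin (u + v) w = (LINT z|lebesgue. (rep_lsq u z + rep_lsq v z) * cnj (rep_lsq w z))"
    by (rule cin_cong[OF rep_plus_lsq]) (auto intro!: borel_measurable_add)
  also have "\<dots> = cin u w + cin v w"
    unfolding cin_def distrib_right by (rule Bochner_Integration.integral_add[OF cin_integrable cin_integrable])
  finally show ?thesis .
qed

lemma cin_commute: "cin u v = cnj (cin v u)"
proof -
  have "cnj (cin v u) = (LINT z|lebesgue. cnj (rep_lsq v z * cnj (rep_lsq u z)))"
    unfolding cin_def by (rule Bochner_Integration.integral_cnj[symmetric])
  then show ?thesis by (simp add: cin_def mult.commute)
qed

lemma cin_scaleR_left: "cin (r *\<^sub>R u) w = of_real r * cin u w"
proof -
  have "cin (r *\<^sub>R u) w = (LINT z|lebesgue. (of_real r * rep_lsq u z) * cnj (rep_lsq w z))"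
    by (rule cin_cong[OF rep_scaleR_lsq]) (auto intro!: borel_measurable_times)
  then show ?thesis by (simp add: cin_def mult.assoc)
qed

lemma cin_self: "cin u u = of_real (LINT z|lebesgue. (cmod (rep_lsq u z))\<^sup>2)"
proof -
  have "rep_lsq u z * cnj (rep_lsq u z) = of_real ((cmod (rep_lsq u z))\<^sup>2)" for z
    by (simp only: complex_norm_square)
  then show ?thesis unfolding cin_def by (simp only: integral_complex_of_real)
qed

instantiation lsq :: (euclidean_space) real_inner
begin

definition inner_lsq :: "'a lsq \<Rightarrow> 'a lsq \<Rightarrow> real" where "inner u v = Re (cin u v)"
definition norm_lsq :: "'a lsq \<Rightarrow> real" where "norm u = sqrt (Re (cin u u))"
definition dist_lsq :: "'a lsq \<Rightarrow> 'a lsq \<Rightarrow> real" where "dist u v = sqrt (Re (cin (u - v) (u - v)))"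
definition sgn_lsq :: "'a lsq \<Rightarrow> 'a lsq" where "sgn u = inverse (sqrt (Re (cin u u))) *\<^sub>R u"
definition uniformity_lsq :: "('a lsq \<times> 'a lsq) filter" where
  "uniformity = (INF e\<in>{0 <..}. principal {(x, y). sqrt (Re (cin (x - y) (x - y))) < e})"
definition open_lsq :: "'a lsq set \<Rightarrow> bool" where
  "open U \<longleftrightarrow> (\<forall>x\<in>U. eventually (\<lambda>(x', y). x' = x \<longrightarrow> y \<in> U)
    (INF e\<in>{0 <..}. principal {(x, y). sqrt (Re (cin (x - y) (x - y))) < e}))"

instance
proof
  fix u v w :: "'a lsq" and a b :: real
  show "inner u v = inner v u" unfolding inner_lsq_def by (subst cin_commute) simp
  show "inner (u + v) w = inner u w + inner v w" by (simp add: inner_lsq_def cin_add_left)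
  show "inner (a *\<^sub>R u) v = a * inner u v" by (simp add: inner_lsq_def cin_scaleR_left)
  show "0 \<le> inner u u" by (simp add: inner_lsq_def cin_self)
  show "inner u u = 0 \<longleftrightarrow> u = 0"
  proof -
    have "inner u u = 0 \<longleftrightarrow> (AE z in lebesgue. (cmod (rep_lsq u z))\<^sup>2 = 0)"
      unfolding inner_lsq_def cin_self Re_complex_of_real
      by (rule integral_nonneg_eq_0_iff_AE) (auto intro: sqint_integrable)
    also have "\<dots> \<longleftrightarrow> u = 0"
    proof
      assume "AE z in lebesgue. (cmod (rep_lsq u z))\<^sup>2 = 0"
      with rep_zero_lsq show "u = 0" unfolding lsq_eq_iff by eventually_elim simp
    next
      assume "u = 0"
      then show "AE z in lebesgue. (cmod (rep_lsq u z))\<^sup>2 = 0" using rep_zero_lsq by auto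
    qed
    finally show ?thesis .
  qed
qed (simp_all add: norm_lsq_def dist_lsq_def sgn_lsq_def uniformity_lsq_def open_lsq_def inner_lsq_def)

end

lemma norm_lsq_sq: "(norm (u :: 'a::euclidean_space lsq))\<^sup>2 = (LINT z|lebesgue. (cmod (rep_lsq u z))\<^sup>2)"
  by (simp add: power2_norm_eq_inner inner_lsq_def cin_self)

lemma norm_lsq_mono:
  assumes "AE z in lebesgue. cmod (rep_lsq u z) \<le> c * cmod (rep_lsq v z)" "c \<ge> 0"
  shows "norm u \<le> c * norm v"
proof -
  have "(norm u)\<^sup>2 \<le> (LINT z|lebesgue. c\<^sup>2 * (cmod (rep_lsq v z))\<^sup>2)"
    unfolding norm_lsq_sq
  proof (rule integral_mono_AE)
    show "AE z in lebesgue. (cmod (rep_lsq u z))\<^sup>2 \<le> c\<^sup>2 * (cmod (rep_lsq v z))\<^sup>2"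
      using assms(1) by eventually_elim (metis norm_ge_zero power_mono power_mult_distrib)
  qed (auto intro: sqint_integrable)
  also have "\<dots> = (c * norm v)\<^sup>2" by (simp add: norm_lsq_sq power_mult_distrib)
  finally show ?thesis using assms(2) by (simp add: power2_le_iff_abs_le)
qed

section \<open>Completeness\<close>

lemma nn_integral_rep_lsq: "(\<integral>\<^sup>+ z. ennreal ((cmod (rep_lsq u z))\<^sup>2) \<partial>lebesgue) = ennreal ((norm u)\<^sup>2)"
  unfolding norm_lsq_sq by (rule nn_integral_eq_integral) (auto intro: sqint_integrable)

text \<open>The weight 2^n splits the decay 4^-n of the squared norms in two halves: one makes the
  integral of the weighted series finite, the other leaves |a n z|^2 \<le> C 2^-n at almost every z,
  so the increments are summable there.\<close>

lemma fast_Cauchy_lsq_AE_convergent: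
  fixes u :: "nat \<Rightarrow> 'a::euclidean_space lsq"
  assumes "\<And>n. norm (u (Suc n) - u n) \<le> (1/2) ^ n"
  shows "AE z in lebesgue. convergent (\<lambda>n. rep_lsq (u n) z)"
proof -
  define a where "a n z = rep_lsq (u (Suc n)) z - rep_lsq (u n) z" for n z
  have ma: "a n \<in> borel_measurable lebesgue" for n
    unfolding a_def by (auto intro!: borel_measurable_diff)
  have "(\<integral>\<^sup>+ z. (\<Sum>n. ennreal (2 ^ n * (cmod (a n z))\<^sup>2)) \<partial>lebesgue)
      = (\<Sum>n. \<integral>\<^sup>+ z. ennreal (2 ^ n * (cmod (a n z))\<^sup>2) \<partial>lebesgue)"
    by (rule nn_integral_suminf) (use ma in measurable)
  also have "\<dots> \<le> (\<Sum>n. ennreal ((1/2) ^ n))"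
  proof (rule suminf_le)
    fix n
    have "(\<integral>\<^sup>+ z. ennreal (2 ^ n * (cmod (a n z))\<^sup>2) \<partial>lebesgue)
       = ennreal (2 ^ n) * (\<integral>\<^sup>+ z. ennreal ((cmod (a n z))\<^sup>2) \<partial>lebesgue)"
      by (subst nn_integral_cmult[symmetric]) (use ma in \<open>auto simp: ennreal_mult\<close>)
    also have "(\<integral>\<^sup>+ z. ennreal ((cmod (a n z))\<^sup>2) \<partial>lebesgue) = ennreal ((norm (u (Suc n) - u n))\<^sup>2)"
      unfolding nn_integral_rep_lsq[symmetric]
      by (rule nn_integral_cong_AE) (use rep_minus_lsq[of "u (Suc n)" "u n"] in eventually_elim, simp add: a_def)
    also have "\<dots> \<le> ennreal (((1/2) ^ n)\<^sup>2)"
      by (intro ennreal_leI power_mono assms) simp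
    also have "ennreal (2 ^ n) * \<dots> = ennreal ((1/2) ^ n)"
      by (subst ennreal_mult[symmetric]) (auto simp: power2_eq_square power_mult_distrib[symmetric] field_simps)
    finally show "(\<integral>\<^sup>+ z. ennreal (2 ^ n * (cmod (a n z))\<^sup>2) \<partial>lebesgue) \<le> ennreal ((1/2) ^ n)"
      by (simp add: mult_left_mono)
  qed auto
  also have "\<dots> = ennreal (\<Sum>n. (1/2) ^ n)"
    by (rule suminf_ennreal2) (auto intro: summable_geometric)
  finally have "(\<integral>\<^sup>+ z. (\<Sum>n. ennreal (2 ^ n * (cmod (a n z))\<^sup>2)) \<partial>lebesgue) \<noteq> \<infinity>"
    by (metis ennreal_less_top infinity_ennreal_def not_le top.not_eq_extremum)
  moreover have "(\<lambda>z. \<Sum>n. ennreal (2 ^ n * (cmod (a n z))\<^sup>2)) \<in> borel_measurable lebesgue"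
    by (rule borel_measurable_suminf_order) (use ma in measurable)
  ultimately have fin: "AE z in lebesgue. (\<Sum>n. ennreal (2 ^ n * (cmod (a n z))\<^sup>2)) \<noteq> \<infinity>"
    by (intro nn_integral_PInf_AE)
  have "convergent (\<lambda>n. rep_lsq (u n) z)" if fz: "(\<Sum>n. ennreal (2 ^ n * (cmod (a n z))\<^sup>2)) \<noteq> \<infinity>" for z
  proof -
    have "\<exists>C. S = ennreal C \<and> C \<ge> 0" if "S \<noteq> \<infinity>" for S
      using that by (cases S) auto
    from this[OF fz] obtain C where
      C': "(\<Sum>n. ennreal (2 ^ n * (cmod (a n z))\<^sup>2)) = ennreal C \<and> C \<ge> 0" ..
    note C = conjunct1[OF C'] conjunct2[OF C']
    have "norm (a n z) \<le> sqrt C * (1 / sqrt 2) ^ n" for n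
    proof -
      have "ennreal (2 ^ n * (cmod (a n z))\<^sup>2) \<le> ennreal C"
      proof -
        have "F n \<le> suminf F" for F :: "nat \<Rightarrow> ennreal" using sum_le_suminf[of F "{n}"] by simp
        from this[of "\<lambda>n. ennreal (2 ^ n * (cmod (a n z))\<^sup>2)"] show ?thesis unfolding C(1) .
      qed
      then have "2 ^ n * (cmod (a n z))\<^sup>2 \<le> C" using C(2) by (simp add: ennreal_le_iff)
      then have "(cmod (a n z))\<^sup>2 \<le> C * (1/2) ^ n" by (simp add: field_simps)
      also have "\<dots> = (sqrt C * (1 / sqrt 2) ^ n)\<^sup>2"
      proof -
        have "((1 / sqrt 2) ^ n)\<^sup>2 = ((1 / sqrt 2)\<^sup>2) ^ n"
          by (simp only: power_mult[symmetric] mult.commute)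
        also have "(1 / sqrt 2)\<^sup>2 = (1/2 :: real)" by (simp add: power_divide)
        finally show ?thesis using C(2) by (simp only: power_mult_distrib real_sqrt_pow2)
      qed
      finally show ?thesis by (simp add: C(2) power2_le_iff_abs_le)
    qed
    then have "summable (\<lambda>n. a n z)"
      by (intro summable_comparison_test'[where g = "\<lambda>n. sqrt C * (1 / sqrt 2) ^ n", OF summable_mult[OF summable_geometric]]) auto
    then have "convergent (\<lambda>n. \<Sum>k<n. a k z)" by (simp add: summable_iff_convergent)
    then have "convergent (\<lambda>n. rep_lsq (u n) z - rep_lsq (u 0) z)"
      by (simp only: a_def sum_lessThan_telescope[of "\<lambda>k. rep_lsq (u k) z"])
    then have "convergent (\<lambda>n. (rep_lsq (u n) z - rep_lsq (u 0) z) + rep_lsq (u 0) z)"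
      by (intro convergent_add convergent_const)
    then show ?thesis by simp
  qed
  with fin show ?thesis by (rule eventually_mono)
qed

text \<open>Fatou's lemma, applied to the differences with a fixed u n, carries the uniform bound on
  the tails over to the pointwise limit f.\<close>

lemma fast_Cauchy_lsq_convergent:
  fixes u :: "nat \<Rightarrow> 'a::euclidean_space lsq"
  assumes "\<And>n. norm (u (Suc n) - u n) \<le> (1/2) ^ n"
  shows "\<exists>v. u \<longlonglongrightarrow> v"
proof -
  define f where "f z = lim (\<lambda>n. rep_lsq (u n) z)" for z
  have mf: "f \<in> borel_measurable lebesgue"
    unfolding f_def by (intro borel_measurable_lim_metric sqint_measurable) auto
  have conv: "AE z in lebesgue. (\<lambda>n. rep_lsq (u n) z) \<longlonglongrightarrow> f z"
    using fast_Cauchy_lsq_AE_convergent[OF assms] unfolding f_def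
    by eventually_elim (simp add: convergent_LIMSEQ_iff)
  have tail: "norm (u (n + k) - u n) \<le> 2 * (1/2) ^ n" for n k
  proof -
    \<comment> \<open>The partial geometric sum in closed form; the bound 2 by itself would not
      survive the induction step.\<close>
    have "norm (u (n + k) - u n) \<le> (2 - 2 * (1/2) ^ k) * (1/2) ^ n"
    proof (induction k)
      case (Suc k)
      have "norm (u (n + Suc k) - u n) \<le> norm (u (Suc (n + k)) - u (n + k)) + norm (u (n + k) - u n)"
        using norm_triangle_ineq[of "u (Suc (n + k)) - u (n + k)" "u (n + k) - u n"] by simp
      also have "\<dots> \<le> (1/2) ^ (n + k) + (2 - 2 * (1/2) ^ k) * (1/2) ^ n"
        by (intro add_mono assms Suc)
      also have "\<dots> = (2 - 2 * (1/2) ^ Suc k) * (1/2) ^ n" by (simp add: power_add algebra_simps)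
      finally show ?case .
    qed simp
    also have "\<dots> \<le> 2 * (1/2) ^ n" by (intro mult_right_mono) auto
    finally show ?thesis .
  qed
  have bound: "(\<integral>\<^sup>+ z. ennreal ((cmod (f z - rep_lsq (u n) z))\<^sup>2) \<partial>lebesgue) \<le> ennreal ((2 * (1/2) ^ n)\<^sup>2)" for n
  proof -
    let ?h = "\<lambda>k z. ennreal ((cmod (rep_lsq (u (n + k)) z - rep_lsq (u n) z))\<^sup>2)"
    have mh: "?h k \<in> borel_measurable lebesgue" for k
      using sqint_measurable[OF sqint_rep, of "u (n + k)"] sqint_measurable[OF sqint_rep, of "u n"] by measurable
    have "(\<integral>\<^sup>+ z. ennreal ((cmod (f z - rep_lsq (u n) z))\<^sup>2) \<partial>lebesgue) = (\<integral>\<^sup>+ z. liminf (\<lambda>k. ?h k z) \<partial>lebesgue)"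
    proof (rule nn_integral_cong_AE, use conv in eventually_elim)
      case (elim z)
      have "(\<lambda>k. rep_lsq (u (n + k)) z) \<longlonglongrightarrow> f z"
        using LIMSEQ_ignore_initial_segment[OF elim, of n] by (simp add: add.commute)
      then have "(\<lambda>k. ?h k z) \<longlonglongrightarrow> ennreal ((cmod (f z - rep_lsq (u n) z))\<^sup>2)"
        by (intro tendsto_intros)
      then show ?case by (intro lim_imp_Liminf[symmetric]) simp_all
    qed
    also have "\<dots> \<le> liminf (\<lambda>k. \<integral>\<^sup>+ z. ?h k z \<partial>lebesgue)"
      by (rule nn_integral_liminf[OF mh])
    also have "\<dots> \<le> ennreal ((2 * (1/2) ^ n)\<^sup>2)"
    proof (rule Liminf_le)
      have "(\<integral>\<^sup>+ z. ?h k z \<partial>lebesgue) \<le> ennreal ((2 * (1/2) ^ n)\<^sup>2)" for k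
      proof -
        have "(\<integral>\<^sup>+ z. ?h k z \<partial>lebesgue) = ennreal ((norm (u (n + k) - u n))\<^sup>2)"
          unfolding nn_integral_rep_lsq[symmetric]
          by (rule nn_integral_cong_AE) (use rep_minus_lsq[of "u (n + k)" "u n"] in eventually_elim, simp)
        also have "\<dots> \<le> ennreal ((2 * (1/2) ^ n)\<^sup>2)" by (intro ennreal_leI power_mono tail) simp
        finally show ?thesis .
      qed
      then show "\<forall>\<^sub>F k in sequentially. (\<integral>\<^sup>+ z. ?h k z \<partial>lebesgue) \<le> ennreal ((2 * (1/2) ^ n)\<^sup>2)" by simp
    qed simp
    finally show ?thesis .
  qed
  have sqd: "sqint (\<lambda>z. f z - rep_lsq (u n) z)" for n
  proof -
    have m: "(\<lambda>z. f z - rep_lsq (u n) z) \<in> borel_measurable lebesgue"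
      by (intro borel_measurable_diff mf sqint_measurable) simp
    have "integrable lebesgue (\<lambda>z. (cmod (f z - rep_lsq (u n) z))\<^sup>2)"
      by (rule integrableI_nonneg) (use m le_less_trans[OF bound[of n] ennreal_less_top] in auto)
    with m show ?thesis by (simp add: sqint_def)
  qed
  have sqf: "sqint f" using sqint_add[OF sqd[of 0] sqint_rep[of "u 0"]] by simp
  define v where "v = abs_lsq f"
  have rv: "AE z in lebesgue. rep_lsq v z = f z" unfolding v_def by (rule rep_abs_lsq[OF sqf])
  have "norm (v - u n) \<le> 2 * (1/2) ^ n" for n
  proof -
    have "ennreal ((norm (v - u n))\<^sup>2) = (\<integral>\<^sup>+ z. ennreal ((cmod (f z - rep_lsq (u n) z))\<^sup>2) \<partial>lebesgue)"
      unfolding nn_integral_rep_lsq[symmetric]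
      by (rule nn_integral_cong_AE) (use rep_minus_lsq[of v "u n"] rv in eventually_elim, simp)
    also have "\<dots> \<le> ennreal ((2 * (1/2) ^ n)\<^sup>2)" by (rule bound)
    finally have "(norm (v - u n))\<^sup>2 \<le> (2 * (1/2) ^ n)\<^sup>2" by simp
    then show ?thesis by (rule power2_le_imp_le) simp
  qed
  moreover have "(\<lambda>n. 2 * (1/2::real) ^ n) \<longlonglongrightarrow> 2 * 0"
    by (intro tendsto_mult tendsto_const LIMSEQ_power_zero) simp
  ultimately have "(\<lambda>n. v - u n) \<longlonglongrightarrow> 0"
    by (intro Lim_null_comparison[of "\<lambda>n. v - u n" "\<lambda>n. 2 * (1/2) ^ n"]) simp_all
  from tendsto_diff[OF tendsto_const[of v] this] have "u \<longlonglongrightarrow> v" by simp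
  then show ?thesis ..
qed

instance lsq :: (euclidean_space) banach
proof
  fix u :: "nat \<Rightarrow> 'a lsq"
  assume C: "Cauchy u"
  \<comment> \<open>A subsequence with consecutive distances at most 2^-n reduces the claim to the
    fast case.\<close>
  have "\<exists>r. \<forall>n. (\<forall>m\<ge>r n. norm (u m - u (r n)) \<le> (1/2) ^ n) \<and> r n < r (Suc n)"
  proof (rule dependent_nat_choice)
    obtain N where "\<And>m. m \<ge> N \<Longrightarrow> norm (u m - u N) < 1"
      using C unfolding Cauchy_iff by (meson order_refl zero_less_one)
    then show "\<exists>N. \<forall>m\<ge>N. norm (u m - u N) \<le> (1/2) ^ 0" by (auto intro: less_imp_le)
  next
    fix N n
    obtain M where M: "\<And>m k. m \<ge> M \<Longrightarrow> k \<ge> M \<Longrightarrow> norm (u m - u k) < (1/2) ^ Suc n"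
      using C unfolding Cauchy_iff by (metis half_gt_zero_iff zero_less_one zero_less_power)
    show "\<exists>y. (\<forall>m\<ge>y. norm (u m - u y) \<le> (1/2) ^ Suc n) \<and> N < y"
    proof (rule exI[of _ "max M (Suc N)"], intro conjI allI impI)
      fix m assume "max M (Suc N) \<le> m"
      then show "norm (u m - u (max M (Suc N))) \<le> (1/2) ^ Suc n"
        using M[of m "max M (Suc N)"] by (intro less_imp_le) linarith
    qed simp
  qed
  then obtain r where r: "\<And>n m. m \<ge> r n \<Longrightarrow> norm (u m - u (r n)) \<le> (1/2) ^ n" "\<And>n. r n < r (Suc n)" by blast
  have "norm (u (r (Suc n)) - u (r n)) \<le> (1/2) ^ n" for n
    using r(1)[of n "r (Suc n)"] r(2)[of n] by simp
  from fast_Cauchy_lsq_convergent[of "u \<circ> r"] this obtain v where v: "(u \<circ> r) \<longlonglongrightarrow> v" by auto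
  have "strict_mono r" using r(2) by (simp add: strict_mono_Suc_iff)
  from Cauchy_converges_subseq[OF C this v] show "convergent u" by (auto simp: convergent_def)
qed

section \<open>Hilbert complexes with a compactness property\<close>

text \<open>A minimising sequence is Cauchy by the parallelogram identity, since midpoints remain in
  V and so have squared distance at least d from x. Moving the minimiser along v then forces
  orthogonality.\<close>

lemma orthogonal_projection_exists:
  fixes V :: "'h::{real_inner, complete_space} set"
  assumes "closed V" "subspace V"
  obtains p where "p \<in> V" "\<And>v. v \<in> V \<Longrightarrow> (x - p) \<bullet> v = 0"
proof -
  define d where "d = Inf ((\<lambda>v. (norm (x - v))\<^sup>2) ` V)"
  have V0: "0 \<in> V" by (rule subspace_0[OF assms(2)])
  have bb: "bdd_below ((\<lambda>v. (norm (x - v))\<^sup>2) ` V)" by (rule bdd_belowI[of _ 0]) auto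
  have dle: "d \<le> (norm (x - v))\<^sup>2" if "v \<in> V" for v
    unfolding d_def by (rule cInf_lower[OF _ bb]) (use that in auto)
  have "\<exists>v\<in>V. (norm (x - v))\<^sup>2 < d + inverse (real (Suc n))" for n
  proof -
    have "Inf ((\<lambda>v. (norm (x - v))\<^sup>2) ` V) < d + inverse (real (Suc n))" unfolding d_def by simp
    from cInf_lessD[OF _ this] V0 show ?thesis by auto
  qed
  then obtain s where s: "\<And>n. s n \<in> V" "\<And>n. (norm (x - s n))\<^sup>2 < d + inverse (real (Suc n))" by metis
  have par: "(norm (s m - s n))\<^sup>2 \<le> 2 * inverse (real (Suc m)) + 2 * inverse (real (Suc n))" for m n
  proof -
    have "(1/2) *\<^sub>R (s m + s n) \<in> V" by (intro subspace_scale subspace_add assms s)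
    from dle[OF this] have "4 * d \<le> (norm ((x - s m) + (x - s n)))\<^sup>2"
    proof -
      have "(x - s m) + (x - s n) = 2 *\<^sub>R (x - (1/2) *\<^sub>R (s m + s n))"
        by (simp add: algebra_simps scaleR_2)
      then have "(norm ((x - s m) + (x - s n)))\<^sup>2 = 4 * (norm (x - (1/2) *\<^sub>R (s m + s n)))\<^sup>2"
        by (simp add: power_mult_distrib)
      with \<open>d \<le> _\<close> show ?thesis by simp
    qed
    moreover have "(norm ((x - s m) + (x - s n)))\<^sup>2 + (norm ((x - s n) - (x - s m)))\<^sup>2
        = 2 * (norm (x - s m))\<^sup>2 + 2 * (norm (x - s n))\<^sup>2"
      unfolding power2_norm_eq_inner by (simp add: algebra_simps inner_commute)
    ultimately show ?thesis using s(2)[of m] s(2)[of n] by (simp add: algebra_simps)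
  qed
  have "Cauchy s"
  proof (rule metric_CauchyI)
    fix e :: real assume e: "e > 0"
    obtain N where N: "N > 0" "inverse (real N) < e\<^sup>2 / 4"
      using real_arch_invD[of "e\<^sup>2 / 4"] e by auto
    show "\<exists>M. \<forall>m\<ge>M. \<forall>n\<ge>M. dist (s m) (s n) < e"
    proof (intro exI[of _ N] allI impI)
      fix m n assume "m \<ge> N" "n \<ge> N"
      then have "inverse (real (Suc m)) \<le> inverse (real N)" "inverse (real (Suc n)) \<le> inverse (real N)"
        using N(1) by (auto intro!: le_imp_inverse_le)
      then have "(norm (s m - s n))\<^sup>2 < e\<^sup>2" using par[of m n] N(2) by linarith
      then show "dist (s m) (s n) < e" using e by (simp add: dist_norm power2_less_imp_less)
    qed
  qed
  then obtain p where p: "s \<longlonglongrightarrow> p" using Cauchy_convergent convergent_def by blast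
  have pV: "p \<in> V" using closed_sequentially[OF assms(1)] s(1) p by blast
  have "(\<lambda>n. (norm (x - s n))\<^sup>2) \<longlonglongrightarrow> (norm (x - p))\<^sup>2" by (intro tendsto_intros p)
  moreover have "(\<lambda>n. d + inverse (real (Suc n))) \<longlonglongrightarrow> d + 0"
    by (intro tendsto_intros LIMSEQ_inverse_real_of_nat)
  ultimately have pd: "(norm (x - p))\<^sup>2 \<le> d"
    using LIMSEQ_le[of "\<lambda>n. (norm (x - s n))\<^sup>2" _ "\<lambda>n. d + inverse (real (Suc n))"] s(2) by (force intro: less_imp_le)
  have "(x - p) \<bullet> v = 0" if v: "v \<in> V" for v
  proof (cases "v = 0")
    case False
    \<comment> \<open>The minimum point of the quadratic polynomial t \<mapsto> |x - p - t
      v|^2.\<close>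
    define t where "t = ((x - p) \<bullet> v) / (v \<bullet> v)"
    have vv: "v \<bullet> v > 0" using False by simp
    have "p + t *\<^sub>R v \<in> V" by (intro subspace_add subspace_scale assms pV v)
    from dle[OF this] pd have "(norm (x - p))\<^sup>2 \<le> (norm (x - (p + t *\<^sub>R v)))\<^sup>2" by linarith
    also have "x - (p + t *\<^sub>R v) = (x - p) - t *\<^sub>R v" by simp
    also have "(norm ((x - p) - t *\<^sub>R v))\<^sup>2 = (norm (x - p))\<^sup>2 - 2 * t * ((x - p) \<bullet> v) + t\<^sup>2 * (v \<bullet> v)"
      unfolding power2_norm_eq_inner by (simp add: inner_diff_left inner_diff_right inner_commute power2_eq_square algebra_simps)
    also have "\<dots> = (norm (x - p))\<^sup>2 - ((x - p) \<bullet> v)\<^sup>2 / (v \<bullet> v)"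
      unfolding t_def using vv by (simp add: power2_eq_square field_simps)
    finally have "((x - p) \<bullet> v)\<^sup>2 / (v \<bullet> v) \<le> 0" by simp
    then show ?thesis using vv by (simp add: divide_le_0_iff)
  qed simp
  with pV that show thesis by blast
qed

text \<open>The functional is assumed linear and bounded on V only, because it will be defined on
  the range of an operator. The representing vector is a multiple of a vector e in V orthogonal to
  the zeros of l: modulo those zeros every v is a multiple of e.\<close>

lemma Riesz_representation_on_subspace:
  fixes V :: "'h::{real_inner, complete_space} set"
  assumes "closed V" "subspace V"
    and add: "\<And>v w. v \<in> V \<Longrightarrow> w \<in> V \<Longrightarrow> l (v + w) = l v + l w"
    and scale: "\<And>r v. v \<in> V \<Longrightarrow> l (r *\<^sub>R v) = r * l v"
    and bound: "\<And>v. v \<in> V \<Longrightarrow> \<bar>l v\<bar> \<le> C * norm v"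
  obtains y where "y \<in> V" "\<And>v. v \<in> V \<Longrightarrow> l v = v \<bullet> y"
proof (cases "\<forall>v\<in>V. l v = 0")
  case True
  then show thesis using that[of 0] subspace_0[OF assms(2)] by simp
next
  case False
  then obtain w where w: "w \<in> V" "l w \<noteq> 0" by blast
  define N where "N = {v\<in>V. l v = 0}"
  have l0: "l 0 = 0" using scale[of 0 0] subspace_0[OF assms(2)] by simp
  have ldiff: "l (v - u) = l v - l u" if "v \<in> V" "u \<in> V" for u v
    using add[of v "- u"] scale[of u "-1"] that subspace_neg[OF assms(2)] by simp
  have Nsub: "subspace N"
    unfolding N_def using assms(2) by (auto simp: subspace_def l0 add scale)
  have "closed N"
    unfolding closed_sequential_limits
  proof (intro allI impI, elim conjE)
    fix s a assume s: "\<forall>n. s n \<in> N" "s \<longlonglongrightarrow> a"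
    have aV: "a \<in> V" using closed_sequentially[OF assms(1), of s a] s by (auto simp: N_def)
    have "\<bar>l a\<bar> \<le> C * norm (a - s n)" for n
    proof -
      have sn: "s n \<in> V" "l (s n) = 0" using s by (auto simp: N_def)
      have "\<bar>l (a - s n)\<bar> \<le> C * norm (a - s n)" by (intro bound subspace_diff assms aV sn)
      then show ?thesis using ldiff[OF aV sn(1)] sn by simp
    qed
    moreover have "(\<lambda>n. C * norm (a - s n)) \<longlonglongrightarrow> C * norm (a - a)" by (intro tendsto_intros s)
    ultimately have "\<bar>l a\<bar> \<le> 0" by (intro LIMSEQ_le_const[of "\<lambda>n. C * norm (a - s n)"]) auto
    then show "a \<in> N" using aV by (simp add: N_def)
  qed
  from orthogonal_projection_exists[OF this Nsub, of w] obtain p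
    where p: "p \<in> N" "\<And>v. v \<in> N \<Longrightarrow> (w - p) \<bullet> v = 0" by blast
  define e where "e = w - p"
  have e: "e \<in> V" "l e = l w" using p w ldiff[of w p] subspace_diff[OF assms(2)] by (auto simp: e_def N_def)
  have e0: "e \<noteq> 0" using e w l0 by auto
  show thesis
  proof (rule that[of "(l e / (e \<bullet> e)) *\<^sub>R e"])
    show "(l e / (e \<bullet> e)) *\<^sub>R e \<in> V" by (intro subspace_scale assms e)
    fix v assume v: "v \<in> V"
    have ve: "(l v / l e) *\<^sub>R e \<in> V" by (intro subspace_scale assms e)
    have "v - (l v / l e) *\<^sub>R e \<in> N"
      using ldiff[OF v ve] scale[OF e(1)] e(2) w(2) subspace_diff[OF assms(2) v ve] by (simp add: N_def)
    from p(2)[OF this] have "e \<bullet> (v - (l v / l e) *\<^sub>R e) = 0" by (simp add: e_def)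
    then have "v \<bullet> e = (l v / l e) * (e \<bullet> e)" by (simp add: inner_diff_right inner_commute)
    then show "l v = v \<bullet> ((l e / (e \<bullet> e)) *\<^sub>R e)" using e0 e(2) w(2) by simp
  qed
qed

text \<open>\<open>W u w\<close> is the graph of a closed operator on \<open>S\<close>, and \<open>Wadj\<close> below that of its adjoint.\<close>

locale hilbert_complex =
  fixes S :: "'h::{real_inner, complete_space} set" and W :: "'h \<Rightarrow> 'h \<Rightarrow> bool"
  assumes S_closed: "closed S" and S_subspace: "subspace S"
    and W_in: "W u w \<Longrightarrow> u \<in> S \<and> w \<in> S"
    and W_0: "W 0 0"
    and W_add: "W u w \<Longrightarrow> W u' w' \<Longrightarrow> W (u + u') (w + w')"
    and W_scale: "W u w \<Longrightarrow> W (r *\<^sub>R u) (r *\<^sub>R w)"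
    and W_limit: "(\<And>n. W (us n) (ws n)) \<Longrightarrow> us \<longlonglongrightarrow> u \<Longrightarrow> ws \<longlonglongrightarrow> w \<Longrightarrow> W u w"
    and W_square: "W u w \<Longrightarrow> W w 0"
    and W_compact: "(\<And>n. W (us n) (ws n)) \<Longrightarrow> (\<And>n v z. W v z \<Longrightarrow> z \<bullet> us n = 0) \<Longrightarrow>
      (\<And>n. norm (us n) \<le> 1) \<Longrightarrow> ws \<longlonglongrightarrow> 0 \<Longrightarrow> \<exists>r::nat \<Rightarrow> nat. strict_mono r \<and> Cauchy (us \<circ> r)"
begin

definition Wadj :: "'h \<Rightarrow> 'h \<Rightarrow> bool" where
  "Wadj u e \<longleftrightarrow> u \<in> S \<and> e \<in> S \<and> (\<forall>v z. W v z \<longrightarrow> z \<bullet> u = v \<bullet> e)"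

definition harm :: "'h set" where "harm = {h. W h 0 \<and> Wadj h 0}"

definition kernel :: "'h set" where "kernel = {u. W u 0}"

definition range :: "'h set" where "range = {w. \<exists>u. W u w}"

lemma W_diff: "W u w \<Longrightarrow> W u' w' \<Longrightarrow> W (u - u') (w - w')"
  using W_add[of u w "- u'" "- w'"] W_scale[of u' w' "-1"] by simp

lemma subspace_kernel: "subspace kernel"
  unfolding subspace_def kernel_def using W_0 W_add[of _ 0 _ 0] W_scale[of _ 0] by auto

lemma closed_kernel: "closed kernel"
  unfolding closed_sequential_limits kernel_def using W_limit[of _ "\<lambda>_. 0"] by auto

lemma subspace_range: "subspace range"
  unfolding subspace_def range_def using W_0 W_add W_scale by blast

lemma range_subset_kernel: "range \<subseteq> kernel"
  unfolding range_def kernel_def using W_square by blast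

lemma subspace_harm: "subspace harm"
  unfolding subspace_def harm_def Wadj_def
  using W_0 W_add[of _ 0 _ 0] W_scale[of _ 0] subspace_add[OF S_subspace] subspace_scale[OF S_subspace]
    subspace_0[OF S_subspace]
  by (auto simp: inner_add_right)

text \<open>If it failed, normalised counterexamples would have images tending to 0. They are
  orthogonal to \<open>kernel\<close>, hence to \<open>range\<close>, so \<open>W_compact\<close>
  yields a limit of norm 1 along a subsequence. That limit is in \<open>kernel\<close>, as the graph
  is closed, and orthogonal to it, which is absurd.\<close>

lemma estimate:
  obtains c where "c > 0" "\<And>u w. W u w \<Longrightarrow> (\<And>x. x \<in> kernel \<Longrightarrow> u \<bullet> x = 0) \<Longrightarrow> norm u \<le> c * norm w"
proof (rule ccontr)
  assume "\<not> thesis"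
  with that have "\<exists>u w. W u w \<and> (\<forall>x\<in>kernel. u \<bullet> x = 0) \<and> \<not> norm u \<le> real (Suc n) * norm w" for n
    by (metis of_nat_0_less_iff zero_less_Suc)
  then obtain u w where uw: "\<And>n. W (u n) (w n)" "\<And>n x. x \<in> kernel \<Longrightarrow> u n \<bullet> x = 0"
    "\<And>n. \<not> norm (u n) \<le> real (Suc n) * norm (w n)" by metis
  define u' where "u' n = inverse (norm (u n)) *\<^sub>R u n" for n
  define w' where "w' n = inverse (norm (u n)) *\<^sub>R w n" for n
  have un: "norm (u n) > 0" for n
  proof -
    have "real (Suc n) * norm (w n) \<ge> 0" by simp
    then show ?thesis using uw(3)[of n] by linarith
  qed
  have 1: "W (u' n) (w' n)" for n unfolding u'_def w'_def by (rule W_scale[OF uw(1)])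
  have n1: "norm (u' n) = 1" for n using un[of n] by (simp add: u'_def)
  have 2: "z \<bullet> u' n = 0" if "W v z" for n v z
    using uw(2)[of z n] W_square[OF that] by (simp add: kernel_def u'_def inner_commute)
  have "norm (w' n) \<le> inverse (real (Suc n))" for n
    using uw(3)[of n] un[of n] by (simp add: w'_def field_simps)
  then have "w' \<longlonglongrightarrow> 0"
    by (intro Lim_null_comparison[OF _ LIMSEQ_inverse_real_of_nat]) auto
  have "\<exists>r::nat \<Rightarrow> nat. strict_mono r \<and> Cauchy (u' \<circ> r)"
  proof (rule W_compact[OF 1 _ _ \<open>w' \<longlonglongrightarrow> 0\<close>])
    show "z \<bullet> u' n = 0" if "W v z" for n v z by (rule 2[OF that])
  qed (simp add: n1)
  then obtain r :: "nat \<Rightarrow> nat" where r: "strict_mono r" "Cauchy (u' \<circ> r)" by auto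
  then obtain a where a: "(u' \<circ> r) \<longlonglongrightarrow> a" using Cauchy_convergent convergent_def by blast
  have "(w' \<circ> r) \<longlonglongrightarrow> 0" by (rule LIMSEQ_subseq_LIMSEQ[OF \<open>w' \<longlonglongrightarrow> 0\<close> r(1)])
  from W_limit[OF _ a this] 1 have "a \<in> kernel" by (simp add: kernel_def)
  then have "u' n \<bullet> a = 0" for n using uw(2)[of a n] by (simp add: u'_def)
  moreover have "(\<lambda>n. (u' \<circ> r) n \<bullet> a) \<longlonglongrightarrow> a \<bullet> a" by (intro tendsto_intros a)
  ultimately have "a \<bullet> a = 0" by (simp add: LIMSEQ_const_iff)
  moreover have "(\<lambda>n. norm ((u' \<circ> r) n)) \<longlonglongrightarrow> norm a" by (intro tendsto_intros a)
  ultimately show False by (simp add: n1 LIMSEQ_const_iff)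
qed

lemma range_lift:
  assumes "w \<in> range"
  obtains u where "W u w" "\<And>x. x \<in> kernel \<Longrightarrow> u \<bullet> x = 0"
proof -
  obtain u where u: "W u w" using assms by (auto simp: range_def)
  obtain p where p: "p \<in> kernel" "\<And>v. v \<in> kernel \<Longrightarrow> (u - p) \<bullet> v = 0"
    using orthogonal_projection_exists[OF closed_kernel subspace_kernel, of u] by blast
  have "W (u - p) w" using W_diff[OF u, of p 0] p(1) by (simp add: kernel_def)
  with p(2) that show thesis by blast
qed

text \<open>Preimages orthogonal to \<open>kernel\<close> are controlled by their images through
  \<open>estimate\<close>, so a convergent sequence in the range lifts to a Cauchy sequence, and
  closedness of the graph finishes.\<close>

lemma closed_range: "closed range"
  unfolding closed_sequential_limits
proof (intro allI impI, elim conjE)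
  fix w b assume w: "\<forall>n. w n \<in> range" "w \<longlonglongrightarrow> b"
  obtain c where c: "c > 0" "\<And>u w. W u w \<Longrightarrow> (\<And>x. x \<in> kernel \<Longrightarrow> u \<bullet> x = 0) \<Longrightarrow> norm u \<le> c * norm w"
    using estimate by blast
  have "\<exists>u. W u (w n) \<and> (\<forall>x\<in>kernel. u \<bullet> x = 0)" for n
    using range_lift[of "w n"] w(1) by metis
  then obtain u where u: "\<And>n. W (u n) (w n)" "\<And>n x. x \<in> kernel \<Longrightarrow> u n \<bullet> x = 0" by metis
  have est: "norm (u m - u n) \<le> c * norm (w m - w n)" for m n
    by (rule c(2)[OF W_diff[OF u(1) u(1)]]) (simp add: inner_diff_left u(2))
  have "Cauchy w" using w(2) by (rule LIMSEQ_imp_Cauchy)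
  have "Cauchy u"
  proof (rule CauchyI)
    fix e :: real assume "e > 0"
    then obtain M where M: "\<And>m n. m \<ge> M \<Longrightarrow> n \<ge> M \<Longrightarrow> norm (w m - w n) < e / c"
      using CauchyD[OF \<open>Cauchy w\<close>, of "e / c"] c(1) by auto
    have "norm (u m - u n) < e" if "m \<ge> M" "n \<ge> M" for m n
      using est[of m n] M[OF that] c(1) by (simp add: field_simps less_le_trans le_less_trans)
    then show "\<exists>M. \<forall>m\<ge>M. \<forall>n\<ge>M. norm (u m - u n) < e" by blast
  qed
  then obtain a where "u \<longlonglongrightarrow> a" using Cauchy_convergent convergent_def by blast
  from W_limit[OF u(1) this w(2)] show "b \<in> range" by (auto simp: range_def)
qed

text \<open>The closed range theorem for the adjoint. Sending w to the pairing of g with a preimage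
  of w is a functional on the closed range, bounded by \<open>estimate\<close>; its Riesz vector y
  is mapped to g by the adjoint.\<close>

lemma orthogonal_kernel_in_adjoint_range:
  assumes "g \<in> S" "\<And>x. x \<in> kernel \<Longrightarrow> g \<bullet> x = 0"
  obtains y where "Wadj y g"
proof -
  obtain c where c: "c > 0" "\<And>u w. W u w \<Longrightarrow> (\<And>x. x \<in> kernel \<Longrightarrow> u \<bullet> x = 0) \<Longrightarrow> norm u \<le> c * norm w"
    using estimate by blast
  \<comment> \<open>The choice of preimage is immaterial: two preimages differ by an element of
    \<open>kernel\<close>, which is orthogonal to g.\<close>
  define l where "l w = (SOME u. W u w) \<bullet> g" for w
  have leq: "l w = u \<bullet> g" if "W u w" for u w
  proof -
    have "W (SOME u. W u w) w" using someI[of "\<lambda>u. W u w", OF that] .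
    from W_diff[OF this that] have "(SOME u. W u w) - u \<in> kernel" by (simp add: kernel_def)
    from assms(2)[OF this] show ?thesis by (simp add: l_def inner_diff_right inner_commute)
  qed
  obtain y where y: "y \<in> range" "\<And>w. w \<in> range \<Longrightarrow> l w = w \<bullet> y"
  proof (rule Riesz_representation_on_subspace[OF closed_range subspace_range, of l "c * norm g"])
    fix v w assume "v \<in> range" "w \<in> range"
    then show "l (v + w) = l v + l w"
      by (auto simp: range_def leq W_add[THEN leq] inner_add_left)
  next
    fix r v assume "v \<in> range"
    then show "l (r *\<^sub>R v) = r * l v" by (auto simp: range_def leq W_scale[THEN leq])
  next
    fix v assume "v \<in> range"
    then obtain u where u: "W u v" "\<And>x. x \<in> kernel \<Longrightarrow> u \<bullet> x = 0" using range_lift by blast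
    have "\<bar>l v\<bar> \<le> norm u * norm g" unfolding leq[OF u(1)] by (rule Cauchy_Schwarz_ineq2)
    also have "\<dots> \<le> (c * norm v) * norm g" by (intro mult_right_mono c(2) u) auto
    finally show "\<bar>l v\<bar> \<le> c * norm g * norm v" by (simp add: mult_ac)
  qed blast
  have "Wadj y g"
    unfolding Wadj_def
  proof (intro conjI allI impI)
    show "y \<in> S" using y(1) W_in by (auto simp: range_def)
    fix v z assume vz: "W v z"
    then have "z \<in> range" by (auto simp: range_def)
    from y(2)[OF this] leq[OF vz] show "z \<bullet> y = v \<bullet> g" by simp
  qed (rule assms(1))
  then show thesis by (rule that)
qed

text \<open>Here b is the projection of x to \<open>range\<close> and a the projection of x - b to
  \<open>kernel\<close>. The rest is orthogonal to \<open>kernel\<close>, so it is an image under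
  the adjoint.\<close>

lemma decomposition:
  assumes "x \<in> S"
  obtains a b c u v where "x = a + b + c" "a \<in> harm" "W u b" "Wadj v c"
proof -
  obtain b where b: "b \<in> range" "\<And>v. v \<in> range \<Longrightarrow> (x - b) \<bullet> v = 0"
    using orthogonal_projection_exists[OF closed_range subspace_range, of x] by blast
  obtain a where a: "a \<in> kernel" "\<And>v. v \<in> kernel \<Longrightarrow> (x - b - a) \<bullet> v = 0"
    using orthogonal_projection_exists[OF closed_kernel subspace_kernel, of "x - b"] by blast
  have aS: "a \<in> S" and bS: "b \<in> S" using a(1) b(1) W_in by (auto simp: kernel_def range_def)
  have "x - b - a \<in> S" by (intro subspace_diff S_subspace aS bS assms)
  from orthogonal_kernel_in_adjoint_range[OF this a(2)] obtain v where v: "Wadj v (x - b - a)" by blast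
  \<comment> \<open>Both x - b and x - b - a are orthogonal to \<open>range\<close>, hence so is
    their difference a; this is the adjoint equation for a harmonic element.\<close>
  have "z \<bullet> a = 0" if "W w z" for w z
  proof -
    have z: "z \<in> range" using that by (auto simp: range_def)
    then have "(x - b) \<bullet> z = 0" "(x - b - a) \<bullet> z = 0" using b(2) a(2) range_subset_kernel by blast+
    moreover have "a \<bullet> z = (x - b) \<bullet> z - (x - b - a) \<bullet> z" by (simp add: inner_diff_left)
    ultimately show ?thesis by (simp add: inner_commute)
  qed
  then have "a \<in> harm"
    using a(1) aS subspace_0[OF S_subspace] by (auto simp: harm_def kernel_def Wadj_def)
  moreover obtain u where "W u b" using b(1) by (auto simp: range_def)
  ultimately show thesis using that[of a b "x - b - a" u v] v by simp
qed

text \<open>In the infinite-dimensional case Gram-Schmidt produces an orthonormal sequence in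
  \<open>harm\<close>. Its images are 0 and it is orthogonal to \<open>range\<close>, so
  \<open>W_compact\<close> would give it a Cauchy subsequence.\<close>

lemma harm_finite_dim:
  obtains B where "finite B" "B \<subseteq> harm" "harm \<subseteq> span B"
proof (rule ccontr)
  assume "\<not> thesis"
  with that have no: "\<And>B. finite B \<Longrightarrow> B \<subseteq> harm \<Longrightarrow> \<exists>x\<in>harm. x \<notin> span B" by blast
  define P where "P f n r \<longleftrightarrow> r \<in> harm \<and> norm r = 1 \<and> (\<forall>m<n. r \<bullet> f m = 0)" for f :: "nat \<Rightarrow> 'h" and n r
  have "\<exists>f. \<forall>n. P f n (f n)"
  proof (rule dependent_wellorder_choice)
    fix n and f :: "nat \<Rightarrow> 'h" assume f: "\<And>m. m < n \<Longrightarrow> P f m (f m)"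
    have orth: "f i \<bullet> f j = (if i = j then 1 else 0)" if "i < n" "j < n" for i j
      using f[OF that(1)] f[OF that(2)] unfolding P_def
      by (cases i j rule: linorder_cases) (auto simp: inner_commute power2_norm_eq_inner[symmetric])
    obtain x where x: "x \<in> harm" "x \<notin> span (f ` {..<n})"
      using no[of "f ` {..<n}"] f by (auto simp: P_def)
    define y where "y = x - (\<Sum>i<n. (x \<bullet> f i) *\<^sub>R f i)"
    have "(\<Sum>i<n. (x \<bullet> f i) *\<^sub>R f i) \<in> span (f ` {..<n})"
      by (intro span_sum span_scale span_base) auto
    then have y0: "y \<noteq> 0" using x(2) by (auto simp: y_def)
    have yh: "y \<in> harm" unfolding y_def
      using f by (intro subspace_diff subspace_harm x subspace_sum subspace_scale) (auto simp: P_def)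
    have "y \<bullet> f j = 0" if "j < n" for j
    proof -
      have "(\<Sum>i<n. (x \<bullet> f i) * (f i \<bullet> f j)) = (\<Sum>i<n. if i = j then x \<bullet> f j else 0)"
        by (intro sum.cong) (use orth that in auto)
      also have "\<dots> = x \<bullet> f j" using that by simp
      finally show ?thesis by (simp add: y_def inner_diff_left inner_sum_left)
    qed
    then show "\<exists>r. P f n r"
      unfolding P_def using y0 yh subspace_scale[OF subspace_harm yh]
      by (intro exI[of _ "inverse (norm y) *\<^sub>R y"]) auto
  qed (auto simp: P_def)
  then obtain f where f: "\<And>n. P f n (f n)" by blast
  have orth: "f i \<bullet> f j = (if i = j then 1 else 0)" for i j
    using f[of i] f[of j] unfolding P_def
    by (cases i j rule: linorder_cases) (auto simp: inner_commute power2_norm_eq_inner[symmetric])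
  have "\<exists>r::nat \<Rightarrow> nat. strict_mono r \<and> Cauchy (f \<circ> r)"
    by (rule W_compact[where ws = "\<lambda>_. 0"]) (use f in \<open>auto simp: P_def harm_def Wadj_def\<close>)
  then obtain r :: "nat \<Rightarrow> nat" where r: "strict_mono r" "Cauchy (f \<circ> r)" by blast
  from CauchyD[OF r(2), of 1] obtain M where
    "\<And>m n. m \<ge> M \<Longrightarrow> n \<ge> M \<Longrightarrow> norm (f (r m) - f (r n)) < 1" by auto
  from this[of M "Suc M"] have M: "norm (f (r M) - f (r (Suc M))) < 1" by simp
  \<comment> \<open>Orthonormal vectors are at distance sqrt 2 from each other, so no subsequence is
    Cauchy.\<close>
  have "(norm (f (r M) - f (r (Suc M))))\<^sup>2 = 2"
    using strict_mono_eq[OF r(1), of M "Suc M"]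
    by (simp add: power2_norm_eq_inner inner_diff_left inner_diff_right orth)
  moreover have "(norm (f (r M) - f (r (Suc M))))\<^sup>2 < 1"
    using M by (simp add: power_less_one_iff abs_square_less_1)
  ultimately show False by simp
qed

end

section \<open>Multiplication operators and bilinear pairings\<close>

definition mul :: "('a::euclidean_space \<Rightarrow> complex) \<Rightarrow> 'a lsq \<Rightarrow> 'a lsq" where
  "mul b u = abs_lsq (\<lambda>z. b z * rep_lsq u z)"

lemma rep_mul: "bmeas b \<Longrightarrow> AE z in lebesgue. rep_lsq (mul b u) z = b z * rep_lsq u z"
  unfolding mul_def by (rule rep_abs_lsq) (simp add: sqint_bmeas_mult)

lemma mul_cong: "(\<And>z. b z = c z) \<Longrightarrow> mul b u = mul c u"
  by (simp add: mul_def)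

lemma mul_mul: "bmeas b \<Longrightarrow> bmeas c \<Longrightarrow> mul b (mul c u) = mul (\<lambda>z. b z * c z) u"
  unfolding lsq_eq_iff using rep_mul[of b "mul c u"] rep_mul[of c u] rep_mul[OF bmeas_mult, of b c u]
  by (auto elim!: AE_mp)

lemma mul_commute: "bmeas b \<Longrightarrow> bmeas c \<Longrightarrow> mul b (mul c u) = mul c (mul b u)"
  by (simp add: mul_mul mult.commute)

lemma mul_add_left: "bmeas b \<Longrightarrow> bmeas c \<Longrightarrow> mul (\<lambda>z. b z + c z) u = mul b u + mul c u"
  unfolding lsq_eq_iff using rep_mul[of b u] rep_mul[of c u] rep_mul[OF bmeas_add, of b c u] rep_plus_lsq[of "mul b u" "mul c u"]
  by (auto elim!: AE_mp simp: algebra_simps)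

lemma mul_add: "bmeas b \<Longrightarrow> mul b (u + v) = mul b u + mul b v"
  unfolding lsq_eq_iff using rep_mul[of b u] rep_mul[of b v] rep_mul[of b "u + v"] rep_plus_lsq[of "mul b u" "mul b v"] rep_plus_lsq[of u v]
  by (auto elim!: AE_mp simp: algebra_simps)

lemma mul_scaleR: "bmeas b \<Longrightarrow> mul b (r *\<^sub>R u) = r *\<^sub>R mul b u"
  unfolding lsq_eq_iff using rep_mul[of b u] rep_mul[of b "r *\<^sub>R u"] rep_scaleR_lsq[of r "mul b u"] rep_scaleR_lsq[of r u]
  by (auto elim!: AE_mp simp: algebra_simps)

lemma mul_of_real: "mul (\<lambda>z. of_real r) u = r *\<^sub>R u"
  unfolding lsq_eq_iff using rep_mul[OF bmeas_const, of "of_real r" u] rep_scaleR_lsq[of r u] by eventually_elim simp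

lemma mul_1 [simp]: "mul (\<lambda>z. 1) u = u"
  using mul_of_real[of 1 u] by simp

lemma mul_0_left [simp]: "mul (\<lambda>z. 0) u = 0"
  using mul_of_real[of 0 u] by simp

lemma norm_mul_mono:
  assumes "bmeas b" "bmeas c" "\<And>z. cmod (b z) \<le> cmod (c z)"
  shows "norm (mul b u) \<le> norm (mul c u)"
proof -
  have "AE z in lebesgue. cmod (rep_lsq (mul b u) z) \<le> 1 * cmod (rep_lsq (mul c u) z)"
    using rep_mul[OF assms(1), of u] rep_mul[OF assms(2), of u]
    by eventually_elim (simp add: norm_mult assms(3) mult_right_mono)
  from norm_lsq_mono[OF this] show ?thesis by simp
qed

lemma norm_mul_le:
  assumes "bmeas b" "\<And>z. cmod (b z) \<le> B"
  shows "norm (mul b u) \<le> B * norm u"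
proof -
  have B: "0 \<le> B" using assms(2) norm_ge_zero order_trans by blast
  have "norm (mul b u) \<le> norm (mul (\<lambda>z. of_real B) u)"
    by (rule norm_mul_mono[OF assms(1) bmeas_const]) (use B assms(2) in simp)
  then show ?thesis using B by (simp add: mul_of_real)
qed

lemma bounded_linear_mul: "bmeas b \<Longrightarrow> bounded_linear (mul b)"
proof -
  assume b: "bmeas b"
  then obtain B where "\<And>z. cmod (b z) \<le> B" by (auto simp: bmeas_def)
  then show ?thesis
    by (intro bounded_linear_intro[of _ B]) (use b norm_mul_le in \<open>auto simp: mul_add mul_scaleR mult.commute\<close>)
qed

lemma mul_0 [simp]: "bmeas b \<Longrightarrow> mul b 0 = 0"
  using mul_scaleR[of b 0 0] by simp

lemma mul_diff: "bmeas b \<Longrightarrow> mul b (u - v) = mul b u - mul b v"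
  using linear_diff[OF bounded_linear.linear[OF bounded_linear_mul]] .

lemma mul_sum: "bmeas b \<Longrightarrow> mul b (\<Sum>i\<in>S. u i) = (\<Sum>i\<in>S. mul b (u i))"
  using linear_sum[OF bounded_linear.linear[OF bounded_linear_mul]] .

lemma mul_sum_left: "(\<And>i. i \<in> S \<Longrightarrow> bmeas (b i)) \<Longrightarrow> mul (\<lambda>z. \<Sum>i\<in>S. b i z) u = (\<Sum>i\<in>S. mul (b i) u)"
  by (induction S rule: infinite_finite_induct) (auto simp: mul_add_left bmeas_sum)

lemma cin_mul: "bmeas b \<Longrightarrow> cin (mul b u) v = cin u (mul (\<lambda>z. cnj (b z)) v)"
proof -
  assume b: "bmeas b"
  have m: "b \<in> borel_measurable lebesgue" using b by (simp add: bmeas_def)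
  have "cin (mul b u) v = (LINT z|lebesgue. (b z * rep_lsq u z) * cnj (rep_lsq v z))"
    by (rule cin_cong[OF rep_mul[OF b]]) (use m in \<open>auto intro!: borel_measurable_times\<close>)
  also have "\<dots> = (LINT z|lebesgue. rep_lsq u z * cnj (cnj (b z) * rep_lsq v z))"
    by (simp add: mult_ac)
  also have "\<dots> = cin u (mul (\<lambda>z. cnj (b z)) v)"
    by (rule cin_cong[symmetric]) (use b m in \<open>auto intro!: borel_measurable_times cnj_measurable rep_mul bmeas_cnj\<close>)
  finally show ?thesis .
qed

lemma cin_add_right: "cin u (v + w) = cin u v + cin u w"
  by (subst (1 2 3) cin_commute) (simp add: cin_add_left)

lemma cin_scaleR_right: "cin u (r *\<^sub>R v) = of_real r * cin u v"
  by (subst (1 2) cin_commute) (simp add: cin_scaleR_left)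

lemma cin_mul_const: "cin (mul (\<lambda>z. c) u) v = c * cin u v"
proof -
  have "cin (mul (\<lambda>z. c) u) v = (LINT z|lebesgue. (c * rep_lsq u z) * cnj (rep_lsq v z))"
    by (rule cin_cong[OF rep_mul]) (auto intro!: borel_measurable_times)
  then show ?thesis by (simp add: cin_def mult.assoc)
qed

text \<open>The factor 2 comes from applying the real Cauchy-Schwarz inequality to the real and the
  imaginary part separately.\<close>

lemma norm_cin_le: "cmod (cin u v) \<le> 2 * norm u * norm v"
proof -
  have 1: "\<bar>Re (cin u v)\<bar> \<le> norm u * norm v"
    using Cauchy_Schwarz_ineq2[of u v] by (simp add: inner_lsq_def)
  have "\<bar>Im (cin u v)\<bar> = \<bar>inner (mul (\<lambda>z. - \<i>) u) v\<bar>" by (simp add: inner_lsq_def cin_mul_const)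
  also have "\<dots> \<le> norm (mul (\<lambda>z. - \<i>) u) * norm v" by (rule Cauchy_Schwarz_ineq2)
  also have "\<dots> \<le> norm u * norm v"
    using norm_mul_le[OF bmeas_const, of "- \<i>" 1 u] by (intro mult_right_mono) auto
  finally show ?thesis using 1 cmod_le[of "cin u v"] by linarith
qed

section \<open>Bilinear pairing with test functions\<close>

definition pr :: "'a::euclidean_space lsq \<Rightarrow> ('a \<Rightarrow> complex) \<Rightarrow> complex" where
  "pr u \<theta> = (LINT z|lebesgue. rep_lsq u z * \<theta> z)"

text \<open>The pairing carries no conjugate, as in the distributional identities, so \<theta> is
  conjugated on the way to the inner product. Linearity and continuity in u are inherited from
  there.\<close>

lemma pr_eq_cin: "sqint \<theta> \<Longrightarrow> pr u \<theta> = cin u (abs_lsq (\<lambda>z. cnj (\<theta> z)))"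
proof -
  assume th: "sqint \<theta>"
  have "cin u (abs_lsq (\<lambda>z. cnj (\<theta> z))) = (LINT z|lebesgue. rep_lsq u z * cnj (cnj (\<theta> z)))"
    by (rule cin_cong) (auto intro!: rep_abs_lsq sqint_cnj th sqint_measurable)
  then show ?thesis by (simp add: pr_def)
qed

lemma pr_cong_AE:
  assumes "AE z in lebesgue. rep_lsq u z = f z" "f \<in> borel_measurable lebesgue" "\<theta> \<in> borel_measurable lebesgue"
  shows "pr u \<theta> = (LINT z|lebesgue. f z * \<theta> z)"
  unfolding pr_def
proof (rule integral_cong_AE)
  show "AE z in lebesgue. rep_lsq u z * \<theta> z = f z * \<theta> z" using assms(1) by eventually_elim simp
qed (auto intro!: borel_measurable_times assms(2,3))

lemma pr_bounded_linear: "sqint \<theta> \<Longrightarrow> bounded_linear (\<lambda>u. pr u \<theta>)"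
  by (rule bounded_linear_intro[of _ "2 * norm (abs_lsq (\<lambda>z. cnj (\<theta> z)))"])
    (auto simp: pr_eq_cin cin_add_left cin_scaleR_left scaleR_conv_of_real
      intro: order_trans[OF norm_cin_le] simp: mult_ac)

lemma pr_add: "sqint \<theta> \<Longrightarrow> pr (u + v) \<theta> = pr u \<theta> + pr v \<theta>"
  by (simp add: pr_eq_cin cin_add_left)

lemma pr_scaleR: "sqint \<theta> \<Longrightarrow> pr (r *\<^sub>R u) \<theta> = r *\<^sub>R pr u \<theta>"
  by (simp add: pr_eq_cin cin_scaleR_left scaleR_conv_of_real)

lemma pr_diff: "sqint \<theta> \<Longrightarrow> pr (u - v) \<theta> = pr u \<theta> - pr v \<theta>"
  using linear_diff[OF bounded_linear.linear[OF pr_bounded_linear]] .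

lemma pr_0 [simp]: "sqint \<theta> \<Longrightarrow> pr 0 \<theta> = 0"
  using linear_0[OF bounded_linear.linear[OF pr_bounded_linear]] .

lemma pr_sum: "sqint \<theta> \<Longrightarrow> pr (\<Sum>i\<in>S. u i) \<theta> = (\<Sum>i\<in>S. pr (u i) \<theta>)"
  using linear_sum[OF bounded_linear.linear[OF pr_bounded_linear]] .

lemma pr_add_right: "sqint \<theta> \<Longrightarrow> sqint \<theta>' \<Longrightarrow> pr u (\<lambda>z. \<theta> z + \<theta>' z) = pr u \<theta> + pr u \<theta>'"
  unfolding pr_def distrib_left
  by (rule Bochner_Integration.integral_add) (simp_all add: integrable_sqint_mult)

lemma pr_cmult_right: "pr u (\<lambda>z. c * \<theta> z) = c * pr u \<theta>"
  unfolding pr_def by (simp add: mult.left_commute)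

lemma pr_mul: "bmeas b \<Longrightarrow> \<theta> \<in> borel_measurable lebesgue \<Longrightarrow> pr (mul b u) \<theta> = pr u (\<lambda>z. b z * \<theta> z)"
  by (subst pr_cong_AE[OF rep_mul]) (auto simp: pr_def bmeas_def mult_ac intro!: borel_measurable_times)

lemma pr_abs: "sqint f \<Longrightarrow> \<theta> \<in> borel_measurable lebesgue \<Longrightarrow> pr (abs_lsq f) \<theta> = (LINT z|lebesgue. f z * \<theta> z)"
  by (rule pr_cong_AE[OF rep_abs_lsq]) (auto intro: sqint_measurable)

lemma continuous_on_imp_lebesgue_measurable:
  "continuous_on UNIV f \<Longrightarrow> f \<in> borel_measurable lebesgue"
  by (intro measurable_completion) (simp add: borel_measurable_continuous_onI)

lemma integrable_indicator_lebesgue: "C \<in> lmeasurable \<Longrightarrow> integrable lebesgue (indicat_real C)"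
  by (rule integrable_real_indicator) (auto simp: fmeasurable_def)

lemma integrable_continuous_compact:
  fixes f :: "'a::euclidean_space \<Rightarrow> complex"
  assumes "continuous_on UNIV f" "compact C" "\<And>z. z \<notin> C \<Longrightarrow> f z = 0"
  shows "integrable lebesgue f"
proof -
  have "(\<lambda>x. indicator C x *\<^sub>R f x) = f" using assms(3) by (auto simp: indicator_def)
  then have "integrable lborel f"
    using borel_integrable_compact[OF assms(2) continuous_on_subset[OF assms(1) subset_UNIV]] by simp
  then show ?thesis using assms(1) by (subst integrable_completion) (auto intro: borel_measurable_continuous_onI)
qed

lemma sqint_continuous_compact:
  assumes "continuous_on UNIV f" "compact C" "\<And>z. z \<notin> C \<Longrightarrow> f z = 0"
  shows "sqint f"
proof -
  have "compact (f ` C)"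
    by (rule compact_continuous_image[OF continuous_on_subset[OF assms(1)] assms(2)]) simp
  then obtain B where B: "B > 0" "\<And>y. y \<in> f ` C \<Longrightarrow> norm y \<le> B"
    using compact_imp_bounded[of "f ` C"] unfolding bounded_pos by metis
  have le: "cmod (f z) \<le> B" for z using B assms(3)[of z] by (cases "z \<in> C") auto
  have C: "C \<in> lmeasurable" by (rule lmeasurable_compact[OF assms(2)])
  show ?thesis
  proof (rule sqint_bound[OF continuous_on_imp_lebesgue_measurable[OF assms(1)]])
    show "integrable lebesgue (\<lambda>z. B\<^sup>2 * indicat_real C z)"
      using C by (intro integrable_mult_right integrable_indicator_lebesgue)
    show "AE z in lebesgue. (cmod (f z))\<^sup>2 \<le> B\<^sup>2 * indicat_real C z"
      using le assms(3) by (auto simp: indicator_def intro!: AE_I2 power_mono)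
  qed
qed

lemma test_function_compact: "test_function D \<theta> \<Longrightarrow> compact (closure {z. \<theta> z \<noteq> 0})"
  by (simp add: test_function_def)

lemma test_function_continuous: "test_function D \<theta> \<Longrightarrow> continuous_on UNIV \<theta>"
  by (rule smooth_on_imp_continuous_on[OF test_function_smooth])

lemma test_function_measurable: "test_function D \<theta> \<Longrightarrow> \<theta> \<in> borel_measurable lebesgue"
  by (rule continuous_on_imp_lebesgue_measurable[OF test_function_continuous])

lemma test_function_sqint: "test_function D \<theta> \<Longrightarrow> sqint \<theta>"
  by (rule sqint_continuous_compact[OF test_function_continuous test_function_compact])
    (use closure_subset[of "{z. \<theta> z \<noteq> 0}"] in \<open>auto\<close>)

lemma test_function_bmeas: "test_function D \<theta> \<Longrightarrow> bmeas \<theta>"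
  using test_function_bounded test_function_measurable unfolding bmeas_def by metis

section \<open>Integration by parts\<close>

lemma integral_translate_lebesgue:
  fixes f :: "'a::euclidean_space \<Rightarrow> complex"
  assumes "continuous_on UNIV f"
  shows "(LINT z|lebesgue. f (c + z)) = (LINT z|lebesgue. f z)"
proof -
  have m: "f \<in> borel_measurable borel" using assms by (rule borel_measurable_continuous_onI)
  have m': "(\<lambda>z. f (c + z)) \<in> borel_measurable borel"
    by (intro borel_measurable_continuous_onI continuous_on_compose2[OF assms]) (auto intro: continuous_intros)
  have "(LINT z|lebesgue. f (c + z)) = (LINT z|lborel. f (c + z))"
    by (rule integral_completion) (use m' in simp)
  also have "\<dots> = (LINT z|distr lborel borel ((+) c). f z)"
    by (subst integral_distr) (use m in auto)
  also have "\<dots> = (LINT z|lborel. f z)" by (simp add: lborel_distr_plus)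
  also have "\<dots> = (LINT z|lebesgue. f z)" by (rule integral_completion[symmetric]) (use m in simp)
  finally show ?thesis .
qed

lemma test_function_frechet_derivative_outside:
  assumes "z \<notin> closure {z. \<theta> z \<noteq> (0::complex)}"
  shows "frechet_derivative \<theta> (at z) v = 0"
proof -
  have "(\<theta> has_derivative (\<lambda>v. 0)) (at z)"
    by (rule has_derivative_transform_within_open[of "\<lambda>_. 0" _ _ UNIV "- closure {z. \<theta> z \<noteq> 0}"])
      (use assms closure_subset[of "{z. \<theta> z \<noteq> 0}"] in auto)
  from frechet_derivative_at[OF this] show ?thesis by metis
qed

lemma test_function_frechet_derivative_continuous:
  "test_function D \<theta> \<Longrightarrow> continuous_on UNIV (\<lambda>z. frechet_derivative \<theta> (at z) v)"
  by (rule smooth_on_imp_continuous_on[OF smooth_on_frechet_derivative[OF test_function_smooth]])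

lemma test_function_frechet_derivative_integrable:
  "test_function D \<theta> \<Longrightarrow> integrable lebesgue (\<lambda>z. frechet_derivative \<theta> (at z) v)"
  by (rule integrable_continuous_compact[OF test_function_frechet_derivative_continuous test_function_compact])
    (auto intro: test_function_frechet_derivative_outside)

text \<open>Difference quotients of \<theta> integrate to 0 by translation invariance. They are
  bounded by the maximum of the derivative and vanish off a fixed ball, so dominated convergence
  passes the value 0 to the derivative.\<close>

lemma integral_frechet_derivative_test_function:
  assumes "test_function D \<theta>"
  shows "(LINT z|lebesgue. frechet_derivative \<theta> (at z) v) = 0"
proof -
  let ?D = "\<lambda>z. frechet_derivative \<theta> (at z) v"
  let ?C = "closure {z. \<theta> z \<noteq> 0}"
  have sm: "smooth_on UNIV \<theta>" by (rule test_function_smooth[OF assms])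
  have hd: "(\<theta> has_derivative frechet_derivative \<theta> (at z)) (at z)" for z
    by (rule smooth_on_has_derivative[OF sm UNIV_I])
  have cont: "continuous_on UNIV ?D" by (rule smooth_on_imp_continuous_on[OF smooth_on_frechet_derivative[OF sm]])
  have zero: "?D z = 0" if "z \<notin> ?C" for z
    by (rule test_function_frechet_derivative_outside[OF that])
  have "compact (?D ` ?C)"
    by (rule compact_continuous_image[OF continuous_on_subset[OF cont] test_function_compact[OF assms]]) simp
  then obtain B where B: "B > 0" "\<And>y. y \<in> ?D ` ?C \<Longrightarrow> norm y \<le> B"
    using compact_imp_bounded[of "?D ` ?C"] unfolding bounded_pos by metis
  have Dle: "norm (?D z) \<le> B" for z using B zero[of z] by (cases "z \<in> ?C") auto
  define q where "q n z = of_nat (Suc n) * (\<theta> (inverse (real (Suc n)) *\<^sub>R v + z) - \<theta> z)" for n z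
  have line: "((\<lambda>s. \<theta> (z + s *\<^sub>R v)) has_vector_derivative ?D (z + s *\<^sub>R v)) (at s)" for z s
  proof -
    have "((\<lambda>s. z + s *\<^sub>R v) has_derivative (\<lambda>t. t *\<^sub>R v)) (at s)"
      by (auto intro!: derivative_eq_intros)
    from has_derivative_compose[OF this hd]
    show ?thesis
      by (simp add: has_vector_derivative_def linear_cmul[OF has_derivative_linear[OF hd]])
  qed
  have qle: "norm (q n z) \<le> B" for n z
  proof -
    have "norm (\<theta> (z + inverse (real (Suc n)) *\<^sub>R v) - \<theta> (z + 0 *\<^sub>R v)) \<le> B * norm (inverse (real (Suc n)) - 0)"
    proof (rule differentiable_bound[where f' = "\<lambda>s t. t *\<^sub>R ?D (z + s *\<^sub>R v)" and S = UNIV])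
      show "((\<lambda>s. \<theta> (z + s *\<^sub>R v)) has_derivative (\<lambda>t. t *\<^sub>R ?D (z + s *\<^sub>R v))) (at s within UNIV)" for s
        using line[of z s] by (simp add: has_vector_derivative_def)
      show "onorm (\<lambda>t. t *\<^sub>R ?D (z + s *\<^sub>R v)) \<le> B" for s
        by (rule onorm_le) (use Dle in \<open>auto simp: mult.commute[of B] intro!: mult_left_mono\<close>)
    qed auto
    then have "norm (\<theta> (inverse (real (Suc n)) *\<^sub>R v + z) - \<theta> z) \<le> B * inverse (real (Suc n))"
      by (simp add: add.commute)
    then show ?thesis unfolding q_def norm_mult by (simp add: field_simps del: of_nat_Suc)
  qed
  obtain R where R: "R > 0" "\<And>z. z \<in> ?C \<Longrightarrow> norm z \<le> R"
    using compact_imp_bounded[OF test_function_compact[OF assms]] unfolding bounded_pos by metis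
  \<comment> \<open>Outside this ball neither z nor z + v / (n + 1) meets the support of \<theta>,
    whatever n is.\<close>
  define K where "K = cball (0::complex^'a) (R + norm v)"
  have qzero: "q n z = 0" if "z \<notin> K" for n z
  proof -
    have "norm z > R + norm v" using that by (simp add: K_def)
    moreover have "norm z \<le> norm (inverse (real (Suc n)) *\<^sub>R v + z) + norm (inverse (real (Suc n)) *\<^sub>R v)"
      using norm_triangle_ineq4[of "inverse (real (Suc n)) *\<^sub>R v + z" "inverse (real (Suc n)) *\<^sub>R v"] by simp
    moreover have "norm (inverse (real (Suc n)) *\<^sub>R v) \<le> norm v"
      by (simp add: mult_left_le_one_le field_simps)
    ultimately have "norm z > R" "norm (inverse (real (Suc n)) *\<^sub>R v + z) > R"
      using norm_ge_zero[of v] by linarith+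
    then have "z \<notin> ?C" "inverse (real (Suc n)) *\<^sub>R v + z \<notin> ?C" using R(2) not_le by blast+
    then have "\<theta> z = 0" "\<theta> (inverse (real (Suc n)) *\<^sub>R v + z) = 0"
      using closure_subset[of "{z. \<theta> z \<noteq> 0}"] by blast+
    then show ?thesis by (simp only: q_def)  simp
  qed
  have cq: "continuous_on UNIV (q n)" for n
    unfolding q_def
    by (intro continuous_intros continuous_on_compose2[OF test_function_continuous[OF assms]]) auto
  have "(\<lambda>n. LINT z|lebesgue. q n z) \<longlonglongrightarrow> (LINT z|lebesgue. ?D z)"
  proof (rule integral_dominated_convergence[where w = "\<lambda>z. B * indicat_real K z"])
    have "K \<in> lmeasurable" unfolding K_def by (rule lmeasurable_cball)
    then show "integrable lebesgue (\<lambda>z. B * indicat_real K z)"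
      by (intro integrable_mult_right integrable_indicator_lebesgue)
    show "AE z in lebesgue. (\<lambda>n. q n z) \<longlonglongrightarrow> ?D z"
    proof (rule AE_I2)
      fix z
      let ?h = "\<lambda>n. inverse (real (Suc n))"
      have "(\<lambda>h. norm (\<theta> (z + (0 + h) *\<^sub>R v) - \<theta> (z + 0 *\<^sub>R v) - h *\<^sub>R ?D (z + 0 *\<^sub>R v)) / norm h) \<midarrow>0\<rightarrow> 0"
        using line[of z 0] unfolding has_vector_derivative_def has_derivative_at by blast
      moreover have "filterlim ?h (at 0) sequentially"
        by (rule filterlim_atI[OF LIMSEQ_inverse_real_of_nat]) auto
      ultimately have "(\<lambda>n. norm (\<theta> (z + (0 + ?h n) *\<^sub>R v) - \<theta> (z + 0 *\<^sub>R v) - ?h n *\<^sub>R ?D (z + 0 *\<^sub>R v)) / norm (?h n)) \<longlonglongrightarrow> 0"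
        by (rule filterlim_compose)
      moreover have "norm (\<theta> (z + (0 + ?h n) *\<^sub>R v) - \<theta> (z + 0 *\<^sub>R v) - ?h n *\<^sub>R ?D (z + 0 *\<^sub>R v)) / norm (?h n) = norm (q n z - ?D z)" for n
      proof -
        have "q n z - ?D z = of_nat (Suc n) * (\<theta> (z + (0 + ?h n) *\<^sub>R v) - \<theta> (z + 0 *\<^sub>R v) - ?h n *\<^sub>R ?D (z + 0 *\<^sub>R v))"
          by (simp add: q_def algebra_simps scaleR_conv_of_real of_real_inverse[symmetric] del: of_nat_Suc)
        moreover have "norm (complex_of_nat (Suc n) * X) = norm X / norm (?h n)" for X
          by (simp only: norm_mult norm_of_nat) (simp add: divide_inverse)
        ultimately show ?thesis by (simp only:)
      qed
      ultimately have "(\<lambda>n. norm (q n z - ?D z)) \<longlonglongrightarrow> 0" by simp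
      then show "(\<lambda>n. q n z) \<longlonglongrightarrow> ?D z" by (simp add: tendsto_norm_zero_iff LIM_zero_iff)
    qed
    show "AE z in lebesgue. norm (q n z) \<le> B * indicat_real K z" for n
      using qle qzero by (auto simp: indicator_def)
  qed (auto intro: continuous_on_imp_lebesgue_measurable cont cq)
  moreover have "(LINT z|lebesgue. q n z) = 0" for n
  proof -
    have int: "integrable lebesgue \<theta>"
      by (rule integrable_continuous_compact[OF test_function_continuous test_function_compact, OF assms assms])
        (use closure_subset[of "{z. \<theta> z \<noteq> 0}"] in auto)
    have int': "integrable lebesgue (\<lambda>z. \<theta> (c + z))" for c
    proof (rule integrable_continuous_compact)
      show "continuous_on UNIV (\<lambda>z. \<theta> (c + z))"
        by (intro continuous_on_compose2[OF test_function_continuous[OF assms]] continuous_intros) auto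
      show "compact ((+) (- c) ` ?C)" by (rule compact_translation[OF test_function_compact[OF assms]])
      fix z assume z: "z \<notin> (+) (- c) ` ?C"
      have "c + z \<notin> ?C"
      proof
        assume "c + z \<in> ?C"
        then have "- c + (c + z) \<in> (+) (- c) ` ?C" by (rule imageI)
        with z show False by simp
      qed
      then show "\<theta> (c + z) = 0" using closure_subset[of "{z. \<theta> z \<noteq> 0}"] by blast
    qed
    have "(LINT z|lebesgue. \<theta> (inverse (real (Suc n)) *\<^sub>R v + z) - \<theta> z) = 0"
      using integral_translate_lebesgue[OF test_function_continuous[OF assms]]
      by (subst Bochner_Integration.integral_diff[OF int' int]) simp
    then show ?thesis unfolding q_def by simp
  qed
  ultimately show ?thesis by (simp add: LIMSEQ_const_iff)
qed

lemma d_zbar_by_parts: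
  assumes "test_function D \<theta>" "test_function D' \<theta>'"
  shows "(LINT z|lebesgue. d_zbar j \<theta> z * \<theta>' z) = - (LINT z|lebesgue. \<theta> z * d_zbar j \<theta>' z)"
proof -
  note sm = test_function_smooth[OF assms(1)] test_function_smooth[OF assms(2)]
  have t: "test_function UNIV (\<lambda>z. \<theta> z * \<theta>' z)"
  proof (rule test_function_mult)
    show "test_function UNIV \<theta>'" using assms(2) by (simp add: test_function_def)
  qed (auto simp: sm)
  let ?D = "\<lambda>v z. frechet_derivative (\<lambda>z. \<theta> z * \<theta>' z) (at z) v"
  have tD: "integrable lebesgue (?D v)" for v
    by (rule test_function_frechet_derivative_integrable[OF t])
  have "(LINT z|lebesgue. d_zbar j (\<lambda>z. \<theta> z * \<theta>' z) z) = ((LINT z|lebesgue. ?D (axis j 1) z) + \<i> * (LINT z|lebesgue. ?D (axis j \<i>) z)) / 2"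
    unfolding d_zbar_def using tD by simp
  also have "\<dots> = 0" by (simp add: integral_frechet_derivative_test_function[OF t])
  finally have 0: "(LINT z|lebesgue. d_zbar j (\<lambda>z. \<theta> z * \<theta>' z) z) = 0" .
  have "(LINT z|lebesgue. d_zbar j (\<lambda>z. \<theta> z * \<theta>' z) z) = (LINT z|lebesgue. \<theta> z * d_zbar j \<theta>' z + d_zbar j \<theta> z * \<theta>' z)"
    by (intro Bochner_Integration.integral_cong refl d_zbar_mult smooth_on_differentiable[OF sm(1)] smooth_on_differentiable[OF sm(2)] UNIV_I)
  also have "\<dots> = (LINT z|lebesgue. \<theta> z * d_zbar j \<theta>' z) + (LINT z|lebesgue. d_zbar j \<theta> z * \<theta>' z)"
    by (intro Bochner_Integration.integral_add integrable_sqint_mult test_function_sqint[OF assms(1)] test_function_sqint[OF assms(2)]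
        test_function_sqint[OF test_function_d_zbar[OF assms(1)]] test_function_sqint[OF test_function_d_zbar[OF assms(2)]])
  finally show ?thesis using 0 by (simp add: add_eq_0_iff)
qed

section \<open>Functions that pair to zero with all bumps\<close>

lemma bmeas_compact_indicator: "compact K \<Longrightarrow> bmeas (indicator K)"
  by (rule bmeas_indicator) (simp add: lmeasurable_compact fmeasurableD)

lemma sqint_indicator_mult:
  assumes "continuous_on UNIV g" "compact K"
  shows "sqint (\<lambda>z. indicator K z * g z)"
proof -
  have "compact (g ` K)"
    by (rule compact_continuous_image[OF continuous_on_subset[OF assms(1)] assms(2)]) simp
  then obtain B where B: "B > 0" "\<And>y. y \<in> g ` K \<Longrightarrow> norm y \<le> B"
    using compact_imp_bounded[of "g ` K"] unfolding bounded_pos by metis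
  have KL: "K \<in> lmeasurable" by (rule lmeasurable_compact[OF assms(2)])
  show ?thesis
  proof (rule sqint_bound)
    show "(\<lambda>z. indicator K z * g z) \<in> borel_measurable lebesgue"
      using KL by (intro borel_measurable_times continuous_on_imp_lebesgue_measurable[OF assms(1)]) (auto simp: fmeasurableD)
    show "integrable lebesgue (\<lambda>z. B\<^sup>2 * indicat_real K z)"
      by (intro integrable_mult_right integrable_indicator_lebesgue KL)
    show "AE z in lebesgue. (cmod (indicator K z * g z))\<^sup>2 \<le> B\<^sup>2 * indicat_real K z"
      using B by (auto simp: indicator_def intro!: AE_I2 power_mono)
  qed
qed

lemma sqint_indicator: "compact K \<Longrightarrow> sqint (indicator K)"
  using sqint_indicator_mult[of "\<lambda>_. 1" K] by (simp add: continuous_on_const)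

lemma box_integral_zero:
  fixes u :: "'a::euclidean_space lsq"
  assumes "\<And>m. pr u (box_bump a c m) = 0" "\<And>b. b \<in> Basis \<Longrightarrow> a \<bullet> b \<le> c \<bullet> b"
  shows "(LINT z|lebesgue. rep_lsq u z * indicator (box a c) z) = 0"
proof -
  have "(\<lambda>m. pr u (box_bump a c m)) \<longlonglongrightarrow> (LINT z|lebesgue. rep_lsq u z * indicator (box a c) z)"
    unfolding pr_def
  proof (rule integral_dominated_convergence[where w = "\<lambda>z. cmod (rep_lsq u z * indicator (cbox a c) z)"])
    show "integrable lebesgue (\<lambda>z. cmod (rep_lsq u z * indicator (cbox a c) z))"
      by (intro integrable_norm integrable_sqint_mult sqint_rep sqint_indicator compact_cbox)
    show "AE z in lebesgue. (\<lambda>m. rep_lsq u z * box_bump a c m z) \<longlonglongrightarrow> rep_lsq u z * indicator (box a c) z"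
      by (intro AE_I2 tendsto_mult tendsto_const box_bump_tendsto assms(2))
    have le: "norm (box_bump a c m z) \<le> indicat_real (cbox a c) z" for m z
      using norm_box_bump_le[of a c m z] box_bump_nonzero_iff[OF assms(2), of m z] box_subset_cbox[of a c]
      by (cases "box_bump a c m z = 0") (auto simp: indicator_def)
    show "AE z in lebesgue. norm (rep_lsq u z * box_bump a c m z) \<le> cmod (rep_lsq u z * indicator (cbox a c) z)" for m
    proof (rule AE_I2)
      fix z
      have "cmod (indicator (cbox a c) z) = indicat_real (cbox a c) z" by (simp add: indicator_def)
      then show "norm (rep_lsq u z * box_bump a c m z) \<le> cmod (rep_lsq u z * indicator (cbox a c) z)"
        unfolding norm_mult using le[of m z] by (simp only: mult_left_mono norm_ge_zero)
    qed
    show "(\<lambda>z. rep_lsq u z * indicator (box a c) z) \<in> borel_measurable lebesgue"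
      by (intro borel_measurable_times borel_measurable_indicator measurable_rep) simp
    show "(\<lambda>z. rep_lsq u z * box_bump a c m z) \<in> borel_measurable lebesgue" for m
      by (intro borel_measurable_times measurable_rep continuous_on_imp_lebesgue_measurable
          smooth_on_imp_continuous_on smooth_on_box_bump)
  qed
  then show ?thesis using assms(1) by (simp add: LIMSEQ_const_iff)
qed

lemma sigma_finite_lebesgue: "sigma_finite_measure (lebesgue :: 'a::euclidean_space measure)"
proof
  let ?A = "range (\<lambda>n::nat. cball (0::'a) (real n))"
  have "(\<Union>n::nat. cball (0::'a) (real n)) = UNIV"
    using real_arch_simple by (auto simp: mem_cball)
  moreover have "emeasure lebesgue (cball (0::'a) r) \<noteq> \<infinity>" for r
    using lmeasurable_cball[of "0::'a" r] by (auto simp: fmeasurable_def)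
  ultimately show "\<exists>A. countable A \<and> A \<subseteq> sets lebesgue \<and> \<Union> A = space (lebesgue :: 'a measure) \<and>
      (\<forall>a\<in>A. emeasure lebesgue a \<noteq> \<infinity>)"
    by (intro exI[of _ ?A]) auto
qed

text \<open>Boxes form an intersection-stable generator of the Borel sets, so the integral of f
  vanishes over every Borel set, then over every Lebesgue set, which is a Borel set up to a
  negligible one. A function all of whose set integrals are 0 vanishes almost everywhere.\<close>

lemma AE_zero_on_open_box:
  fixes u :: "'a::euclidean_space lsq"
  assumes Z: "\<And>a c. cbox a c \<subseteq> \<Omega> \<Longrightarrow> (LINT z|lebesgue. rep_lsq u z * indicator (box a c) z) = 0"
    and pq: "cbox p q \<subseteq> \<Omega>"
  shows "AE z in lebesgue. z \<in> box p q \<longrightarrow> rep_lsq u z = 0"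
proof -
  define f where "f z = rep_lsq u z * indicator (box p q) z" for z
  have int: "integrable lebesgue f"
  proof -
    have "sqint (\<lambda>z. indicator (box p q) z :: complex)"
    proof (rule sqint_bound)
      show "integrable lebesgue (indicat_real (cbox p q))" by (intro integrable_indicator_lebesgue lmeasurable_cbox)
      show "AE z in lebesgue. (cmod (indicator (box p q) z))\<^sup>2 \<le> indicat_real (cbox p q) z"
        using box_subset_cbox[of p q] by (auto simp: indicator_def)
      show "indicator (box p q) \<in> borel_measurable lebesgue" by (intro borel_measurable_indicator) simp
    qed
    then show ?thesis unfolding f_def by (intro integrable_sqint_mult sqint_rep)
  qed
  have borel: "(LINT z:A|lebesgue. f z) = 0" if "A \<in> sets borel" for A
  proof -
    have eq: "sets (borel :: 'a measure) = sigma_sets UNIV (range (\<lambda>(a, b). box a b))"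
      by (subst borel_eq_box) simp
    have A: "A \<in> sigma_sets UNIV (range (\<lambda>(a, b). box a b))" using that unfolding eq .
    have sub: "sigma_sets UNIV (range (\<lambda>(a, b). box a b)) \<subseteq> sets (lebesgue :: 'a measure)"
      unfolding eq[symmetric] by (auto intro: sets_completionI_sets)
    have "Int_stable (range (\<lambda>(a, b). box a (b :: 'a)))"
      by (auto simp: Int_stable_def box_Int_box)
    moreover have "range (\<lambda>(a, b). box a (b :: 'a)) \<subseteq> Pow UNIV" by simp
    ultimately show ?thesis using A
    proof (induction rule: sigma_sets_induct_disjoint)
      case (basic B)
      then obtain a c where B: "B = box a c" by auto
      \<comment> \<open>The intersection of two open boxes is an open box, and if it is nonempty its
        closure stays in \<open>cbox p q\<close>, so that \<open>Z\<close> applies.\<close>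
      obtain a' c' where ac: "box a c \<inter> box p q = box a' c'" by (simp add: box_Int_box)
      have "(LINT z|lebesgue. rep_lsq u z * indicator (box a' c') z) = 0"
      proof (cases "box a' c' = {}")
        case False
        have "closure (box a' c') \<subseteq> closure (box p q)" by (rule closure_mono) (use ac in blast)
        moreover have "box p q \<noteq> {}" using ac False by blast
        ultimately have "cbox a' c' \<subseteq> cbox p q"
          using closure_box[OF False] closure_box[of p q] by simp
        then show ?thesis using pq by (intro Z) blast
      qed simp
      also have "(LINT z|lebesgue. rep_lsq u z * indicator (box a' c') z) = (LINT z:B|lebesgue. f z)"
        unfolding set_lebesgue_integral_def f_def B ac[symmetric]
        by (intro Bochner_Integration.integral_cong) (auto simp: indicator_def)
      finally show ?case .
    next
      case empty
      then show ?case by (simp add: set_lebesgue_integral_def)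
    next
      case (compl B)
      have B: "B \<in> sets lebesgue" using compl sub by blast
      have all: "(LINT z|lebesgue. f z) = 0" unfolding f_def by (rule Z[OF pq])
      have "(LINT z:UNIV - B|lebesgue. f z) = (LINT z|lebesgue. f z - indicator B z *\<^sub>R f z)"
        unfolding set_lebesgue_integral_def by (intro Bochner_Integration.integral_cong) (auto simp: indicator_def)
      also have "\<dots> = (LINT z|lebesgue. f z) - (LINT z:B|lebesgue. f z)"
        unfolding set_lebesgue_integral_def
        by (intro Bochner_Integration.integral_diff int integrable_mult_indicator B)
      finally show ?case using compl all by simp
    next
      case (union A)
      have m: "A i \<in> sets lebesgue" for i using union sub by blast
      have "set_integrable lebesgue (\<Union>i. A i) f"
        unfolding set_integrable_def using m by (intro integrable_mult_indicator int) auto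
      then have "(LINT z:(\<Union>i. A i)|lebesgue. f z) = (\<Sum>i. (LINT z:(A i)|lebesgue. f z))"
        using union m by (intro lebesgue_integral_countable_add) (auto simp: disjoint_family_on_def)
      then show ?case using union by simp
    qed
  qed
  have leb: "(LINT z:A|lebesgue. f z) = 0" if A: "A \<in> sets lebesgue" for A
  proof -
    obtain B N where BN: "B \<in> sets borel" "negligible N" "B \<union> N = A"
      using sets_lebesgue_almost_borel[OF A] by blast
    have N: "AE z in lebesgue. z \<notin> N"
      using BN(2) by (simp add: negligible_iff_null_sets AE_not_in)
    have Bl: "B \<in> sets lebesgue" using BN(1) by simp
    have "(LINT z:A|lebesgue. f z) = (LINT z:B|lebesgue. f z)"
      unfolding set_lebesgue_integral_def
    proof (rule integral_cong_AE)
      show "AE z in lebesgue. indicator A z *\<^sub>R f z = indicator B z *\<^sub>R f z"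
        using N by eventually_elim (use BN(3) in \<open>auto simp: indicator_def\<close>)
    qed (use int A Bl in auto)
    then show ?thesis using borel[OF BN(1)] by simp
  qed
  have "AE z in lebesgue. f z = 0"
    by (rule sigma_finite_measure.density_zero[OF sigma_finite_lebesgue int leb])
  then show ?thesis by eventually_elim (auto simp: f_def)
qed

text \<open>The fundamental lemma of the calculus of variations, with box bumps as the only test
  functions. By Lindelof countably many boxes cover the open set, so the exceptional null sets can
  be united.\<close>

theorem AE_zero_of_bump_integrals:
  fixes u :: "'a::euclidean_space lsq"
  assumes "open \<Omega>"
    and "\<And>a c m. (\<And>b. b \<in> Basis \<Longrightarrow> a \<bullet> b \<le> c \<bullet> b) \<Longrightarrow> cbox a c \<subseteq> \<Omega> \<Longrightarrow> pr u (box_bump a c m) = 0"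
  shows "AE z in lebesgue. z \<in> \<Omega> \<longrightarrow> rep_lsq u z = 0"
proof -
  have Z: "(LINT z|lebesgue. rep_lsq u z * indicator (box a c) z) = 0" if "cbox a c \<subseteq> \<Omega>" for a c
  proof (cases "box a c = {}")
    case False
    then have le: "\<And>b. b \<in> Basis \<Longrightarrow> a \<bullet> b \<le> c \<bullet> b" by (auto simp: box_ne_empty intro: less_imp_le)
    show ?thesis by (rule box_integral_zero[OF assms(2)[OF le that] le])
  qed simp
  define F where "F = {box p q | p q. cbox p q \<subseteq> \<Omega>}"
  obtain F' where F': "F' \<subseteq> F" "countable F'" "\<Union>F' = \<Union>F"
    by (rule Lindelof[of F]) (auto simp: F_def)
  have cov: "\<Omega> \<subseteq> \<Union>F"
  proof
    fix x assume "x \<in> \<Omega>"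
    obtain a c where "cbox a c \<subseteq> \<Omega>" "x \<in> box a c" "\<forall>b\<in>Basis. a \<bullet> b < c \<bullet> b"
      by (rule open_contains_cbox[OF assms(1) \<open>x \<in> \<Omega>\<close>])
    then show "x \<in> \<Union>F" unfolding F_def by blast
  qed
  have "AE z in lebesgue. \<forall>B\<in>F'. z \<in> B \<longrightarrow> rep_lsq u z = 0"
  proof (rule AE_ball_countable[THEN iffD2, OF F'(2)], rule ballI)
    fix B assume "B \<in> F'"
    then obtain p q where "B = box p q" "cbox p q \<subseteq> \<Omega>" using F'(1) by (auto simp: F_def)
    then show "AE z in lebesgue. z \<in> B \<longrightarrow> rep_lsq u z = 0"
      using AE_zero_on_open_box[OF Z, of \<Omega> p q] by simp
  qed
  then show ?thesis by eventually_elim (use cov F'(3) in blast)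
qed

section \<open>Product integrals and trigonometric polynomials\<close>

lemma integral_prod_Basis:
  fixes g :: "'a::euclidean_space \<Rightarrow> real \<Rightarrow> complex"
  assumes "\<And>b. b \<in> Basis \<Longrightarrow> integrable lborel (g b)"
  shows "(LINT z|lborel. (\<Prod>b\<in>Basis. g b (z \<bullet> b))) = (\<Prod>b\<in>Basis. LINT x|lborel. g b x)"
proof -
  interpret product_sigma_finite "\<lambda>_::'a. lborel :: real measure" by standard
  have [measurable]: "b \<in> Basis \<Longrightarrow> g b \<in> borel_measurable borel" for b
    using assms[of b] by (auto dest: borel_measurable_integrable)
  have "(LINT z|lborel. (\<Prod>b\<in>(Basis::'a set). g b (z \<bullet> b)))
    = (LINT f|(\<Pi>\<^sub>M b\<in>Basis. lborel). (\<Prod>b\<in>Basis. g b ((\<Sum>b\<in>Basis. f b *\<^sub>R b) \<bullet> b)))"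
    by (subst lborel_eq, subst integral_distr) auto
  also have "\<dots> = (LINT f|(\<Pi>\<^sub>M b\<in>Basis. lborel). (\<Prod>b\<in>(Basis::'a set). g b (f b)))"
    by (intro Bochner_Integration.integral_cong refl prod.cong) simp_all
  also have "\<dots> = (\<Prod>b\<in>(Basis::'a set). LINT x|lborel. g b x)"
    by (rule product_integral_prod) (auto intro: assms)
  finally show ?thesis .
qed

text \<open>Trigonometric polynomials of period 2 pi / \<kappa>. The inductive form allows closure
  under products, and later the vanishing of pairings, to be shown by rule induction.\<close>

inductive trig_poly :: "real \<Rightarrow> (real \<Rightarrow> complex) \<Rightarrow> bool" for \<kappa> where
  trig_base: "trig_poly \<kappa> (\<lambda>x. c * cis (\<kappa> * of_int m * x))"
| trig_add: "trig_poly \<kappa> s \<Longrightarrow> trig_poly \<kappa> t \<Longrightarrow> trig_poly \<kappa> (\<lambda>x. s x + t x)"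

lemma trig_poly_const: "trig_poly \<kappa> (\<lambda>x. c)"
  using trig_base[of \<kappa> c 0] by simp

lemma trig_poly_base_mult:
  assumes "trig_poly \<kappa> t" shows "trig_poly \<kappa> (\<lambda>x. (c * cis (\<kappa> * of_int m * x)) * t x)"
  using assms
proof induction
  case (trig_base d n)
  have "(c * cis (\<kappa> * of_int m * x)) * (d * cis (\<kappa> * of_int n * x)) = (c * d) * cis (\<kappa> * of_int (m + n) * x)" for x
    by (simp add: cis_mult algebra_simps)
  then show ?case using trig_poly.trig_base[of \<kappa> "c * d" "m + n"] by (simp only:)
next
  case (trig_add s t)
  show ?case using trig_poly.trig_add[OF trig_add.IH] by (simp add: algebra_simps)
qed

lemma trig_poly_mult:
  assumes "trig_poly \<kappa> s" "trig_poly \<kappa> t" shows "trig_poly \<kappa> (\<lambda>x. s x * t x)"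
  using assms(1)
proof induction
  case (trig_base c m)
  show ?case by (rule trig_poly_base_mult[OF assms(2)])
next
  case (trig_add s s')
  show ?case using trig_poly.trig_add[OF trig_add.IH] by (simp add: algebra_simps)
qed

text \<open>On the unit circle Re w and Im w are trigonometric by Euler's formulas. This connects
  Stone-Weierstrass on the circle, which delivers real polynomials, with exponentials.\<close>

lemma trig_poly_real_polynomial:
  fixes p :: "complex \<Rightarrow> real"
  assumes "real_polynomial_function p"
  shows "trig_poly \<kappa> (\<lambda>x. of_real (p (cis (\<kappa> * x))))"
  using assms
proof induction
  case (linear f)
  have "of_real (f (cis (\<kappa> * x))) = ((f 1 - \<i> * f \<i>) / 2) * cis (\<kappa> * of_int 1 * x) + ((f 1 + \<i> * f \<i>) / 2) * cis (\<kappa> * of_int (-1) * x)" for x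
  proof -
    have "cis (\<kappa> * x) = cos (\<kappa> * x) *\<^sub>R 1 + sin (\<kappa> * x) *\<^sub>R \<i>" by (simp add: complex_eq_iff)
    then have "f (cis (\<kappa> * x)) = cos (\<kappa> * x) * f 1 + sin (\<kappa> * x) * f \<i>"
      using linear by (simp add: bounded_linear.linear linear_add linear_cmul)
    then show ?thesis by (simp add: complex_eq_iff field_simps)
  qed
  then show ?case
    using trig_add[OF trig_base[of \<kappa> "(f 1 - \<i> * f \<i>) / 2" 1] trig_base[of \<kappa> "(f 1 + \<i> * f \<i>) / 2" "-1"]]
    by (simp only:)
next
  case (const c)
  then show ?case by (simp add: trig_poly_const)
next
  case (add f g)
  then show ?case using trig_add[OF add.IH] by simp
next
  case (mult f g)
  then show ?case using trig_poly_mult[OF mult.IH] by simp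
qed

text \<open>Since \<alpha> vanishes near both ends of the period interval, it descends to a
  continuous function \<Theta> on the unit circle, to which Stone-Weierstrass applies.\<close>

lemma trig_poly_approximation:
  fixes \<alpha> :: "real \<Rightarrow> real"
  assumes \<kappa>: "\<kappa> > 0" and cont: "continuous_on UNIV \<alpha>" and r: "0 \<le> r" "\<kappa> * r < pi"
    and zero: "\<And>x. \<bar>x\<bar> \<ge> r \<Longrightarrow> \<alpha> x = 0" and e: "e > 0"
  obtains t where "trig_poly \<kappa> t" "\<And>x. \<kappa> * \<bar>x\<bar> \<le> pi \<Longrightarrow> norm (of_real (\<alpha> x) - t x) < e"
proof -
  define \<Theta> where "\<Theta> w = \<alpha> (Arg w / \<kappa>)" for w
  \<comment> \<open>Two closed arcs cover the circle. The arc \<open>?A\<close> avoids -1, so the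
    argument is continuous on it; on \<open>?B\<close> the argument has modulus at least \<kappa> r,
    so \<Theta> is 0 there.\<close>
  let ?A = "{w \<in> sphere (0::complex) 1. cos (\<kappa> * r) \<le> Re w}"
  let ?B = "{w \<in> sphere (0::complex) 1. Re w \<le> cos (\<kappa> * r)}"
  have cosr: "cos (\<kappa> * r) > -1"
  proof -
    have "cos pi < cos (\<kappa> * r)" using r \<kappa> by (intro cos_monotone_0_pi) auto
    then show ?thesis by simp
  qed
  have "?A = sphere 0 1 \<inter> {w. cos (\<kappa> * r) \<le> Re w}" "?B = sphere 0 1 \<inter> {w. Re w \<le> cos (\<kappa> * r)}" by auto
  then have cA: "closed ?A" and cB: "closed ?B"
    by (simp_all add: closed_Int closed_Collect_le continuous_on_Re continuous_on_id)
  have "continuous_on ?A \<Theta>"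
    unfolding \<Theta>_def
  proof (rule continuous_on_compose2[OF cont])
    have "w \<notin> \<real>\<^sub>\<le>\<^sub>0" if "w \<in> ?A" for w
    proof
      assume "w \<in> \<real>\<^sub>\<le>\<^sub>0"
      then have "Im w = 0" "Re w \<le> 0" by (auto simp: complex_nonpos_Reals_iff)
      moreover have "norm w = 1" using that by simp
      ultimately have "Re w = -1" by (auto simp: cmod_def)
      then show False using that cosr by simp
    qed
    then show "continuous_on ?A (\<lambda>w. Arg w / \<kappa>)"
      by (intro continuous_on_divide continuous_at_imp_continuous_on ballI continuous_at_Arg continuous_on_const) (use \<kappa> in auto)
  qed auto
  moreover have "continuous_on ?B \<Theta>"
  proof -
    have "\<Theta> w = 0" if "w \<in> ?B" for w
    proof -
      have n1: "norm w = 1" using that by simp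
      then have "w \<noteq> 0" by auto
      from cis_Arg[OF this] n1 have "cis (Arg w) = w" by (simp add: sgn_div_norm)
      from arg_cong[OF this, of Re] have "cos (Arg w) = Re w" by simp
      then have le: "cos \<bar>Arg w\<bar> \<le> cos (\<kappa> * r)" using that by simp
      have "\<kappa> * r \<le> \<bar>Arg w\<bar>"
      proof (rule ccontr)
        assume "\<not> \<kappa> * r \<le> \<bar>Arg w\<bar>"
        then have "cos (\<kappa> * r) < cos \<bar>Arg w\<bar>" using r by (intro cos_monotone_0_pi) auto
        with le show False by linarith
      qed
      then have "\<bar>Arg w / \<kappa>\<bar> \<ge> r" using \<kappa> by (simp add: field_simps)
      then show ?thesis unfolding \<Theta>_def by (rule zero)
    qed
    then show ?thesis by (subst continuous_on_cong[OF refl, of _ _ "\<lambda>_. 0"]) auto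
  qed
  ultimately have "continuous_on (?A \<union> ?B) \<Theta>" by (rule continuous_on_closed_Un[OF cA cB])
  moreover have "?A \<union> ?B = sphere 0 1" by auto
  ultimately have "continuous_on (sphere 0 1) \<Theta>" by simp
  from Stone_Weierstrass_real_polynomial_function[OF compact_sphere this e]
  obtain p where p: "real_polynomial_function p" "\<And>w. w \<in> sphere 0 1 \<Longrightarrow> \<bar>\<Theta> w - p w\<bar> < e" by blast
  show thesis
  proof (rule that[OF trig_poly_real_polynomial[OF p(1)]])
    fix x assume x: "\<kappa> * \<bar>x\<bar> \<le> pi"
    have "\<Theta> (cis (\<kappa> * x)) = \<alpha> x"
    \<comment> \<open>At the left end the principal argument is pi instead of - pi; \<alpha>
      vanishes at both ends, so the identity persists.\<close>
    proof (cases "\<kappa> * x = - pi")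
      case True
      have "x = - (pi / \<kappa>)" using True \<kappa> by (simp add: field_simps)
      then have "\<bar>x\<bar> = pi / \<kappa>" using \<kappa> by simp
      moreover have "pi / \<kappa> \<ge> r" using r \<kappa> by (simp add: field_simps less_imp_le)
      moreover have "\<bar>Arg (cis (\<kappa> * x)) / \<kappa>\<bar> = pi / \<kappa>"
      proof -
        have "cis (\<kappa> * x) = cis pi" unfolding True by (simp add: complex_eq_iff)
        moreover have "Arg (cis pi) = pi" by (rule Arg_cis) simp
        ultimately show ?thesis using \<kappa> by simp
      qed
      ultimately show ?thesis unfolding \<Theta>_def using zero by simp
    next
      case False
      have "\<bar>\<kappa> * x\<bar> \<le> pi" using x \<kappa> by (simp add: abs_mult)
      then have "\<kappa> * x \<in> {-pi<..pi}" using False by auto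
      then have "Arg (cis (\<kappa> * x)) = \<kappa> * x" by (simp add: Arg_cis)
      then show ?thesis using \<kappa> by (simp add: \<Theta>_def)
    qed
    moreover have "\<bar>\<Theta> (cis (\<kappa> * x)) - p (cis (\<kappa> * x))\<bar> < e" by (rule p(2)) simp
    ultimately show "norm (of_real (\<alpha> x) - complex_of_real (p (cis (\<kappa> * x)))) < e"
      by (simp flip: of_real_diff)
  qed
qed

section \<open>Fourier series and Rellich compactness on a cube\<close>

lemma orthonormal_residual:
  fixes e :: "'i \<Rightarrow> 'h::real_inner" and u :: 'h
  assumes "finite F" "\<And>i j. i \<in> F \<Longrightarrow> j \<in> F \<Longrightarrow> e i \<bullet> e j = (if i = j then 1 else 0)"
  defines "s \<equiv> \<Sum>i\<in>F. (u \<bullet> e i) *\<^sub>R e i"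
  shows "i \<in> F \<Longrightarrow> (u - s) \<bullet> e i = 0" "(norm (u - s))\<^sup>2 = (norm u)\<^sup>2 - (\<Sum>i\<in>F. (u \<bullet> e i)\<^sup>2)"
proof -
  show orth: "(u - s) \<bullet> e i = 0" if "i \<in> F" for i
  proof -
    have "s \<bullet> e i = (\<Sum>j\<in>F. if j = i then u \<bullet> e i else 0)"
      unfolding s_def inner_sum_left by (intro sum.cong) (use assms(2) that in auto)
    then show ?thesis using that assms(1) by (simp add: inner_diff_left)
  qed
  have us: "(u - s) \<bullet> s = 0" by (subst s_def) (simp add: inner_sum_right orth del: s_def)
  have "s \<bullet> u = (\<Sum>i\<in>F. (u \<bullet> e i)\<^sup>2)"
    unfolding s_def inner_sum_left by (simp add: power2_eq_square inner_commute)
  moreover have "(norm (u - s))\<^sup>2 = u \<bullet> u - s \<bullet> u"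
    using us by (simp add: power2_norm_eq_inner inner_diff_left inner_diff_right inner_commute)
  ultimately show "(norm (u - s))\<^sup>2 = (norm u)\<^sup>2 - (\<Sum>i\<in>F. (u \<bullet> e i)\<^sup>2)"
    by (simp add: power2_norm_eq_inner)
qed

text \<open>The projection s onto finitely many e i is at least as close to u as the given element p
  of their span, and the squared distance from u to s is the defect in Bessel's inequality. A finite
  F with an error term stands in for a convergent series.\<close>

lemma Parseval_approximation:
  fixes e :: "'i \<Rightarrow> 'h::real_inner"
  assumes on: "\<And>i j. i \<in> I \<Longrightarrow> j \<in> I \<Longrightarrow> e i \<bullet> e j = (if i = j then 1 else 0)"
    and u: "u \<in> closure (span (e ` I))" and \<epsilon>: "\<epsilon> > 0"
  obtains F where "finite F" "F \<subseteq> I" "(norm u)\<^sup>2 \<le> (\<Sum>i\<in>F. (u \<bullet> e i)\<^sup>2) + \<epsilon>"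
proof -
  obtain p where p: "p \<in> span (e ` I)" "dist p u < sqrt \<epsilon>"
    using u \<epsilon> unfolding closure_approachable by (meson real_sqrt_gt_zero)
  obtain S r where S: "finite S" "S \<subseteq> e ` I" "p = (\<Sum>a\<in>S. r a *\<^sub>R a)"
    using p(1) unfolding span_explicit by blast
  obtain F where F: "F \<subseteq> I" "finite F" "S = e ` F"
    using finite_subset_image[OF S(1,2)] by blast
  define s where "s = (\<Sum>i\<in>F. (u \<bullet> e i) *\<^sub>R e i)"
  have onF: "e i \<bullet> e j = (if i = j then 1 else 0)" if "i \<in> F" "j \<in> F" for i j using on F that by blast
  have orth: "(u - s) \<bullet> e i = 0" if "i \<in> F" for i
    unfolding s_def by (rule orthonormal_residual(1)[OF F(2) onF that])
  have "(u - s) \<bullet> p = 0" unfolding S(3) inner_sum_right F(3) by (intro sum.neutral) (auto simp: orth)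
  moreover have "(u - s) \<bullet> s = 0"
  proof -
    have "(u - s) \<bullet> (\<Sum>i\<in>F. c i *\<^sub>R e i) = 0" for c unfolding inner_sum_right by (simp add: orth)
    from this[of "\<lambda>i. u \<bullet> e i"] show ?thesis by (fold s_def)
  qed
  ultimately have o: "(u - s) \<bullet> (s - p) = 0" by (simp add: inner_diff_right)
  have "(norm (u - p))\<^sup>2 = (norm (u - s))\<^sup>2 + (norm (s - p))\<^sup>2"
  proof -
    have "u - p = (u - s) + (s - p)" by simp
    then show ?thesis using o by (simp only: power2_norm_eq_inner inner_add_left inner_add_right) (simp add: inner_commute)
  qed
  then have "(norm (u - s))\<^sup>2 \<le> (norm (u - p))\<^sup>2" by simp
  also have "\<dots> \<le> (sqrt \<epsilon>)\<^sup>2" using p(2) by (intro power_mono) (auto simp: dist_norm norm_minus_commute)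
  finally have "(norm (u - s))\<^sup>2 \<le> \<epsilon>" using \<epsilon> by simp
  moreover have "(norm (u - s))\<^sup>2 = (norm u)\<^sup>2 - (\<Sum>i\<in>F. (u \<bullet> e i)\<^sup>2)"
    unfolding s_def by (rule orthonormal_residual(2)[OF F(2) onF])
  ultimately have "(norm u)\<^sup>2 \<le> (\<Sum>i\<in>F. (u \<bullet> e i)\<^sup>2) + \<epsilon>" by linarith
  then show thesis by (rule that[OF F(2,1)])
qed

section \<open>Characters of a cube and their completeness\<close>

definition cube :: "real \<Rightarrow> 'a::euclidean_space set" where
  "cube \<kappa> = cbox (- (pi / \<kappa>) *\<^sub>R One) ((pi / \<kappa>) *\<^sub>R One)"

definition char_fn :: "real \<Rightarrow> ('a::euclidean_space \<Rightarrow> int) \<Rightarrow> 'a \<Rightarrow> complex" where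
  "char_fn \<kappa> k z = (\<Prod>b\<in>Basis. cis (\<kappa> * of_int (k b) * (z \<bullet> b)))"

definition cube_char :: "real \<Rightarrow> ('a::euclidean_space \<Rightarrow> int) \<Rightarrow> 'a \<Rightarrow> complex" where
  "cube_char \<kappa> k z = indicator (cube \<kappa>) z * char_fn \<kappa> k z"

definition cube_vol :: "'a::euclidean_space itself \<Rightarrow> real \<Rightarrow> real" where
  "cube_vol _ \<kappa> = (2 * pi / \<kappa>) ^ DIM('a)"

text \<open>\<open>PiE\<close> pins down the values off \<open>Basis\<close>, so that distinct
  members give distinct characters.\<close>

definition freqs :: "('a::euclidean_space \<Rightarrow> int) set" where
  "freqs = PiE Basis (\<lambda>_. UNIV)"

lemma mem_cube: "z \<in> cube \<kappa> \<longleftrightarrow> (\<forall>b\<in>Basis. \<bar>z \<bullet> b\<bar> \<le> pi / \<kappa>)"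
  unfolding cube_def mem_box by (auto simp: abs_le_iff)

lemma compact_cube: "compact (cube \<kappa>)"
  by (simp add: cube_def)

lemma norm_char_fn [simp]: "norm (char_fn \<kappa> k z) = 1"
  by (simp add: char_fn_def prod_norm[symmetric])

lemma continuous_on_char_fn: "continuous_on UNIV (char_fn \<kappa> k)"
  unfolding char_fn_def cis_conv_exp by (intro continuous_intros)

lemma char_fn_measurable: "char_fn \<kappa> k \<in> borel_measurable lebesgue"
  by (rule continuous_on_imp_lebesgue_measurable[OF continuous_on_char_fn])

lemma char_fn_bmeas: "bmeas (char_fn \<kappa> k)"
  by (rule bmeasI[OF char_fn_measurable, of _ _ 1]) simp

lemma sqint_cube_char: "sqint (cube_char \<kappa> k)"
  unfolding cube_char_def by (rule sqint_indicator_mult[OF continuous_on_char_fn compact_cube])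

lemma char_fn_cong: "(\<And>b. b \<in> Basis \<Longrightarrow> k b = l b) \<Longrightarrow> char_fn \<kappa> k = char_fn \<kappa> l"
  by (auto simp: char_fn_def intro!: ext prod.cong)

lemma cnj_char_fn: "cnj (char_fn \<kappa> k z) = char_fn \<kappa> (\<lambda>b. - k b) z"
  by (simp add: char_fn_def cnj_prod cis_cnj)

lemma integral_cis_interval:
  assumes "\<kappa> > 0"
  shows "integrable lborel (\<lambda>x::real. indicator {- (pi/\<kappa>)..pi/\<kappa>} x *\<^sub>R cis (\<kappa> * of_int m * x))"
    and "(LINT x|lborel. indicator {- (pi/\<kappa>)..pi/\<kappa>} x *\<^sub>R cis (\<kappa> * of_int m * x)) = (if m = 0 then of_real (2 * pi / \<kappa>) else 0)"
proof -
  have c: "continuous_on A (\<lambda>x. cis (\<kappa> * of_int m * x))" for A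
    unfolding cis_conv_exp by (intro continuous_intros)
  show "integrable lborel (\<lambda>x::real. indicator {- (pi/\<kappa>)..pi/\<kappa>} x *\<^sub>R cis (\<kappa> * of_int m * x))"
    by (rule borel_integrable_compact[OF _ c]) simp
  have le: "- (pi/\<kappa>) \<le> pi/\<kappa>" using assms by (simp add: field_simps)
  show "(LINT x|lborel. indicator {- (pi/\<kappa>)..pi/\<kappa>} x *\<^sub>R cis (\<kappa> * of_int m * x)) = (if m = 0 then of_real (2 * pi / \<kappa>) else 0)"
  proof (cases "m = 0")
    case True
    have "(LINT x|lborel. indicator {- (pi/\<kappa>)..pi/\<kappa>} x *\<^sub>R (1::complex)) = of_real (pi/\<kappa>) - of_real (- (pi/\<kappa>))"
      by (rule integral_FTC_Icc[OF le])
        (simp_all add: has_vector_derivative_def scaleR_conv_of_real bounded_linear_imp_has_derivative bounded_linear_of_real continuous_on_const)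
    then show ?thesis using True by simp
  next
    case False
    have nz: "\<i> * of_real (\<kappa> * of_int m) \<noteq> 0" using assms False by simp
    let ?F = "\<lambda>x. cis (\<kappa> * of_int m * x) / (\<i> * of_real (\<kappa> * of_int m))"
    have "(?F has_vector_derivative cis (\<kappa> * of_int m * x)) (at x within A)" for x A
    proof -
      have "((\<lambda>z. exp ((\<i> * of_real (\<kappa> * of_int m)) * z) / (\<i> * of_real (\<kappa> * of_int m))) has_field_derivative
          exp ((\<i> * of_real (\<kappa> * of_int m)) * of_real x)) (at (of_real x))"
        using nz by (auto intro!: derivative_eq_intros)
      from has_vector_derivative_real_field[OF this]
      moreover have "cis (\<kappa> * of_int m * x) = exp ((\<i> * of_real (\<kappa> * of_int m)) * of_real x)" for x
        by (simp add: cis_conv_exp mult_ac)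
      ultimately show ?thesis by (simp only: has_vector_derivative_at_within)
    qed
    then have "(LINT x|lborel. indicator {- (pi/\<kappa>)..pi/\<kappa>} x *\<^sub>R cis (\<kappa> * of_int m * x)) = ?F (pi/\<kappa>) - ?F (- (pi/\<kappa>))"
      by (intro integral_FTC_Icc[OF le] c)
    also have "cis (\<kappa> * of_int m * (pi/\<kappa>)) = cis (\<kappa> * of_int m * (- (pi/\<kappa>)))"
    proof -
      have "cis (of_int m * pi) = cis (- (of_int m * pi) + 2 * pi * of_int m)" by (simp add: algebra_simps)
      also have "\<dots> = cis (- (of_int m * pi))" unfolding cis_mult[symmetric] by (simp add: cis_multiple_2pi)
      finally show ?thesis using assms by simp
    qed
    finally show ?thesis using False by simp
  qed
qed

lemma integral_cube_char:
  fixes k :: "'a::euclidean_space \<Rightarrow> int"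
  assumes "\<kappa> > 0"
  shows "(LINT z|lebesgue. cube_char \<kappa> k z) =
    (if \<forall>b\<in>Basis. k b = 0 then of_real (cube_vol TYPE('a) \<kappa>) else 0)"
proof -
  have eq: "cube_char \<kappa> k z = (\<Prod>b\<in>Basis. indicator {- (pi/\<kappa>)..pi/\<kappa>} (z \<bullet> b) *\<^sub>R cis (\<kappa> * of_int (k b) * (z \<bullet> b)))" for z :: 'a
  proof (cases "z \<in> cube \<kappa>")
    case True
    then have "(\<Prod>b\<in>Basis. indicator {- (pi/\<kappa>)..pi/\<kappa>} (z \<bullet> b) *\<^sub>R cis (\<kappa> * of_int (k b) * (z \<bullet> b))) = char_fn \<kappa> k z"
      unfolding char_fn_def by (intro prod.cong) (auto simp: mem_cube abs_le_iff indicator_def)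
    then show ?thesis using True by (simp add: cube_char_def)
  next
    case False
    then obtain b where b: "b \<in> Basis" "z \<bullet> b \<notin> {- (pi/\<kappa>)..pi/\<kappa>}" by (auto simp: mem_cube abs_le_iff)
    have "indicator {- (pi/\<kappa>)..pi/\<kappa>} (z \<bullet> b) *\<^sub>R cis (\<kappa> * of_int (k b) * (z \<bullet> b)) = 0"
      using b(2) by (simp add: indicator_def del: atLeastAtMost_iff)
    from this b(1) have "\<exists>b\<in>Basis. indicator {- (pi/\<kappa>)..pi/\<kappa>} (z \<bullet> b) *\<^sub>R cis (\<kappa> * of_int (k b) * (z \<bullet> b)) = 0"
      by (rule bexI)
    then have "(\<Prod>b\<in>Basis. indicator {- (pi/\<kappa>)..pi/\<kappa>} (z \<bullet> b) *\<^sub>R cis (\<kappa> * of_int (k b) * (z \<bullet> b))) = 0"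
      by (rule prod_zero[OF finite_Basis])
    then show ?thesis using False by (simp add: cube_char_def)
  qed
  have "(LINT z|lebesgue. cube_char \<kappa> k z) = (LINT z|lborel. cube_char \<kappa> k z)"
  proof (rule integral_completion)
    have "(\<lambda>z. indicator (cube \<kappa>) z * char_fn \<kappa> k z) \<in> borel_measurable borel"
      by (intro borel_measurable_times borel_measurable_indicator borel_measurable_continuous_onI continuous_on_char_fn)
        (simp add: borel_compact compact_cube)
    then show "cube_char \<kappa> k \<in> borel_measurable lborel" by (simp add: cube_char_def[abs_def])
  qed
  also have "\<dots> = (\<Prod>b\<in>(Basis::'a set). (if k b = 0 then of_real (2 * pi / \<kappa>) else 0))"
    unfolding eq by (subst integral_prod_Basis) (use integral_cis_interval[OF assms] in auto)
  also have "\<dots> = (if \<forall>b\<in>Basis. k b = 0 then of_real (cube_vol TYPE('a) \<kappa>) else 0)"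
  proof (cases "\<forall>b\<in>(Basis::'a set). k b = 0")
    case True
    then have "(\<Prod>b\<in>(Basis::'a set). (if k b = 0 then of_real (2 * pi / \<kappa>) else (0::complex))) = (\<Prod>b\<in>(Basis::'a set). of_real (2 * pi / \<kappa>))"
      by (intro prod.cong) auto
    then show ?thesis using True by (simp add: cube_vol_def)
  next
    case False
    then show ?thesis by (auto intro!: prod_zero)
  qed
  finally show ?thesis .
qed

text \<open>Conjugated so that the coefficient of u is the bilinear pairing with the character
  itself, the form in which characters enter the weak equation as test functions.\<close>

definition four :: "real \<Rightarrow> ('a::euclidean_space \<Rightarrow> int) \<Rightarrow> 'a lsq" where
  "four \<kappa> k = abs_lsq (\<lambda>z. cnj (cube_char \<kappa> k z))"

lemma cin_four: "cin u (four \<kappa> k) = pr u (cube_char \<kappa> k)"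
  unfolding four_def by (rule pr_eq_cin[OF sqint_cube_char, symmetric])

lemma cin_four_four:
  assumes "\<kappa> > 0" "k \<in> freqs" "l \<in> freqs"
  shows "cin (four \<kappa> k) (four \<kappa> l :: 'a::euclidean_space lsq) = (if k = l then of_real (cube_vol TYPE('a) \<kappa>) else 0)"
proof -
  have "cin (four \<kappa> k) (four \<kappa> l) = (LINT z|lebesgue. cnj (cube_char \<kappa> k z) * cube_char \<kappa> l z)"
    unfolding cin_four unfolding four_def
    by (rule pr_abs) (auto intro: sqint_cnj sqint_cube_char sqint_measurable)
  also have "\<dots> = (LINT z|lebesgue. cube_char \<kappa> (\<lambda>b. l b - k b) z)"
  proof (rule Bochner_Integration.integral_cong[OF refl])
    fix z :: 'a
    have "cnj (char_fn \<kappa> k z) * char_fn \<kappa> l z = char_fn \<kappa> (\<lambda>b. l b - k b) z"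
      unfolding char_fn_def cnj_prod cis_cnj prod.distrib[symmetric]
      by (intro prod.cong) (auto simp: cis_mult algebra_simps)
    then show "cnj (cube_char \<kappa> k z) * cube_char \<kappa> l z = cube_char \<kappa> (\<lambda>b. l b - k b) z"
      by (auto simp: cube_char_def indicator_def)
  qed
  also have "\<dots> = (if \<forall>b\<in>(Basis::'a set). l b - k b = 0 then of_real (cube_vol TYPE('a) \<kappa>) else 0)"
    by (rule integral_cube_char[OF assms(1)])
  also have "(\<forall>b\<in>(Basis::'a set). l b - k b = 0) \<longleftrightarrow> k = l"
    using assms(2,3) PiE_ext[of k Basis "\<lambda>_. UNIV" l] unfolding freqs_def by auto
  finally show ?thesis .
qed

lemma pr_cube_char_prod_trig_zero:
  fixes u :: "'a::euclidean_space lsq"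
  assumes z: "\<And>k. pr u (cube_char \<kappa> k) = 0" and t: "\<And>b. b \<in> Basis \<Longrightarrow> trig_poly \<kappa> (t b)"
  shows "pr u (\<lambda>z. indicator (cube \<kappa>) z * (\<Prod>b\<in>Basis. t b (z \<bullet> b))) = 0"
    and "continuous_on UNIV (\<lambda>z::'a. \<Prod>b\<in>Basis. t b (z \<bullet> b))"
proof -
  have ct: "continuous_on UNIV s" if "trig_poly \<kappa> s" for s
    using that by induction (auto simp: cis_conv_exp intro!: continuous_intros)
  have cont: "continuous_on UNIV (\<lambda>z::'a. \<Prod>b\<in>Basis. s b (z \<bullet> b))" if "\<And>b. b \<in> Basis \<Longrightarrow> trig_poly \<kappa> (s b)" for s
    by (intro continuous_on_prod continuous_on_compose2[OF ct[OF that]] continuous_intros) auto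
  show "continuous_on UNIV (\<lambda>z::'a. \<Prod>b\<in>Basis. t b (z \<bullet> b))" by (rule cont[OF t])
  have base: "trig_poly \<kappa> (\<lambda>x. c * cis (\<kappa> * of_int m * x))" for c m by (rule trig_base)
  \<comment> \<open>The set A collects the coordinates whose factor may be more than a single
    exponential. Each of them is treated by rule induction on its \<open>trig_poly\<close> factor,
    and with A empty the product is a multiple of one character.\<close>
  have main: "pr u (\<lambda>z. indicator (cube \<kappa>) z * (\<Prod>b\<in>Basis. t b (z \<bullet> b))) = 0"
    if "finite A" "A \<subseteq> Basis" "\<And>b. b \<in> Basis \<Longrightarrow> trig_poly \<kappa> (t b)"
      "\<And>b. b \<in> Basis - A \<Longrightarrow> \<exists>c m. t b = (\<lambda>x. c * cis (\<kappa> * of_int m * x))" for A t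
    using that
  proof (induction A arbitrary: t)
    case empty
    then have "\<forall>b\<in>Basis. \<exists>cm. t b = (\<lambda>x. fst cm * cis (\<kappa> * of_int (snd cm) * x))" by simp
    from bchoice[OF this] obtain cm where cm: "\<And>b. b \<in> Basis \<Longrightarrow> t b = (\<lambda>x. fst (cm b) * cis (\<kappa> * of_int (snd (cm b)) * x))" by blast
    have "indicator (cube \<kappa>) z * (\<Prod>b\<in>Basis. t b (z \<bullet> b)) = (\<Prod>b\<in>Basis. fst (cm b)) * cube_char \<kappa> (\<lambda>b. snd (cm b)) z" for z :: 'a
    proof -
      have "(\<Prod>b\<in>Basis. t b (z \<bullet> b)) = (\<Prod>b\<in>Basis. fst (cm b) * cis (\<kappa> * of_int (snd (cm b)) * (z \<bullet> b)))"
        by (intro prod.cong) (auto simp: cm)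
      then show ?thesis by (simp add: prod.distrib cube_char_def char_fn_def)
    qed
    then show ?case by (simp add: pr_cmult_right z)
  next
    case (insert a A)
    have a: "a \<in> Basis" using insert.prems by simp
    have split: "(\<Prod>b\<in>Basis. (t(a := s)) b (z \<bullet> b)) = s (z \<bullet> a) * (\<Prod>b\<in>Basis - {a}. t b (z \<bullet> b))" for s and z :: 'a
      by (subst prod.remove[OF finite_Basis a]) (auto intro!: prod.cong)
    have "pr u (\<lambda>z. indicator (cube \<kappa>) z * (\<Prod>b\<in>Basis. (t(a := s)) b (z \<bullet> b))) = 0" if "trig_poly \<kappa> s" for s
      using that
    proof induction
      case (trig_base c m)
      show ?case
        by (rule insert.IH) (use insert.prems base in auto)
    next
      case (trig_add s s')
      have sq: "sqint (\<lambda>z. indicator (cube \<kappa>) z * (\<Prod>b\<in>Basis. (t(a := s)) b (z \<bullet> b)))" if "trig_poly \<kappa> s" for s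
        by (intro sqint_indicator_mult cont compact_cube) (use insert.prems(2) that in auto)
      have "(\<lambda>z. indicator (cube \<kappa>) z * (\<Prod>b\<in>Basis. (t(a := \<lambda>x. s x + s' x)) b (z \<bullet> b))) =
        (\<lambda>z. indicator (cube \<kappa>) z * (\<Prod>b\<in>Basis. (t(a := s)) b (z \<bullet> b)) + indicator (cube \<kappa>) z * (\<Prod>b\<in>Basis. (t(a := s')) b (z \<bullet> b)))"
        by (rule ext) (simp only: split distrib_left distrib_right)
      then show ?case
        using pr_add_right[OF sq[OF trig_add.hyps(1)] sq[OF trig_add.hyps(2)], of u] trig_add.IH by simp
    qed
    from this[OF insert.prems(2)[OF a]] show ?case by simp
  qed
  show "pr u (\<lambda>z. indicator (cube \<kappa>) z * (\<Prod>b\<in>Basis. t b (z \<bullet> b))) = 0"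
    by (rule main[of Basis]) (use t in auto)
qed

lemma box_bump_trig_approximation:
  fixes a c :: "'a::euclidean_space"
  assumes \<kappa>: "\<kappa> > 0" and ac: "\<And>b. b \<in> Basis \<Longrightarrow> a \<bullet> b \<le> c \<bullet> b" "cbox a c \<subseteq> interior (cube \<kappa>)"
    and e: "e > 0" "e < 1"
  obtains t where "\<And>b. b \<in> Basis \<Longrightarrow> trig_poly \<kappa> (t b)"
    "\<And>z. z \<in> cube \<kappa> \<Longrightarrow> norm (box_bump a c m z - (\<Prod>b\<in>Basis. t b (z \<bullet> b))) \<le> real DIM('a) * (2 * e)"
proof -
  define \<alpha> where "\<alpha> b x = flat_exp 0 (real (Suc m) * ((x - a \<bullet> b) * (c \<bullet> b - x)))" for b x
  have int: "interior (cube \<kappa>) = box (- (pi / \<kappa>) *\<^sub>R One) ((pi / \<kappa>) *\<^sub>R (One::'a))"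
    unfolding cube_def by simp
  have ne: "a \<in> cbox a c" "c \<in> cbox a c" using ac(1) by (auto simp: mem_box)
  have rng: "- (pi/\<kappa>) < a \<bullet> b" "c \<bullet> b < pi/\<kappa>" if "b \<in> Basis" for b
    using subsetD[OF ac(2) ne(1)] subsetD[OF ac(2) ne(2)] that unfolding int mem_box by auto
  \<comment> \<open>Approximating (1 - e) \<alpha> in place of \<alpha> keeps the approximants below
    1 in modulus, as the product estimate \<open>norm_prod_diff\<close> requires, and costs a second
    e in the error.\<close>
  have "\<exists>t. trig_poly \<kappa> t \<and> (\<forall>x. \<kappa> * \<bar>x\<bar> \<le> pi \<longrightarrow> norm (of_real ((1 - e) * \<alpha> b x) - t x) < e)" if b: "b \<in> Basis" for b
  proof -
    define r where "r = max \<bar>a \<bullet> b\<bar> \<bar>c \<bullet> b\<bar>"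
    have r0: "0 \<le> r" by (simp add: r_def)
    have "r < pi / \<kappa>" using rng[OF b] ac(1)[OF b] by (auto simp: r_def abs_if)
    then have r1: "\<kappa> * r < pi" using \<kappa> by (simp add: field_simps)
    have zero: "(1 - e) * \<alpha> b x = 0" if "\<bar>x\<bar> \<ge> r" for x
    proof -
      have "x \<le> a \<bullet> b \<or> c \<bullet> b \<le> x"
        using that unfolding r_def by linarith
      then have "(x - a \<bullet> b) * (c \<bullet> b - x) \<le> 0"
      proof
        assume "x \<le> a \<bullet> b"
        then show ?thesis using ac(1)[OF b] by (intro mult_nonpos_nonneg) linarith+
      next
        assume "c \<bullet> b \<le> x"
        then show ?thesis using ac(1)[OF b] by (intro mult_nonneg_nonpos) linarith+
      qed
      then have "real (Suc m) * ((x - a \<bullet> b) * (c \<bullet> b - x)) \<le> 0"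
        by (rule mult_nonneg_nonpos[OF of_nat_0_le_iff])
      then have "\<not> 0 < real (Suc m) * ((x - a \<bullet> b) * (c \<bullet> b - x))" by (simp only: not_less)
      then show ?thesis unfolding \<alpha>_def flat_exp_def by (simp only: if_False mult_zero_right)
    qed
    have "continuous_on UNIV (\<lambda>x. (1 - e) * \<alpha> b x)"
    proof -
      have "smooth_on UNIV (\<alpha> b)" unfolding \<alpha>_def
        by (intro smooth_on_flat_exp smooth_on_mult smooth_on_const smooth_on_diff smooth_on_bounded_linear bounded_linear_ident open_UNIV)
      then show ?thesis by (intro continuous_intros smooth_on_imp_continuous_on)
    qed
    from trig_poly_approximation[OF \<kappa> this r0 r1 zero e(1)] show ?thesis by metis
  qed
  then have "\<forall>b\<in>Basis. \<exists>t. trig_poly \<kappa> t \<and> (\<forall>x. \<kappa> * \<bar>x\<bar> \<le> pi \<longrightarrow> norm (of_real ((1 - e) * \<alpha> b x) - t x) < e)" by blast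
  from bchoice[OF this] obtain t where t: "\<And>b. b \<in> Basis \<Longrightarrow> trig_poly \<kappa> (t b)"
    "\<And>b x. b \<in> Basis \<Longrightarrow> \<kappa> * \<bar>x\<bar> \<le> pi \<Longrightarrow> norm (of_real ((1 - e) * \<alpha> b x) - t b x) < e" by blast
  show thesis
  proof (rule that[of t, OF t(1)])
    fix z :: 'a assume z: "z \<in> cube \<kappa>"
    have zb: "\<kappa> * \<bar>z \<bullet> b\<bar> \<le> pi" if "b \<in> Basis" for b
      using z that \<kappa> by (simp add: mem_cube field_simps)
    have \<alpha>01: "0 \<le> \<alpha> b x" "\<alpha> b x \<le> 1" for b x by (auto simp: \<alpha>_def flat_exp_nonneg flat_exp_0_le_1)
    have close: "norm (of_real (\<alpha> b (z \<bullet> b)) - t b (z \<bullet> b)) \<le> 2 * e" "norm (t b (z \<bullet> b)) \<le> 1" if b: "b \<in> Basis" for b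
    proof -
      let ?x = "z \<bullet> b"
      have n: "norm (of_real ((1 - e) * \<alpha> b ?x) - t b ?x) < e" by (rule t(2)[OF b zb[OF b]])
      have eq: "complex_of_real (\<alpha> b ?x) - t b ?x = (of_real ((1 - e) * \<alpha> b ?x) - t b ?x) + of_real (e * \<alpha> b ?x)"
        by (simp add: algebra_simps)
      have "norm (complex_of_real (\<alpha> b ?x) - t b ?x) \<le> e + norm (complex_of_real (e * \<alpha> b ?x))"
        unfolding eq
        using norm_triangle_ineq[of "of_real ((1 - e) * \<alpha> b ?x) - t b ?x" "complex_of_real (e * \<alpha> b ?x)"] n
        by linarith
      also have "norm (complex_of_real (e * \<alpha> b ?x)) \<le> e * 1"
        unfolding norm_of_real using e \<alpha>01[of b ?x] by (simp add: abs_mult mult_left_le)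
      finally show "norm (of_real (\<alpha> b ?x) - t b ?x) \<le> 2 * e" by simp
      have "norm (t b ?x) \<le> norm (complex_of_real ((1 - e) * \<alpha> b ?x)) + norm (of_real ((1 - e) * \<alpha> b ?x) - t b ?x)"
        using norm_triangle_ineq4[of "complex_of_real ((1 - e) * \<alpha> b ?x)" "of_real ((1 - e) * \<alpha> b ?x) - t b ?x"] by simp
      also have "\<dots> \<le> (1 - e) * 1 + e"
      proof (intro add_mono)
        show "norm (complex_of_real ((1 - e) * \<alpha> b ?x)) \<le> (1 - e) * 1"
          unfolding norm_of_real using e \<alpha>01[of b ?x] by (simp add: abs_mult mult_left_le)
      qed (use n in simp)
      finally show "norm (t b ?x) \<le> 1" by simp
    qed
    have "norm (box_bump a c m z - (\<Prod>b\<in>Basis. t b (z \<bullet> b)))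
      = norm ((\<Prod>b\<in>Basis. complex_of_real (\<alpha> b (z \<bullet> b))) - (\<Prod>b\<in>Basis. t b (z \<bullet> b)))"
      by (simp add: box_bump_def \<alpha>_def)
    also have "\<dots> \<le> (\<Sum>b\<in>(Basis::'a set). norm (complex_of_real (\<alpha> b (z \<bullet> b)) - t b (z \<bullet> b)))"
      by (rule norm_prod_diff) (use \<alpha>01 close in auto)
    also have "\<dots> \<le> (\<Sum>b\<in>(Basis::'a set). 2 * e)" by (intro sum_mono close)
    finally show "norm (box_bump a c m z - (\<Prod>b\<in>Basis. t b (z \<bullet> b))) \<le> real DIM('a) * (2 * e)" by simp
  qed
qed

text \<open>Vanishing coefficients annihilate all products of trigonometric polynomials on the cube,
  hence by uniform approximation all bumps in its interior. So u vanishes almost everywhere inside;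
  the faces are negligible.\<close>

theorem cube_char_complete:
  fixes u :: "'a::euclidean_space lsq"
  assumes \<kappa>: "\<kappa> > 0" and supp: "mul (indicator (cube \<kappa>)) u = u"
    and z: "\<And>k. k \<in> freqs \<Longrightarrow> pr u (cube_char \<kappa> k) = 0"
  shows "u = 0"
proof -
  let ?Q = "cube \<kappa> :: 'a set"
  have z': "pr u (cube_char \<kappa> k) = 0" for k
  proof -
    have "cube_char \<kappa> k = cube_char \<kappa> (restrict k Basis)"
      unfolding cube_char_def[abs_def] by (simp add: char_fn_cong[of k "restrict k Basis"])
    then show ?thesis using z[of "restrict k Basis"] by (simp add: freqs_def)
  qed
  have bQ: "bmeas (indicator ?Q :: 'a \<Rightarrow> complex)" by (rule bmeas_compact_indicator[OF compact_cube])
  define C where "C = (LINT z|lebesgue. norm (rep_lsq u z * indicator ?Q z))"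
  have C0: "C \<ge> 0" by (simp add: C_def)
  have bump: "pr u (box_bump a c m) = 0"
    if ac: "\<And>b. b \<in> Basis \<Longrightarrow> a \<bullet> b \<le> c \<bullet> b" "cbox a c \<subseteq> interior ?Q" for a c m
  proof -
    have "norm (pr u (box_bump a c m)) \<le> C * (real DIM('a) * (2 * e))" if e: "e > 0" "e < 1" for e
    proof -
      obtain t where t: "\<And>b. b \<in> Basis \<Longrightarrow> trig_poly \<kappa> (t b)"
        "\<And>z. z \<in> ?Q \<Longrightarrow> norm (box_bump a c m z - (\<Prod>b\<in>Basis. t b (z \<bullet> b))) \<le> real DIM('a) * (2 * e)"
        using box_bump_trig_approximation[OF \<kappa> ac e] by metis
      let ?T = "\<lambda>z::'a. \<Prod>b\<in>Basis. t b (z \<bullet> b)"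
      note T = pr_cube_char_prod_trig_zero[where t = t, OF z' t(1)]
      have cb: "continuous_on UNIV (box_bump a c m)" by (rule smooth_on_imp_continuous_on[OF smooth_on_box_bump])
      have s1: "sqint (\<lambda>z. indicator ?Q z * box_bump a c m z)" by (rule sqint_indicator_mult[OF cb compact_cube])
      have s2: "sqint (\<lambda>z. indicator ?Q z * ?T z)" by (rule sqint_indicator_mult[OF T(2) compact_cube])
      have "pr u (box_bump a c m) = pr (mul (indicator ?Q) u) (box_bump a c m)" by (simp add: supp)
      also have "\<dots> = pr u (\<lambda>z. indicator ?Q z * box_bump a c m z)"
        by (rule pr_mul[OF bQ continuous_on_imp_lebesgue_measurable[OF cb]])
      also have "\<dots> = pr u (\<lambda>z. indicator ?Q z * box_bump a c m z) - pr u (\<lambda>z. indicator ?Q z * ?T z)"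
        using T(1) by simp
      also have "\<dots> = (LINT z|lebesgue. rep_lsq u z * (indicator ?Q z * box_bump a c m z) - rep_lsq u z * (indicator ?Q z * ?T z))"
        unfolding pr_def by (intro Bochner_Integration.integral_diff[symmetric] integrable_sqint_mult sqint_rep s1 s2)
      finally have "norm (pr u (box_bump a c m)) \<le> (LINT z|lebesgue. norm (rep_lsq u z * (indicator ?Q z * box_bump a c m z) - rep_lsq u z * (indicator ?Q z * ?T z)))"
        by (simp only: integral_norm_bound)
      also have "\<dots> \<le> (LINT z|lebesgue. norm (rep_lsq u z * indicator ?Q z) * (real DIM('a) * (2 * e)))"
      proof (rule integral_mono)
        show "integrable lebesgue (\<lambda>z. norm (rep_lsq u z * (indicator ?Q z * box_bump a c m z) - rep_lsq u z * (indicator ?Q z * ?T z)))"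
          by (intro integrable_norm Bochner_Integration.integrable_diff integrable_sqint_mult sqint_rep s1 s2)
        show "integrable lebesgue (\<lambda>z. norm (rep_lsq u z * indicator ?Q z) * (real DIM('a) * (2 * e)))"
          by (intro integrable_mult_left integrable_norm integrable_sqint_mult sqint_rep sqint_indicator compact_cube)
        fix z :: 'a
        have "rep_lsq u z * (indicator ?Q z * box_bump a c m z) - rep_lsq u z * (indicator ?Q z * ?T z)
            = rep_lsq u z * indicator ?Q z * (box_bump a c m z - ?T z)" by (simp add: algebra_simps)
        then show "norm (rep_lsq u z * (indicator ?Q z * box_bump a c m z) - rep_lsq u z * (indicator ?Q z * ?T z))
            \<le> norm (rep_lsq u z * indicator ?Q z) * (real DIM('a) * (2 * e))"
          using t(2)[of z] by (cases "z \<in> ?Q") (auto simp: norm_mult intro!: mult_left_mono)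
      qed
      also have "\<dots> = C * (real DIM('a) * (2 * e))" unfolding C_def by simp
      finally show ?thesis .
    qed
    note le = this
    have "norm (pr u (box_bump a c m)) \<le> 0 + d" if d: "d > 0" for d
    proof -
      \<comment> \<open>Makes the bound at most d; the 1 in the denominator covers C = 0, and the
        minimum keeps e below 1.\<close>
      define e where "e = min (1/2) (d / (C * real DIM('a) * 2 + 1))"
      have den: "C * real DIM('a) * 2 + 1 > 0" using C0 by (simp add: add_nonneg_pos)
      have e: "e > 0" "e < 1" using d den by (auto simp: e_def)
      have "C * (real DIM('a) * (2 * e)) = (C * real DIM('a) * 2) * e" by simp
      also have "\<dots> \<le> (C * real DIM('a) * 2 + 1) * e" using e by (intro mult_right_mono) auto
      also have "\<dots> \<le> (C * real DIM('a) * 2 + 1) * (d / (C * real DIM('a) * 2 + 1))"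
        using den by (intro mult_left_mono) (auto simp: e_def)
      also have "\<dots> = d" using den by simp
      finally show ?thesis using le[OF e] by simp
    qed
    then have "norm (pr u (box_bump a c m)) \<le> 0" by (rule field_le_epsilon)
    then show ?thesis by simp
  qed
  have "AE z in lebesgue. z \<in> interior ?Q \<longrightarrow> rep_lsq u z = 0"
    by (rule AE_zero_of_bump_integrals[OF open_interior bump])
  moreover have "AE z in lebesgue. z \<notin> ?Q - interior ?Q"
  proof -
    have "negligible (?Q - interior ?Q)"
      unfolding cube_def interior_cbox by (rule negligible_frontier_interval)
    then show ?thesis unfolding negligible_iff_null_sets by (rule AE_not_in)
  qed
  moreover have "AE z in lebesgue. rep_lsq u z = indicator ?Q z * rep_lsq u z"
    using rep_mul[OF bQ, of u] unfolding supp .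
  ultimately have "AE z in lebesgue. rep_lsq u z = rep_lsq 0 z"
    using rep_zero_lsq
  proof eventually_elim
    case (elim z)
    then show ?case by (cases "z \<in> ?Q") auto
  qed
  then show ?thesis by (simp add: lsq_eq_iff)
qed

section \<open>Bessel and Parseval on the cube\<close>

lemma closure_subspace:
  fixes V :: "'a::real_normed_vector set"
  assumes "subspace V" shows "subspace (closure V)"
  unfolding subspace_def
proof (intro conjI ballI allI)
  show "0 \<in> closure V" using subspace_0[OF assms] closure_subset by blast
next
  fix x y assume "x \<in> closure V" "y \<in> closure V"
  then obtain f g where f: "\<And>n::nat. f n \<in> V" "f \<longlonglongrightarrow> x" and g: "\<And>n::nat. g n \<in> V" "g \<longlonglongrightarrow> y"
    unfolding closure_sequential by metis
  have "\<forall>n. f n + g n \<in> V" using f g subspace_add[OF assms] by blast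
  moreover have "(\<lambda>n. f n + g n) \<longlonglongrightarrow> x + y" by (intro tendsto_intros f g)
  ultimately show "x + y \<in> closure V" unfolding closure_sequential by (intro exI conjI)
next
  fix c x assume "x \<in> closure V"
  then obtain f where f: "\<And>n::nat. f n \<in> V" "f \<longlonglongrightarrow> x" unfolding closure_sequential by metis
  have "\<forall>n. c *\<^sub>R f n \<in> V" using f subspace_scale[OF assms] by blast
  moreover have "(\<lambda>n. c *\<^sub>R f n) \<longlonglongrightarrow> c *\<^sub>R x" by (intro tendsto_intros f)
  ultimately show "c *\<^sub>R x \<in> closure V" unfolding closure_sequential by (intro exI conjI)
qed

lemma cube_vol_pos: "\<kappa> > 0 \<Longrightarrow> cube_vol TYPE('a::euclidean_space) \<kappa> > 0"
  by (simp add: cube_vol_def)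

text \<open>The second component of the index accounts for the real span: \<open>four \<kappa> k\<close> and \<open>\<i> four \<kappa> k\<close> are orthogonal
  for the real inner product.\<close>

definition four_onb :: "real \<Rightarrow> ('a::euclidean_space \<Rightarrow> int) \<times> bool \<Rightarrow> 'a lsq" where
  "four_onb \<kappa> kb = (1 / sqrt (cube_vol TYPE('a) \<kappa>)) *\<^sub>R
     (if snd kb then four \<kappa> (fst kb) else mul (\<lambda>z. \<i>) (four \<kappa> (fst kb)))"

lemma cin_mul_const_right: "cin u (mul (\<lambda>z. c) v) = cnj c * cin u v"
  by (subst (1 2) cin_commute) (simp add: cin_mul_const)

lemma inner_four_onb:
  fixes u :: "'a::euclidean_space lsq"
  shows "u \<bullet> four_onb \<kappa> (k, True) = Re (pr u (cube_char \<kappa> k)) / sqrt (cube_vol TYPE('a) \<kappa>)"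
    "u \<bullet> four_onb \<kappa> (k, False) = Im (pr u (cube_char \<kappa> k)) / sqrt (cube_vol TYPE('a) \<kappa>)"
  by (simp_all add: four_onb_def inner_lsq_def cin_scaleR_right cin_mul_const_right cin_four)

lemma sum_inner_four_onb:
  fixes u :: "'a::euclidean_space lsq"
  assumes "\<kappa> > 0"
  shows "(\<Sum>kb\<in>F \<times> UNIV. (u \<bullet> four_onb \<kappa> kb)\<^sup>2) = (\<Sum>k\<in>F. (norm (pr u (cube_char \<kappa> k)))\<^sup>2) / cube_vol TYPE('a) \<kappa>"
proof -
  have V: "cube_vol TYPE('a) \<kappa> > 0" by (rule cube_vol_pos[OF assms])
  have "(\<Sum>kb\<in>F \<times> UNIV. (u \<bullet> four_onb \<kappa> kb)\<^sup>2) = (\<Sum>k\<in>F. \<Sum>b\<in>UNIV. (u \<bullet> four_onb \<kappa> (k, b))\<^sup>2)"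
    by (simp add: sum.cartesian_product)
  also have "\<dots> = (\<Sum>k\<in>F. (norm (pr u (cube_char \<kappa> k)))\<^sup>2 / cube_vol TYPE('a) \<kappa>)"
    by (intro sum.cong refl) (use V in \<open>simp add: UNIV_bool inner_four_onb power_divide cmod_power2 add_divide_distrib\<close>)
  finally show ?thesis by (simp add: sum_divide_distrib)
qed

lemma orthonormal_four_onb:
  assumes "\<kappa> > 0" "x \<in> freqs \<times> UNIV" "y \<in> freqs \<times> UNIV"
  shows "four_onb \<kappa> x \<bullet> (four_onb \<kappa> y :: 'a::euclidean_space lsq) = (if x = y then 1 else 0)"
proof -
  obtain k b l c where xy: "x = (k, b)" "y = (l, c)" by (cases x; cases y)
  have kl: "k \<in> freqs" "l \<in> freqs" using assms xy by auto
  let ?V = "cube_vol TYPE('a) \<kappa>"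
  have V: "?V > 0" by (rule cube_vol_pos[OF assms(1)])
  have inv: "(1 / sqrt ?V) * ((1 / sqrt ?V) * ?V) = 1" using V by (simp add: field_simps)
  have "cin (four_onb \<kappa> x) (four_onb \<kappa> y) =
    (if b then 1 else \<i>) * (if c then 1 else - \<i>) * (of_real (1 / sqrt ?V) * (of_real (1 / sqrt ?V) * cin (four \<kappa> k) (four \<kappa> l)))"
    unfolding xy four_onb_def by (simp add: cin_scaleR_left cin_scaleR_right cin_mul_const cin_mul_const_right)
  also have "of_real (1 / sqrt ?V) * (of_real (1 / sqrt ?V) * cin (four \<kappa> k) (four \<kappa> l)) = (if k = l then 1 else 0)"
    unfolding cin_four_four[OF assms(1) kl] using inv by (simp only: of_real_mult[symmetric] of_real_1 if_distrib mult_zero_right split: if_split) simp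
  finally show ?thesis by (auto simp: inner_lsq_def xy)
qed

lemma Bessel_cube_char:
  fixes u :: "'a::euclidean_space lsq"
  assumes "\<kappa> > 0" "finite F" "F \<subseteq> freqs"
  shows "(\<Sum>k\<in>F. (norm (pr u (cube_char \<kappa> k)))\<^sup>2) \<le> cube_vol TYPE('a) \<kappa> * (norm u)\<^sup>2"
proof -
  have "(\<Sum>kb\<in>F \<times> UNIV. (u \<bullet> four_onb \<kappa> kb)\<^sup>2) \<le> (norm u)\<^sup>2"
  proof -
    have "four_onb \<kappa> i \<bullet> (four_onb \<kappa> j :: 'a lsq) = (if i = j then 1 else 0)" if "i \<in> F \<times> UNIV" "j \<in> F \<times> UNIV" for i j
      by (rule orthonormal_four_onb[OF assms(1)]) (use that assms(3) in auto)
    from orthonormal_residual(2)[OF _ this, of "F \<times> UNIV" u] assms(2)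
    have "(norm (u - (\<Sum>i\<in>F \<times> UNIV. (u \<bullet> four_onb \<kappa> i) *\<^sub>R four_onb \<kappa> i)))\<^sup>2 =
        (norm u)\<^sup>2 - (\<Sum>i\<in>F \<times> UNIV. (u \<bullet> four_onb \<kappa> i)\<^sup>2)" by simp
    then show ?thesis
      using zero_le_power2[of "norm (u - (\<Sum>i\<in>F \<times> UNIV. (u \<bullet> four_onb \<kappa> i) *\<^sub>R four_onb \<kappa> i))"] by linarith
  qed
  then show ?thesis
    unfolding sum_inner_four_onb[OF assms(1)] using cube_vol_pos[OF assms(1), where 'a = 'a] by (simp add: field_simps)
qed

lemma four_onb_support:
  fixes x :: "('a::euclidean_space \<Rightarrow> int) \<times> bool"
  shows "mul (indicator (cube \<kappa>)) (four_onb \<kappa> x) = four_onb \<kappa> x"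
proof -
  have b: "bmeas (indicator (cube \<kappa>) :: 'a \<Rightarrow> complex)" by (rule bmeas_compact_indicator[OF compact_cube])
  have "mul (indicator (cube \<kappa>)) (four \<kappa> k) = four \<kappa> k" for k :: "'a \<Rightarrow> int"
  proof -
    have s: "sqint (\<lambda>z. cnj (cube_char \<kappa> k z))" by (intro sqint_cnj sqint_cube_char)
    have "AE z in lebesgue. rep_lsq (mul (indicator (cube \<kappa>)) (four \<kappa> k)) z = rep_lsq (four \<kappa> k) z"
      using rep_mul[OF b, of "four \<kappa> k"] rep_abs_lsq[OF s] unfolding four_def
      by eventually_elim (simp add: cube_char_def indicator_def)
    then show ?thesis by (simp add: lsq_eq_iff)
  qed
  then show ?thesis
    unfolding four_onb_def by (simp add: mul_scaleR[OF b] mul_commute[OF b bmeas_const])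
qed

text \<open>The part of u orthogonal to the closed span is still supported in the cube and has only
  zero coefficients, so \<open>cube_char_complete\<close> removes it.\<close>

lemma span_four_onb_dense:
  fixes u :: "'a::euclidean_space lsq"
  assumes \<kappa>: "\<kappa> > 0" and supp: "mul (indicator (cube \<kappa>)) u = u"
  shows "u \<in> closure (span (four_onb \<kappa> ` (freqs \<times> UNIV)))"
proof -
  let ?V = "closure (span (four_onb \<kappa> ` (freqs \<times> UNIV))) :: 'a lsq set"
  have b: "bmeas (indicator (cube \<kappa>) :: 'a \<Rightarrow> complex)" by (rule bmeas_compact_indicator[OF compact_cube])
  have sub: "subspace ?V" by (intro closure_subspace subspace_span)
  obtain p where p: "p \<in> ?V" "\<And>v. v \<in> ?V \<Longrightarrow> (u - p) \<bullet> v = 0"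
    using orthogonal_projection_exists[OF closed_closure sub, of u] by blast
  let ?S = "{x. mul (indicator (cube \<kappa>)) x = (x :: 'a lsq)}"
  have "subspace ?S" unfolding subspace_def by (simp add: b mul_add mul_scaleR)
  moreover have "closed ?S"
  proof -
    have "continuous_on UNIV (mul (indicator (cube \<kappa>)) :: 'a lsq \<Rightarrow> _)"
      by (rule linear_continuous_on[OF bounded_linear_mul[OF b]])
    then show ?thesis by (intro closed_Collect_eq continuous_on_id)
  qed
  moreover have "four_onb \<kappa> ` (freqs \<times> UNIV) \<subseteq> ?S" by (auto simp: four_onb_support)
  ultimately have "?V \<subseteq> ?S" by (intro closure_minimal span_minimal)
  then have ps: "mul (indicator (cube \<kappa>)) (u - p) = u - p"
    using p(1) supp by (auto simp: mul_diff[OF b])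
  have "pr (u - p) (cube_char \<kappa> k) = 0" if k: "k \<in> freqs" for k
  proof -
    have "four_onb \<kappa> (k, c) \<in> ?V" for c
      by (intro subsetD[OF closure_subset] span_base imageI) (use k in simp)
    from p(2)[OF this] have "(u - p) \<bullet> four_onb \<kappa> (k, c) = 0" for c .
    from this[of True] this[of False] show ?thesis
      using cube_vol_pos[OF \<kappa>, where 'a = 'a] by (simp add: inner_four_onb complex_eq_iff)
  qed
  from cube_char_complete[OF \<kappa> ps this] have "u - p = 0" by simp
  then show ?thesis using p(1) by simp
qed

lemma Parseval_cube_char:
  fixes u :: "'a::euclidean_space lsq"
  assumes \<kappa>: "\<kappa> > 0" and supp: "mul (indicator (cube \<kappa>)) u = u" and e: "e > 0"
  obtains F where "finite F" "F \<subseteq> freqs" "cube_vol TYPE('a) \<kappa> * (norm u)\<^sup>2 \<le> (\<Sum>k\<in>F. (norm (pr u (cube_char \<kappa> k)))\<^sup>2) + e"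
proof -
  let ?V = "cube_vol TYPE('a) \<kappa>"
  have V: "?V > 0" by (rule cube_vol_pos[OF \<kappa>])
  have eV: "e / ?V > 0" using e V by simp
  obtain F where F: "finite F" "F \<subseteq> freqs \<times> UNIV" "(norm u)\<^sup>2 \<le> (\<Sum>i\<in>F. (u \<bullet> four_onb \<kappa> i)\<^sup>2) + e / ?V"
    using Parseval_approximation[OF orthonormal_four_onb[OF \<kappa>] span_four_onb_dense[OF \<kappa> supp] eV] by metis
  have fin: "finite (fst ` F)" using F(1) by simp
  have sub: "fst ` F \<subseteq> freqs" using F(2) by auto
  \<comment> \<open>F is enlarged so as to contain both real basis vectors of each of its
    frequencies; their two terms recombine to the squared modulus of one complex
    coefficient.\<close>
  have "(\<Sum>i\<in>F. (u \<bullet> four_onb \<kappa> i)\<^sup>2) \<le> (\<Sum>i\<in>fst ` F \<times> UNIV. (u \<bullet> four_onb \<kappa> i)\<^sup>2)"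
    by (rule sum_mono2) (use F in \<open>force+\<close>)
  also have "\<dots> = (\<Sum>k\<in>fst ` F. (norm (pr u (cube_char \<kappa> k)))\<^sup>2) / ?V" by (rule sum_inner_four_onb[OF \<kappa>])
  finally have "(norm u)\<^sup>2 \<le> ((\<Sum>k\<in>fst ` F. (norm (pr u (cube_char \<kappa> k)))\<^sup>2) + e) / ?V"
    using F(3) by (simp add: add_divide_distrib)
  then have "?V * (norm u)\<^sup>2 \<le> (\<Sum>k\<in>fst ` F. (norm (pr u (cube_char \<kappa> k)))\<^sup>2) + e"
    using V by (simp add: field_simps)
  then show thesis by (rule that[OF fin sub])
qed

lemma countable_freqs: "countable (freqs :: ('a::euclidean_space \<Rightarrow> int) set)"
  unfolding freqs_def by (intro countable_PiE finite_Basis) simp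

lemma norm_pr_cube_char_le:
  fixes u :: "'a::euclidean_space lsq"
  assumes "\<kappa> > 0" "k \<in> freqs"
  shows "norm (pr u (cube_char \<kappa> k)) \<le> sqrt (cube_vol TYPE('a) \<kappa>) * norm u"
proof -
  have "(norm (pr u (cube_char \<kappa> k)))\<^sup>2 \<le> cube_vol TYPE('a) \<kappa> * (norm u)\<^sup>2"
    using Bessel_cube_char[OF assms(1), of "{k}" u] assms(2) by simp
  also have "\<dots> = (sqrt (cube_vol TYPE('a) \<kappa>) * norm u)\<^sup>2"
    using cube_vol_pos[OF assms(1), where 'a = 'a] by (simp add: power_mult_distrib)
  finally show ?thesis
    by (rule power2_le_imp_le) (use cube_vol_pos[OF assms(1), where 'a = 'a] in simp)
qed

text \<open>A diagonal subsequence makes every Fourier coefficient converge. The weighted bound C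
  makes the coefficients of weight above N uniformly small in square sum, and only finitely many
  frequencies have weight at most N, so Parseval turns coefficientwise convergence into Cauchy
  sequences in norm.\<close>

theorem Rellich_cube:
  fixes x :: "nat \<Rightarrow> 'p \<Rightarrow> 'a::euclidean_space lsq" and w :: "('a \<Rightarrow> int) \<Rightarrow> real"
  assumes \<kappa>: "\<kappa> > 0" and P: "finite P"
    and supp: "\<And>n p. p \<in> P \<Longrightarrow> mul (indicator (cube \<kappa>)) (x n p) = x n p"
    and bdd: "\<And>n p. p \<in> P \<Longrightarrow> norm (x n p) \<le> B"
    and w: "\<And>N. finite {k \<in> freqs. w k \<le> N}"
    and C: "\<And>n p F. p \<in> P \<Longrightarrow> finite F \<Longrightarrow> F \<subseteq> freqs \<Longrightarrow> (\<Sum>k\<in>F. w k * (norm (pr (x n p) (cube_char \<kappa> k)))\<^sup>2) \<le> C"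
    and w0: "\<And>k. w k \<ge> 0"
  obtains r :: "nat \<Rightarrow> nat" where "strict_mono r" "\<And>p. p \<in> P \<Longrightarrow> Cauchy (\<lambda>n. x (r n) p)"
proof -
  let ?V = "cube_vol TYPE('a) \<kappa>"
  have V: "?V > 0" by (rule cube_vol_pos[OF \<kappa>])
  define c where "c n pk = pr (x n (fst pk)) (cube_char \<kappa> (snd pk))" for n pk
  have cb: "norm (c n pk) \<le> sqrt ?V * B" if "pk \<in> P \<times> freqs" for n pk
  proof -
    have "norm (c n pk) \<le> sqrt ?V * norm (x n (fst pk))"
      unfolding c_def by (rule norm_pr_cube_char_le[OF \<kappa>]) (use that in auto)
    also have "\<dots> \<le> sqrt ?V * B" by (intro mult_left_mono bdd) (use that V in auto)
    finally show ?thesis .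
  qed
  have cnt: "countable (P \<times> (freqs :: ('a \<Rightarrow> int) set))"
    using P countable_freqs by (intro countable_SIGMA) (auto intro: countable_finite)
  have "\<exists>r::nat \<Rightarrow> nat. strict_mono r \<and> (\<forall>pk\<in>P \<times> freqs. \<exists>l. (\<lambda>n. c (r n) pk) \<longlonglongrightarrow> l)"
  proof (rule function_convergent_subsequence[OF cnt, of c "sqrt ?V * B"])
    show "norm (c n pk) \<le> sqrt ?V * B" if "pk \<in> P \<times> freqs" for n pk by (rule cb[OF that])
  qed blast
  then obtain r :: "nat \<Rightarrow> nat" where r: "strict_mono r"
    "\<And>pk. pk \<in> P \<times> freqs \<Longrightarrow> \<exists>l. (\<lambda>n. c (r n) pk) \<longlonglongrightarrow> l" by blast
  have "Cauchy (\<lambda>n. x (r n) p)" if p: "p \<in> P" for p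
  proof (rule metric_CauchyI)
    fix \<epsilon> :: real assume \<epsilon>: "\<epsilon> > 0"
    \<comment> \<open>The low frequencies, the tail and the error in Parseval's formula contribute
      at most d each, and 3 d < 4 d = \<open>?V * \<epsilon>\<^sup>2\<close>.\<close>
    define d where "d = ?V * \<epsilon>\<^sup>2 / 4"
    have d: "d > 0" using V \<epsilon> by (simp add: d_def)
    \<comment> \<open>Above N the squared differences sum to at most (2 C + 2 C) / N, which is at
      most d; the 1 keeps N positive.\<close>
    define N where "N = (4 * \<bar>C\<bar> + 1) / d"
    have N: "N > 0" using d by (simp add: N_def add_nonneg_pos)
    define G where "G = {k \<in> freqs. w k \<le> N}"
    have fG: "finite G" "G \<subseteq> freqs" unfolding G_def using w by auto
    have "\<exists>l. (\<lambda>n. c (r n) (p, k)) \<longlonglongrightarrow> l" if "k \<in> G" for k using r(2)[of "(p, k)"] p that fG by auto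
    then obtain l where l: "\<And>k. k \<in> G \<Longrightarrow> (\<lambda>n. c (r n) (p, k)) \<longlonglongrightarrow> l k" by metis
    have "(\<lambda>n. \<Sum>k\<in>G. 2 * (norm (c (r n) (p, k) - l k))\<^sup>2) \<longlonglongrightarrow> (\<Sum>k\<in>G. 2 * (norm (l k - l k))\<^sup>2)"
      by (intro tendsto_intros l)
    then have "(\<lambda>n. \<Sum>k\<in>G. 2 * (norm (c (r n) (p, k) - l k))\<^sup>2) \<longlonglongrightarrow> 0" by simp
    from order_tendstoD(2)[OF this, of "d / 2"] d obtain M where
      M: "\<And>n. n \<ge> M \<Longrightarrow> (\<Sum>k\<in>G. 2 * (norm (c (r n) (p, k) - l k))\<^sup>2) < d / 2"
      by (auto simp: eventually_sequentially)
    have "dist (x (r m) p) (x (r n) p) < \<epsilon>" if mn: "m \<ge> M" "n \<ge> M" for m n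
    proof -
      let ?y = "x (r m) p - x (r n) p"
      have supy: "mul (indicator (cube \<kappa>)) ?y = ?y"
        by (simp add: mul_diff[OF bmeas_compact_indicator[OF compact_cube]] supp[OF p])
      obtain F where F: "finite F" "F \<subseteq> freqs" "?V * (norm ?y)\<^sup>2 \<le> (\<Sum>k\<in>F. (norm (pr ?y (cube_char \<kappa> k)))\<^sup>2) + d"
        using Parseval_cube_char[OF \<kappa> supy d] by metis
      have ck: "pr ?y (cube_char \<kappa> k) = c (r m) (p, k) - c (r n) (p, k)" for k
        by (simp add: c_def pr_diff[OF sqint_cube_char])
      have sq: "(norm (a - b :: complex))\<^sup>2 \<le> 2 * (norm (a - e))\<^sup>2 + 2 * (norm (b - e))\<^sup>2" for a b e
      proof -
        have "(norm (a - b))\<^sup>2 \<le> (norm (a - e) + norm (b - e))\<^sup>2"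
          using norm_triangle_ineq4[of "a - e" "b - e"] by (intro power_mono) auto
        also have "\<dots> \<le> 2 * (norm (a - e))\<^sup>2 + 2 * (norm (b - e))\<^sup>2"
          using zero_le_power2[of "norm (a - e) - norm (b - e)"] by (simp add: power2_eq_square algebra_simps)
        finally show ?thesis .
      qed
      have "(\<Sum>k\<in>F. (norm (pr ?y (cube_char \<kappa> k)))\<^sup>2) \<le> (\<Sum>k\<in>G \<union> (F - G). (norm (pr ?y (cube_char \<kappa> k)))\<^sup>2)"
        by (rule sum_mono2) (use fG F in auto)
      also have "\<dots> = (\<Sum>k\<in>G. (norm (pr ?y (cube_char \<kappa> k)))\<^sup>2) + (\<Sum>k\<in>F - G. (norm (pr ?y (cube_char \<kappa> k)))\<^sup>2)"
        by (rule sum.union_disjoint) (use fG F in auto)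
      also have "(\<Sum>k\<in>G. (norm (pr ?y (cube_char \<kappa> k)))\<^sup>2) < d"
      proof -
        have "(\<Sum>k\<in>G. (norm (pr ?y (cube_char \<kappa> k)))\<^sup>2) \<le>
          (\<Sum>k\<in>G. 2 * (norm (c (r m) (p, k) - l k))\<^sup>2 + 2 * (norm (c (r n) (p, k) - l k))\<^sup>2)"
          unfolding ck by (intro sum_mono sq)
        also have "\<dots> < d" unfolding sum.distrib using M[OF mn(1)] M[OF mn(2)] by linarith
        finally show ?thesis .
      qed
      also have "(\<Sum>k\<in>F - G. (norm (pr ?y (cube_char \<kappa> k)))\<^sup>2) \<le> d"
      proof -
        have "(\<Sum>k\<in>F - G. (norm (pr ?y (cube_char \<kappa> k)))\<^sup>2) \<le>
          (\<Sum>k\<in>F - G. (1 / N) * (2 * (w k * (norm (c (r m) (p, k)))\<^sup>2) + 2 * (w k * (norm (c (r n) (p, k)))\<^sup>2)))"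
        proof (rule sum_mono)
          fix k assume k: "k \<in> F - G"
          then have wk: "w k > N" using F(2) by (auto simp: G_def)
          have "N * (norm (pr ?y (cube_char \<kappa> k)))\<^sup>2 \<le> w k * (2 * (norm (c (r m) (p, k)))\<^sup>2 + 2 * (norm (c (r n) (p, k)))\<^sup>2)"
            using wk N sq[of "c (r m) (p, k)" "c (r n) (p, k)" 0] unfolding ck by (intro mult_mono) auto
          then show "(norm (pr ?y (cube_char \<kappa> k)))\<^sup>2 \<le> (1 / N) * (2 * (w k * (norm (c (r m) (p, k)))\<^sup>2) + 2 * (w k * (norm (c (r n) (p, k)))\<^sup>2))"
            using N by (simp add: field_simps)
        qed
        also have "\<dots> = (1 / N) * (2 * (\<Sum>k\<in>F - G. w k * (norm (c (r m) (p, k)))\<^sup>2) + 2 * (\<Sum>k\<in>F - G. w k * (norm (c (r n) (p, k)))\<^sup>2))"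
          by (simp only: sum_distrib_left[symmetric] sum.distrib)
        also have "\<dots> \<le> (1 / N) * (2 * C + 2 * C)"
          using C[OF p, of "F - G"] F N unfolding c_def fst_conv snd_conv
          by (intro mult_left_mono add_mono) auto
        also have "\<dots> \<le> (1 / N) * (4 * \<bar>C\<bar> + 1)" using N by (intro mult_left_mono) auto
        also have "\<dots> = d" using d by (simp add: N_def add_nonneg_eq_0_iff)
        finally show ?thesis .
      qed
      finally have "?V * (norm ?y)\<^sup>2 < 3 * d" using F(3) by simp
      also have "\<dots> < ?V * \<epsilon>\<^sup>2" using V \<epsilon> by (simp add: d_def)
      finally have "(norm ?y)\<^sup>2 < \<epsilon>\<^sup>2" using V by simp
      then show ?thesis using \<epsilon> by (simp add: dist_norm power2_less_imp_less)
    qed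
    then show "\<exists>M. \<forall>m\<ge>M. \<forall>n\<ge>M. dist (x (r m) p) (x (r n) p) < \<epsilon>" by blast
  qed
  with r(1) that show thesis by blast
qed

section \<open>Exterior algebra and the twisted operator\<close>

type_synonym ('n, 'v) family = "'n set \<times> 'n set \<Rightarrow> 'v"

text \<open>The sign of moving dz_i into its place in dz^I. It is a real number, so that it acts on
  families with values in any real vector space.\<close>

definition sgnl :: "'n::linorder \<Rightarrow> 'n set \<Rightarrow> real" where
  "sgnl i I = (-1) ^ card {l\<in>I. l < i}"

text \<open>On coefficient families, \<open>ext i\<close> and \<open>extb j\<close> are the exterior products with \<open>dz\<^sub>i\<close> and \<open>dzbar\<^sub>j\<close>; \<open>con i\<close> and
  \<open>conb j\<close> are their adjoints.\<close>

definition ext :: "'n::{finite,linorder} \<Rightarrow> ('n, 'v::real_vector) family \<Rightarrow> ('n, 'v) family" where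
  "ext i c p = (if i \<in> fst p then sgnl i (fst p) *\<^sub>R c (fst p - {i}, snd p) else 0)"

definition con :: "'n::{finite,linorder} \<Rightarrow> ('n, 'v::real_vector) family \<Rightarrow> ('n, 'v) family" where
  "con i c p = (if i \<in> fst p then 0 else sgnl i (fst p) *\<^sub>R c (insert i (fst p), snd p))"

definition extb :: "'n::{finite,linorder} \<Rightarrow> ('n, 'v::real_vector) family \<Rightarrow> ('n, 'v) family" where
  "extb j c p = (if j \<in> snd p then ((-1) ^ card (fst p) * sgnl j (snd p)) *\<^sub>R c (fst p, snd p - {j}) else 0)"

definition conb :: "'n::{finite,linorder} \<Rightarrow> ('n, 'v::real_vector) family \<Rightarrow> ('n, 'v) family" where
  "conb j c p = (if j \<in> snd p then 0 else ((-1) ^ card (fst p) * sgnl j (snd p)) *\<^sub>R c (fst p, insert j (snd p)))"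

lemmas car_defs = ext_def con_def extb_def conb_def

section \<open>Anticommutation relations\<close>

lemma sgnl_remove_self: "sgnl i (I - {i}) = sgnl i I"
  unfolding sgnl_def by (rule arg_cong[of _ _ "\<lambda>S. (-1) ^ card S"]) auto

lemma sgnl_insert_self: "sgnl i (insert i I) = sgnl i I"
  unfolding sgnl_def by (rule arg_cong[of _ _ "\<lambda>S. (-1) ^ card S"]) auto

lemma sgnl_insert:
  fixes l :: "'n::{finite,linorder}"
  assumes "l \<notin> I" shows "sgnl i (insert l I) = (if l < i then - sgnl i I else sgnl i I)"
proof (cases "l < i")
  case True
  then have "{k \<in> insert l I. k < i} = insert l {k \<in> I. k < i}" by auto
  then show ?thesis using True assms by (simp add: sgnl_def)
next
  case False
  then have "{k \<in> insert l I. k < i} = {k \<in> I. k < i}" by auto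
  then show ?thesis using False by (simp add: sgnl_def)
qed

lemma sgnl_remove:
  fixes l :: "'n::{finite,linorder}"
  assumes "l \<in> I" shows "sgnl i (I - {l}) = (if l < i then - sgnl i I else sgnl i I)"
proof -
  have "sgnl i (insert l (I - {l})) = (if l < i then - sgnl i (I - {l}) else sgnl i (I - {l}))"
    by (rule sgnl_insert) simp
  moreover have "insert l (I - {l}) = I" using assms by auto
  ultimately show ?thesis by (auto split: if_splits)
qed

lemma sgnl_square [simp]: "sgnl i I * sgnl i I = 1"
  by (simp add: sgnl_def flip: power_mult_distrib)

lemma card_insert_parity: "(-1::real) ^ card (insert i (I::'n::finite set)) = (if i \<in> I then (-1) ^ card I else - ((-1) ^ card I))"
  by (auto simp: insert_absorb)

lemma card_remove_parity: "(-1::real) ^ card ((I::'n::finite set) - {i}) = (if i \<in> I then - ((-1) ^ card I) else (-1) ^ card I)"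
proof (cases "i \<in> I")
  case True
  then have "card I = Suc (card (I - {i}))" by (metis card.remove finite)
  then have e: "(-1::real) ^ card I = - ((-1) ^ card (I - {i}))" by (metis mult_minus1 power_Suc)
  show ?thesis unfolding if_P[OF True] e by simp
qed simp

text \<open>For i \<noteq> l exactly one of the two signs changes when the other index is removed,
  because exactly one of i < l and l < i holds. The same count governs \<open>ext_con\<close>,
  \<open>extb_extb\<close> and \<open>extb_conb\<close>.\<close>

lemma ext_ext: "ext i (ext l c) p = - ext l (ext i c) p"
proof (cases "i = l")
  case False
  have lt: "l < i \<longleftrightarrow> \<not> i < l" using False by auto
  obtain I J where p: "p = (I, J)" by (cases p)
  have e: "I - {l} - {i} = I - {i} - {l}" by auto
  show ?thesis
    using False by (cases "i < l") (simp_all add: ext_def p e sgnl_remove lt mult.commute del: Diff_iff, auto)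
qed (simp add: ext_def)

text \<open>For i = l just one of the two terms survives, depending on whether i occurs in the index
  set. Through this relation contraction with g and the product with \<partial>f combine to
  multiplication by \<Sum> g_i f_i.\<close>

lemma ext_con: "ext i (con l c) p + con l (ext i c) p = (if i = l then c p else 0)"
proof (cases "i = l")
  case True
  obtain I J where p: "p = (I, J)" by (cases p)
  show ?thesis
    using True by (simp add: ext_def con_def p sgnl_remove_self sgnl_insert_self insert_absorb)
next
  case False
  have lt: "l < i \<longleftrightarrow> \<not> i < l" using False by auto
  obtain I J where p: "p = (I, J)" by (cases p)
  have e: "insert l I - {i} = insert l (I - {i})" using False by auto
  show ?thesis
    using False by (cases "i < l") (simp_all add: ext_def con_def p e sgnl_insert sgnl_remove lt mult.commute)
qed

lemma extb_extb: "extb i (extb l c) p = - extb l (extb i c) p"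
proof (cases "i = l")
  case False
  have lt: "l < i \<longleftrightarrow> \<not> i < l" using False by auto
  obtain I J where p: "p = (I, J)" by (cases p)
  have e: "J - {l} - {i} = J - {i} - {l}" by auto
  show ?thesis
    using False by (cases "i < l") (simp_all add: extb_def p e sgnl_remove lt mult_ac del: Diff_iff, auto)
qed (simp add: extb_def)

text \<open>The Clifford relation behind ellipticity: it makes the symbol of dbar together with that
  of its adjoint invertible in \<open>symbol_estimate\<close>.\<close>

lemma extb_conb: "extb i (conb l c) p + conb l (extb i c) p = (if i = l then c p else 0)"
proof (cases "i = l")
  case True
  obtain I J where p: "p = (I, J)" by (cases p)
  show ?thesis
    using True by (simp add: extb_def conb_def p sgnl_remove_self sgnl_insert_self insert_absorb mult_ac)
next
  case False
  have lt: "l < i \<longleftrightarrow> \<not> i < l" using False by auto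
  obtain I J where p: "p = (I, J)" by (cases p)
  have e: "insert l J - {i} = insert l (J - {i})" using False by auto
  show ?thesis
    using False by (cases "i < l") (simp_all add: extb_def conb_def p e sgnl_insert sgnl_remove lt mult_ac)
qed

text \<open>In its place in dz^I dzbar^J, dzbar_j has passed all of dz^I, so changing I by one index
  reverses the sign.\<close>

lemma ext_extb: "ext i (extb j c) p = - extb j (ext i c) p"
  by (simp add: ext_def extb_def card_remove_parity mult_ac del: card_Diff_insert card_Diff_singleton_if)

lemma con_extb: "con i (extb j c) p = - extb j (con i c) p"
  by (simp add: con_def extb_def card_insert_parity mult_ac del: card_insert_if card.insert card_insert_disjoint)

definition family_linear :: "(('n::{finite,linorder}, 'v::real_vector) family \<Rightarrow> ('n, 'v) family) \<Rightarrow> bool" where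
  "family_linear T \<longleftrightarrow> (\<forall>c d p. T (\<lambda>q. c q + d q) p = T c p + T d p) \<and> (\<forall>r c p. T (\<lambda>q. r *\<^sub>R c q) p = r *\<^sub>R T c p)"

lemma family_linear_car: "family_linear (ext i)" "family_linear (con i)" "family_linear (extb i)" "family_linear (conb i)"
  by (auto simp: family_linear_def car_defs algebra_simps)

lemma family_linear_add: "family_linear T \<Longrightarrow> T (\<lambda>q. c q + d q) p = T c p + T d p"
  unfolding family_linear_def by blast

lemma family_linear_scale: "family_linear T \<Longrightarrow> T (\<lambda>q. r *\<^sub>R c q) p = r *\<^sub>R T c p"
  unfolding family_linear_def by blast

lemma family_linear_uminus: "family_linear T \<Longrightarrow> T (\<lambda>q. - c q) p = - T c p"
  using family_linear_scale[of T "-1" c p] by simp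

lemma family_linear_diff: "family_linear T \<Longrightarrow> T (\<lambda>q. c q - d q) p = T c p - T d p"
  using family_linear_add[of T c "\<lambda>q. - d q" p] by (simp add: family_linear_uminus)

lemma family_linear_0: "family_linear T \<Longrightarrow> T (\<lambda>q. 0) p = 0"
  using family_linear_scale[of T 0 "\<lambda>q. 0" p] by simp

lemma family_linear_sum: "family_linear T \<Longrightarrow> T (\<lambda>q. \<Sum>i\<in>S. c i q) p = (\<Sum>i\<in>S. T (c i) p)"
proof (induction S rule: infinite_finite_induct)
  case (insert x S)
  then show ?case using family_linear_add[of T "c x" "\<lambda>q. \<Sum>i\<in>S. c i q" p] by simp
qed (simp_all add: family_linear_0)

text \<open>The four operators only move components and multiply them by 0 or a real sign, so they
  commute with every real linear map on the values, such as multiplication by a complex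
  number.\<close>

lemma car_comp_linear:
  assumes "linear L"
  shows "ext i (\<lambda>q. L (c q)) p = L (ext i c p)" "con i (\<lambda>q. L (c q)) p = L (con i c p)"
    "extb i (\<lambda>q. L (c q)) p = L (extb i c p)" "conb i (\<lambda>q. L (c q)) p = L (conb i c p)"
  by (auto simp: car_defs linear_cmul[OF assms] linear_0[OF assms])

lemma norm_sgnl [simp]: "\<bar>sgnl i I\<bar> = 1"
  by (simp add: sgnl_def power_abs)

lemma norm_parity [simp]: "\<bar>(-1::real) ^ n * sgnl i I\<bar> = 1"
  by (simp add: abs_mult power_abs)

lemma norm_car_le:
  fixes c :: "('n::{finite,linorder}, 'v::real_normed_vector) family"
  assumes "\<And>q. norm (c q) \<le> B"
  shows "norm (ext i c p) \<le> B" "norm (con i c p) \<le> B" "norm (extb i c p) \<le> B" "norm (conb i c p) \<le> B"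
proof -
  have B: "B \<ge> 0" using assms norm_ge_zero order_trans by blast
  show "norm (ext i c p) \<le> B" "norm (con i c p) \<le> B" "norm (extb i c p) \<le> B" "norm (conb i c p) \<le> B"
    using assms B by (auto simp: car_defs)
qed

section \<open>The maximal operator on families of square integrable coefficients\<close>

type_synonym 'n cn = "(complex, 'n) vec"

text \<open>The component at \<open>(I, J)\<close> is the coefficient of \<open>dz\<^sup>I \<and> dzbar\<^sup>J\<close>.\<close>

type_synonym 'n hf = "((complex, 'n) vec lsq, 'n set \<times> 'n set) vec"

definition P :: "'n::{finite,linorder} hf \<Rightarrow> ('n cn \<Rightarrow> complex) \<Rightarrow> ('n, complex) family" where
  "P u \<theta> q = pr (u $ q) \<theta>"

lemma P_add: "sqint \<theta> \<Longrightarrow> P (u + v) \<theta> q = P u \<theta> q + P v \<theta> q"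
  by (simp add: P_def pr_add)

lemma P_diff: "sqint \<theta> \<Longrightarrow> P (u - v) \<theta> q = P u \<theta> q - P v \<theta> q"
  by (simp add: P_def pr_diff)

lemma P_scaleR: "sqint \<theta> \<Longrightarrow> P (r *\<^sub>R u) \<theta> q = r *\<^sub>R P u \<theta> q"
  by (simp only: P_def vector_scaleR_component pr_scaleR)

lemma P_0: "sqint \<theta> \<Longrightarrow> P 0 \<theta> q = 0"
  by (simp add: P_def)

text \<open>Extension by zero is written as a fixed-point condition for a bounded operator, which
  exhibits the forms on D as a closed subspace of one fixed Hilbert space.\<close>

definition supported :: "('n::{finite,linorder} cn) set \<Rightarrow> 'n hf set" where
  "supported D = {u. \<forall>p. mul (indicator D) (u $ p) = u $ p}"

lemma supportedD: "u \<in> supported D \<Longrightarrow> mul (indicator D) (u $ p) = u $ p"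
  unfolding supported_def by blast

lemma supportedI: "(\<And>p. mul (indicator D) (u $ p) = u $ p) \<Longrightarrow> u \<in> supported D"
  unfolding supported_def by blast

text \<open>With \<open>F i = f\<^sub>i\<close>, \<open>wd\<close> is the graph of the maximal extension of \<open>dbar\<^sub>f\<close>, with derivatives moved to the test
  function.\<close>

definition wsum :: "('n::{finite,linorder} cn \<Rightarrow> complex) \<Rightarrow> ('n \<Rightarrow> 'n cn \<Rightarrow> complex) \<Rightarrow> 'n hf \<Rightarrow> ('n, complex) family" where
  "wsum \<theta> F u p = (\<Sum>i\<in>UNIV. ext i (P u (\<lambda>z. F i z * \<theta> z)) p) - (\<Sum>j\<in>UNIV. extb j (P u (d_zbar j \<theta>)) p)"

definition wd :: "('n::{finite,linorder} cn) set \<Rightarrow> ('n \<Rightarrow> 'n cn \<Rightarrow> complex) \<Rightarrow> 'n hf \<Rightarrow> 'n hf \<Rightarrow> bool" where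
  "wd D F u w \<longleftrightarrow> u \<in> supported D \<and> w \<in> supported D \<and>
     (\<forall>\<theta> p. test_function D \<theta> \<longrightarrow> P w \<theta> p = wsum \<theta> F u p)"

text \<open>F abstracts the partial derivatives of f. The square of the operator dbar + F is 0
  because each F i is holomorphic and the exterior square of a one-form vanishes.\<close>

locale twisted =
  fixes D :: "('n::{finite,linorder} cn) set" and F :: "'n \<Rightarrow> 'n cn \<Rightarrow> complex"
  assumes D_open: "open D" and D_bounded: "bounded D"
    and F_hol: "\<And>i. holomorphic_cn (F i) D" and F_bdd: "\<And>i. \<exists>B. \<forall>z\<in>D. cmod (F i z) \<le> B"
begin

text \<open>Coefficients such as f_i and g_i are controlled on D only; cutting to 0 outside turns
  them into bounded multipliers on the whole space, without effect on pairings with test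
  functions.\<close>

definition cut :: "('n cn \<Rightarrow> complex) \<Rightarrow> 'n cn \<Rightarrow> complex" where
  "cut b z = (if z \<in> D then b z else 0)"

definition nice :: "('n cn \<Rightarrow> complex) \<Rightarrow> bool" where
  "nice b \<longleftrightarrow> continuous_on D b \<and> (\<exists>B. \<forall>z\<in>D. cmod (b z) \<le> B)"

lemma bmeas_ind: "bmeas (indicator D :: _ \<Rightarrow> complex)"
  using D_open by (intro bmeas_indicator) auto

lemma nice_bmeas: "nice b \<Longrightarrow> bmeas (cut b)"
proof -
  assume b: "nice b"
  then obtain B where B: "\<forall>z\<in>D. cmod (b z) \<le> B" unfolding nice_def by blast
  have "(\<lambda>z. if z \<in> D then b z else 0) \<in> borel_measurable borel"
    using b D_open unfolding nice_def by (intro borel_measurable_continuous_on_if continuous_on_const) auto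
  then have "cut b \<in> borel_measurable lebesgue"
    unfolding cut_def[abs_def] by (intro measurable_completion) simp
  then show ?thesis by (rule bmeasI[where B = "\<bar>B\<bar>"]) (use B in \<open>auto simp: cut_def intro: order_trans\<close>)
qed

lemma nice_mult: "nice b \<Longrightarrow> nice c \<Longrightarrow> nice (\<lambda>z. b z * c z)"
  unfolding nice_def by (auto simp: norm_mult intro!: continuous_intros) (meson mult_mono' norm_ge_zero)

lemma nice_F: "nice (F i)"
  unfolding nice_def using F_bdd holomorphic_cn_continuous_on[OF F_hol] by blast

lemma cut_test: "test_function D \<theta> \<Longrightarrow> cut b z * \<theta> z = b z * \<theta> z"
  using test_function_outside[of D \<theta> z] by (auto simp: cut_def)

lemma F_smooth: "smooth_on D (F i)"
  by (rule holomorphic_cn_imp_smooth_on[OF D_open F_hol])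

lemma test_F: "test_function D \<theta> \<Longrightarrow> test_function D (\<lambda>z. F i z * \<theta> z)"
  by (rule test_function_mult[OF D_open F_smooth])

lemma d_zbar_F:
  assumes "test_function D \<theta>"
  shows "d_zbar j (\<lambda>z. F i z * \<theta> z) = (\<lambda>z. F i z * d_zbar j \<theta> z)"
proof
  fix z
  show "d_zbar j (\<lambda>z. F i z * \<theta> z) z = F i z * d_zbar j \<theta> z"
  proof (cases "z \<in> D")
    case True
    then show ?thesis by (rule d_zbar_holomorphic_mult[OF F_hol _ test_function_differentiable[OF assms]])
  next
    case False
    then show ?thesis
      using test_function_outside[OF test_function_d_zbar[OF test_F[OF assms]]] test_function_outside[OF test_function_d_zbar[OF assms]] by simp
  qed
qed

lemma d_zbar_smooth_mult:
  assumes "test_function D \<theta>" "smooth_on D g"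
  shows "d_zbar j (\<lambda>z. g z * \<theta> z) = (\<lambda>z. g z * d_zbar j \<theta> z + d_zbar j g z * \<theta> z)"
proof
  fix z
  show "d_zbar j (\<lambda>z. g z * \<theta> z) z = g z * d_zbar j \<theta> z + d_zbar j g z * \<theta> z"
  proof (cases "z \<in> D")
    case True
    show ?thesis by (rule d_zbar_mult[OF smooth_on_differentiable[OF assms(2) True] test_function_differentiable[OF assms(1)]])
  next
    case False
    then show ?thesis
      using test_function_outside[OF test_function_d_zbar[OF test_function_mult[OF D_open assms(2,1)]]]
       test_function_outside[OF test_function_d_zbar[OF assms(1)]] test_function_outside[OF assms(1)] by simp
  qed
qed

lemma P_add_right: "test_function D \<theta> \<Longrightarrow> test_function D \<theta>' \<Longrightarrow> P u (\<lambda>z. \<theta> z + \<theta>' z) = (\<lambda>q. P u \<theta> q + P u \<theta>' q)"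
  by (auto simp: P_def pr_add_right test_function_sqint)

lemma subspace_supported: "subspace (supported D)"
  unfolding subspace_def supported_def by (simp add: bmeas_ind mul_add mul_scaleR)

lemma closed_supported: "closed (supported D)"
proof -
  have "supported D = (\<Inter>p. {u. mul (indicator D) (u $ p) = u $ p})" by (auto simp: supported_def)
  moreover have "closed {u :: 'n hf. mul (indicator D) (u $ p) = u $ p}" for p
    by (intro closed_Collect_eq bounded_linear.continuous_on[OF bounded_linear_mul[OF bmeas_ind]] continuous_intros)
  ultimately show ?thesis by auto
qed

lemma supported_mul:
  assumes "bmeas b" "mul (indicator D) v = v"
  shows "mul (indicator D) (mul b v) = mul b v"
  by (subst mul_commute[OF bmeas_ind assms(1)]) (simp add: assms(2))

lemma car_supported:
  assumes "\<And>q. mul (indicator D) (c q) = c q"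
  shows "mul (indicator D) (ext i c p) = ext i c p" "mul (indicator D) (con i c p) = con i c p"
    "mul (indicator D) (extb i c p) = extb i c p" "mul (indicator D) (conb i c p) = conb i c p"
  using assms by (auto simp: car_defs mul_scaleR[OF bmeas_ind] bmeas_ind)

lemma wsum_linear:
  assumes "test_function D \<theta>"
  shows "wsum \<theta> F (u + v) p = wsum \<theta> F u p + wsum \<theta> F v p" "wsum \<theta> F (r *\<^sub>R u) p = r *\<^sub>R wsum \<theta> F u p"
proof -
  have 1: "P (u + v) \<theta>' = (\<lambda>q. P u \<theta>' q + P v \<theta>' q)" "P (r *\<^sub>R u) \<theta>' = (\<lambda>q. r *\<^sub>R P u \<theta>' q)" if "test_function D \<theta>'" for \<theta>'
    using test_function_sqint[OF that] by (auto simp: P_add P_scaleR simp del: scaleR_conv_of_real)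
  note t = 1[OF test_F[OF assms]] 1[OF test_function_d_zbar[OF assms]]
  show "wsum \<theta> F (u + v) p = wsum \<theta> F u p + wsum \<theta> F v p"
    unfolding wsum_def t by (simp add: family_linear_add family_linear_car sum.distrib)
  show "wsum \<theta> F (r *\<^sub>R u) p = r *\<^sub>R wsum \<theta> F u p"
    unfolding wsum_def t by (simp only: family_linear_scale family_linear_car scaleR_right.sum[symmetric] scaleR_right_diff_distrib)
qed

lemma wd_0: "wd D F 0 0"
  unfolding wd_def using subspace_0[OF subspace_supported] wsum_linear(2)[of _ 0 0] by (auto simp: P_0 test_function_sqint)

lemma wd_add: "wd D F u w \<Longrightarrow> wd D F u' w' \<Longrightarrow> wd D F (u + u') (w + w')"
  unfolding wd_def using subspace_add[OF subspace_supported] by (auto simp: P_add test_function_sqint wsum_linear)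

lemma wd_scaleR: "wd D F u w \<Longrightarrow> wd D F (r *\<^sub>R u) (r *\<^sub>R w)"
  unfolding wd_def using subspace_scale[OF subspace_supported]
  by (auto simp: P_scaleR test_function_sqint wsum_linear simp del: scaleR_conv_of_real)

text \<open>For a fixed test function both sides of the weak equation are continuous in u and w, so
  the maximal operator is closed.\<close>

lemma wd_limit:
  assumes "\<And>n. wd D F (us n) (ws n)" "us \<longlonglongrightarrow> u" "ws \<longlonglongrightarrow> w"
  shows "wd D F u w"
  unfolding wd_def
proof (intro conjI allI impI)
  show "u \<in> supported D" "w \<in> supported D"
    using closed_sequentially[OF closed_supported] assms unfolding wd_def by blast+
  fix \<theta> p assume \<theta>: "test_function D \<theta>"
  have lim: "(\<lambda>n. P (vs n) \<theta>' q) \<longlonglongrightarrow> P v \<theta>' q" if "test_function D \<theta>'" "vs \<longlonglongrightarrow> v" for vs v \<theta>' q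
    unfolding P_def
    by (intro bounded_linear.tendsto[OF pr_bounded_linear[OF test_function_sqint[OF that(1)]]] tendsto_vec_nth that(2))
  have carlim: "(\<lambda>n. ext i (cs n) p) \<longlonglongrightarrow> ext i c p" "(\<lambda>n. extb i (cs n) p) \<longlonglongrightarrow> extb i c p"
    if "\<And>q. (\<lambda>n. cs n q) \<longlonglongrightarrow> c q" for cs :: "nat \<Rightarrow> ('n, complex) family" and c i p
    using that by (auto simp: car_defs intro!: tendsto_intros)
  have "(\<lambda>n. wsum \<theta> F (us n) p) \<longlonglongrightarrow> wsum \<theta> F u p"
    unfolding wsum_def by (intro tendsto_intros carlim lim test_F test_function_d_zbar \<theta> assms(2))
  moreover have "(\<lambda>n. P (ws n) \<theta> p) \<longlonglongrightarrow> P w \<theta> p" by (rule lim[OF \<theta> assms(3)])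
  moreover have "P (ws n) \<theta> p = wsum \<theta> F (us n) p" for n using assms(1)[of n] \<theta> unfolding wd_def by blast
  ultimately show "P w \<theta> p = wsum \<theta> F u p" using LIMSEQ_unique by simp
qed

text \<open>Pairings of w with F i \<theta> and with the derivatives of \<theta> are rewritten as
  pairings of u, since these are test functions again. Double exterior products are antisymmetric
  while their coefficients are symmetric, and the mixed terms cancel because F i passes through
  d/dzbar_j.\<close>

lemma wd_square:
  assumes "wd D F u w" shows "wd D F w 0"
  unfolding wd_def
proof (intro conjI allI impI)
  show "w \<in> supported D" using assms by (simp add: wd_def)
  show "0 \<in> supported D" by (rule subspace_0[OF subspace_supported])
  fix \<theta> p assume \<theta>: "test_function D \<theta>"
  have Pw: "P w \<theta>' = (\<lambda>q. wsum \<theta>' F u q)" if "test_function D \<theta>'" for \<theta>'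
    using assms that by (auto simp: wd_def)
  let ?EE = "\<Sum>i\<in>UNIV. \<Sum>l\<in>UNIV. ext i (ext l (P u (\<lambda>z. F l z * (F i z * \<theta> z)))) p"
  let ?EB = "\<Sum>i\<in>UNIV. \<Sum>j\<in>UNIV. ext i (extb j (P u (\<lambda>z. F i z * d_zbar j \<theta> z))) p"
  let ?BE = "\<Sum>j\<in>UNIV. \<Sum>i\<in>UNIV. extb j (ext i (P u (\<lambda>z. F i z * d_zbar j \<theta> z))) p"
  let ?BB = "\<Sum>j\<in>UNIV. \<Sum>l\<in>UNIV. extb j (extb l (P u (d_zbar l (d_zbar j \<theta>)))) p"
  have "wsum \<theta> F w p = (?EE - ?EB) - (?BE - ?BB)"
    unfolding wsum_def[of \<theta> F w] Pw[OF test_F[OF \<theta>]] Pw[OF test_function_d_zbar[OF \<theta>]]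
    unfolding wsum_def d_zbar_F[OF \<theta>]
    by (simp only: family_linear_diff[OF family_linear_car(1)] family_linear_diff[OF family_linear_car(3)]
        family_linear_sum[OF family_linear_car(1)] family_linear_sum[OF family_linear_car(3)] sum_subtractf)
  moreover have anti: "(\<Sum>i\<in>UNIV. \<Sum>l\<in>UNIV. A i l) = 0" if "\<And>i l. A i l = - A l i" for A :: "'n \<Rightarrow> 'n \<Rightarrow> complex"
  proof -
    have "(\<Sum>i\<in>UNIV. \<Sum>l\<in>UNIV. A i l) = (\<Sum>i\<in>UNIV. \<Sum>l\<in>UNIV. - A l i)" using that by (intro sum.cong refl)
    also have "\<dots> = - (\<Sum>i\<in>UNIV. \<Sum>l\<in>UNIV. A l i)" by (simp add: sum_negf)
    also have "(\<Sum>i\<in>UNIV. \<Sum>l\<in>UNIV. A l i) = (\<Sum>i\<in>UNIV. \<Sum>l\<in>UNIV. A i l)" by (rule sum.swap)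
    finally show ?thesis by (simp add: eq_neg_iff_add_eq_0 flip: mult_2)
  qed
  have "?EE = 0"
  proof (rule anti)
    fix i l :: 'n
    have "(\<lambda>z. F l z * (F i z * \<theta> z)) = (\<lambda>z. F i z * (F l z * \<theta> z))" by (simp add: mult.left_commute)
    then show "ext i (ext l (P u (\<lambda>z. F l z * (F i z * \<theta> z)))) p = - ext l (ext i (P u (\<lambda>z. F i z * (F l z * \<theta> z)))) p"
      by (simp only: ext_ext[of i l])
  qed
  moreover have "?BB = 0"
  proof (rule anti)
    fix i l :: 'n
    have "d_zbar l (d_zbar i \<theta>) = d_zbar i (d_zbar l \<theta>)"
      by (rule ext) (rule d_zbar_commute[OF test_function_smooth[OF \<theta>]])
    then show "extb i (extb l (P u (d_zbar l (d_zbar i \<theta>)))) p = - extb l (extb i (P u (d_zbar i (d_zbar l \<theta>)))) p"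
      by (simp only: extb_extb[of i l])
  qed
  moreover have "?EB = - ?BE"
    by (subst sum.swap) (simp only: ext_extb sum_negf)
  ultimately show "P 0 \<theta> p = wsum \<theta> F w p" by (simp add: P_0 test_function_sqint[OF \<theta>])
qed

end

section \<open>The homotopy off the critical points\<close>

lemma norm_vec_le_sum:
  fixes x :: "('b::real_normed_vector, 'm::finite) vec"
  shows "norm x \<le> (\<Sum>p\<in>UNIV. norm (x $ p))"
  unfolding norm_vec_def by (rule L2_set_le_sum) simp

lemma bounded_linear_vec_lambda:
  fixes T :: "'m::finite \<Rightarrow> 'x::real_normed_vector \<Rightarrow> 'b::real_normed_vector"
  assumes "\<And>p. bounded_linear (T p)"
  shows "bounded_linear (\<lambda>u. \<chi> p. T p u)"
proof -
  obtain B where B: "\<And>p u. norm (T p u) \<le> norm u * B p"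
    using bounded_linear.bounded[OF assms] by metis
  show ?thesis
  proof (rule bounded_linear_intro[of _ "\<Sum>p\<in>UNIV. B p"])
    fix u v :: 'x and r :: real
    show "(\<chi> p. T p (u + v)) = (\<chi> p. T p u) + (\<chi> p. T p v)"
      by (simp add: vec_eq_iff linear_add[OF bounded_linear.linear[OF assms]])
    show "(\<chi> p. T p (r *\<^sub>R u)) = r *\<^sub>R (\<chi> p. T p u)"
      by (simp add: vec_eq_iff linear_cmul[OF bounded_linear.linear[OF assms]])
    have "norm (\<chi> p. T p u) \<le> (\<Sum>p\<in>UNIV. norm (T p u))" using norm_vec_le_sum[of "\<chi> p. T p u"] by simp
    also have "\<dots> \<le> (\<Sum>p\<in>UNIV. norm u * B p)" by (intro sum_mono B)
    finally show "norm (\<chi> p. T p u) \<le> norm u * (\<Sum>p\<in>UNIV. B p)" by (simp add: sum_distrib_left)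
  qed
qed

lemma bounded_linear_car:
  fixes L :: "'x::real_normed_vector \<Rightarrow> ('n::{finite,linorder}, 'v::real_normed_vector) family"
  assumes "\<And>q. bounded_linear (\<lambda>u. L u q)"
  shows "bounded_linear (\<lambda>u. ext i (L u) p)" "bounded_linear (\<lambda>u. con i (L u) p)"
    "bounded_linear (\<lambda>u. extb i (L u) p)" "bounded_linear (\<lambda>u. conb i (L u) p)"
proof -
  note bl = bounded_linear_const_scaleR[OF assms] bounded_linear_zero
  show "bounded_linear (\<lambda>u. ext i (L u) p)" unfolding ext_def by (cases "i \<in> fst p") (simp_all only: if_True if_False bl)
  show "bounded_linear (\<lambda>u. con i (L u) p)" unfolding con_def by (cases "i \<in> fst p") (simp_all only: if_True if_False bl)
  show "bounded_linear (\<lambda>u. extb i (L u) p)" unfolding extb_def by (cases "i \<in> snd p") (simp_all only: if_True if_False bl)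
  show "bounded_linear (\<lambda>u. conb i (L u) p)" unfolding conb_def by (cases "i \<in> snd p") (simp_all only: if_True if_False bl)
qed

locale twisted_homotopy = twisted D F
  for D :: "'n::{finite,linorder} cn set" and F :: "'n \<Rightarrow> 'n cn \<Rightarrow> complex" +
  fixes g :: "'n \<Rightarrow> 'n cn \<Rightarrow> complex" and K :: "'n cn set"
  assumes g_smooth: "\<And>i. smooth_on D (g i)" and g_bdd: "\<And>i. \<exists>B. \<forall>z\<in>D. cmod (g i z) \<le> B"
    and g_dbar_bdd: "\<And>i j. \<exists>B. \<forall>z\<in>D. cmod (d_zbar j (g i) z) \<le> B"
    and K_compact: "compact K" and K_D: "K \<subseteq> D"
    and gF: "\<And>z. z \<in> D \<Longrightarrow> z \<notin> K \<Longrightarrow> (\<Sum>i\<in>UNIV. g i z * F i z) = 1"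
begin

lemma nice_g: "nice (g i)"
  unfolding nice_def using g_bdd smooth_on_imp_continuous_on[OF g_smooth] by blast

lemma nice_g_dbar: "nice (d_zbar j (g i))"
  unfolding nice_def using g_dbar_bdd smooth_on_imp_continuous_on[OF smooth_on_d_zbar[OF D_open g_smooth]] by blast

lemma test_g: "test_function D \<theta> \<Longrightarrow> test_function D (\<lambda>z. g i z * \<theta> z)"
  by (rule test_function_mult[OF D_open g_smooth])

lemma test_g_dbar: "test_function D \<theta> \<Longrightarrow> test_function D (\<lambda>z. d_zbar j (g i) z * \<theta> z)"
  by (rule test_function_mult[OF D_open smooth_on_d_zbar[OF D_open g_smooth]])

definition hop :: "'n hf \<Rightarrow> 'n hf" where
  "hop u = (\<chi> p. \<Sum>i\<in>UNIV. mul (cut (g i)) (con i (($) u) p))"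

text \<open>\<open>Mop = dbar\<^sub>f hop + hop dbar\<^sub>f\<close>: the terms that differentiate the form cancel by the anticommutation relations.\<close>

definition Mop :: "'n hf \<Rightarrow> 'n hf" where
  "Mop u = (\<chi> p. (\<Sum>i\<in>UNIV. mul (cut (\<lambda>z. g i z * F i z)) (u $ p)) +
     (\<Sum>i\<in>UNIV. \<Sum>j\<in>UNIV. mul (cut (d_zbar j (g i))) (extb j (con i (($) u)) p)))"

lemma pr_mul_cut:
  assumes "nice b" "test_function D \<theta>"
  shows "pr (mul (cut b) v) \<theta> = pr v (\<lambda>z. b z * \<theta> z)"
  using pr_mul[OF nice_bmeas[OF assms(1)] test_function_measurable[OF assms(2)], of v] cut_test[OF assms(2), of b]
  by simp

lemma pr_car:
  assumes "sqint \<theta>"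
  shows "pr (ext i c p) \<theta> = ext i (\<lambda>q. pr (c q) \<theta>) p" "pr (con i c p) \<theta> = con i (\<lambda>q. pr (c q) \<theta>) p"
    "pr (extb i c p) \<theta> = extb i (\<lambda>q. pr (c q) \<theta>) p" "pr (conb i c p) \<theta> = conb i (\<lambda>q. pr (c q) \<theta>) p"
  using assms by (auto simp: car_defs pr_scaleR simp del: scaleR_conv_of_real)

lemma P_hop:
  assumes \<theta>: "test_function D \<theta>"
  shows "P (hop u) \<theta> = (\<lambda>q. \<Sum>i\<in>UNIV. con i (P u (\<lambda>z. g i z * \<theta> z)) q)"
proof
  fix q
  have "P (hop u) \<theta> q = (\<Sum>i\<in>UNIV. pr (mul (cut (g i)) (con i (($) u) q)) \<theta>)"
    by (simp add: P_def hop_def pr_sum[OF test_function_sqint[OF \<theta>]])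
  also have "\<dots> = (\<Sum>i\<in>UNIV. con i (P u (\<lambda>z. g i z * \<theta> z)) q)"
    by (simp only: pr_mul_cut[OF nice_g \<theta>] pr_car[OF test_function_sqint[OF test_g[OF \<theta>]]] P_def[abs_def])
  finally show "P (hop u) \<theta> q = (\<Sum>i\<in>UNIV. con i (P u (\<lambda>z. g i z * \<theta> z)) q)" .
qed

lemma P_Mop:
  assumes \<theta>: "test_function D \<theta>"
  shows "P (Mop u) \<theta> p = (\<Sum>i\<in>UNIV. P u (\<lambda>z. g i z * (F i z * \<theta> z)) p) +
    (\<Sum>i\<in>UNIV. \<Sum>j\<in>UNIV. extb j (con i (P u (\<lambda>z. d_zbar j (g i) z * \<theta> z))) p)"
proof -
  have s: "sqint \<theta>" by (rule test_function_sqint[OF \<theta>])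
  have "P (Mop u) \<theta> p = (\<Sum>i\<in>UNIV. pr (mul (cut (\<lambda>z. g i z * F i z)) (u $ p)) \<theta>) +
     (\<Sum>i\<in>UNIV. \<Sum>j\<in>UNIV. pr (mul (cut (d_zbar j (g i))) (extb j (con i (($) u)) p)) \<theta>)"
    by (simp add: P_def Mop_def pr_sum[OF s] pr_add[OF s])
  also have "\<dots> = (\<Sum>i\<in>UNIV. P u (\<lambda>z. g i z * (F i z * \<theta> z)) p) +
    (\<Sum>i\<in>UNIV. \<Sum>j\<in>UNIV. extb j (con i (P u (\<lambda>z. d_zbar j (g i) z * \<theta> z))) p)"
    by (simp only: pr_mul_cut[OF nice_mult[OF nice_g nice_F] \<theta>] pr_mul_cut[OF nice_g_dbar \<theta>]
        pr_car[OF test_function_sqint[OF test_g_dbar[OF \<theta>]]] P_def[abs_def] mult.assoc)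
  finally show ?thesis .
qed

lemma supported_sum_lsq: "(\<And>i. i \<in> S \<Longrightarrow> mul (indicator D) (v i) = v i) \<Longrightarrow> mul (indicator D) (\<Sum>i\<in>S. v i) = (\<Sum>i\<in>S. v i)"
  by (simp add: mul_sum[OF bmeas_ind])

lemma hop_supported:
  assumes "u \<in> supported D" shows "hop u \<in> supported D"
  unfolding hop_def
  by (rule supportedI, unfold vec_lambda_beta)
    (intro supported_sum_lsq supported_mul[OF nice_bmeas[OF nice_g]] car_supported supportedD[OF assms])

lemma Mop_supported:
  assumes "u \<in> supported D" shows "Mop u \<in> supported D"
  unfolding Mop_def
proof (rule supportedI, unfold vec_lambda_beta mul_add[OF bmeas_ind])
  fix p :: "'n set \<times> 'n set"
  have "mul (indicator D) (\<Sum>i\<in>UNIV. mul (cut (\<lambda>z. g i z * F i z)) (u $ p)) = (\<Sum>i\<in>UNIV. mul (cut (\<lambda>z. g i z * F i z)) (u $ p))"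
    by (intro supported_sum_lsq supported_mul[OF nice_bmeas[OF nice_mult[OF nice_g nice_F]]] supportedD[OF assms])
  moreover have "mul (indicator D) (\<Sum>i\<in>UNIV. \<Sum>j\<in>UNIV. mul (cut (d_zbar j (g i))) (extb j (con i (($) u)) p)) =
      (\<Sum>i\<in>UNIV. \<Sum>j\<in>UNIV. mul (cut (d_zbar j (g i))) (extb j (con i (($) u)) p))"
    by (intro supported_sum_lsq supported_mul[OF nice_bmeas[OF nice_g_dbar]] car_supported supportedD[OF assms])
  ultimately show "mul (indicator D) (\<Sum>i\<in>UNIV. mul (cut (\<lambda>z. g i z * F i z)) (u $ p)) +
      mul (indicator D) (\<Sum>i\<in>UNIV. \<Sum>j\<in>UNIV. mul (cut (d_zbar j (g i))) (extb j (con i (($) u)) p)) =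
     (\<Sum>i\<in>UNIV. mul (cut (\<lambda>z. g i z * F i z)) (u $ p)) +
     (\<Sum>i\<in>UNIV. \<Sum>j\<in>UNIV. mul (cut (d_zbar j (g i))) (extb j (con i (($) u)) p))" by simp
qed

text \<open>Contraction preserves the maximal domain although g need not vanish at the boundary: the
  product of g i with a test function is a test function. The identity dbar_f hop u + hop w = Mop u
  is thus verified in weak form.\<close>

lemma wd_hop:
  assumes uw: "wd D F u w"
  shows "wd D F (hop u) (Mop u - hop w)"
  unfolding wd_def
proof (intro conjI allI impI)
  have us: "u \<in> supported D" "w \<in> supported D" using uw by (auto simp: wd_def)
  show "hop u \<in> supported D" by (rule hop_supported[OF us(1)])
  show "Mop u - hop w \<in> supported D"
    by (intro subspace_diff[OF subspace_supported] Mop_supported hop_supported us)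
  fix \<theta> p assume \<theta>: "test_function D \<theta>"
  have Pw: "P w \<theta>' = (\<lambda>q. wsum \<theta>' F u q)" if "test_function D \<theta>'" for \<theta>'
    using uw that unfolding wd_def by blast
  \<comment> \<open>The three kinds of terms: A comes from multiplication by F, B has the derivative
    on \<theta>, C has it on g. The B terms cancel, the A terms collapse by \<open>ext_con\<close>,
    and C is the part of \<open>Mop\<close> with the derivatives of g.\<close>
  define A where "A i l = P u (\<lambda>z. F l z * (g i z * \<theta> z))" for i l
  define B where "B i j = P u (\<lambda>z. g i z * d_zbar j \<theta> z)" for i j
  define C where "C i j = P u (\<lambda>z. d_zbar j (g i) z * \<theta> z)" for i j
  have dz: "P u (d_zbar j (\<lambda>z. g i z * \<theta> z)) = (\<lambda>q. B i j q + C i j q)" for i j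
    unfolding d_zbar_smooth_mult[OF \<theta> g_smooth] B_def C_def
    by (rule P_add_right[OF test_g[OF test_function_d_zbar[OF \<theta>]] test_g_dbar[OF \<theta>]])
  have "P (hop w) \<theta> p = (\<Sum>i\<in>UNIV. con i (\<lambda>q. wsum (\<lambda>z. g i z * \<theta> z) F u q) p)"
    unfolding P_hop[OF \<theta>] Pw[OF test_g[OF \<theta>]] ..
  also have "\<dots> = (\<Sum>i\<in>UNIV. (\<Sum>l\<in>UNIV. con i (ext l (A i l)) p) - ((\<Sum>j\<in>UNIV. con i (extb j (B i j)) p) + (\<Sum>j\<in>UNIV. con i (extb j (C i j)) p)))"
  proof (rule sum.cong[OF refl])
    fix i
    have "wsum (\<lambda>z. g i z * \<theta> z) F u = (\<lambda>q. (\<Sum>l\<in>UNIV. ext l (A i l) q) - ((\<Sum>j\<in>UNIV. extb j (B i j) q) + (\<Sum>j\<in>UNIV. extb j (C i j) q)))"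
      unfolding wsum_def[abs_def] dz A_def[symmetric]
      by (simp only: family_linear_add[OF family_linear_car(3)] sum.distrib)
    then show "con i (\<lambda>q. wsum (\<lambda>z. g i z * \<theta> z) F u q) p = (\<Sum>l\<in>UNIV. con i (ext l (A i l)) p) - ((\<Sum>j\<in>UNIV. con i (extb j (B i j)) p) + (\<Sum>j\<in>UNIV. con i (extb j (C i j)) p))"
      by (simp only: family_linear_diff[OF family_linear_car(2)] family_linear_add[OF family_linear_car(2)] family_linear_sum[OF family_linear_car(2)])
  qed
  finally have 1: "P (hop w) \<theta> p = (\<Sum>i\<in>UNIV. \<Sum>l\<in>UNIV. con i (ext l (A i l)) p) + (\<Sum>i\<in>UNIV. \<Sum>j\<in>UNIV. extb j (con i (B i j)) p) + (\<Sum>i\<in>UNIV. \<Sum>j\<in>UNIV. extb j (con i (C i j)) p)"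
    by (simp only: con_extb sum_subtractf sum.distrib sum_negf) simp
  have swap: "(\<lambda>z. F l z * (g i z * \<theta> z)) = (\<lambda>z. g i z * (F l z * \<theta> z))" for i l by (simp add: mult.left_commute)
  have "wsum \<theta> F (hop u) p = (\<Sum>l\<in>UNIV. ext l (\<lambda>q. \<Sum>i\<in>UNIV. con i (A i l) q) p) - (\<Sum>j\<in>UNIV. extb j (\<lambda>q. \<Sum>i\<in>UNIV. con i (B i j) q) p)"
    unfolding wsum_def P_hop[OF test_F[OF \<theta>]] P_hop[OF test_function_d_zbar[OF \<theta>]] A_def B_def swap ..
  also have "\<dots> = (\<Sum>l\<in>UNIV. \<Sum>i\<in>UNIV. ext l (con i (A i l)) p) - (\<Sum>j\<in>UNIV. \<Sum>i\<in>UNIV. extb j (con i (B i j)) p)"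
    by (simp only: family_linear_sum[OF family_linear_car(1)] family_linear_sum[OF family_linear_car(3)])
  finally have 2: "wsum \<theta> F (hop u) p = (\<Sum>i\<in>UNIV. \<Sum>l\<in>UNIV. ext l (con i (A i l)) p) - (\<Sum>i\<in>UNIV. \<Sum>j\<in>UNIV. extb j (con i (B i j)) p)"
    by (simp only: sum.swap[of "\<lambda>l i. ext l (con i (A i l)) p"] sum.swap[of "\<lambda>j i. extb j (con i (B i j)) p"])
  have 3: "(\<Sum>i\<in>UNIV. \<Sum>l\<in>UNIV. ext l (con i (A i l)) p) + (\<Sum>i\<in>UNIV. \<Sum>l\<in>UNIV. con i (ext l (A i l)) p) = (\<Sum>i\<in>UNIV. A i i p)"
  proof -
    have "(\<Sum>i\<in>UNIV. \<Sum>l\<in>UNIV. ext l (con i (A i l)) p) + (\<Sum>i\<in>UNIV. \<Sum>l\<in>UNIV. con i (ext l (A i l)) p)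
      = (\<Sum>i\<in>UNIV. \<Sum>l\<in>UNIV. if l = i then A i l p else 0)"
      by (simp only: sum.distrib[symmetric] ext_con)
    also have "\<dots> = (\<Sum>i\<in>UNIV. A i i p)" by simp
    finally show ?thesis .
  qed
  have "P (Mop u) \<theta> p = (\<Sum>i\<in>UNIV. A i i p) + (\<Sum>i\<in>UNIV. \<Sum>j\<in>UNIV. extb j (con i (C i j)) p)"
    unfolding P_Mop[OF \<theta>] A_def C_def swap ..
  then show "P (Mop u - hop w) \<theta> p = wsum \<theta> F (hop u) p"
    unfolding P_diff[OF test_function_sqint[OF \<theta>]] 1 2 using 3 by (simp add: algebra_simps)
qed

lemma wd_diff: "wd D F u w \<Longrightarrow> wd D F u' w' \<Longrightarrow> wd D F (u - u') (w - w')"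
  using wd_add[of u w "- u'" "- w'"] wd_scaleR[of u' w' "-1"] by simp

lemma bounded_linear_hop: "bounded_linear hop"
  unfolding hop_def[abs_def]
  by (intro bounded_linear_vec_lambda bounded_linear_sum bounded_linear_compose[OF bounded_linear_mul[OF nice_bmeas[OF nice_g]]]
      bounded_linear_car bounded_linear_vec_nth)

lemma hop_0: "hop 0 = 0"
  by (rule linear_0[OF bounded_linear.linear[OF bounded_linear_hop]])

text \<open>An anticommutator with an operator of square 0 commutes with it. In weak form this adds
  two graph pairs: \<open>wd_hop\<close> for the pair (w, 0), and \<open>wd_square\<close> applied
  to \<open>wd_hop\<close> for (u, w).\<close>

lemma wd_Mop: "wd D F u w \<Longrightarrow> wd D F (Mop u) (Mop w)"
proof -
  assume uw: "wd D F u w"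
  have "wd D F (hop w) (Mop w)" using wd_hop[OF wd_square[OF uw]] by (simp add: hop_0)
  moreover have "wd D F (Mop u - hop w) 0" by (rule wd_square[OF wd_hop[OF uw]])
  ultimately show ?thesis using wd_add by fastforce
qed

section \<open>The remainder of the homotopy and its nilpotency off K\<close>

definition Bop :: "'n hf \<Rightarrow> 'n hf" where "Bop u = u - Mop u"

lemma wd_Bop: "wd D F u w \<Longrightarrow> wd D F (Bop u) (Bop w)"
  unfolding Bop_def by (intro wd_diff wd_Mop)

lemma wd_Bop_power: "wd D F u w \<Longrightarrow> wd D F ((Bop ^^ k) u) ((Bop ^^ k) w)"
  by (induction k) (auto intro: wd_Bop)

lemma bounded_linear_Mop: "bounded_linear Mop"
  unfolding Mop_def[abs_def]
  by (intro bounded_linear_vec_lambda bounded_linear_add bounded_linear_sum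
      bounded_linear_compose[OF bounded_linear_mul[OF nice_bmeas[OF nice_mult[OF nice_g nice_F]]]]
      bounded_linear_compose[OF bounded_linear_mul[OF nice_bmeas[OF nice_g_dbar]]]
      bounded_linear_car bounded_linear_vec_nth)

lemma bounded_linear_Bop: "bounded_linear Bop"
  unfolding Bop_def[abs_def] by (intro bounded_linear_sub bounded_linear_ident bounded_linear_Mop)

lemma bounded_linear_Bop_power: "bounded_linear (Bop ^^ k)"
proof (induction k)
  case 0
  then show ?case by (simp add: id_def bounded_linear_ident)
next
  case (Suc k)
  then show ?case using bounded_linear_compose[OF bounded_linear_Bop Suc] by (simp add: o_def)
qed

definition koff :: "'n cn \<Rightarrow> complex" where "koff z = indicator (- K) z"

lemma bmeas_koff: "bmeas koff"
proof -
  have "- K \<in> sets lebesgue" using compact_imp_closed[OF K_compact] by (auto simp: closed_def)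
  then show ?thesis unfolding koff_def[abs_def] by (rule bmeas_indicator)
qed

text \<open>Off K the multiplier \<Sum> g_i F_i equals 1 and cancels the identity; only the terms
  with derivatives of g remain, and each of them contains one \<open>extb\<close>.\<close>

lemma Bop_component:
  assumes "u \<in> supported D"
  shows "mul koff (Bop u $ p) = - (\<Sum>i\<in>UNIV. \<Sum>j\<in>UNIV. mul (cut (d_zbar j (g i))) (mul koff (extb j (con i (($) u)) p)))"
proof -
  let ?m = "\<lambda>z. \<Sum>i\<in>UNIV. cut (\<lambda>z. g i z * F i z) z"
  have b: "bmeas (cut (\<lambda>z. g i z * F i z))" for i by (rule nice_bmeas[OF nice_mult[OF nice_g nice_F]])
  have bm: "bmeas ?m" by (intro bmeas_sum b)
  have "mul koff (mul ?m (u $ p)) = mul koff (u $ p)"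
  proof -
    have "mul koff (mul ?m (mul (indicator D) (u $ p))) = mul (\<lambda>z. koff z * (?m z * indicator D z)) (u $ p)"
      by (simp add: mul_mul bmeas_koff bm bmeas_ind bmeas_mult)
    also have "\<dots> = mul (\<lambda>z. koff z * indicator D z) (u $ p)"
    proof (rule mul_cong)
      fix z show "koff z * (?m z * indicator D z) = koff z * indicator D z"
        using gF[of z] by (cases "z \<in> D"; cases "z \<in> K") (auto simp: koff_def cut_def)
    qed
    also have "\<dots> = mul koff (mul (indicator D) (u $ p))" by (simp add: mul_mul bmeas_koff bmeas_ind)
    finally show ?thesis by (simp only: supportedD[OF assms])
  qed
  moreover have "(\<Sum>i\<in>UNIV. mul (cut (\<lambda>z. g i z * F i z)) (u $ p)) = mul ?m (u $ p)"
    by (rule mul_sum_left[symmetric]) (rule b)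
  ultimately have "mul koff (Bop u $ p) = - mul koff (\<Sum>i\<in>UNIV. \<Sum>j\<in>UNIV. mul (cut (d_zbar j (g i))) (extb j (con i (($) u)) p))"
    by (simp add: Bop_def Mop_def mul_diff[OF bmeas_koff] mul_add[OF bmeas_koff])
  also have "\<dots> = - (\<Sum>i\<in>UNIV. \<Sum>j\<in>UNIV. mul (cut (d_zbar j (g i))) (mul koff (extb j (con i (($) u)) p)))"
    by (simp add: mul_sum[OF bmeas_koff] mul_commute[OF bmeas_koff nice_bmeas[OF nice_g_dbar]])
  finally show ?thesis .
qed

lemma Bop_supported: "u \<in> supported D \<Longrightarrow> Bop u \<in> supported D"
  unfolding Bop_def by (intro subspace_diff[OF subspace_supported] Mop_supported)

lemma Bop_power_supported: "u \<in> supported D \<Longrightarrow> (Bop ^^ k) u \<in> supported D"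
  by (induction k) (auto intro: Bop_supported)

text \<open>Off \<open>K\<close> the operator \<open>Bop\<close> strictly raises the antiholomorphic degree, hence is nilpotent there.\<close>

lemma Bop_power_vanish:
  assumes "u \<in> supported D"
  shows "card J < k \<Longrightarrow> mul koff ((Bop ^^ k) u $ (I, J)) = 0"
proof (induction k arbitrary: I J)
  case (Suc k)
  have "mul koff (extb j (con i (($) ((Bop ^^ k) u))) (I, J)) = 0" for i j
  proof (cases "j \<in> J \<and> i \<notin> I")
    case True
    then have "card (J - {j}) < card J" by (intro card_Diff1_less) auto
    then have "card (J - {j}) < k" using Suc.prems by simp
    from Suc.IH[OF this] show ?thesis using True
      by (simp add: extb_def con_def mul_scaleR[OF bmeas_koff])
  qed (auto simp: extb_def con_def bmeas_koff)
  then show ?case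
    using Bop_component[OF Bop_power_supported[OF assms, of k], of "(I, J)"]
    by (simp add: nice_bmeas[OF nice_g_dbar])
qed simp

text \<open>The antiholomorphic degree is at most n and has to be smaller than the exponent, hence n
  + 1.\<close>

lemma Bop_power_nilpotent:
  assumes "u \<in> supported D"
  shows "mul koff ((Bop ^^ Suc CARD('n)) u $ p) = 0"
proof -
  have "card (snd p) \<le> CARD('n)" by (rule card_mono) auto
  then show ?thesis using Bop_power_vanish[OF assms, of "snd p" "Suc CARD('n)" "fst p"] by simp
qed

section \<open>Localization of the norm to K\<close>

definition vmul :: "('n cn \<Rightarrow> complex) \<Rightarrow> 'n hf \<Rightarrow> 'n hf" where
  "vmul b u = (\<chi> p. mul b (u $ p))"

lemma bounded_linear_vmul: "bmeas b \<Longrightarrow> bounded_linear (vmul b)"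
  unfolding vmul_def[abs_def]
  by (intro bounded_linear_vec_lambda bounded_linear_compose[OF bounded_linear_mul] bounded_linear_vec_nth)

lemma inner_vmul_real:
  assumes "bmeas b" "\<And>z. cnj (b z) = b z"
  shows "vmul b u \<bullet> v = u \<bullet> vmul b v"
  unfolding inner_vec_def vmul_def inner_lsq_def by (simp add: cin_mul[OF assms(1)] assms(2))

text \<open>By \<open>wd_hop\<close> the difference of Mop (Bop^k u) and hop (Bop^k w) lies in the
  range, so it is orthogonal to u. Each step thus trades the pairing of Bop^k u with u for that of
  Bop^(k+1) u and a term controlled by w.\<close>

lemma homotopy_telescope:
  assumes uw: "wd D F u w" and orth: "\<And>v z. wd D F v z \<Longrightarrow> z \<bullet> u = 0"
  shows "u \<bullet> u = (Bop ^^ k) u \<bullet> u + (\<Sum>m<k. hop ((Bop ^^ m) w) \<bullet> u)"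
proof (induction k)
  case (Suc k)
  have W: "wd D F ((Bop ^^ k) u) ((Bop ^^ k) w)" by (rule wd_Bop_power[OF uw])
  have "(Mop ((Bop ^^ k) u) - hop ((Bop ^^ k) w)) \<bullet> u = 0" by (rule orth[OF wd_hop[OF W]])
  then have "Mop ((Bop ^^ k) u) \<bullet> u = hop ((Bop ^^ k) w) \<bullet> u" by (simp add: inner_diff_left)
  then have "(Bop ^^ Suc k) u \<bullet> u = (Bop ^^ k) u \<bullet> u - hop ((Bop ^^ k) w) \<bullet> u"
    by (simp add: Bop_def inner_diff_left)
  then show ?case using Suc by simp
qed simp

text \<open>After n + 1 steps of the telescope, the iterate paired with u is supported in K, so only
  the restriction of u to K enters, and r \<ge> 1 there. Both contributions carry a factor norm u,
  which is divided out.\<close>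

theorem localization_estimate:
  assumes \<chi>: "test_function D (\<lambda>z. complex_of_real (r z))" "\<And>z. z \<in> K \<Longrightarrow> 1 \<le> r z" "\<And>z. 0 \<le> r z"
  obtains c where "c > 0" "\<And>u w. wd D F u w \<Longrightarrow> (\<And>v z. wd D F v z \<Longrightarrow> z \<bullet> u = 0) \<Longrightarrow>
     norm u \<le> c * (norm w + norm (vmul (\<lambda>z. complex_of_real (r z)) u))"
proof -
  let ?N = "Suc CARD('n)"
  let ?\<chi> = "\<lambda>z. complex_of_real (r z)"
  obtain c1 where c1: "c1 > 0" "\<And>u. norm ((Bop ^^ ?N) u) \<le> norm u * c1"
    using bounded_linear.pos_bounded[OF bounded_linear_Bop_power] by blast
  have "\<exists>c>0. \<forall>w. norm (hop ((Bop ^^ m) w)) \<le> norm w * c" for m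
    using bounded_linear.pos_bounded[OF bounded_linear_compose[OF bounded_linear_hop bounded_linear_Bop_power]] by blast
  then obtain c2 where c2: "\<And>m. c2 m > 0" "\<And>m w. norm (hop ((Bop ^^ m) w)) \<le> norm w * c2 m" by metis
  define c where "c = c1 + (\<Sum>m<?N. c2 m)"
  have s2: "0 \<le> (\<Sum>m<?N. c2 m)" using c2(1) by (intro sum_nonneg) (simp add: less_imp_le)
  have c0: "c > 0" using c1(1) s2 by (simp add: c_def)
  have K: "K \<in> sets lebesgue" using compact_imp_closed[OF K_compact] by auto
  have bK: "bmeas (indicator K :: 'n cn \<Rightarrow> complex)" by (rule bmeas_indicator[OF K])
  have "norm u \<le> c * (norm w + norm (vmul ?\<chi> u))"
    if uw: "wd D F u w" and orth: "\<And>v z. wd D F v z \<Longrightarrow> z \<bullet> u = 0" for u w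
  proof (cases "u = 0")
    case True
    then show ?thesis using c0 by simp
  next
    case False
    let ?b = "(Bop ^^ ?N) u"
    have us: "u \<in> supported D" using uw by (simp add: wd_def)
    \<comment> \<open>The iterate has no mass off K, by nilpotency, so it equals its restriction to
      K.\<close>
    have "vmul (indicator K) ?b = ?b"
    proof -
      have "mul (indicator K) (?b $ p) = ?b $ p" for p
      proof -
        have "?b $ p = mul (\<lambda>z. indicator K z + koff z) (?b $ p)"
        proof -
          have "mul (\<lambda>z. indicator K z + koff z) (?b $ p) = mul (\<lambda>z. 1) (?b $ p)"
            by (rule mul_cong) (simp add: koff_def indicator_def)
          then show ?thesis by simp
        qed
        also have "\<dots> = mul (indicator K) (?b $ p) + mul koff (?b $ p)" by (rule mul_add_left[OF bK bmeas_koff])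
        finally show ?thesis using Bop_power_nilpotent[OF us, of p] by simp
      qed
      then show ?thesis by (simp add: vmul_def vec_eq_iff)
    qed
    then have "?b \<bullet> u = ?b \<bullet> vmul (indicator K) u"
      using inner_vmul_real[OF bK, of ?b u] by (simp add: indicator_def)
    also have "\<dots> \<le> norm ?b * norm (vmul (indicator K) u)" by (rule norm_cauchy_schwarz)
    also have "\<dots> \<le> (norm u * c1) * norm (vmul ?\<chi> u)"
    proof (intro mult_mono c1)
      have "norm (mul (indicator K) (u $ p)) \<le> norm (mul ?\<chi> (u $ p))" for p
        by (rule norm_mul_mono[OF bK test_function_bmeas[OF \<chi>(1)]]) (use \<chi>(2,3) in \<open>auto simp: indicator_def\<close>)
      then show "norm (vmul (indicator K) u) \<le> norm (vmul ?\<chi> u)"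
        unfolding norm_vec_def vmul_def by (intro L2_set_mono) auto
    qed (use c1 in auto)
    finally have 1: "?b \<bullet> u \<le> norm u * c1 * norm (vmul ?\<chi> u)" .
    have 2: "(\<Sum>m<?N. hop ((Bop ^^ m) w) \<bullet> u) \<le> (\<Sum>m<?N. norm w * c2 m * norm u)"
    proof (rule sum_mono)
      fix m
      have "hop ((Bop ^^ m) w) \<bullet> u \<le> norm (hop ((Bop ^^ m) w)) * norm u" by (rule norm_cauchy_schwarz)
      also have "\<dots> \<le> norm w * c2 m * norm u" by (intro mult_right_mono c2) auto
      finally show "hop ((Bop ^^ m) w) \<bullet> u \<le> norm w * c2 m * norm u" .
    qed
    have tel: "u \<bullet> u = ?b \<bullet> u + (\<Sum>m<?N. hop ((Bop ^^ m) w) \<bullet> u)"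
      by (rule homotopy_telescope[OF uw]) (rule orth)
    have "norm u * norm u = u \<bullet> u" by (simp add: power2_norm_eq_inner flip: power2_eq_square)
    also have "\<dots> \<le> norm u * c1 * norm (vmul ?\<chi> u) + (\<Sum>m<?N. norm w * c2 m * norm u)"
      using tel 1 2 by linarith
    also have "\<dots> = norm u * (c1 * norm (vmul ?\<chi> u) + (\<Sum>m<?N. c2 m) * norm w)"
      by (simp only: sum_distrib_right sum_distrib_left distrib_left mult_ac)
    finally have "norm u \<le> c1 * norm (vmul ?\<chi> u) + (\<Sum>m<?N. c2 m) * norm w"
      using False by simp
    also have "\<dots> \<le> c * norm (vmul ?\<chi> u) + c * norm w"
      using c1(1) s2 by (intro add_mono mult_right_mono) (auto simp: c_def)
    finally show ?thesis by (simp add: algebra_simps)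
  qed
  with c0 that show thesis by blast
qed

end

section \<open>Interior compactness\<close>

lemma Basis_cn: "(b :: 'n::finite cn) \<in> Basis \<longleftrightarrow> (\<exists>j. b = axis j 1 \<or> b = axis j \<i>)"
  by (auto simp: Basis_vec_def Basis_complex_def)

definition freq_vec :: "('a::euclidean_space \<Rightarrow> int) \<Rightarrow> 'a" where
  "freq_vec k = (\<Sum>b\<in>Basis. real_of_int (k b) *\<^sub>R b)"

lemma inner_freq_vec: "b \<in> Basis \<Longrightarrow> b \<bullet> freq_vec k = real_of_int (k b)"
  unfolding freq_vec_def inner_commute[of b] by (rule inner_sum_left_Basis)

lemma char_fn_eq: "char_fn \<kappa> k z = exp (\<i> * of_real (\<kappa> * (z \<bullet> freq_vec k)))"
proof -
  have "char_fn \<kappa> k z = (\<Prod>b\<in>Basis. exp (\<i> * of_real (\<kappa> * of_int (k b) * (z \<bullet> b))))"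
    by (simp only: char_fn_def cis_conv_exp)
  also have "\<dots> = exp (\<Sum>b\<in>Basis. \<i> * of_real (\<kappa> * of_int (k b) * (z \<bullet> b)))"
    by (rule exp_sum[OF finite_Basis, symmetric])
  also have "(\<Sum>b\<in>Basis. \<i> * of_real (\<kappa> * of_int (k b) * (z \<bullet> b))) = \<i> * of_real (\<kappa> * (z \<bullet> freq_vec k))"
    by (simp add: freq_vec_def inner_sum_right sum_distrib_left mult.assoc)
  finally show ?thesis .
qed

lemma smooth_on_char_fn: "smooth_on UNIV (char_fn \<kappa> k)"
proof -
  have "bounded_linear (\<lambda>z. \<i> * of_real (\<kappa> * (z \<bullet> freq_vec k)))"
    by (intro bounded_linear_const_mult bounded_linear_compose[OF bounded_linear_of_real] bounded_linear_inner_left)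
  then have "smooth_on UNIV (\<lambda>z. exp (\<i> * of_real (\<kappa> * (z \<bullet> freq_vec k))))"
    by (intro smooth_on_exp smooth_on_bounded_linear open_UNIV)
  then show ?thesis by (simp add: char_fn_eq[abs_def])
qed

text \<open>The eigenvalue of d/dzbar_j on the character of frequency k; see
  \<open>d_zbar_char_fn\<close>.\<close>

definition symb :: "real \<Rightarrow> ('n::finite cn \<Rightarrow> int) \<Rightarrow> 'n \<Rightarrow> complex" where
  "symb \<kappa> k j = \<i> * of_real (\<kappa> / 2) * (of_int (k (axis j 1)) + \<i> * of_int (k (axis j \<i>)))"

lemma d_zbar_char_fn: "d_zbar j (char_fn \<kappa> k) z = symb \<kappa> k j * char_fn \<kappa> k z"
proof -
  have "((\<lambda>z. exp (\<i> * of_real (\<kappa> * (z \<bullet> freq_vec k)))) has_derivative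
     (\<lambda>v. (\<i> * of_real (\<kappa> * (v \<bullet> freq_vec k))) * exp (\<i> * of_real (\<kappa> * (z \<bullet> freq_vec k))))) (at z)"
  proof -
    have bl: "bounded_linear (\<lambda>z. \<i> * of_real (\<kappa> * (z \<bullet> freq_vec k)))"
      by (intro bounded_linear_const_mult bounded_linear_compose[OF bounded_linear_of_real] bounded_linear_inner_left)
    have "(exp has_derivative (\<lambda>v. v * exp w)) (at w)" for w :: complex
      using DERIV_exp[of w] by (simp add: has_field_derivative_def mult.commute[of _ "exp w"])
    from has_derivative_compose[OF bounded_linear_imp_has_derivative[OF bl] this] show ?thesis .
  qed
  then have hd: "(char_fn \<kappa> k has_derivative (\<lambda>v. (\<i> * of_real (\<kappa> * (v \<bullet> freq_vec k))) * char_fn \<kappa> k z)) (at z)"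
    by (simp add: char_fn_eq[abs_def])
  have b: "axis j 1 \<in> (Basis :: 'a cn set)" "axis j \<i> \<in> (Basis :: 'a cn set)" by (auto simp: Basis_cn)
  show ?thesis
    unfolding d_zbar_has_derivative[OF hd] inner_freq_vec[OF b(1)] inner_freq_vec[OF b(2)]
    by (simp add: symb_def algebra_simps add_divide_distrib diff_divide_distrib)
qed

definition symb2 :: "real \<Rightarrow> ('n::finite cn \<Rightarrow> int) \<Rightarrow> real" where
  "symb2 \<kappa> k = (\<Sum>j\<in>UNIV. (cmod (symb \<kappa> k j))\<^sup>2)"

lemma symb2_nonneg: "symb2 \<kappa> k \<ge> 0"
  by (simp add: symb2_def sum_nonneg)

lemma norm_symb: "(cmod (symb \<kappa> k j))\<^sup>2 = (\<kappa> / 2)\<^sup>2 * ((real_of_int (k (axis j 1)))\<^sup>2 + (real_of_int (k (axis j \<i>)))\<^sup>2)"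
proof -
  have "of_int a + \<i> * of_int b = Complex (real_of_int a) (real_of_int b)" for a b by (simp add: complex_eq_iff)
  then have "cmod (of_int a + \<i> * of_int b) = sqrt ((real_of_int a)\<^sup>2 + (real_of_int b)\<^sup>2)" for a b by (simp only: complex_norm)
  then have *: "(cmod (of_int a + \<i> * of_int b))\<^sup>2 = (real_of_int a)\<^sup>2 + (real_of_int b)\<^sup>2" for a b by simp
  have "(cmod (symb \<kappa> k j))\<^sup>2 = (\<kappa> / 2)\<^sup>2 * (cmod (of_int (k (axis j 1)) + \<i> * of_int (k (axis j \<i>))))\<^sup>2"
    unfolding symb_def norm_mult norm_of_real by (simp add: power_mult_distrib power_divide)
  then show ?thesis unfolding * .
qed

text \<open>By \<open>norm_symb\<close> the squared symbol is (\<kappa> / 2)^2 times the squared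
  frequency. It tends to infinity, as a weight in \<open>Rellich_cube\<close> must.\<close>

lemma finite_symb2_le:
  assumes "\<kappa> > 0"
  shows "finite {k \<in> (freqs :: ('n::finite cn \<Rightarrow> int) set). symb2 \<kappa> k \<le> N}"
proof -
  \<comment> \<open>An integer is at most its square in modulus, so the bound 4 |N| / \<kappa>^2 on
    the square of each frequency component also bounds that component.\<close>
  define M where "M = \<lceil>4 * \<bar>N\<bar> / \<kappa>\<^sup>2\<rceil>"
  have "k b \<in> {-M..M}" if k: "symb2 \<kappa> k \<le> N" and b: "b \<in> Basis" for k :: "'n cn \<Rightarrow> int" and b
  proof -
    obtain j where j: "b = axis j 1 \<or> b = axis j \<i>" using b unfolding Basis_cn by blast
    have "(cmod (symb \<kappa> k j))\<^sup>2 \<le> symb2 \<kappa> k"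
      unfolding symb2_def by (rule member_le_sum) auto
    then have "(\<kappa> / 2)\<^sup>2 * ((real_of_int (k (axis j 1)))\<^sup>2 + (real_of_int (k (axis j \<i>)))\<^sup>2) \<le> \<bar>N\<bar>"
      using k unfolding norm_symb by linarith
    moreover have "(real_of_int (k b))\<^sup>2 \<le> (real_of_int (k (axis j 1)))\<^sup>2 + (real_of_int (k (axis j \<i>)))\<^sup>2"
      using j by auto
    ultimately have "(\<kappa> / 2)\<^sup>2 * (real_of_int (k b))\<^sup>2 \<le> \<bar>N\<bar>"
      by (meson mult_left_mono order_trans zero_le_power2)
    then have "(real_of_int (k b))\<^sup>2 \<le> 4 * \<bar>N\<bar> / \<kappa>\<^sup>2"
      using assms by (simp add: power_divide field_simps)
    moreover have "\<bar>real_of_int (k b)\<bar> \<le> (real_of_int (k b))\<^sup>2"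
    proof (cases "k b = 0")
      case False
      then have "1 \<le> \<bar>k b\<bar>" by linarith
      then have "1 \<le> \<bar>real_of_int (k b)\<bar>" by linarith
      then show ?thesis using mult_left_mono[of 1 "\<bar>real_of_int (k b)\<bar>" "\<bar>real_of_int (k b)\<bar>"] by (simp add: power2_eq_square)
    qed simp
    ultimately have "\<bar>real_of_int (k b)\<bar> \<le> real_of_int M" unfolding M_def by linarith
    then show ?thesis by (simp add: abs_le_iff)
  qed
  then have "{k \<in> freqs. symb2 \<kappa> k \<le> N} \<subseteq> PiE (Basis :: 'n cn set) (\<lambda>_. {-M..M})"
    unfolding freqs_def by (auto simp: PiE_def)
  moreover have "finite (PiE (Basis :: 'n cn set) (\<lambda>_. {-M..M}))" by (intro finite_PiE finite_Basis) simp
  ultimately show ?thesis by (rule finite_subset)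
qed

lemma d_zbar_cmult:
  assumes "\<theta> differentiable (at z)"
  shows "d_zbar j (\<lambda>z. c * \<theta> z) z = c * d_zbar j \<theta> z"
  unfolding d_zbar_has_derivative[OF has_derivative_mult_right[OF assms[unfolded frechet_derivative_works]]]
  by (simp add: d_zbar_def algebra_simps)

lemma d_zbar_test_cmult: "test_function D \<theta> \<Longrightarrow> d_zbar j (\<lambda>z. c * \<theta> z) = (\<lambda>z. c * d_zbar j \<theta> z)"
  by (rule ext) (rule d_zbar_cmult[OF test_function_differentiable])

lemma cin_abs_left: "sqint \<theta> \<Longrightarrow> cin (abs_lsq \<theta>) v = cnj (pr v (\<lambda>z. cnj (\<theta> z)))"
  by (subst cin_commute) (simp add: pr_eq_cin sqint_cnj)

lemma cnj_sum_zero: "cnj a + cnj b = 0 \<Longrightarrow> a + b = 0"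
  by (simp add: complex_eq_iff)

section \<open>Test forms and the formal adjoint\<close>

context twisted
begin

definition tf :: "('n cn \<Rightarrow> complex) \<Rightarrow> 'n set \<times> 'n set \<Rightarrow> 'n hf" where
  "tf \<theta> q = (\<chi> p. if p = q then abs_lsq \<theta> else 0)"

definition dtf :: "('n cn \<Rightarrow> complex) \<Rightarrow> 'n set \<times> 'n set \<Rightarrow> 'n hf" where
  "dtf \<theta> q = (\<chi> p. (\<Sum>i\<in>UNIV. ext i (($) (tf (\<lambda>z. F i z * \<theta> z) q)) p) + (\<Sum>j\<in>UNIV. extb j (($) (tf (d_zbar j \<theta>) q)) p))"

lemma tf_supported:
  assumes "test_function D \<theta>" shows "tf \<theta> q \<in> supported D"
proof (rule supportedI)
  fix p
  have s: "sqint \<theta>" by (rule test_function_sqint[OF assms])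
  have "AE z in lebesgue. rep_lsq (mul (indicator D) (abs_lsq \<theta>)) z = rep_lsq (abs_lsq \<theta>) z"
    using rep_mul[OF bmeas_ind, of "abs_lsq \<theta>"] rep_abs_lsq[OF s]
    by eventually_elim (use test_function_outside[OF assms] in \<open>auto simp: indicator_def\<close>)
  then show "mul (indicator D) (tf \<theta> q $ p) = tf \<theta> q $ p"
    by (simp add: tf_def lsq_eq_iff[symmetric] bmeas_ind)
qed

lemma P_tf:
  assumes "test_function D \<theta>" "test_function D \<theta>'"
  shows "P (tf \<theta> q) \<theta>' = (\<lambda>p. if p = q then (LINT z|lebesgue. \<theta> z * \<theta>' z) else 0)"
  using assms by (auto simp: P_def tf_def pr_abs[OF test_function_sqint test_function_measurable] test_function_sqint)

text \<open>Integration by parts places test forms in the maximal domain, with their classical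
  image. This makes the domain dense, and it turns orthogonality to the range into the weak equation
  of the formal adjoint.\<close>

lemma wd_tf:
  assumes \<theta>: "test_function D \<theta>"
  shows "wd D F (tf \<theta> q) (dtf \<theta> q)"
  unfolding wd_def
proof (intro conjI allI impI)
  note t1 = test_F[OF \<theta>] and t2 = test_function_d_zbar[OF \<theta>]
  show "tf \<theta> q \<in> supported D" by (rule tf_supported[OF \<theta>])
  show "dtf \<theta> q \<in> supported D"
    unfolding dtf_def
  proof (rule supportedI, unfold vec_lambda_beta mul_add[OF bmeas_ind])
    fix p
    show "mul (indicator D) (\<Sum>i\<in>UNIV. ext i (($) (tf (\<lambda>z. F i z * \<theta> z) q)) p) + mul (indicator D) (\<Sum>j\<in>UNIV. extb j (($) (tf (d_zbar j \<theta>) q)) p) =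
      (\<Sum>i\<in>UNIV. ext i (($) (tf (\<lambda>z. F i z * \<theta> z) q)) p) + (\<Sum>j\<in>UNIV. extb j (($) (tf (d_zbar j \<theta>) q)) p)"
      unfolding mul_sum[OF bmeas_ind]
      by (simp only: car_supported(1)[OF supportedD[OF tf_supported[OF t1]]] car_supported(3)[OF supportedD[OF tf_supported[OF t2]]])
  qed
  fix \<theta>' and p :: "'n set \<times> 'n set" assume \<theta>': "test_function D \<theta>'"
  have s: "sqint \<theta>'" by (rule test_function_sqint[OF \<theta>'])
  have pc: "pr (ext i c p) \<theta>' = ext i (\<lambda>q. pr (c q) \<theta>') p" "pr (extb i c p) \<theta>' = extb i (\<lambda>q. pr (c q) \<theta>') p" for i and c :: "('n, 'n cn lsq) family"
    using s by (auto simp: car_defs pr_scaleR simp del: scaleR_conv_of_real)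
  have "P (dtf \<theta> q) \<theta>' p = (\<Sum>i\<in>UNIV. ext i (P (tf (\<lambda>z. F i z * \<theta> z) q) \<theta>') p) + (\<Sum>j\<in>UNIV. extb j (P (tf (d_zbar j \<theta>) q) \<theta>') p)"
    unfolding P_def[abs_def] dtf_def by (simp only: vec_lambda_beta pr_add[OF s] pr_sum[OF s] pc)
  also have "\<dots> = wsum \<theta>' F (tf \<theta> q) p"
  proof -
    have a: "P (tf (\<lambda>z. F i z * \<theta> z) q) \<theta>' = P (tf \<theta> q) (\<lambda>z. F i z * \<theta>' z)" for i
      unfolding P_tf[OF t1 \<theta>'] P_tf[OF \<theta> test_F[OF \<theta>']] by (simp only: mult_ac)
    have b: "P (tf (d_zbar j \<theta>) q) \<theta>' = (\<lambda>p. - P (tf \<theta> q) (d_zbar j \<theta>') p)" for j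
      unfolding P_tf[OF t2 \<theta>'] P_tf[OF \<theta> test_function_d_zbar[OF \<theta>']]
      by (rule ext) (simp add: d_zbar_by_parts[OF \<theta> \<theta>'])
    show ?thesis unfolding wsum_def a b by (simp add: family_linear_uminus[OF family_linear_car(3)] sum_negf)
  qed
  finally show "P (dtf \<theta> q) \<theta>' p = wsum \<theta>' F (tf \<theta> q) p" .
qed

text \<open>Contraction is the adjoint of the exterior product. A test form has a single component
  q, so only the index p obtained from q by inserting i can contribute.\<close>

lemma ext_axis_adjoint:
  fixes u :: "'n hf"
  shows "(\<Sum>p\<in>UNIV. cin (ext i (($) (tf \<theta> q)) p) (u $ p)) = cin (abs_lsq \<theta>) (con i (($) u) q)"
    "(\<Sum>p\<in>UNIV. cin (extb i (($) (tf \<theta> q)) p) (u $ p)) = cin (abs_lsq \<theta>) (conb i (($) u) q)"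
proof -
  have c0: "cin 0 v = 0" "cin v 0 = 0" for v :: "'n cn lsq"
    using cin_scaleR_left[of 0 0 v] cin_scaleR_right[of v 0 0] by auto
  have "cin (ext i (($) (tf \<theta> q)) p) (u $ p) = (if p = (insert i (fst q), snd q) then cin (abs_lsq \<theta>) (con i (($) u) q) else 0)" for p
  proof (cases "i \<in> fst p \<and> (fst p - {i}, snd p) = q")
    case True
    then have p: "p = (insert i (fst q), snd q)" "i \<notin> fst q" by (auto simp: prod_eq_iff)
    then show ?thesis using True by (simp add: ext_def con_def tf_def sgnl_insert_self cin_scaleR_left cin_scaleR_right)
  next
    case False
    then have "ext i (($) (tf \<theta> q)) p = 0" by (auto simp: ext_def tf_def)
    moreover have "con i (($) u) q = 0" if "p = (insert i (fst q), snd q)"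
      using False that by (auto simp: con_def prod_eq_iff)
    ultimately show ?thesis by (auto simp: c0)
  qed
  then show "(\<Sum>p\<in>UNIV. cin (ext i (($) (tf \<theta> q)) p) (u $ p)) = cin (abs_lsq \<theta>) (con i (($) u) q)" by simp
  have "cin (extb i (($) (tf \<theta> q)) p) (u $ p) = (if p = (fst q, insert i (snd q)) then cin (abs_lsq \<theta>) (conb i (($) u) q) else 0)" for p
  proof (cases "i \<in> snd p \<and> (fst p, snd p - {i}) = q")
    case True
    then have p: "p = (fst q, insert i (snd q))" "i \<notin> snd q" by (auto simp: prod_eq_iff)
    then show ?thesis using True by (simp add: extb_def conb_def tf_def sgnl_insert_self cin_scaleR_left cin_scaleR_right)
  next
    case False
    then have "extb i (($) (tf \<theta> q)) p = 0" by (auto simp: extb_def tf_def)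
    moreover have "conb i (($) u) q = 0" if "p = (fst q, insert i (snd q))"
      using False that by (auto simp: conb_def prod_eq_iff)
    ultimately show ?thesis by (auto simp: c0)
  qed
  then show "(\<Sum>p\<in>UNIV. cin (extb i (($) (tf \<theta> q)) p) (u $ p)) = cin (abs_lsq \<theta>) (conb i (($) u) q)" by simp
qed

definition adj_pairing :: "'n hf \<Rightarrow> ('n cn \<Rightarrow> complex) \<Rightarrow> 'n set \<times> 'n set \<Rightarrow> complex" where
  "adj_pairing u \<theta> q = (\<Sum>i\<in>UNIV. cin (abs_lsq (\<lambda>z. F i z * \<theta> z)) (con i (($) u) q)) + (\<Sum>j\<in>UNIV. cin (abs_lsq (d_zbar j \<theta>)) (conb j (($) u) q))"

lemma inner_dtf: "dtf \<theta> q \<bullet> u = Re (adj_pairing u \<theta> q)"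
proof -
  have cs: "cin (\<Sum>i\<in>S. a i) v = (\<Sum>i\<in>S. cin (a i) v)" for S and a :: "'n \<Rightarrow> 'n cn lsq" and v
    using cin_scaleR_left[of 0 0 v] by (induction S rule: infinite_finite_induct) (simp_all add: cin_add_left)
  have "(\<Sum>p\<in>UNIV. cin (dtf \<theta> q $ p) (u $ p)) = adj_pairing u \<theta> q"
    unfolding dtf_def vec_lambda_beta cin_add_left cs sum.distrib adj_pairing_def
    by (subst (1 2) sum.swap) (simp only: ext_axis_adjoint)
  then show ?thesis unfolding inner_vec_def inner_lsq_def by (metis Re_sum)
qed

text \<open>Orthogonality for the real inner product kills the real part only; replacing \<theta> by
  \<i> \<theta> kills the imaginary part.\<close>

lemma adj_pairing_zero:
  assumes orth: "\<And>v z. wd D F v z \<Longrightarrow> z \<bullet> u = 0" and \<theta>: "test_function D \<theta>"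
  shows "adj_pairing u \<theta> q = 0"
proof -
  have 0: "Re (adj_pairing u \<theta> q) = 0" if "test_function D \<theta>" for \<theta>
    using orth[OF wd_tf[OF that]] by (simp add: inner_dtf)
  have t: "test_function D (\<lambda>z. \<i> * \<theta> z)"
    by (rule test_function_mult[OF D_open smooth_on_const[OF D_open] \<theta>])
  have ab: "cin (abs_lsq (\<lambda>z. \<i> * f z)) v = \<i> * cin (abs_lsq f) v" if "sqint f" for f :: "'n cn \<Rightarrow> complex" and v
    unfolding cin_abs_left[OF sqint_cmult[OF that]] cin_abs_left[OF that] complex_cnj_mult pr_cmult_right by simp
  have "adj_pairing u (\<lambda>z. \<i> * \<theta> z) q = \<i> * adj_pairing u \<theta> q"
    unfolding adj_pairing_def d_zbar_test_cmult[OF \<theta>] mult.left_commute[of _ \<i>]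
      ab[OF test_function_sqint[OF test_F[OF \<theta>]]] ab[OF test_function_sqint[OF test_function_d_zbar[OF \<theta>]]]
    by (simp only: distrib_left sum_distrib_left)
  then show ?thesis using 0[OF \<theta>] 0[OF t] by (simp add: complex_eq_iff)
qed

lemma test_char: "test_function D \<eta> \<Longrightarrow> test_function D (\<lambda>z. char_fn \<kappa> k z * \<eta> z)"
  by (rule test_function_mult[OF D_open smooth_on_subset[OF smooth_on_char_fn subset_UNIV]])

lemma d_zbar_char_mult:
  assumes "test_function D \<eta>"
  shows "d_zbar j (\<lambda>z. char_fn \<kappa> k z * \<eta> z) = (\<lambda>z. char_fn \<kappa> k z * d_zbar j \<eta> z + symb \<kappa> k j * (char_fn \<kappa> k z * \<eta> z))"
  unfolding d_zbar_smooth_mult[OF assms smooth_on_subset[OF smooth_on_char_fn subset_UNIV]] d_zbar_char_fn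
  by (simp add: mult.assoc)

lemma P_cmult_right: "P u (\<lambda>z. c * \<theta> z) = (\<lambda>q. c * P u \<theta> q)"
  by (rule ext) (simp add: P_def pr_cmult_right)

text \<open>The weak equation is tested with a character times \<eta>. The derivative falling on the
  character produces the symbol acting on a Fourier coefficient of \<eta> u; all other terms contain
  no derivative of u and form a coefficient of a square integrable form.\<close>

lemma symbol_equation:
  assumes uw: "wd D F u w" and \<eta>: "test_function D \<eta>"
  shows "(\<Sum>j\<in>UNIV. symb \<kappa> k j * extb j (P u (\<lambda>z. char_fn \<kappa> k z * \<eta> z)) p) =
    (\<Sum>i\<in>UNIV. ext i (P u (\<lambda>z. char_fn \<kappa> k z * (F i z * \<eta> z))) p) -
    (\<Sum>j\<in>UNIV. extb j (P u (\<lambda>z. char_fn \<kappa> k z * d_zbar j \<eta> z)) p) -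
    P w (\<lambda>z. char_fn \<kappa> k z * \<eta> z) p"
proof -
  let ?e = "char_fn \<kappa> k"
  have "P w (\<lambda>z. ?e z * \<eta> z) p = wsum (\<lambda>z. ?e z * \<eta> z) F u p"
    using uw test_char[OF \<eta>] unfolding wd_def by blast
  moreover have "P u (d_zbar j (\<lambda>z. ?e z * \<eta> z)) = (\<lambda>q. P u (\<lambda>z. ?e z * d_zbar j \<eta> z) q + symb \<kappa> k j * P u (\<lambda>z. ?e z * \<eta> z) q)" for j
    unfolding d_zbar_char_mult[OF \<eta>]
    by (subst P_add_right) (simp_all only: P_cmult_right test_char[OF test_function_d_zbar[OF \<eta>]]
        test_function_mult[OF D_open smooth_on_const[OF D_open] test_char[OF \<eta>]])
  moreover have "(\<lambda>z. F i z * (?e z * \<eta> z)) = (\<lambda>z. ?e z * (F i z * \<eta> z))" for i by (simp add: mult.left_commute)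
  moreover have "linear (times c :: complex \<Rightarrow> complex)" for c by (rule bounded_linear.linear[OF bounded_linear_mult_right])
  ultimately show ?thesis
    unfolding wsum_def
    by (simp add: family_linear_add[OF family_linear_car(3)] car_comp_linear(3) sum.distrib)
qed

text \<open>The companion of \<open>symbol_equation\<close> for the formal adjoint: the conjugate
  symbol contracts the same Fourier coefficients of \<eta> u, up to terms without derivatives of
  u.\<close>

lemma adjoint_symbol_equation:
  assumes orth: "\<And>v z. wd D F v z \<Longrightarrow> z \<bullet> u = 0" and \<eta>: "test_function D \<eta>" and real: "\<And>z. cnj (\<eta> z) = \<eta> z"
  shows "(\<Sum>j\<in>UNIV. cnj (symb \<kappa> k j) * conb j (P u (\<lambda>z. char_fn \<kappa> k z * \<eta> z)) p) =
    (\<Sum>i\<in>UNIV. con i (P u (\<lambda>z. char_fn \<kappa> k z * (cnj (F i z) * \<eta> z))) p) +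
    (\<Sum>j\<in>UNIV. conb j (P u (\<lambda>z. char_fn \<kappa> k z * cnj (d_zbar j \<eta> z))) p)"
proof -
  \<comment> \<open>In the inner product u is the conjugated argument. Testing with the character of
    frequency - k and conjugating the result brings out the coefficient at k.\<close>
  let ?e = "char_fn \<kappa> k" and ?e' = "char_fn \<kappa> (\<lambda>b. - k b)"
  have ce: "cnj (?e' z) = ?e z" for z by (simp add: cnj_char_fn)
  have cs: "symb \<kappa> (\<lambda>b. - k b) j = - symb \<kappa> k j" for j by (simp add: symb_def algebra_simps)
  have t: "test_function D (\<lambda>z. ?e' z * \<eta> z)" by (rule test_char[OF \<eta>])
  have pc: "pr (con i (($) u) p) \<theta> = con i (P u \<theta>) p" "pr (conb i (($) u) p) \<theta> = conb i (P u \<theta>) p" if "sqint \<theta>" for i \<theta>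
    using that by (auto simp: car_defs P_def[abs_def] pr_scaleR simp del: scaleR_conv_of_real)
  have lin: "linear (times c :: complex \<Rightarrow> complex)" for c by (rule bounded_linear.linear[OF bounded_linear_mult_right])
  have 1: "cin (abs_lsq (\<lambda>z. F i z * (?e' z * \<eta> z))) (con i (($) u) p) = cnj (con i (P u (\<lambda>z. ?e z * (cnj (F i z) * \<eta> z))) p)" for i
  proof -
    have eqf: "(\<lambda>z. cnj (F i z * (?e' z * \<eta> z))) = (\<lambda>z. ?e z * (cnj (F i z) * \<eta> z))"
      by (simp only: complex_cnj_mult ce real mult.left_commute)
    have s: "sqint (\<lambda>z. ?e z * (cnj (F i z) * \<eta> z))"
      using sqint_cnj[OF test_function_sqint[OF test_F[OF t, of i]]] unfolding eqf .
    show ?thesis unfolding cin_abs_left[OF test_function_sqint[OF test_F[OF t]]] eqf pc[OF s] ..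
  qed
  have 2: "cin (abs_lsq (d_zbar j (\<lambda>z. ?e' z * \<eta> z))) (conb j (($) u) p) =
     cnj (conb j (P u (\<lambda>z. ?e z * cnj (d_zbar j \<eta> z))) p - cnj (symb \<kappa> k j) * conb j (P u (\<lambda>z. ?e z * \<eta> z)) p)" for j
  proof -
    have eq: "cnj (d_zbar j (\<lambda>z. ?e' z * \<eta> z) z) = ?e z * cnj (d_zbar j \<eta> z) + (- cnj (symb \<kappa> k j)) * (?e z * \<eta> z)" for z
      unfolding d_zbar_char_mult[OF \<eta>] by (simp add: ce real cs)
    have s: "sqint (\<lambda>z. ?e z * cnj (d_zbar j \<eta> z))" "sqint (\<lambda>z. ?e z * \<eta> z)"
      by (intro sqint_bmeas_mult char_fn_bmeas sqint_cnj test_function_sqint[OF test_function_d_zbar[OF \<eta>]] test_function_sqint[OF \<eta>])+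
    have "pr (conb j (($) u) p) (\<lambda>z. cnj (d_zbar j (\<lambda>z. ?e' z * \<eta> z) z)) =
      pr (conb j (($) u) p) (\<lambda>z. ?e z * cnj (d_zbar j \<eta> z)) + (- cnj (symb \<kappa> k j)) * pr (conb j (($) u) p) (\<lambda>z. ?e z * \<eta> z)"
      unfolding eq by (subst pr_add_right[OF s(1) sqint_cmult[OF s(2)]]) (simp only: pr_cmult_right)
    then show ?thesis
      by (simp add: cin_abs_left test_function_sqint[OF test_function_d_zbar[OF t]] pc[OF s(1)] pc[OF s(2)])
  qed
  have "cnj (\<Sum>i\<in>UNIV. con i (P u (\<lambda>z. ?e z * (cnj (F i z) * \<eta> z))) p) +
    cnj (\<Sum>j\<in>UNIV. conb j (P u (\<lambda>z. ?e z * cnj (d_zbar j \<eta> z))) p - cnj (symb \<kappa> k j) * conb j (P u (\<lambda>z. ?e z * \<eta> z)) p) = 0"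
  proof -
    have "adj_pairing u (\<lambda>z. ?e' z * \<eta> z) p = 0" by (rule adj_pairing_zero[OF _ t]) (rule orth)
    then show ?thesis unfolding adj_pairing_def 1 2 by (simp only: cnj_sum)
  qed
  from cnj_sum_zero[OF this] show ?thesis unfolding sum_subtractf by (simp only: add_diff_eq right_minus_eq)
qed

end

section \<open>Elliptic estimate and compactness\<close>

lemma norm_vec_squared:
  fixes x :: "('b::real_inner, 'm::finite) vec"
  shows "(norm x)\<^sup>2 = (\<Sum>p\<in>UNIV. (norm (x $ p))\<^sup>2)"
  by (simp add: power2_norm_eq_inner inner_vec_def)

text \<open>By \<open>extb_conb\<close>, wedging with \<sigma> after contracting, plus contracting
  after wedging, is multiplication by |\<sigma>|^2. So |\<sigma>|^2 c is recovered from A and B at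
  the cost of one factor |\<sigma>|, which leaves a bound for |\<sigma>| c, that is, for first
  derivatives.\<close>

lemma symbol_estimate:
  fixes c :: "('n::{finite,linorder}, complex) family"
  assumes A: "\<And>p. (\<Sum>j\<in>UNIV. \<sigma> j * extb j c p) = A p" and B: "\<And>p. (\<Sum>j\<in>UNIV. cnj (\<sigma> j) * conb j c p) = B p"
  shows "(\<Sum>j\<in>UNIV. (cmod (\<sigma> j))\<^sup>2) * (cmod (c p))\<^sup>2 \<le>
    2 * real CARD('n) * ((\<Sum>q\<in>UNIV. (cmod (A q))\<^sup>2) + (\<Sum>q\<in>UNIV. (cmod (B q))\<^sup>2))"
proof -
  define s where "s = (\<Sum>j\<in>UNIV. (cmod (\<sigma> j))\<^sup>2)"
  have s0: "s \<ge> 0" by (simp add: s_def sum_nonneg)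
  define a where "a = sqrt (\<Sum>q\<in>UNIV. (cmod (A q))\<^sup>2)"
  define b where "b = sqrt (\<Sum>q\<in>UNIV. (cmod (B q))\<^sup>2)"
  have ab0: "a \<ge> 0" "b \<ge> 0" by (simp_all add: a_def b_def sum_nonneg)
  have ab2: "a\<^sup>2 = (\<Sum>q\<in>UNIV. (cmod (A q))\<^sup>2)" "b\<^sup>2 = (\<Sum>q\<in>UNIV. (cmod (B q))\<^sup>2)"
    by (simp_all add: a_def b_def sum_nonneg)
  have le: "cmod (A q) \<le> a" "cmod (B q) \<le> b" for q
  proof -
    have "(cmod (A q))\<^sup>2 \<le> a\<^sup>2" "(cmod (B q))\<^sup>2 \<le> b\<^sup>2" unfolding ab2 by (rule member_le_sum; simp)+
    then show "cmod (A q) \<le> a" "cmod (B q) \<le> b" using ab0 by (auto intro: power2_le_imp_le)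
  qed
  have lin: "linear (times c :: complex \<Rightarrow> complex)" for c by (rule bounded_linear.linear[OF bounded_linear_mult_right])
  have Bf: "B = (\<lambda>q. \<Sum>l\<in>UNIV. cnj (\<sigma> l) * conb l c q)" and Af: "A = (\<lambda>q. \<Sum>j\<in>UNIV. \<sigma> j * extb j c q)"
    using A B by auto
  have "extb j B p = (\<Sum>l\<in>UNIV. cnj (\<sigma> l) * extb j (conb l c) p)" for j
    unfolding Bf by (simp only: family_linear_sum[OF family_linear_car(3)] car_comp_linear(3)[OF lin])
  moreover have "conb l A p = (\<Sum>j\<in>UNIV. \<sigma> j * conb l (extb j c) p)" for l
    unfolding Af by (simp only: family_linear_sum[OF family_linear_car(4)] car_comp_linear(4)[OF lin])
  ultimately have "(\<Sum>j\<in>UNIV. \<sigma> j * extb j B p) + (\<Sum>l\<in>UNIV. cnj (\<sigma> l) * conb l A p)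
    = (\<Sum>j\<in>UNIV. \<Sum>l\<in>UNIV. \<sigma> j * (cnj (\<sigma> l) * extb j (conb l c) p)) + (\<Sum>l\<in>UNIV. \<Sum>j\<in>UNIV. cnj (\<sigma> l) * (\<sigma> j * conb l (extb j c) p))"
    by (simp only: sum_distrib_left)
  also have "(\<Sum>l\<in>UNIV. \<Sum>j\<in>UNIV. cnj (\<sigma> l) * (\<sigma> j * conb l (extb j c) p)) = (\<Sum>j\<in>UNIV. \<Sum>l\<in>UNIV. \<sigma> j * (cnj (\<sigma> l) * conb l (extb j c) p))"
    by (subst sum.swap) (simp only: mult.left_commute)
  also have "(\<Sum>j\<in>UNIV. \<Sum>l\<in>UNIV. \<sigma> j * (cnj (\<sigma> l) * extb j (conb l c) p)) + \<dots> =
     (\<Sum>j\<in>UNIV. \<Sum>l\<in>UNIV. \<sigma> j * (cnj (\<sigma> l) * (if j = l then c p else 0)))"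
    by (simp only: sum.distrib[symmetric] distrib_left[symmetric] extb_conb)
  also have "\<dots> = (\<Sum>j\<in>UNIV. \<sigma> j * (cnj (\<sigma> j) * c p))"
    by (simp add: if_distrib[of "\<lambda>x. _ * x"] cong: if_cong)
  also have "\<dots> = of_real s * c p"
    by (simp only: s_def of_real_sum sum_distrib_right complex_norm_square mult.assoc[symmetric])
  finally have eq: "of_real s * c p = (\<Sum>j\<in>UNIV. \<sigma> j * extb j B p) + (\<Sum>l\<in>UNIV. cnj (\<sigma> l) * conb l A p)" ..
  have "s * cmod (c p) = cmod (of_real s * c p)" using s0 by (simp add: norm_mult)
  also have "\<dots> \<le> (\<Sum>j\<in>UNIV. cmod (\<sigma> j * extb j B p)) + (\<Sum>l\<in>UNIV. cmod (cnj (\<sigma> l) * conb l A p))"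
    unfolding eq by (intro order_trans[OF norm_triangle_ineq] add_mono norm_sum)
  also have "\<dots> \<le> (\<Sum>j\<in>UNIV. cmod (\<sigma> j) * b) + (\<Sum>l\<in>UNIV. cmod (\<sigma> l) * a)"
    unfolding norm_mult complex_mod_cnj
    by (intro add_mono sum_mono mult_left_mono norm_car_le le norm_ge_zero)
  also have "\<dots> = (\<Sum>j\<in>UNIV. cmod (\<sigma> j)) * (a + b)"
    by (simp add: sum_distrib_right[symmetric] distrib_left)
  finally have 1: "s * cmod (c p) \<le> (\<Sum>j\<in>UNIV. cmod (\<sigma> j)) * (a + b)" .
  \<comment> \<open>Cauchy-Schwarz against the constant 1 over n coordinates, the origin of the
    dimension in the constant.\<close>
  have 2: "(\<Sum>j\<in>UNIV. cmod (\<sigma> j))\<^sup>2 \<le> real CARD('n) * s"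
  proof -
    have "(\<Sum>j\<in>UNIV. \<bar>cmod (\<sigma> j)\<bar> * \<bar>1\<bar>) \<le> L2_set (\<lambda>j. cmod (\<sigma> j)) UNIV * L2_set (\<lambda>j. 1) (UNIV :: 'n set)"
      by (rule L2_set_mult_ineq)
    then have "(\<Sum>j\<in>UNIV. cmod (\<sigma> j)) \<le> sqrt s * sqrt (real CARD('n))"
      by (simp add: L2_set_def s_def)
    then have "(\<Sum>j\<in>UNIV. cmod (\<sigma> j))\<^sup>2 \<le> (sqrt s * sqrt (real CARD('n)))\<^sup>2"
      by (intro power_mono sum_nonneg) auto
    then show ?thesis using s0 by (simp add: power_mult_distrib mult.commute)
  qed
  have "s * (cmod (c p))\<^sup>2 \<le> real CARD('n) * (a + b)\<^sup>2"
  proof (cases "s = 0")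
    case False
    then have sp: "s > 0" using s0 by simp
    have "(s * cmod (c p))\<^sup>2 \<le> ((\<Sum>j\<in>UNIV. cmod (\<sigma> j)) * (a + b))\<^sup>2"
      using 1 s0 by (intro power_mono) auto
    also have "\<dots> \<le> (real CARD('n) * s) * (a + b)\<^sup>2"
      unfolding power_mult_distrib by (intro mult_right_mono 2) auto
    finally have "s * (s * (cmod (c p))\<^sup>2) \<le> s * (real CARD('n) * (a + b)\<^sup>2)"
      by (simp add: power_mult_distrib power2_eq_square mult_ac)
    then show ?thesis using sp by simp
  qed simp
  also have "\<dots> \<le> real CARD('n) * (2 * a\<^sup>2 + 2 * b\<^sup>2)"
    using zero_le_power2[of "a - b"] by (intro mult_left_mono) (simp_all add: power2_eq_square algebra_simps)
  finally show ?thesis unfolding s_def ab2 by (simp add: algebra_simps)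
qed

lemma pr_mul_cube:
  assumes "bmeas b" "\<forall>z. z \<notin> cube \<kappa> \<longrightarrow> b z = 0"
  shows "pr (mul b x) (cube_char \<kappa> k) = pr x (\<lambda>z. char_fn \<kappa> k z * b z)"
proof -
  have "(\<lambda>z. b z * cube_char \<kappa> k z) = (\<lambda>z. char_fn \<kappa> k z * b z)"
  proof (rule HOL.ext)
    fix z show "b z * cube_char \<kappa> k z = char_fn \<kappa> k z * b z"
      using assms(2) by (cases "z \<in> cube \<kappa>") (simp_all add: cube_char_def)
  qed
  then show ?thesis using pr_mul[OF assms(1) sqint_measurable[OF sqint_cube_char]] by simp
qed

context twisted
begin

text \<open>\<open>Yop\<close> and \<open>Zop\<close> collect the lower order terms of \<open>dbar (\<eta> u)\<close> and of the formal adjoint applied to \<open>\<eta> u\<close>.\<close>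

definition Yop :: "('n cn \<Rightarrow> complex) \<Rightarrow> 'n hf \<times> 'n hf \<Rightarrow> 'n hf" where
  "Yop \<eta> uw = (\<chi> p. (\<Sum>i\<in>UNIV. ext i (\<lambda>q. mul (\<lambda>z. F i z * \<eta> z) (fst uw $ q)) p) -
     (\<Sum>j\<in>UNIV. extb j (\<lambda>q. mul (d_zbar j \<eta>) (fst uw $ q)) p) - mul \<eta> (snd uw $ p))"

definition Zop :: "('n cn \<Rightarrow> complex) \<Rightarrow> 'n hf \<Rightarrow> 'n hf" where
  "Zop \<eta> u = (\<chi> p. (\<Sum>i\<in>UNIV. con i (\<lambda>q. mul (\<lambda>z. cnj (F i z * \<eta> z)) (u $ q)) p) +
     (\<Sum>j\<in>UNIV. conb j (\<lambda>q. mul (\<lambda>z. cnj (d_zbar j \<eta> z)) (u $ q)) p))"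

lemma bounded_linear_Yop:
  assumes "test_function D \<eta>" shows "bounded_linear (Yop \<eta>)"
  unfolding Yop_def[abs_def]
  by (intro bounded_linear_vec_lambda bounded_linear_sub bounded_linear_sum bounded_linear_car
      bounded_linear_compose[OF bounded_linear_mul[OF test_function_bmeas[OF assms]]]
      bounded_linear_compose[OF bounded_linear_mul[OF test_function_bmeas[OF test_F[OF assms]]]]
      bounded_linear_compose[OF bounded_linear_mul[OF test_function_bmeas[OF test_function_d_zbar[OF assms]]]]
      bounded_linear_compose[OF bounded_linear_vec_nth bounded_linear_fst]
      bounded_linear_compose[OF bounded_linear_vec_nth bounded_linear_snd])

lemma bounded_linear_Zop:
  assumes "test_function D \<eta>" shows "bounded_linear (Zop \<eta>)"
  unfolding Zop_def[abs_def]
  by (intro bounded_linear_vec_lambda bounded_linear_add bounded_linear_sum bounded_linear_car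
      bounded_linear_compose[OF bounded_linear_mul[OF bmeas_cnj[OF test_function_bmeas[OF test_F[OF assms]]]]]
      bounded_linear_compose[OF bounded_linear_mul[OF bmeas_cnj[OF test_function_bmeas[OF test_function_d_zbar[OF assms]]]]]
      bounded_linear_vec_nth)

lemma D_in_cube: obtains \<kappa> where "\<kappa> > 0" "D \<subseteq> cube \<kappa>"
proof -
  obtain R where R: "R > 0" "\<And>z. z \<in> D \<Longrightarrow> norm z \<le> R" using D_bounded unfolding bounded_pos by blast
  have "D \<subseteq> cube (pi / R)"
  proof
    fix z assume z: "z \<in> D"
    have "\<bar>z \<bullet> b\<bar> \<le> R" if "b \<in> Basis" for b
      using Basis_le_norm[OF that, of z] R(2)[OF z] by linarith
    then show "z \<in> cube (pi / R)" using R(1) by (simp add: mem_cube)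
  qed
  then show thesis using that[of "pi / R"] R(1) by simp
qed

lemma pr_car_family:
  assumes "sqint \<theta>"
  shows "pr (ext i c p) \<theta> = ext i (\<lambda>q. pr (c q) \<theta>) p" "pr (con i c p) \<theta> = con i (\<lambda>q. pr (c q) \<theta>) p"
    "pr (extb i c p) \<theta> = extb i (\<lambda>q. pr (c q) \<theta>) p" "pr (conb i c p) \<theta> = conb i (\<lambda>q. pr (c q) \<theta>) p"
  using assms by (auto simp: car_defs pr_scaleR simp del: scaleR_conv_of_real)

text \<open>The symbol estimate bounds each weighted Fourier coefficient of \<eta> u by coefficients
  of \<open>Yop\<close> and \<open>Zop\<close>, and Bessel's inequality sums these to a bound
  independent of n. With the squared symbol as weight, \<open>Rellich_cube\<close> applies to all
  components at once.\<close>

theorem interior_compactness: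
  assumes \<eta>: "test_function D \<eta>" and real: "\<And>z. cnj (\<eta> z) = \<eta> z"
    and wd: "\<And>n. wd D F (us n) (ws n)" and orth: "\<And>n v z. wd D F v z \<Longrightarrow> z \<bullet> us n = 0"
    and bdd: "\<And>n. norm (us n) \<le> 1" "\<And>n. norm (ws n) \<le> b"
  obtains r :: "nat \<Rightarrow> nat" where "strict_mono r" "Cauchy (\<lambda>n. \<chi> p. mul \<eta> (us (r n) $ p))"
proof -
  obtain \<kappa> where \<kappa>: "\<kappa> > 0" "D \<subseteq> cube \<kappa>" by (rule D_in_cube)
  let ?V = "cube_vol TYPE('n cn) \<kappa>"
  have V: "?V > 0" by (rule cube_vol_pos[OF \<kappa>(1)])
  have b\<eta>: "bmeas \<eta>" by (rule test_function_bmeas[OF \<eta>])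
  have off: "\<forall>z. z \<notin> cube \<kappa> \<longrightarrow> \<theta> z = 0" if "test_function D \<theta>" for \<theta>
    using test_function_outside[OF that] \<kappa>(2) by blast
  obtain B where B: "\<And>z. cmod (\<eta> z) \<le> B" using test_function_bounded[OF \<eta>] by metis
  have B0: "B \<ge> 0" using B norm_ge_zero order_trans by blast
  obtain cY where cY: "cY > 0" "\<And>uw. norm (Yop \<eta> uw) \<le> norm uw * cY"
    using bounded_linear.pos_bounded[OF bounded_linear_Yop[OF \<eta>]] by blast
  obtain cZ where cZ: "cZ > 0" "\<And>u. norm (Zop \<eta> u) \<le> norm u * cZ"
    using bounded_linear.pos_bounded[OF bounded_linear_Zop[OF \<eta>]] by blast
  define x where "x n p = mul \<eta> (us n $ p)" for n p
  have b0: "b \<ge> 0" using bdd(2)[of 0] norm_ge_zero order_trans by blast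
  \<comment> \<open>Built from Bessel's constant, the operator norms of \<open>Yop\<close> and
    \<open>Zop\<close>, and the bound 1 + b on the norm of the pair (u, w).\<close>
  define C where "C = 2 * real CARD('n) * (?V * ((1 + b) * cY)\<^sup>2 + ?V * cZ\<^sup>2)"
  have key: "(\<Sum>k\<in>K. symb2 \<kappa> k * (norm (pr (x n p) (cube_char \<kappa> k)))\<^sup>2) \<le> C"
    if K: "finite K" "K \<subseteq> freqs" for n p K
  proof -
    let ?Y = "Yop \<eta> (us n, ws n)" and ?Z = "Zop \<eta> (us n)"
    have pt: "symb2 \<kappa> k * (norm (pr (x n p) (cube_char \<kappa> k)))\<^sup>2 \<le>
      2 * real CARD('n) * ((\<Sum>q\<in>UNIV. (cmod (pr (?Y $ q) (cube_char \<kappa> k)))\<^sup>2) + (\<Sum>q\<in>UNIV. (cmod (pr (?Z $ q) (cube_char \<kappa> k)))\<^sup>2))" for k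
    proof -
      let ?c = "P (us n) (\<lambda>z. char_fn \<kappa> k z * \<eta> z)"
      have c: "pr (x n p) (cube_char \<kappa> k) = ?c p"
        unfolding x_def P_def by (rule pr_mul_cube[OF b\<eta> off[OF \<eta>]])
      have s: "sqint (cube_char \<kappa> k)" by (rule sqint_cube_char)
      note m1 = pr_mul_cube[OF test_function_bmeas[OF test_F[OF \<eta>]] off[OF test_F[OF \<eta>]]]
      note m2 = pr_mul_cube[OF test_function_bmeas[OF test_function_d_zbar[OF \<eta>]] off[OF test_function_d_zbar[OF \<eta>]]]
      note m3 = pr_mul_cube[OF test_function_bmeas[OF test_function_cnj[OF test_F[OF \<eta>]]] off[OF test_function_cnj[OF test_F[OF \<eta>]]]]
      note m4 = pr_mul_cube[OF test_function_bmeas[OF test_function_cnj[OF test_function_d_zbar[OF \<eta>]]] off[OF test_function_cnj[OF test_function_d_zbar[OF \<eta>]]]]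
      have "(\<Sum>j\<in>UNIV. symb \<kappa> k j * extb j ?c q) = pr (?Y $ q) (cube_char \<kappa> k)" for q
        unfolding symbol_equation[OF wd \<eta>]
        unfolding Yop_def vec_lambda_beta pr_diff[OF s] pr_sum[OF s] pr_car_family[OF s] m1 m2 fst_conv snd_conv
          pr_mul_cube[OF b\<eta> off[OF \<eta>]] P_def[abs_def] ..
      moreover have "(\<Sum>j\<in>UNIV. cnj (symb \<kappa> k j) * conb j ?c q) = pr (?Z $ q) (cube_char \<kappa> k)" for q
      proof -
        have "(\<Sum>j\<in>UNIV. cnj (symb \<kappa> k j) * conb j ?c q) =
          (\<Sum>i\<in>UNIV. con i (P (us n) (\<lambda>z. char_fn \<kappa> k z * (cnj (F i z) * \<eta> z))) q) +
          (\<Sum>j\<in>UNIV. conb j (P (us n) (\<lambda>z. char_fn \<kappa> k z * cnj (d_zbar j \<eta> z))) q)"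
          by (rule adjoint_symbol_equation[OF _ \<eta> real]) (rule orth)
        also have "\<dots> = pr (?Z $ q) (cube_char \<kappa> k)"
          unfolding Zop_def vec_lambda_beta pr_add[OF s] pr_sum[OF s] pr_car_family[OF s] m3 m4 P_def[abs_def]
          by (simp only: complex_cnj_mult real)
        finally show ?thesis .
      qed
      ultimately show ?thesis unfolding c symb2_def by (rule symbol_estimate)
    qed
    have "(\<Sum>k\<in>K. symb2 \<kappa> k * (norm (pr (x n p) (cube_char \<kappa> k)))\<^sup>2) \<le>
      (\<Sum>k\<in>K. 2 * real CARD('n) * ((\<Sum>q\<in>UNIV. (cmod (pr (?Y $ q) (cube_char \<kappa> k)))\<^sup>2) + (\<Sum>q\<in>UNIV. (cmod (pr (?Z $ q) (cube_char \<kappa> k)))\<^sup>2)))"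
      by (intro sum_mono pt)
    also have "\<dots> = 2 * real CARD('n) * ((\<Sum>q\<in>UNIV. \<Sum>k\<in>K. (cmod (pr (?Y $ q) (cube_char \<kappa> k)))\<^sup>2) + (\<Sum>q\<in>UNIV. \<Sum>k\<in>K. (cmod (pr (?Z $ q) (cube_char \<kappa> k)))\<^sup>2))"
      by (subst (1 2) sum.swap) (simp only: sum_distrib_left[symmetric] sum.distrib)
    also have "\<dots> \<le> 2 * real CARD('n) * ((\<Sum>q\<in>UNIV. ?V * (norm (?Y $ q))\<^sup>2) + (\<Sum>q\<in>UNIV. ?V * (norm (?Z $ q))\<^sup>2))"
      by (intro mult_left_mono add_mono sum_mono Bessel_cube_char \<kappa>(1) K) simp
    also have "\<dots> = 2 * real CARD('n) * (?V * (norm ?Y)\<^sup>2 + ?V * (norm ?Z)\<^sup>2)"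
      by (simp only: sum_distrib_left[symmetric] norm_vec_squared)
    also have "\<dots> \<le> C"
      unfolding C_def
    proof (intro mult_left_mono add_mono)
      have "norm ?Y \<le> norm (us n, ws n) * cY" by (rule cY(2))
      also have "\<dots> \<le> (1 + b) * cY"
        using norm_Pair_le[of "us n" "ws n"] bdd[of n] cY(1) by (intro mult_right_mono) linarith+
      finally show "(norm ?Y)\<^sup>2 \<le> ((1 + b) * cY)\<^sup>2" by (intro power_mono) auto
      have "norm ?Z \<le> norm (us n) * cZ" by (rule cZ(2))
      also have "\<dots> \<le> 1 * cZ" using bdd(1)[of n] cZ(1) by (intro mult_right_mono) auto
      finally show "(norm ?Z)\<^sup>2 \<le> cZ\<^sup>2" by (intro power_mono) auto
    qed (use V in auto)
    finally show ?thesis .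
  qed
  have bC: "bmeas (indicator (cube \<kappa>) :: 'n cn \<Rightarrow> complex)" by (rule bmeas_compact_indicator[OF compact_cube])
  have supp: "mul (indicator (cube \<kappa>)) (x n p) = x n p" for n p
    unfolding x_def mul_mul[OF bC b\<eta>] by (rule mul_cong) (use off[OF \<eta>] in \<open>auto simp: indicator_def\<close>)
  have bd: "norm (x n p) \<le> B" for n p
  proof -
    have "norm (x n p) \<le> B * norm (us n $ p)" unfolding x_def by (rule norm_mul_le[OF b\<eta> B])
    also have "\<dots> \<le> B * 1" using Finite_Cartesian_Product.norm_nth_le[of "us n" p] bdd(1)[of n] B0 by (intro mult_left_mono) auto
    finally show ?thesis by simp
  qed
  obtain r :: "nat \<Rightarrow> nat" where r: "strict_mono r" "\<And>p. Cauchy (\<lambda>n. x (r n) p)"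
  proof (rule Rellich_cube[where \<kappa> = \<kappa> and P = UNIV and x = x and B = B and w = "symb2 \<kappa>" and C = C])
    fix r :: "nat \<Rightarrow> nat" assume r: "strict_mono r" "\<And>p. p \<in> UNIV \<Longrightarrow> Cauchy (\<lambda>n. x (r n) p)"
    show thesis by (rule \<open>\<And>r. \<lbrakk>strict_mono r; \<And>p. Cauchy (\<lambda>n. x (r n) p)\<rbrakk> \<Longrightarrow> thesis\<close>[OF r(1)]) (rule r(2)[OF UNIV_I])
  qed (use \<kappa>(1) supp bd finite_symb2_le[OF \<kappa>(1)] key symb2_nonneg in auto)
  have "Cauchy (\<lambda>n. \<chi> p. x (r n) p)" by (rule vec_CauchyI) (simp add: r(2))
  then show thesis using that[OF r(1)] by (simp add: x_def)
qed

end

context twisted_homotopy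
begin

text \<open>All the analysis enters through the compactness axiom. Interior compactness makes the
  cut-off sequence Cauchy along a subsequence, and the localization estimate, applied to
  differences, upgrades this to the sequence itself.\<close>

theorem hilbert_complex: "hilbert_complex (supported D) (wd D F)"
proof
  show "closed (supported D)" by (rule closed_supported)
  show "subspace (supported D)" by (rule subspace_supported)
  show "wd D F u w \<Longrightarrow> u \<in> supported D \<and> w \<in> supported D" for u w by (simp add: wd_def)
  show "wd D F 0 0" by (rule wd_0)
  show "wd D F u w \<Longrightarrow> wd D F u' w' \<Longrightarrow> wd D F (u + u') (w + w')" for u w u' w' by (rule wd_add)
  show "wd D F u w \<Longrightarrow> wd D F (r *\<^sub>R u) (r *\<^sub>R w)" for u w r by (rule wd_scaleR)
  show "(\<And>n. wd D F (us n) (ws n)) \<Longrightarrow> us \<longlonglongrightarrow> u \<Longrightarrow> ws \<longlonglongrightarrow> w \<Longrightarrow> wd D F u w" for us ws u w by (rule wd_limit)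
  show "wd D F u w \<Longrightarrow> wd D F w 0" for u w by (rule wd_square)
  fix us ws assume wd: "\<And>n. wd D F (us n) (ws n)" and orth: "\<And>n v z. wd D F v z \<Longrightarrow> z \<bullet> us n = 0"
    and b1: "\<And>n. norm (us n) \<le> 1" and lim: "ws \<longlonglongrightarrow> 0"
  obtain r where r: "test_function D (\<lambda>z. complex_of_real (r z))" "\<And>z. 0 \<le> r z" "\<And>z. z \<in> K \<Longrightarrow> 1 \<le> r z"
    using exists_test_function_ge_1[OF D_open K_compact K_D] by blast
  let ?\<eta> = "\<lambda>z. complex_of_real (r z)"
  obtain b where b: "\<And>n. norm (ws n) \<le> b"
    using convergent_imp_Bseq[of ws] lim unfolding convergent_def Bseq_def by blast
  obtain c where c: "c > 0" "\<And>u w. wd D F u w \<Longrightarrow> (\<And>v z. wd D F v z \<Longrightarrow> z \<bullet> u = 0) \<Longrightarrow>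
     norm u \<le> c * (norm w + norm (vmul ?\<eta> u))"
    using localization_estimate[OF r(1,3,2)] by blast
  obtain s :: "nat \<Rightarrow> nat" where s: "strict_mono s" "Cauchy (\<lambda>n. \<chi> p. mul ?\<eta> (us (s n) $ p))"
    by (rule interior_compactness[OF r(1) _ wd orth b1 b]) simp_all
  have C1: "Cauchy (\<lambda>n. vmul ?\<eta> (us (s n)))" using s(2) by (simp add: vmul_def)
  have C2: "Cauchy (ws \<circ> s)" using LIMSEQ_imp_Cauchy[OF LIMSEQ_subseq_LIMSEQ[OF lim s(1)]] .
  have "Cauchy (us \<circ> s)"
  proof (rule CauchyI)
    fix e :: real assume e: "e > 0"
    have e2: "e / (2 * c) > 0" using e c(1) by simp
    obtain M where M: "\<And>m n. m \<ge> M \<Longrightarrow> n \<ge> M \<Longrightarrow> norm (vmul ?\<eta> (us (s m)) - vmul ?\<eta> (us (s n))) < e / (2 * c)"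
      using CauchyD[OF C1 e2] by blast
    obtain N where N: "\<And>m n. m \<ge> N \<Longrightarrow> n \<ge> N \<Longrightarrow> norm ((ws \<circ> s) m - (ws \<circ> s) n) < e / (2 * c)"
      using CauchyD[OF C2 e2] by blast
    show "\<exists>M. \<forall>m\<ge>M. \<forall>n\<ge>M. norm ((us \<circ> s) m - (us \<circ> s) n) < e"
    proof (intro exI[of _ "max M N"] allI impI)
      fix m n assume mn: "max M N \<le> m" "max M N \<le> n"
      \<comment> \<open>Differences of members of the sequence are again in the domain and
        orthogonal to the range.\<close>
      have "norm (us (s m) - us (s n)) \<le> c * (norm (ws (s m) - ws (s n)) + norm (vmul ?\<eta> (us (s m) - us (s n))))"
        by (rule c(2)[OF wd_diff[OF wd wd]]) (simp add: inner_diff_right orth)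
      also have "vmul ?\<eta> (us (s m) - us (s n)) = vmul ?\<eta> (us (s m)) - vmul ?\<eta> (us (s n))"
        by (rule linear_diff[OF bounded_linear.linear[OF bounded_linear_vmul[OF test_function_bmeas[OF r(1)]]]])
      also have "c * (norm (ws (s m) - ws (s n)) + norm (vmul ?\<eta> (us (s m)) - vmul ?\<eta> (us (s n)))) < c * (e / (2 * c) + e / (2 * c))"
        using M[of m n] N[of m n] mn c(1) by (intro mult_strict_left_mono add_strict_mono) auto
      also have "\<dots> = e" using c(1) by simp
      finally show "norm ((us \<circ> s) m - (us \<circ> s) n) < e" by simp
    qed
  qed
  with s(1) show "\<exists>r::nat \<Rightarrow> nat. strict_mono r \<and> Cauchy (us \<circ> r)" by blast
qed

end

section \<open>Complex structure and grading\<close>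

definition hin :: "'n::{finite,linorder} hf \<Rightarrow> 'n hf \<Rightarrow> complex" where
  "hin u v = (\<Sum>p\<in>UNIV. cin (u $ p) (v $ p))"

definition csc :: "complex \<Rightarrow> 'n::{finite,linorder} hf \<Rightarrow> 'n hf" where
  "csc c u = (\<chi> p. mul (\<lambda>z. c) (u $ p))"

definition bideg :: "'n set \<times> 'n set \<Rightarrow> int" where
  "bideg p = int (card (fst p) + card (snd p))"

definition deg :: "int \<Rightarrow> 'n::{finite,linorder} hf \<Rightarrow> 'n hf" where
  "deg k u = (\<chi> p. if bideg p = k then u $ p else 0)"

lemma cin_0 [simp]: "cin 0 v = 0" "cin v 0 = 0"
  using cin_scaleR_left[of 0 0 v] cin_scaleR_right[of v 0 0] by auto

lemma hin_0 [simp]: "hin 0 v = 0" "hin v 0 = 0"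
  by (simp_all add: hin_def)

lemma hin_add_left: "hin (u + v) w = hin u w + hin v w"
  by (simp add: hin_def cin_add_left sum.distrib)

lemma hin_add_right: "hin u (v + w) = hin u v + hin u w"
  by (simp add: hin_def cin_add_right sum.distrib)

lemma hin_diff_right: "hin u (v - w) = hin u v - hin u w"
  using hin_add_right[of u "v - w" w] by simp

lemma hin_csc: "hin (csc c u) v = c * hin u v"
  by (simp add: hin_def csc_def cin_mul_const sum_distrib_left)

lemma hin_commute: "hin u v = cnj (hin v u)"
  unfolding hin_def cnj_sum by (subst cin_commute) rule

lemma inner_eq_hin: "u \<bullet> v = Re (hin u v)"
  by (simp add: hin_def inner_vec_def inner_lsq_def)

lemma hin_self_eq_0: "hin u u = 0 \<longleftrightarrow> u = 0"
  using inner_eq_hin[of u u] by (auto simp: inner_eq_zero_iff)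

lemma complex_eq_by_Re: "Re a = Re b \<Longrightarrow> Re (- \<i> * a) = Re (- \<i> * b) \<Longrightarrow> a = b"
  by (simp add: complex_eq_iff)

lemma deg_idem [simp]: "deg k (deg k u) = deg k u"
  by (simp add: deg_def vec_eq_iff)

lemma deg_add: "deg k (u + v) = deg k u + deg k v"
  by (simp add: deg_def vec_eq_iff)

lemma linear_deg: "linear (deg k)"
  by (rule linearI) (simp_all add: deg_def vec_eq_iff)

lemma deg_0 [simp]: "deg k 0 = 0"
  by (simp add: deg_def vec_eq_iff)

lemma hin_deg: "hin (deg k u) v = hin u (deg k v)"
  by (auto simp: hin_def deg_def intro!: sum.cong)

lemma card_remove: "i \<in> I \<Longrightarrow> int (card (I - {i})) = int (card I) - 1" for I :: "'n::finite set"
  using card_Suc_Diff1[of I i] by simp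

lemma ext_graded: "ext i (\<lambda>q. if bideg q = k then a q else 0) p = (if bideg p = k + 1 then ext i a p else 0)"
  and extb_graded: "extb i (\<lambda>q. if bideg q = k then a q else 0) p = (if bideg p = k + 1 then extb i a p else 0)"
  by (auto simp: ext_def extb_def bideg_def card_remove simp del: card_Diff_singleton card_Diff_insert)

context twisted
begin

lemma supported_deg: "u \<in> supported D \<Longrightarrow> deg k u \<in> supported D"
  by (intro supportedI) (simp add: deg_def supportedD bmeas_ind)

text \<open>Each exterior product raises the total degree by one, so the components of the weak
  equation in degree k + 1 involve only the degree k part of u.\<close>

lemma wd_deg:
  assumes "wd D F u w" shows "wd D F (deg k u) (deg (k + 1) w)"
  unfolding wd_def
proof (intro conjI allI impI)
  show "deg k u \<in> supported D" "deg (k + 1) w \<in> supported D"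
    using assms by (auto simp: wd_def intro: supported_deg)
  fix \<theta> and p :: "'n set \<times> 'n set" assume \<theta>: "test_function D \<theta>"
  have P: "P (deg k u) \<theta> = (\<lambda>q. if bideg q = k then P u \<theta> q else 0)" if "test_function D \<theta>" for k u \<theta>
    using test_function_sqint[OF that] by (auto simp: P_def deg_def)
  have w: "P w \<theta> p = wsum \<theta> F u p" using assms \<theta> unfolding wd_def by blast
  show "P (deg (k + 1) w) \<theta> p = wsum \<theta> F (deg k u) p"
    unfolding wsum_def P[OF \<theta>] P[OF test_F[OF \<theta>]] P[OF test_function_d_zbar[OF \<theta>]] ext_graded extb_graded
    using w by (simp add: wsum_def)
qed

lemma P_csc: "test_function D \<theta> \<Longrightarrow> P (csc c u) \<theta> = (\<lambda>q. c * P u \<theta> q)"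
  by (rule HOL.ext) (simp add: P_def csc_def pr_mul test_function_measurable pr_cmult_right)

lemma wd_csc:
  assumes "wd D F u w" shows "wd D F (csc c u) (csc c w)"
  unfolding wd_def
proof (intro conjI allI impI)
  have "csc c v \<in> supported D" if "v \<in> supported D" for v
    by (rule supportedI) (simp add: csc_def supported_mul supportedD[OF that])
  then show "csc c u \<in> supported D" "csc c w \<in> supported D" using assms by (auto simp: wd_def)
  fix \<theta> and p :: "'n set \<times> 'n set" assume \<theta>: "test_function D \<theta>"
  have lin: "linear (times c :: complex \<Rightarrow> complex)" by (rule bounded_linear.linear[OF bounded_linear_mult_right])
  have w: "P w \<theta> p = wsum \<theta> F u p" using assms \<theta> unfolding wd_def by blast
  show "P (csc c w) \<theta> p = wsum \<theta> F (csc c u) p"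
    unfolding P_csc[OF \<theta>] w wsum_def P_csc[OF test_F[OF \<theta>]] P_csc[OF test_function_d_zbar[OF \<theta>]] car_comp_linear[OF lin]
    by (simp only: sum_distrib_left right_diff_distrib)
qed

lemma supported_eq_0:
  fixes u :: "'n hf"
  assumes u: "u \<in> supported D" and 0: "\<And>\<theta> p. test_function D \<theta> \<Longrightarrow> pr (u $ p) \<theta> = 0"
  shows "u = 0"
proof -
  have "u $ p = 0" for p
  proof -
    have "AE z in lebesgue. z \<in> D \<longrightarrow> rep_lsq (u $ p) z = 0"
      by (rule AE_zero_of_bump_integrals[OF D_open]) (rule 0[OF test_function_box_bump])
    moreover have "AE z in lebesgue. rep_lsq (u $ p) z = indicator D z * rep_lsq (u $ p) z"
      using rep_mul[OF bmeas_ind, of "u $ p"] unfolding supportedD[OF u] .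
    ultimately have "AE z in lebesgue. rep_lsq (u $ p) z = rep_lsq 0 z"
      using rep_zero_lsq by eventually_elim (auto simp: indicator_def)
    then show ?thesis by (simp add: lsq_eq_iff)
  qed
  then show ?thesis by (simp add: vec_eq_iff)
qed

text \<open>An image is determined by its pairings with test functions; this makes the definite
  description in \<open>dbar\<close> meaningful.\<close>

lemma wd_unique:
  assumes "wd D F u w" "wd D F u w'" shows "w = w'"
proof -
  have 0: "wd D F 0 (w - w')" using wd_add[OF assms(1) wd_scaleR[OF assms(2), of "-1"]] by simp
  have "w - w' = 0"
  proof (rule supported_eq_0)
    show "w - w' \<in> supported D" using 0 by (simp add: wd_def)
    fix \<theta> p assume \<theta>: "test_function D \<theta>"
    have "pr ((w - w') $ p) \<theta> = wsum \<theta> F 0 p" using 0 \<theta> unfolding wd_def P_def by blast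
    also have "\<dots> = 0" using wsum_linear(2)[OF \<theta>, of 0 0 p] by simp
    finally show "pr ((w - w') $ p) \<theta> = 0" .
  qed
  then show ?thesis by simp
qed

text \<open>Test forms lie in the domain, so an element orthogonal to the domain pairs to zero with
  all test functions. Density makes the adjoint single-valued.\<close>

lemma domain_dense:
  assumes "e \<in> supported D" and "\<And>v z. wd D F v z \<Longrightarrow> hin v e = 0"
  shows "e = 0"
proof (rule supported_eq_0[OF assms(1)])
  fix \<theta> p assume "test_function D \<theta>"
  then have \<theta>: "test_function D (\<lambda>z. cnj (\<theta> z))" by (rule test_function_cnj)
  have "cin (abs_lsq (\<lambda>z. cnj (\<theta> z))) (e $ p) = hin (tf (\<lambda>z. cnj (\<theta> z)) p) e"
    by (simp add: hin_def tf_def if_distrib[of "\<lambda>x. cin x _"] cong: if_cong)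
  also have "\<dots> = 0" by (rule assms(2)[OF wd_tf[OF \<theta>]])
  finally show "pr (e $ p) \<theta> = 0"
    by (simp add: cin_abs_left[OF test_function_sqint[OF \<theta>]])
qed

end

section \<open>The complex adjoint and the grading\<close>

context twisted_homotopy
begin

sublocale hc: hilbert_complex "supported D" "wd D F" by (rule hilbert_complex)

text \<open>The graph is stable under complex scalars, so the real adjoint relation may be applied
  to - \<i> times a graph pair; this yields the imaginary part. The real and the complex adjoint
  therefore coincide.\<close>

lemma Wadj_iff:
  "hc.Wadj u e \<longleftrightarrow> u \<in> supported D \<and> e \<in> supported D \<and> (\<forall>v z. wd D F v z \<longrightarrow> hin z u = hin v e)"
proof -
  have "hin z u = hin v e" if W: "hc.Wadj u e" and wd: "wd D F v z" for v z
  proof (rule complex_eq_by_Re)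
    have "Re (c * hin z u) = Re (c * hin v e)" for c
      using W wd_csc[OF wd, of c] unfolding hc.Wadj_def inner_eq_hin hin_csc[symmetric] by blast
    from this[of 1] this[of "- \<i>"]
    show "Re (hin z u) = Re (hin v e)" "Re (- \<i> * hin z u) = Re (- \<i> * hin v e)" by simp_all
  qed
  then show ?thesis by (auto simp: hc.Wadj_def inner_eq_hin)
qed

lemma WadjD: "hc.Wadj u e \<Longrightarrow> wd D F v z \<Longrightarrow> hin z u = hin v e"
  by (simp add: Wadj_iff)

lemma Wadj_unique:
  assumes "hc.Wadj u e" "hc.Wadj u e'" shows "e = e'"
proof -
  have "e - e' = 0"
  proof (rule domain_dense)
    show "e - e' \<in> supported D" using assms subspace_diff[OF subspace_supported] by (simp add: Wadj_iff)
    fix v z assume "wd D F v z"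
    from WadjD[OF assms(1) this] WadjD[OF assms(2) this] show "hin v (e - e') = 0" by (simp add: hin_diff_right)
  qed
  then show ?thesis by simp
qed

lemma Wadj_add: "hc.Wadj u e \<Longrightarrow> hc.Wadj u' e' \<Longrightarrow> hc.Wadj (u + u') (e + e')"
  by (simp add: Wadj_iff hin_add_right subspace_add[OF subspace_supported])

lemma csc_supported: "v \<in> supported D \<Longrightarrow> csc c v \<in> supported D"
  by (rule supportedI) (simp add: csc_def supported_mul supportedD)

lemma Wadj_csc: "hc.Wadj u e \<Longrightarrow> hc.Wadj (csc c u) (csc c e)"
  unfolding Wadj_iff by (subst hin_commute, subst (2) hin_commute) (simp add: hin_csc csc_supported hin_commute[symmetric])

lemma Wadj_deg:
  assumes "hc.Wadj u e" shows "hc.Wadj (deg (k + 1) u) (deg k e)"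
  unfolding Wadj_iff
proof (intro conjI allI impI)
  show "deg (k + 1) u \<in> supported D" "deg k e \<in> supported D" using assms by (simp_all add: Wadj_iff supported_deg)
  fix v z assume "wd D F v z"
  from WadjD[OF assms wd_deg[OF this]] show "hin z (deg (k + 1) u) = hin v (deg k e)" by (simp add: hin_deg)
qed

lemma harm_iff: "h \<in> hc.harm \<longleftrightarrow> wd D F h 0 \<and> hc.Wadj h 0"
  by (simp add: hc.harm_def)

lemma harm_deg: "h \<in> hc.harm \<Longrightarrow> deg k h \<in> hc.harm"
  using wd_deg[of h 0 k] Wadj_deg[of h 0 "k - 1"] by (simp add: harm_iff)

text \<open>The ungraded decomposition is projected to degree k; the projections are compatible with
  the operator, its adjoint and the harmonic space.\<close>

lemma graded_decomposition:
  assumes "x \<in> supported D" "deg k x = x"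
  obtains a b c u v where "x = a + b + c" "a \<in> hc.harm" "deg k a = a" "wd D F u b" "deg (k - 1) u = u" "deg k b = b"
    "hc.Wadj v c" "deg k c = c"
proof -
  obtain a b c u v where d: "x = a + b + c" "a \<in> hc.harm" "wd D F u b" "hc.Wadj v c"
    by (rule hc.decomposition[OF assms(1)])
  show thesis
  proof (rule that[of "deg k a" "deg k b" "deg k c" "deg (k - 1) u" "deg (k + 1) v"])
    show "x = deg k a + deg k b + deg k c" using assms(2) unfolding d(1) deg_add ..
  qed (use wd_deg[OF d(3), of "k - 1"] Wadj_deg[OF d(4), of k] harm_deg[OF d(2)] in simp_all)
qed

lemma graded_harm_finite_dim:
  obtains B where "finite B" "B \<subseteq> {h \<in> hc.harm. deg k h = h}" "{h \<in> hc.harm. deg k h = h} \<subseteq> span B"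
proof -
  obtain B where B: "finite B" "B \<subseteq> hc.harm" "hc.harm \<subseteq> span B" by (rule hc.harm_finite_dim)
  show thesis
  proof (rule that[of "deg k ` B"])
    show "finite (deg k ` B)" using B(1) by simp
    show "deg k ` B \<subseteq> {h \<in> hc.harm. deg k h = h}" using B(2) harm_deg by auto
    show "{h \<in> hc.harm. deg k h = h} \<subseteq> span (deg k ` B)"
    proof
      fix h assume "h \<in> {h \<in> hc.harm. deg k h = h}"
      then have "deg k h \<in> deg k ` span B" "deg k h = h" using B(3) by blast+
      then show "h \<in> span (deg k ` B)" by (simp add: linear_span_image[OF linear_deg])
    qed
  qed
qed

end

section \<open>Transfer to differential forms\<close>

definition of_hf :: "'n::{finite,linorder} hf \<Rightarrow> 'n form" where
  "of_hf u = abs_form (\<lambda>I J. rep_lsq (u $ (I, J)))"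

text \<open>\<open>coef\<close> returns an arbitrary representative, known only up to a null set in
  each coefficient, so all later comparisons of coefficients hold almost everywhere.\<close>

lemma coef_abs_form: "AE z in lebesgue. coef (abs_form r) I J z = r I J z"
proof -
  have "abs_form (rep_form (abs_form r)) = abs_form r" by (rule Quotient3_abs_rep[OF Quotient3_form])
  then show ?thesis by (simp add: form.abs_eq_iff ae_eq_def)
qed

lemma coef_of_hf: "AE z in lebesgue. coef (of_hf u) I J z = rep_lsq (u $ (I, J)) z"
  unfolding of_hf_def by (rule coef_abs_form)

lemma coef_of_hf_measurable: "coef (of_hf u) I J \<in> borel_measurable lebesgue"
  by (rule borel_measurable_AE[OF measurable_rep]) (use coef_of_hf[of u I J] in eventually_elim, simp)

lemma of_hf_eq_iff: "of_hf u = of_hf v \<longleftrightarrow> u = v"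
  by (auto simp: of_hf_def form.abs_eq_iff ae_eq_def lsq_eq_iff vec_eq_iff)

lemma of_hf_add: "of_hf (u + v) = of_hf u + of_hf v"
  by (simp add: of_hf_def plus_form.abs_eq form.abs_eq_iff ae_eq_def rep_plus_lsq)

lemma of_hf_0 [simp]: "of_hf 0 = 0"
  by (simp add: of_hf_def zero_form_def form.abs_eq_iff ae_eq_def rep_zero_lsq)

lemma of_hf_eq_0_iff [simp]: "of_hf u = 0 \<longleftrightarrow> u = 0"
  using of_hf_eq_iff[of u 0] by simp

lemma of_hf_diff: "of_hf (u - v) = of_hf u - of_hf v"
  using of_hf_add[of "u - v" v] by simp

lemma of_hf_csc: "of_hf (csc c u) = scale_form c (of_hf u)"
  by (simp add: of_hf_def csc_def scale_form.abs_eq form.abs_eq_iff ae_eq_def rep_mul)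

lemma of_hf_scaleR: "of_hf (r *\<^sub>R u) = scale_form (of_real r) (of_hf u)"
  by (simp add: of_hf_def scale_form.abs_eq form.abs_eq_iff ae_eq_def rep_scaleR_lsq)

lemma of_hf_L2:
  fixes u :: "'n::{finite,linorder} hf"
  assumes "u \<in> supported D" "open D" shows "of_hf u \<in> L2 D"
  unfolding L2_def
proof (intro CollectI allI conjI coef_of_hf_measurable)
  fix I J :: "'n set"
  have D: "bmeas (indicator D :: 'n cn \<Rightarrow> complex)" using assms(2) by (intro bmeas_indicator) auto
  show "integrable lebesgue (\<lambda>z. (cmod (coef (of_hf u) I J z))\<^sup>2)"
  proof (rule integrable_cong_AE_imp[OF sqint_integrable[OF sqint_rep]])
    show "(\<lambda>z. (cmod (coef (of_hf u) I J z))\<^sup>2) \<in> borel_measurable lebesgue"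
      using coef_of_hf_measurable[of u I J] by measurable
    show "AE z in lebesgue. (cmod (rep_lsq (u $ (I, J)) z))\<^sup>2 = (cmod (coef (of_hf u) I J z))\<^sup>2"
      using coef_of_hf[of u I J] by eventually_elim simp
  qed
  show "AE z in lebesgue. z \<notin> D \<longrightarrow> coef (of_hf u) I J z = 0"
    using coef_of_hf[of u I J] rep_mul[OF D, of "u $ (I, J)", unfolded supportedD[OF assms(1)]]
    by eventually_elim (auto simp: indicator_def)
qed

lemma L2_eq:
  fixes D :: "'n::{finite,linorder} cn set"
  assumes "open D" shows "L2 D = of_hf ` supported D"
proof (intro equalityI subsetI)
  fix \<phi> assume "\<phi> \<in> L2 D"
  then have s: "sqint (coef \<phi> I J)" and o: "AE z in lebesgue. z \<notin> D \<longrightarrow> coef \<phi> I J z = 0" for I J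
    by (auto simp: L2_def sqint_def)
  define u where "u = (\<chi> p. abs_lsq (coef \<phi> (fst p) (snd p)))"
  have r: "AE z in lebesgue. rep_lsq (u $ p) z = coef \<phi> (fst p) (snd p) z" for p
    unfolding u_def vec_lambda_beta by (rule rep_abs_lsq[OF s])
  have D: "bmeas (indicator D :: 'n cn \<Rightarrow> complex)" using assms by (intro bmeas_indicator) auto
  have "of_hf u = abs_form (coef \<phi>)"
    using r[of "(_, _)"] by (simp add: of_hf_def form.abs_eq_iff ae_eq_def)
  then have "of_hf u = \<phi>" by (simp add: Quotient3_abs_rep[OF Quotient3_form])
  moreover have "u \<in> supported D"
  proof (rule supportedI)
    fix p
    have "AE z in lebesgue. rep_lsq (mul (indicator D) (u $ p)) z = rep_lsq (u $ p) z"
      using rep_mul[OF D, of "u $ p"] r[of p] o[of "fst p" "snd p"]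
      by eventually_elim (auto simp: indicator_def)
    then show "mul (indicator D) (u $ p) = u $ p" by (simp add: lsq_eq_iff[of "mul _ _"])
  qed
  ultimately show "\<phi> \<in> of_hf ` supported D" by blast
qed (use of_hf_L2[OF _ assms] in blast)

lemma of_hf_L2_deg:
  fixes D :: "'n::{finite,linorder} cn set"
  assumes "open D" "u \<in> supported D" shows "of_hf u \<in> L2_deg D k \<longleftrightarrow> deg k u = u"
proof -
  have "(AE z in lebesgue. coef (of_hf u) I J z = 0) \<longleftrightarrow> u $ (I, J) = 0" for I J
  proof -
    have "(AE z in lebesgue. coef (of_hf u) I J z = 0) \<longleftrightarrow> (AE z in lebesgue. rep_lsq (u $ (I, J)) z = rep_lsq 0 z)"
    proof (rule eventually_subst)
      show "AE z in lebesgue. (coef (of_hf u) I J z = 0) = (rep_lsq (u $ (I, J)) z = rep_lsq 0 z)"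
        using coef_of_hf[of u I J] rep_zero_lsq by eventually_elim simp
    qed
    then show ?thesis by (simp add: lsq_eq_iff)
  qed
  then show ?thesis using of_hf_L2[OF assms(2,1)] by (auto simp: L2_deg_def deg_def vec_eq_iff bideg_def)
qed

lemma L2_deg_eq:
  fixes D :: "'n::{finite,linorder} cn set"
  assumes "open D" shows "L2_deg D k = of_hf ` {u \<in> supported D. deg k u = u}"
proof -
  have "L2_deg D k \<subseteq> of_hf ` supported D" using L2_eq[OF assms] by (auto simp: L2_deg_def)
  then show ?thesis using of_hf_L2_deg[OF assms] by auto
qed

lemma set_integral_coef_of_hf:
  fixes D :: "'n::{finite,linorder} cn set"
  assumes "open D" "u \<in> supported D" "\<theta> \<in> borel_measurable lebesgue"
  shows "(LINT z:D|lebesgue. coef (of_hf u) I J z * \<theta> z) = pr (u $ (I, J)) \<theta>"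
  unfolding set_lebesgue_integral_def pr_def
proof (rule integral_cong_AE)
  have D: "bmeas (indicator D :: 'n cn \<Rightarrow> complex)" using assms(1) by (intro bmeas_indicator) auto
  have [measurable]: "D \<in> sets lebesgue" using assms(1) by auto
  note [measurable] = coef_of_hf_measurable assms(3)
  show "(\<lambda>z. indicat_real D z *\<^sub>R (coef (of_hf u) I J z * \<theta> z)) \<in> borel_measurable lebesgue" by measurable
  show "(\<lambda>z. rep_lsq (u $ (I, J)) z * \<theta> z) \<in> borel_measurable lebesgue" by measurable
  show "AE z in lebesgue. indicat_real D z *\<^sub>R (coef (of_hf u) I J z * \<theta> z) = rep_lsq (u $ (I, J)) z * \<theta> z"
    using coef_of_hf[of u I J] rep_mul[OF D, of "u $ (I, J)", unfolded supportedD[OF assms(2)]]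
    by eventually_elim (auto simp: indicator_def)
qed

lemma inner_form_of_hf:
  fixes D :: "'n::{finite,linorder} cn set"
  assumes "open D" "u \<in> supported D" "v \<in> supported D"
  shows "inner_form D (of_hf u) (of_hf v) = hin u v"
proof -
  have "(LINT z:D|lebesgue. coef (of_hf u) I J z * cnj (coef (of_hf v) I J z)) = cin (u $ (I, J)) (v $ (I, J))" for I J
  proof -
    have m: "(\<lambda>z. cnj (coef (of_hf v) I J z)) \<in> borel_measurable lebesgue"
      by (rule cnj_measurable[OF coef_of_hf_measurable])
    have "(LINT z:D|lebesgue. coef (of_hf u) I J z * cnj (coef (of_hf v) I J z)) = pr (u $ (I, J)) (\<lambda>z. cnj (coef (of_hf v) I J z))"
      by (rule set_integral_coef_of_hf[OF assms(1,2) m])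
    also have "\<dots> = cin (u $ (I, J)) (v $ (I, J))"
      unfolding pr_def cin_def
    proof (rule integral_cong_AE)
      note [measurable] = m cnj_measurable[OF measurable_rep]
      show "(\<lambda>z. rep_lsq (u $ (I, J)) z * cnj (coef (of_hf v) I J z)) \<in> borel_measurable lebesgue"
        "(\<lambda>z. rep_lsq (u $ (I, J)) z * cnj (rep_lsq (v $ (I, J)) z)) \<in> borel_measurable lebesgue" by measurable
      show "AE z in lebesgue. rep_lsq (u $ (I, J)) z * cnj (coef (of_hf v) I J z) = rep_lsq (u $ (I, J)) z * cnj (rep_lsq (v $ (I, J)) z)"
        using coef_of_hf[of v I J] by eventually_elim simp
    qed
    finally show ?thesis .
  qed
  then have "inner_form D (of_hf u) (of_hf v) = (\<Sum>(I, J)\<in>UNIV \<times> UNIV. cin (u $ (I, J)) (v $ (I, J)))"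
    unfolding inner_form_def by (simp only: sum.cartesian_product)
  then show ?thesis by (simp add: hin_def case_prod_beta')
qed

text \<open>The sums over I and J in \<open>weak_dbar\<close> become sums over all indices, because
  \<open>ext i\<close> and \<open>extb j\<close> vanish at index sets that lack i or j. The minus
  sign of the derivative moved to \<theta> is the one in \<open>wsum\<close>.\<close>

lemma (in twisted) weak_dbar_of_hf:
  assumes F: "\<And>i. F i = d_z i f" and u: "u \<in> supported D" and w: "w \<in> supported D"
  shows "weak_dbar D f (of_hf u) (of_hf w) \<longleftrightarrow> wd D F u w"
proof -
  have eq: "(\<Sum>j\<in>J. (-1) ^ (card I + card {l\<in>J. l < j}) *
                    - (LINT z:D|lebesgue. coef (of_hf u) I (J - {j}) z * d_zbar j \<theta> z)) +
          (\<Sum>i\<in>I. (-1) ^ card {l\<in>I. l < i} *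
                    (LINT z:D|lebesgue. d_z i f z * coef (of_hf u) (I - {i}) J z * \<theta> z)) = wsum \<theta> F u (I, J)" (is "?A + ?B = _")
    if \<theta>: "test_function D \<theta>" for I J \<theta>
  proof -
    have c: "d_z i f z * c * \<theta> z = c * (F i z * \<theta> z)" for i z c by (simp only: F mult_ac)
    have 1: "(LINT z:D|lebesgue. d_z i f z * coef (of_hf u) (I - {i}) J z * \<theta> z) = P u (\<lambda>z. F i z * \<theta> z) (I - {i}, J)" for i
      unfolding c P_def by (rule set_integral_coef_of_hf[OF D_open u test_function_measurable[OF test_F[OF \<theta>]]])
    have 2: "(LINT z:D|lebesgue. coef (of_hf u) I (J - {j}) z * d_zbar j \<theta> z) = P u (d_zbar j \<theta>) (I, J - {j})" for j
      using set_integral_coef_of_hf[OF D_open u test_function_measurable[OF test_function_d_zbar[OF \<theta>]]] by (simp add: P_def)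
    have "?B = (\<Sum>i\<in>UNIV. ext i (P u (\<lambda>z. F i z * \<theta> z)) (I, J))"
      unfolding 1 ext_def sgnl_def by (simp add: sum.If_cases scaleR_conv_of_real)
    moreover have "?A = - (\<Sum>j\<in>UNIV. extb j (P u (d_zbar j \<theta>)) (I, J))"
      unfolding 2 extb_def sgnl_def by (simp add: sum.If_cases scaleR_conv_of_real power_add sum_negf)
    ultimately show ?thesis by (simp add: wsum_def)
  qed
  have "weak_dbar D f (of_hf u) (of_hf w) \<longleftrightarrow> (\<forall>I J \<theta>. test_function D \<theta> \<longrightarrow> P w \<theta> (I, J) = wsum \<theta> F u (I, J))"
    unfolding weak_dbar_def
  proof (intro iff_allI imp_cong refl)
    fix I J \<theta> assume \<theta>: "test_function D \<theta>"
    show "((LINT z:D|lebesgue. coef (of_hf w) I J z * \<theta> z) =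
      (\<Sum>j\<in>J. (-1) ^ (card I + card {l\<in>J. l < j}) *
                    - (LINT z:D|lebesgue. coef (of_hf u) I (J - {j}) z * d_zbar j \<theta> z)) +
          (\<Sum>i\<in>I. (-1) ^ card {l\<in>I. l < i} *
                    (LINT z:D|lebesgue. d_z i f z * coef (of_hf u) (I - {i}) J z * \<theta> z))) = (P w \<theta> (I, J) = wsum \<theta> F u (I, J))"
      unfolding eq[OF \<theta>] set_integral_coef_of_hf[OF D_open w test_function_measurable[OF \<theta>]] P_def ..
  qed
  then show ?thesis using u w by (auto simp: wd_def)
qed

lemma subspace_of_hf:
  assumes "0 \<in> A" "\<And>u v. u \<in> A \<Longrightarrow> v \<in> A \<Longrightarrow> u + v \<in> A" "\<And>c u. u \<in> A \<Longrightarrow> csc c u \<in> A"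
  shows "form.subspace (of_hf ` A)"
proof (rule form.subspaceI)
  show "0 \<in> of_hf ` A" using assms(1) of_hf_0 by force
  show "x + y \<in> of_hf ` A" if xy: "x \<in> of_hf ` A" "y \<in> of_hf ` A" for x y
    using xy assms(2) by (auto simp flip: of_hf_add)
  show "scale_form c x \<in> of_hf ` A" if x: "x \<in> of_hf ` A" for c x
    using x assms(3) by (auto simp flip: of_hf_csc)
qed

lemma deg_csc: "deg k (csc c u) = csc c (deg k u)"
  by (simp add: deg_def csc_def vec_eq_iff)

lemma csc_0 [simp]: "csc c 0 = 0"
  by (simp add: csc_def vec_eq_iff)

text \<open>By \<open>ex\<close> and \<open>disj\<close> every class contains exactly one element of
  H. Selecting it is linear because sums and multiples of representatives are again representatives
  in H.\<close>

lemma cohomology_iso_representatives: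
  fixes D :: "'n::{finite,linorder} cn set"
  assumes Z: "form.subspace (cocycles D f k)" and B: "form.subspace (coboundaries D f k)"
    and H: "form.subspace H" "H \<subseteq> cocycles D f k"
    and ex: "\<And>\<phi>. \<phi> \<in> cocycles D f k \<Longrightarrow> \<exists>h\<in>H. \<phi> - h \<in> coboundaries D f k"
    and disj: "\<And>h. h \<in> H \<Longrightarrow> h \<in> coboundaries D f k \<Longrightarrow> h = 0"
  shows "\<exists>T. cohomology_iso D f k T H"
proof -
  let ?Z = "cocycles D f k" and ?B = "coboundaries D f k" and ?c = "cohomology_class D f k"
  have c: "\<psi> \<in> ?c \<phi> \<longleftrightarrow> \<phi> \<in> ?Z \<and> \<psi> \<in> ?Z \<and> \<phi> - \<psi> \<in> ?B" for \<phi> \<psi>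
    by (auto simp: cohomology_class_def cohomologous_def)
  have eqv: "equiv ?Z (cohomologous D f k)"
  proof (rule equivI)
    show "cohomologous D f k \<subseteq> ?Z \<times> ?Z" by (auto simp: cohomologous_def)
    show "refl_on ?Z (cohomologous D f k)"
      by (auto simp: refl_on_def cohomologous_def form.subspace_0[OF B])
    show "sym (cohomologous D f k)"
      using form.subspace_neg[OF B] by (fastforce simp: sym_def cohomologous_def)
    show "trans (cohomologous D f k)"
    proof (rule transI)
      fix x y z assume "(x, y) \<in> cohomologous D f k" "(y, z) \<in> cohomologous D f k"
      then show "(x, z) \<in> cohomologous D f k"
        using form.subspace_add[OF B, of "x - y" "y - z"] by (simp add: cohomologous_def)
    qed
  qed
  define T where "T C = (THE h. h \<in> H \<and> h \<in> C)" for C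
  have T: "T (?c \<phi>) = h" if \<phi>: "\<phi> \<in> ?Z" and h: "h \<in> H" "\<phi> - h \<in> ?B" for \<phi> h
    unfolding T_def
  proof (rule the_equality)
    show "h \<in> H \<and> h \<in> ?c \<phi>" using \<phi> h H(2) by (auto simp: c)
    fix h' assume h': "h' \<in> H \<and> h' \<in> ?c \<phi>"
    then have "\<phi> - h' \<in> ?B" by (simp add: c)
    from form.subspace_diff[OF B h(2) this] have "h' - h \<in> ?B" by simp
    moreover have "h' - h \<in> H" using form.subspace_diff[OF H(1)] h' h(1) by blast
    ultimately show "h' = h" using disj by force
  qed
  have cls: "C \<in> cohomology D f k \<longleftrightarrow> (\<exists>\<phi>\<in>?Z. C = ?c \<phi>)" for C
    by (auto simp: cohomology_def quotient_def cohomology_class_def)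
  have ex': "\<exists>h\<in>H. \<phi> - h \<in> ?B \<and> T (?c \<phi>) = h" if "\<phi> \<in> ?Z" for \<phi>
    using ex[OF that] T[OF that] by blast
  have same: "?c \<phi> = ?c h" if "\<phi> \<in> ?Z" "h \<in> H" "\<phi> - h \<in> ?B" for \<phi> h
    unfolding cohomology_class_def
    by (rule equiv_class_eq[OF eqv]) (use that H(2) in \<open>auto simp: cohomologous_def\<close>)
  have "bij_betw T (cohomology D f k) H"
  proof (rule bij_betw_imageI)
    show "inj_on T (cohomology D f k)"
    proof (rule inj_onI)
      have fix_class: "C = ?c (T C)" if C: "C \<in> cohomology D f k" for C
      proof -
        obtain \<phi> where \<phi>: "\<phi> \<in> ?Z" "C = ?c \<phi>" using cls[THEN iffD1, OF C] by (elim bexE)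
        obtain h where h: "h \<in> H" "\<phi> - h \<in> ?B" using ex[OF \<phi>(1)] by (elim bexE)
        show ?thesis unfolding \<phi>(2) T[OF \<phi>(1) h] by (rule same[OF \<phi>(1) h])
      qed
      fix C C' assume C: "C \<in> cohomology D f k" and C': "C' \<in> cohomology D f k" and eq: "T C = T C'"
      have "C = ?c (T C)" by (rule fix_class[OF C])
      also have "\<dots> = C'" unfolding eq by (rule fix_class[OF C', symmetric])
      finally show "C = C'" .
    qed
    show "T ` cohomology D f k = H"
    proof (intro equalityI subsetI)
      fix h assume "h \<in> T ` cohomology D f k"
      then obtain C where C: "h = T C" "C \<in> cohomology D f k" by (rule imageE)
      obtain \<phi> where \<phi>: "\<phi> \<in> ?Z" "C = ?c \<phi>" using C(2) cls by blast
      show "h \<in> H" using ex'[OF \<phi>(1)] unfolding C(1) \<phi>(2) by blast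
    next
      fix h assume h: "h \<in> H"
      then have Z: "h \<in> ?Z" using H(2) by blast
      have "T (?c h) = h" by (rule T[OF Z h]) (simp add: form.subspace_0[OF B])
      moreover have "?c h \<in> cohomology D f k" using cls Z by blast
      ultimately show "h \<in> T ` cohomology D f k" by (metis imageI)
    qed
  qed
  moreover have "T (?c (\<phi> + \<psi>)) = T (?c \<phi>) + T (?c \<psi>)" if \<phi>: "\<phi> \<in> ?Z" and \<psi>: "\<psi> \<in> ?Z" for \<phi> \<psi>
  proof -
    obtain h where h: "h \<in> H" "\<phi> - h \<in> ?B" "T (?c \<phi>) = h" using ex'[OF \<phi>] by blast
    obtain h' where h': "h' \<in> H" "\<psi> - h' \<in> ?B" "T (?c \<psi>) = h'" using ex'[OF \<psi>] by blast
    have "T (?c (\<phi> + \<psi>)) = h + h'"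
    proof (rule T)
      show "\<phi> + \<psi> \<in> ?Z" by (rule form.subspace_add[OF Z \<phi> \<psi>])
      show "h + h' \<in> H" by (rule form.subspace_add[OF H(1) h(1) h'(1)])
      show "\<phi> + \<psi> - (h + h') \<in> ?B" using form.subspace_add[OF B h(2) h'(2)] by (simp add: algebra_simps)
    qed
    then show ?thesis using h(3) h'(3) by simp
  qed
  moreover have "T (?c (scale_form c \<phi>)) = scale_form c (T (?c \<phi>))" if \<phi>: "\<phi> \<in> ?Z" for c \<phi>
  proof -
    obtain h where h: "h \<in> H" "\<phi> - h \<in> ?B" "T (?c \<phi>) = h" using ex'[OF \<phi>] by blast
    have "T (?c (scale_form c \<phi>)) = scale_form c h"
    proof (rule T)
      show "scale_form c \<phi> \<in> ?Z" by (rule form.subspace_scale[OF Z \<phi>])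
      show "scale_form c h \<in> H" by (rule form.subspace_scale[OF H(1) h(1)])
      show "scale_form c \<phi> - scale_form c h \<in> ?B"
        using form.subspace_scale[OF B h(2), of c] by (simp add: form.scale_right_diff_distrib)
    qed
    then show ?thesis using h(3) by simp
  qed
  ultimately show ?thesis unfolding cohomology_iso_def by blast
qed

section \<open>Domains, images and harmonic spaces in terms of coefficient families\<close>

locale twisted_form = twisted_homotopy D "\<lambda>i. d_z i f" g K
  for D :: "'n::{finite,linorder} cn set" and f :: "'n cn \<Rightarrow> complex" and g :: "'n \<Rightarrow> 'n cn \<Rightarrow> complex"
    and K :: "'n cn set"
begin

abbreviation W :: "'n hf \<Rightarrow> 'n hf \<Rightarrow> bool" where "W \<equiv> wd D (\<lambda>i. d_z i f)"

lemma W_supported: "W u w \<Longrightarrow> u \<in> supported D \<and> w \<in> supported D"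
  by (simp add: wd_def)

lemma weak_dbar_iff: "u \<in> supported D \<Longrightarrow> w \<in> supported D \<Longrightarrow> weak_dbar D f (of_hf u) (of_hf w) \<longleftrightarrow> W u w"
  by (rule weak_dbar_of_hf) simp

lemma Dom_dbar_eq: "Dom_dbar D f = of_hf ` {u. \<exists>w. W u w}"
  unfolding Dom_dbar_def L2_eq[OF D_open] using weak_dbar_iff W_supported by blast

lemma dbar_of_hf:
  assumes "W u w" shows "dbar D f (of_hf u) = of_hf w"
  unfolding dbar_def
proof (rule the_equality)
  have s: "u \<in> supported D" "w \<in> supported D" using W_supported[OF assms] by auto
  show "of_hf w \<in> L2 D \<and> weak_dbar D f (of_hf u) (of_hf w)"
    using s assms weak_dbar_iff of_hf_L2[OF _ D_open] by blast
  fix \<psi> assume \<psi>: "\<psi> \<in> L2 D \<and> weak_dbar D f (of_hf u) \<psi>"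
  then obtain w' where w': "w' \<in> supported D" "\<psi> = of_hf w'" using L2_eq[OF D_open] by blast
  then have "W u w'" using \<psi> s(1) weak_dbar_iff by blast
  then show "\<psi> = of_hf w" using wd_unique[OF assms] w'(2) by simp
qed

lemma adjoint_relation_iff:
  assumes "u \<in> supported D" "e \<in> supported D"
  shows "(\<forall>\<phi>\<in>Dom_dbar D f. inner_form D (dbar D f \<phi>) (of_hf u) = inner_form D \<phi> (of_hf e)) \<longleftrightarrow> hc.Wadj u e"
proof -
  have "inner_form D (dbar D f (of_hf v)) (of_hf u) = hin z u" "inner_form D (of_hf v) (of_hf e) = hin v e" if "W v z" for v z
    using W_supported[OF that] assms by (simp_all add: dbar_of_hf[OF that] inner_form_of_hf[OF D_open])
  then show ?thesis unfolding Dom_dbar_eq Wadj_iff using assms by auto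
qed

lemma Wadj_supported: "hc.Wadj u e \<Longrightarrow> u \<in> supported D \<and> e \<in> supported D"
  by (simp add: Wadj_iff)

lemma Dom_dbar_adj_eq: "Dom_dbar_adj D f = of_hf ` {u. \<exists>e. hc.Wadj u e}"
  unfolding Dom_dbar_adj_def L2_eq[OF D_open] using adjoint_relation_iff Wadj_supported by blast

lemma dbar_adj_of_hf:
  assumes "hc.Wadj u e" shows "dbar_adj D f (of_hf u) = of_hf e"
  unfolding dbar_adj_def
proof (rule the_equality)
  have s: "u \<in> supported D" "e \<in> supported D" using Wadj_supported[OF assms] by auto
  show "of_hf e \<in> L2 D \<and> (\<forall>\<phi>\<in>Dom_dbar D f. inner_form D (dbar D f \<phi>) (of_hf u) = inner_form D \<phi> (of_hf e))"
    using s assms adjoint_relation_iff of_hf_L2[OF _ D_open] by blast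
  fix \<eta> assume \<eta>: "\<eta> \<in> L2 D \<and> (\<forall>\<phi>\<in>Dom_dbar D f. inner_form D (dbar D f \<phi>) (of_hf u) = inner_form D \<phi> \<eta>)"
  then obtain e' where e': "e' \<in> supported D" "\<eta> = of_hf e'" using L2_eq[OF D_open] by blast
  then have "hc.Wadj u e'" using \<eta> s(1) adjoint_relation_iff by blast
  then show "\<eta> = of_hf e" using Wadj_unique[OF assms] e'(2) by simp
qed

text \<open>Pairing the Laplacian of u with u gives the sum of the squared norms of dbar_f u and of
  its adjoint counterpart, so both vanish when the Laplacian does.\<close>

lemma harmonic_iff:
  assumes "u \<in> supported D"
  shows "of_hf u \<in> Dom_laplacian D f \<and> laplacian D f (of_hf u) = 0 \<longleftrightarrow> u \<in> hc.harm"
proof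
  assume L: "of_hf u \<in> Dom_laplacian D f \<and> laplacian D f (of_hf u) = 0"
  then have "of_hf u \<in> Dom_dbar D f" "of_hf u \<in> Dom_dbar_adj D f" by (auto simp: Dom_laplacian_def)
  then obtain w e where w: "W u w" and e: "hc.Wadj u e"
    unfolding Dom_dbar_eq Dom_dbar_adj_eq by (auto simp: of_hf_eq_iff)
  have "of_hf w \<in> Dom_dbar_adj D f" "of_hf e \<in> Dom_dbar D f"
    using L by (auto simp: Dom_laplacian_def dbar_of_hf[OF w] dbar_adj_of_hf[OF e])
  then obtain e' w' where e': "hc.Wadj w e'" and w': "W e w'"
    unfolding Dom_dbar_eq Dom_dbar_adj_eq by (auto simp: of_hf_eq_iff)
  have "w' + e' = 0"
    using L by (simp add: laplacian_def dbar_of_hf[OF w] dbar_adj_of_hf[OF e] dbar_of_hf[OF w'] dbar_adj_of_hf[OF e'] flip: of_hf_add)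
  then have "hin w' u + hin e' u = 0" by (simp flip: hin_add_left)
  moreover have "hin w' u = hin e e" by (rule WadjD[OF e w'])
  moreover have "hin e' u = cnj (hin w w)" using WadjD[OF e' w] hin_commute[of e' u] by simp
  ultimately have "Re (hin e e + cnj (hin w w)) = 0" by simp
  then have "e \<bullet> e + w \<bullet> w = 0" by (simp add: inner_eq_hin)
  then have "e \<bullet> e = 0" "w \<bullet> w = 0" using inner_ge_zero[of e] inner_ge_zero[of w] by linarith+
  then show "u \<in> hc.harm" using w e by (simp add: harm_iff)
next
  assume "u \<in> hc.harm"
  then have h: "W u 0" "hc.Wadj u 0" by (simp_all add: harm_iff)
  have 0: "W 0 0" "hc.Wadj 0 0" using wd_0 subspace_0[OF subspace_supported] by (simp_all add: Wadj_iff)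
  note d = dbar_of_hf[OF h(1)] dbar_adj_of_hf[OF h(2)] dbar_of_hf[OF 0(1)] dbar_adj_of_hf[OF 0(2)]
  have "0 \<in> Dom_dbar D f" "0 \<in> Dom_dbar_adj D f" "of_hf u \<in> Dom_dbar D f" "of_hf u \<in> Dom_dbar_adj D f"
    unfolding Dom_dbar_eq Dom_dbar_adj_eq using h 0 of_hf_0 by (metis (mono_tags, lifting) image_eqI mem_Collect_eq)+
  then show "of_hf u \<in> Dom_laplacian D f \<and> laplacian D f (of_hf u) = 0"
    using d by (simp add: Dom_laplacian_def laplacian_def)
qed

lemma harmonic_eq: "harmonic D f k = of_hf ` {h \<in> hc.harm. deg k h = h}"
proof -
  have "hc.harm \<subseteq> supported D" using W_supported by (auto simp: harm_iff)
  then show ?thesis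
    unfolding harmonic_def L2_deg_eq[OF D_open] using harmonic_iff by blast
qed

lemma L2_degI: "u \<in> supported D \<Longrightarrow> deg k u = u \<Longrightarrow> of_hf u \<in> L2_deg D k"
  using L2_deg_eq[OF D_open] by blast

lemma im_dbar_eq: "im_dbar D f k = of_hf ` {w. (\<exists>u. W u w) \<and> deg k w = w}"
proof -
  have "dbar D f ` Dom_dbar D f = of_hf ` {w. \<exists>u. W u w}"
    unfolding Dom_dbar_eq by (force simp: dbar_of_hf)
  then show ?thesis
    unfolding im_dbar_def using of_hf_L2_deg[OF D_open] W_supported by (simp only:) blast
qed

lemma im_dbar_adj_eq: "im_dbar_adj D f k = of_hf ` {e. (\<exists>u. hc.Wadj u e) \<and> deg k e = e}"
proof -
  have "dbar_adj D f ` Dom_dbar_adj D f = of_hf ` {e. \<exists>u. hc.Wadj u e}"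
    unfolding Dom_dbar_adj_eq by (force simp: dbar_adj_of_hf)
  then show ?thesis
    unfolding im_dbar_adj_def using of_hf_L2_deg[OF D_open] Wadj_supported by (simp only:) blast
qed

lemma cocycles_eq: "cocycles D f k = of_hf ` {u. W u 0 \<and> deg k u = u}"
proof (intro equalityI subsetI)
  fix \<phi> assume \<phi>: "\<phi> \<in> cocycles D f k"
  then obtain u w where u: "\<phi> = of_hf u" "W u w" unfolding cocycles_def Dom_dbar_eq by blast
  then have "w = 0" using \<phi> by (simp add: cocycles_def dbar_of_hf[OF u(2)])
  moreover have "deg k u = u"
    using \<phi> of_hf_L2_deg[OF D_open, of u k] W_supported[OF u(2)] by (auto simp: cocycles_def u(1))
  ultimately show "\<phi> \<in> of_hf ` {u. W u 0 \<and> deg k u = u}" using u by blast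
next
  fix \<phi> assume "\<phi> \<in> of_hf ` {u. W u 0 \<and> deg k u = u}"
  then obtain u where u: "\<phi> = of_hf u" "W u 0" "deg k u = u" by blast
  have "\<phi> \<in> Dom_dbar D f" unfolding Dom_dbar_eq using u(1,2) by blast
  then show "\<phi> \<in> cocycles D f k"
    using L2_degI[OF _ u(3)] W_supported[OF u(2)] dbar_of_hf[OF u(2)] u(1) by (simp add: cocycles_def)
qed

lemma coboundaries_eq: "coboundaries D f k = im_dbar D f k"
proof (intro equalityI subsetI)
  fix \<phi> assume "\<phi> \<in> coboundaries D f k"
  then obtain \<psi> where \<psi>: "\<psi> \<in> Dom_dbar D f" "\<psi> \<in> L2_deg D (k - 1)" "\<phi> = dbar D f \<psi>"
    unfolding coboundaries_def by blast
  then obtain u w where u: "\<psi> = of_hf u" "W u w" unfolding Dom_dbar_eq by blast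
  have "deg (k - 1) u = u" using \<psi>(2) of_hf_L2_deg[OF D_open, of u "k - 1"] W_supported[OF u(2)] u(1) by simp
  then have "W u (deg k w)" using wd_deg[OF u(2), of "k - 1"] by simp
  then have "deg k w = w" using wd_unique u(2) by blast
  then show "\<phi> \<in> im_dbar D f k" unfolding im_dbar_eq using u \<psi>(3) dbar_of_hf[OF u(2)] by blast
next
  fix \<phi> assume "\<phi> \<in> im_dbar D f k"
  then obtain u w where u: "\<phi> = of_hf w" "W u w" "deg k w = w" unfolding im_dbar_eq by blast
  have d: "W (deg (k - 1) u) w" using wd_deg[OF u(2), of "k - 1"] u(3) by simp
  have "of_hf (deg (k - 1) u) \<in> Dom_dbar D f \<inter> L2_deg D (k - 1)"
    using d W_supported[OF d] L2_degI[of "deg (k - 1) u" "k - 1"] unfolding Dom_dbar_eq by auto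
  then show "\<phi> \<in> coboundaries D f k" unfolding coboundaries_def using dbar_of_hf[OF d] u(1) by (metis imageI)
qed

lemma hin_harm_range: "a \<in> hc.harm \<Longrightarrow> W u b \<Longrightarrow> hin a b = 0"
  using WadjD[of a 0 u b] hin_commute[of a b] by (simp add: harm_iff)

lemma hin_kernel_adjoint_range: "W b 0 \<Longrightarrow> hc.Wadj v c \<Longrightarrow> hin b c = 0"
  using WadjD[of v c b 0] by simp

lemma subspaces:
  "form.subspace (harmonic D f k)" "form.subspace (im_dbar D f k)" "form.subspace (im_dbar_adj D f k)"
  "form.subspace (cocycles D f k)"
proof -
  have 0: "W 0 0" "hc.Wadj 0 0" using wd_0 subspace_0[OF subspace_supported] by (simp_all add: Wadj_iff)
  have add: "W (u + v) 0" if "W u 0" "W v 0" for u v using wd_add[OF that] by simp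
  have adj_add: "hc.Wadj (u + v) 0" if "hc.Wadj u 0" "hc.Wadj v 0" for u v using Wadj_add[OF that] by simp
  have csc: "W (csc c u) 0" if "W u 0" for c u using wd_csc[OF that] by simp
  have adj_csc: "hc.Wadj (csc c u) 0" if "hc.Wadj u 0" for c u using Wadj_csc[OF that] by simp
  show "form.subspace (harmonic D f k)"
    unfolding harmonic_eq harm_iff by (rule subspace_of_hf) (simp_all add: 0 add adj_add csc adj_csc deg_add deg_csc)
  show "form.subspace (cocycles D f k)"
    unfolding cocycles_eq by (rule subspace_of_hf) (simp_all add: 0 add csc deg_add deg_csc)
  show "form.subspace (im_dbar D f k)"
    unfolding im_dbar_eq
  proof (rule subspace_of_hf; unfold mem_Collect_eq)
    show "(\<exists>u. W u 0) \<and> deg k 0 = (0 :: 'n hf)" using 0 by auto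
    show "(\<exists>x. W x (u + v)) \<and> deg k (u + v) = u + v" if "(\<exists>x. W x u) \<and> deg k u = u" "(\<exists>x. W x v) \<and> deg k v = v" for u v
      using that wd_add by (metis deg_add)
    show "(\<exists>x. W x (csc c u)) \<and> deg k (csc c u) = csc c u" if "(\<exists>x. W x u) \<and> deg k u = u" for c u
      using that wd_csc by (metis deg_csc)
  qed
  show "form.subspace (im_dbar_adj D f k)"
    unfolding im_dbar_adj_eq
  proof (rule subspace_of_hf; unfold mem_Collect_eq)
    show "(\<exists>u. hc.Wadj u 0) \<and> deg k 0 = (0 :: 'n hf)" using 0 by auto
    show "(\<exists>x. hc.Wadj x (u + v)) \<and> deg k (u + v) = u + v" if "(\<exists>x. hc.Wadj x u) \<and> deg k u = u" "(\<exists>x. hc.Wadj x v) \<and> deg k v = v" for u v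
      using that Wadj_add by (metis deg_add)
    show "(\<exists>x. hc.Wadj x (csc c u)) \<and> deg k (csc c u) = csc c u" if "(\<exists>x. hc.Wadj x u) \<and> deg k u = u" for c u
      using that Wadj_csc by (metis deg_csc)
  qed
qed

end

section \<open>Hodge decomposition and cohomology\<close>

lemma orthogonal_sum_eq_0:
  assumes "x + y + z = 0" "hin x y = 0" "hin x z = 0" "hin y z = 0"
  shows "x = 0 \<and> y = 0 \<and> z = 0"
proof -
  have "hin x x = hin x (x + y + z)" using assms(2,3) by (simp add: hin_add_right)
  then have x: "x = 0" using assms(1) by (simp add: hin_self_eq_0)
  have "hin y y = hin y (y + z)" using assms(4) by (simp add: hin_add_right)
  then have "y = 0" using assms(1) x by (simp add: hin_self_eq_0)
  then show ?thesis using assms(1) x by simp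
qed

context twisted_form
begin

lemma decomposition_unique:
  assumes "a + b + c = a' + b' + c'" and a: "a \<in> hc.harm" "a' \<in> hc.harm" and b: "W u b" "W u' b'"
    and c: "hc.Wadj v c" "hc.Wadj v' c'"
  shows "a = a' \<and> b = b' \<and> c = c'"
proof -
  have a3: "a - a' \<in> hc.harm" by (rule subspace_diff[OF hc.subspace_harm a])
  have b3: "W (u - u') (b - b')" by (rule hc.W_diff[OF b])
  have c3: "hc.Wadj (v - v') (c - c')"
    using c by (simp add: Wadj_iff hin_diff_right subspace_diff[OF subspace_supported])
  have "(a - a') + (b - b') + (c - c') = 0" using assms(1) by (simp add: algebra_simps)
  then have "a - a' = 0 \<and> b - b' = 0 \<and> c - c' = 0"
    by (rule orthogonal_sum_eq_0)
      (use a3 hin_harm_range[OF a3 b3] hin_kernel_adjoint_range[OF _ c3] wd_square[OF b3] in \<open>auto simp: harm_iff\<close>)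
  then show ?thesis by simp
qed

theorem hodge_decomposition:
  "direct_sum3 D (L2_deg D k) (harmonic D f k) (im_dbar D f k) (im_dbar_adj D f k)"
  unfolding direct_sum3_def
proof (intro conjI ballI)
  show "harmonic D f k \<subseteq> L2_deg D k" "im_dbar D f k \<subseteq> L2_deg D k" "im_dbar_adj D f k \<subseteq> L2_deg D k"
    by (auto simp: harmonic_def im_dbar_def im_dbar_adj_def)
  have sup: "hc.harm \<subseteq> supported D" using W_supported by (auto simp: harm_iff)
  show "orthogonal_sets D (harmonic D f k) (im_dbar D f k)"
    unfolding orthogonal_sets_def harmonic_eq im_dbar_eq
    using sup W_supported hin_harm_range by (fastforce simp: inner_form_of_hf[OF D_open])
  show "orthogonal_sets D (harmonic D f k) (im_dbar_adj D f k)"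
    unfolding orthogonal_sets_def harmonic_eq im_dbar_adj_eq
    using W_supported Wadj_supported hin_kernel_adjoint_range by (fastforce simp: inner_form_of_hf[OF D_open] harm_iff)
  show "orthogonal_sets D (im_dbar D f k) (im_dbar_adj D f k)"
    unfolding orthogonal_sets_def im_dbar_eq im_dbar_adj_eq
    using W_supported Wadj_supported hin_kernel_adjoint_range[OF wd_square] by (fastforce simp: inner_form_of_hf[OF D_open])
  fix \<phi> assume "\<phi> \<in> L2_deg D k"
  then obtain x where x: "\<phi> = of_hf x" "x \<in> supported D" "deg k x = x" using L2_deg_eq[OF D_open] by blast
  obtain a b c u v where d: "x = a + b + c" "a \<in> hc.harm" "deg k a = a" "W u b" "deg (k - 1) u = u" "deg k b = b"
    "hc.Wadj v c" "deg k c = c" by (rule graded_decomposition[OF x(2,3)])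
  show "\<exists>!(a, b, c). a \<in> harmonic D f k \<and> b \<in> im_dbar D f k \<and> c \<in> im_dbar_adj D f k \<and> \<phi> = a + b + c"
  proof (rule ex1I[of _ "(of_hf a, of_hf b, of_hf c)"])
    show "case (of_hf a, of_hf b, of_hf c) of (a, b, c) \<Rightarrow> a \<in> harmonic D f k \<and> b \<in> im_dbar D f k \<and> c \<in> im_dbar_adj D f k \<and> \<phi> = a + b + c"
      unfolding harmonic_eq im_dbar_eq im_dbar_adj_eq x(1) d(1) of_hf_add using d by auto
    fix t assume t: "case t of (a, b, c) \<Rightarrow> a \<in> harmonic D f k \<and> b \<in> im_dbar D f k \<and> c \<in> im_dbar_adj D f k \<and> \<phi> = a + b + c"
    then obtain a' b' c' u' v' where t': "t = (of_hf a', of_hf b', of_hf c')" "a' \<in> hc.harm" "W u' b'" "hc.Wadj v' c'"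
      "\<phi> = of_hf a' + of_hf b' + of_hf c'"
      unfolding harmonic_eq im_dbar_eq im_dbar_adj_eq by auto
    then have "a + b + c = a' + b' + c'" using x(1) d(1) by (simp add: of_hf_eq_iff flip: of_hf_add)
    from decomposition_unique[OF this d(2) t'(2) d(4) t'(3) d(7) t'(4)] show "t = (of_hf a, of_hf b, of_hf c)"
      using t'(1) by simp
  qed
qed (rule subspaces)+

theorem cohomology_iso_harmonic: "\<exists>T. cohomology_iso D f k T (harmonic D f k)"
proof (rule cohomology_iso_representatives)
  show "form.subspace (cocycles D f k)" "form.subspace (coboundaries D f k)" "form.subspace (harmonic D f k)"
    unfolding coboundaries_eq by (rule subspaces)+
  show "harmonic D f k \<subseteq> cocycles D f k" unfolding harmonic_eq cocycles_eq harm_iff by blast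
next
  fix \<phi> assume "\<phi> \<in> cocycles D f k"
  then obtain x where x: "\<phi> = of_hf x" "W x 0" "deg k x = x" unfolding cocycles_eq by blast
  obtain a b c u v where d: "x = a + b + c" "a \<in> hc.harm" "deg k a = a" "W u b" "deg (k - 1) u = u" "deg k b = b"
    "hc.Wadj v c" "deg k c = c" using graded_decomposition[OF _ x(3)] W_supported[OF x(2)] by metis
  have a: "W a 0" using d(2) by (simp add: harm_iff)
  \<comment> \<open>For a cocycle the third component c is closed as well. It also lies in the range
    of the adjoint, which is orthogonal to the kernel, so c = 0 and a represents the class of
    x.\<close>
  have "W (x - a - b) 0" using hc.W_diff[OF hc.W_diff[OF x(2) a] wd_square[OF d(4)]] by simp
  then have "W c 0" using d(1) by simp
  from hin_kernel_adjoint_range[OF this d(7)] have "c = 0" by (simp add: hin_self_eq_0)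
  then have "\<phi> - of_hf a = of_hf b" unfolding x(1) by (simp add: d(1) flip: of_hf_diff)
  moreover have "of_hf b \<in> coboundaries D f k" unfolding coboundaries_eq im_dbar_eq using d by blast
  moreover have "of_hf a \<in> harmonic D f k" unfolding harmonic_eq using d by blast
  ultimately show "\<exists>h\<in>harmonic D f k. \<phi> - h \<in> coboundaries D f k" by metis
next
  fix h assume "h \<in> harmonic D f k" "h \<in> coboundaries D f k"
  then obtain a u where a: "h = of_hf a" "a \<in> hc.harm" "W u a"
    unfolding harmonic_eq coboundaries_eq im_dbar_eq by (auto simp: of_hf_eq_iff)
  have "a = 0" using hin_harm_range[OF a(2,3)] by (simp add: hin_self_eq_0)
  then show "h = 0" using a(1) by simp
qed

theorem finite_dim_harmonic: "finite_dim (harmonic D f k)"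
proof -
  obtain B where B: "finite B" "B \<subseteq> {h \<in> hc.harm. deg k h = h}" "{h \<in> hc.harm. deg k h = h} \<subseteq> span B"
    by (rule graded_harm_finite_dim)
  \<comment> \<open>A finite set that spans the harmonic space over the reals spans it over the
    complex numbers too.\<close>
  have "of_hf h \<in> form.span (of_hf ` B)" if "h \<in> span B" for h
    using that
  proof (induction rule: span_induct_alt)
    case base then show ?case by (simp add: form.span_zero)
  next
    case (step r x y)
    then show ?case by (simp add: of_hf_add of_hf_scaleR form.span_add form.span_scale form.span_base)
  qed
  then have "harmonic D f k \<subseteq> form.span (of_hf ` B)" unfolding harmonic_eq using B(3) by blast
  moreover have "form.span (of_hf ` B) \<subseteq> harmonic D f k"
    by (rule form.span_minimal[OF _ subspaces(1)]) (use B(2) harmonic_eq in blast)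
  ultimately show ?thesis unfolding finite_dim_def using B(1) by blast
qed

end

section \<open>Construction of the vector field\<close>

lemma bounded_on_compact:
  fixes h :: "'a::euclidean_space \<Rightarrow> complex"
  assumes "compact C" "continuous_on C h" "D \<subseteq> C"
  shows "\<exists>B. \<forall>z\<in>D. cmod (h z) \<le> B"
  using compact_imp_bounded[OF compact_continuous_image[OF assms(2,1)]] assms(3)
  unfolding bounded_iff by blast

text \<open>The vector field \<open>g = conj(\<partial>f) / (|\<partial>f|\<^sup>2 + r)\<close> inverts \<open>\<partial>f\<close> off the support of the bump function \<open>r\<close>
  around the critical points.\<close>

lemma twisted_form_exists:
  fixes D :: "'n::{finite,linorder} cn set"
  assumes "open D" "bounded D" "holomorphic_near_closure f D" "crit_points f \<inter> frontier D = {}"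
  shows "\<exists>g K. twisted_form D f g K"
proof -
  obtain U where U: "open U" "closure D \<subseteq> U" "holomorphic_cn f U"
    using assms(3) unfolding holomorphic_near_closure_def by blast
  have C: "compact (closure D)" using assms(2) by (simp add: compact_closure)
  have DC: "D \<subseteq> closure D" by (rule closure_subset)
  have hol: "holomorphic_cn (d_z i f) U" for i by (rule holomorphic_cn_d_z[OF U(1,3)])
  have sm: "smooth_on U (d_z i f)" for i by (rule holomorphic_cn_imp_smooth_on[OF U(1) hol])
  define N where "N z = (\<Sum>i\<in>UNIV. d_z i f z * cnj (d_z i f z))" for z
  have N: "N z = of_real (\<Sum>i\<in>UNIV. (cmod (d_z i f z))\<^sup>2)" for z
    by (simp only: N_def of_real_sum complex_norm_square)
  have N0: "N z = 0 \<longleftrightarrow> z \<in> crit_points f" for z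
    unfolding N of_real_eq_0_iff by (subst sum_nonneg_eq_0_iff) (auto simp: crit_points_def)
  have smN: "smooth_on U N"
    unfolding N_def[abs_def]
    by (intro smooth_on_sum smooth_on_mult sm U(1) smooth_on_bounded_linear_comp[OF bounded_linear_cnj] finite)
  define K0 where "K0 = {z \<in> closure D. N z = 0}"
  have "closed K0" unfolding K0_def
    by (rule continuous_closed_preimage_constant[OF continuous_on_subset[OF smooth_on_imp_continuous_on[OF smN] U(2)] closed_closure])
  then have cK: "compact K0" using compact_Int_closed[OF C] by (metis (no_types, lifting) K0_def Int_absorb1 mem_Collect_eq subsetI)
  \<comment> \<open>No critical point lies on the frontier, so the zeros of N in the closure of D
    are inside D.\<close>
  have KD: "K0 \<subseteq> D" using assms(4) closure_Un_frontier[of D] unfolding K0_def N0 by blast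
  obtain r where r: "test_function D (\<lambda>z. complex_of_real (r z))" "\<And>z. 0 \<le> r z" "\<And>z. z \<in> K0 \<Longrightarrow> 1 \<le> r z"
    using exists_test_function_ge_1[OF assms(1) cK KD] by blast
  define d where "d z = N z + of_real (r z)" for z
  have d0: "d z \<noteq> 0" if z: "z \<in> closure D" for z
  proof -
    have s: "0 \<le> (\<Sum>i\<in>UNIV. (cmod (d_z i f z))\<^sup>2)" by (simp add: sum_nonneg)
    have "(\<Sum>i\<in>UNIV. (cmod (d_z i f z))\<^sup>2) + r z \<noteq> 0"
    proof (cases "z \<in> K0")
      case True then show ?thesis using s r(3)[OF True] by linarith
    next
      case False
      then have "N z \<noteq> 0" using z by (simp add: K0_def)
      then have "(\<Sum>i\<in>UNIV. (cmod (d_z i f z))\<^sup>2) \<noteq> 0" unfolding N of_real_eq_0_iff .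
      then show ?thesis using s r(2)[of z] by linarith
    qed
    then show ?thesis unfolding d_def N of_real_add[symmetric] of_real_eq_0_iff .
  qed
  have smd: "smooth_on U d"
    unfolding d_def[abs_def] by (intro smooth_on_add U(1) smN smooth_on_subset[OF test_function_smooth[OF r(1)]]) simp
  \<comment> \<open>On this open neighbourhood of the closure of D the denominator has no zero. So g
    is smooth across the boundary, and g and its derivatives are bounded on D by compactness of the
    closure.\<close>
  define U' where "U' = U \<inter> d -` (- {0})"
  have U': "open U'" "closure D \<subseteq> U'" "U' \<subseteq> U"
    unfolding U'_def using U(2) d0
    by (auto intro: continuous_open_preimage[OF smooth_on_imp_continuous_on[OF smd] U(1)])
  define g where "g i z = cnj (d_z i f z) * inverse (d z)" for i z
  have smg: "smooth_on U' (g i)" for i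
    unfolding g_def[abs_def]
  proof (intro smooth_on_mult smooth_on_inverse U'(1))
    show "smooth_on U' (\<lambda>z. cnj (d_z i f z))"
      by (rule smooth_on_bounded_linear_comp[OF bounded_linear_cnj U'(1) smooth_on_subset[OF sm U'(3)]])
    show "smooth_on U' d" by (rule smooth_on_subset[OF smd U'(3)])
  qed (simp add: U'_def)
  define K where "K = closure {z. complex_of_real (r z) \<noteq> 0}"
  have "twisted_form D f g K"
  proof
    show "open D" "bounded D" by fact+
    show "holomorphic_cn (d_z i f) D" for i by (rule holomorphic_cn_subset[OF hol order_trans[OF DC U(2)]])
    show "\<exists>B. \<forall>z\<in>D. cmod (d_z i f z) \<le> B" for i
      by (rule bounded_on_compact[OF C continuous_on_subset[OF smooth_on_imp_continuous_on[OF sm] U(2)] DC])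
    show "smooth_on D (g i)" for i by (rule smooth_on_subset[OF smg order_trans[OF DC U'(2)]])
    show "\<exists>B. \<forall>z\<in>D. cmod (g i z) \<le> B" for i
      by (rule bounded_on_compact[OF C continuous_on_subset[OF smooth_on_imp_continuous_on[OF smg] U'(2)] DC])
    show "\<exists>B. \<forall>z\<in>D. cmod (d_zbar j (g i) z) \<le> B" for i j
      by (rule bounded_on_compact[OF C continuous_on_subset[OF smooth_on_imp_continuous_on[OF smooth_on_d_zbar[OF U'(1) smg]] U'(2)] DC])
    show "compact K" "K \<subseteq> D" using r(1) by (simp_all add: K_def test_function_def)
    fix z assume z: "z \<in> D" "z \<notin> K"
    have "z \<notin> {z. complex_of_real (r z) \<noteq> 0}"
      by (rule contra_subsetD[OF closure_subset z(2)[unfolded K_def]])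
    then have "r z = 0" by simp
    then have dN: "d z = N z" by (simp add: d_def)
    have "(\<Sum>i\<in>UNIV. g i z * d_z i f z) = N z * inverse (d z)"
      by (simp add: g_def N_def sum_distrib_left mult_ac)
    also have "\<dots> = 1" using d0[of z] z(1) DC unfolding dN by auto
    finally show "(\<Sum>i\<in>UNIV. g i z * d_z i f z) = 1" .
  qed
  then show ?thesis by blast
qed

theorem theorem1p1:
  fixes D :: "(complex ^ 'n::{finite,linorder}) set"
    and f :: "complex ^ 'n::{finite,linorder} \<Rightarrow> complex"
  assumes "domain_cn D" and "bounded D"
    and "smooth_boundary D" and "strongly_pseudoconvex D"
    and "holomorphic_near_closure f D"
    and "\<forall>z \<in> crit_points f \<inter> D. z isolated_in (crit_points f \<inter> D)"
    and "crit_points f \<inter> frontier D = {}"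
  shows "\<forall>k. direct_sum3 D (L2_deg D k) (harmonic D f k) (im_dbar D f k) (im_dbar_adj D f k)
             \<and> (\<exists>T. cohomology_iso D f k T (harmonic D f k))
             \<and> finite_dim (harmonic D f k)"
proof -
  have "open D" using assms(1) by (simp add: domain_cn_def)
  then obtain g K where "twisted_form D f g K"
    using twisted_form_exists[OF _ assms(2,5,7)] by blast
  then interpret twisted_form D f g K .
  show ?thesis using hodge_decomposition cohomology_iso_harmonic finite_dim_harmonic by blast
qed

end
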